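(* Let $0<\alpha<1$, $\theta>-\alpha$, and let $(\Pi_n)_{n\ge1}$ be the Ewens--Pitman partition process with parameter $(\alpha,\theta)$, with maximum likelihood estimator $(\hat\alpha_n,\hat\theta_n)$ and number of blocks $K_n$. Then, as $n\to\infty$, $$\sqrt{I_\alpha K_n}\,(\hat\alpha_n-\alpha)\to N\quad\mathcal F_\infty\text{-mixing},$$ where $N\sim N(0,1)$ is independent of $\mathcal F_\infty$. Therefore, for any $p\in(0,1)$, letting $\tau_{1-p/2}$ be the $(1-p/2)$-quantile of the standard normal distribution, the interval $$\hat I_n:=\Big[\hat\alpha_n-\tfrac{\tau_{1-p/2}}{\sqrt{I_{\hat\alpha_n}K_n}},\ \hat\alpha_n+\tfrac{\tau_{1-p/2}}{\sqrt{I_{\hat\alpha_n}K_n}}\Big]$$ is an approximate $100(1-p)\%$ confidence interval in the sense that $\lim_{n\to\infty}\Pr(\alpha\in\hat I_n)=1-p$.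
   Context: Ewens--Pitman partition $(\alpha,\theta)$: a random sequence $(\Pi_n)_{n\ge1}$, $\Pi_n$ a partition of $\{1,\dots,n\}$, built sequentially. Ball $1$ forms the first block. Given $\Pi_n$ with blocks $U_1,\dots,U_{K_n}$, ball $n+1$ joins $U_i$ with probability $(|U_i|-\alpha)/(\theta+n)$ for each $i$, and forms a new block with probability $(\theta+K_n\alpha)/(\theta+n)$. $K_n$ is the number of blocks of $\Pi_n$; $S_{n,j}$ is the number of blocks of size $j$. $\mathcal F_n$ is the $\sigma$-field generated by the partition of the first $n$ balls, and $\mathcal F_\infty=\sigma(\bigcup_n\mathcal F_n)$. Log-likelihood: for $x\in(0,1)$, $y>-x$, $$\ell_n(x,y)=\sum_{i=1}^{K_n-1}\log(y+ix)-\sum_{i=1}^{n-1}\log(y+i)+\sum_{j=2}^nS_{n,j}\sum_{i=1}^{j-1}\log(i-x).$$ The maximum likelihood estimator is $(\hat\alpha_n,\hat\theta_n)\in\operatorname{argmax}_{x\in(0,1),\,y>-x}\ell_n(x,y)$, a function of $\Pi_n$ (with arbitrary values in the parameter space when the argmax is empty). For $a\in(0,1)$, $I_a=-\sum_{j\ge1}p_a(j)\,\partial_a^2\log p_a(j)$ where $p_a(j)=a\prod_{i=1}^{j-1}(i-a)/j!$, $j\in\mathbb N=\{1,2,\dots\}$. Stable and mixing convergence: for a sub-$\sigma$-field $\mathcal G$ of a probability space $(\Omega,\mathcal F,P)$ (large enough to carry all variables mentioned), $X_n\to X$ $\mathcal G$-stably means $\lim_n\mathbb E[f\,\mathbb E[h(X_n)\mid\mathcal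 G]]=\mathbb E[f\,\mathbb E[h(X)\mid\mathcal G]]$ for all $f\in\mathcal L^1(\Omega,\mathcal F,P)$ and all bounded continuous $h$. If moreover $X$ is independent of $\mathcal G$, the convergence is called $\mathcal G$-mixing. *)

theory Defs
  imports "HOL-Probability.Probability"
begin

definition partitions_upto :: "nat \<Rightarrow> nat set set set" where
  "partitions_upto n = {P. partition_on {1..n} P}"

text \<open>
  The transition law is prescribed for every state \<open>P\<close> that is attained with positive probability.
  The listed transition probabilities add up to 1, so \<open>\<pi> (Suc n)\<close> almost surely extends \<open>\<pi> n\<close>;
  hence \<open>\<pi> n\<close> determines the past and conditioning on it is conditioning on the whole history.
\<close>

locale ewens_pitman = prob_space M
  for M :: "'a measure" and \<alpha> \<theta> :: real and \<pi> :: "nat \<Rightarrow> 'a \<Rightarrow> nat set set" +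
  assumes random_partition:
    "\<And>n. n \<ge> 1 \<Longrightarrow> \<pi> n \<in> M \<rightarrow>\<^sub>M count_space (partitions_upto n)"
  and join_block:
    "\<And>n P U. n \<ge> 1 \<Longrightarrow> P \<in> partitions_upto n \<Longrightarrow> \<P>(\<omega> in M. \<pi> n \<omega> = P) > 0 \<Longrightarrow> U \<in> P \<Longrightarrow>
      \<P>(\<omega> in M. \<pi> (Suc n) \<omega> = insert (insert (Suc n) U) (P - {U}) \<bar> \<pi> n \<omega> = P)
        = (real (card U) - \<alpha>) / (\<theta> + real n)"
  and new_block:
    "\<And>n P. n \<ge> 1 \<Longrightarrow> P \<in> partitions_upto n \<Longrightarrow> \<P>(\<omega> in M. \<pi> n \<omega> = P) > 0 \<Longrightarrow>
      \<P>(\<omega> in M. \<pi> (Suc n) \<omega> = insert {Suc n} P \<bar> \<pi> n \<omega> = P)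
        = (\<theta> + real (card P) * \<alpha>) / (\<theta> + real n)"

definition partition_algebra :: "'a measure \<Rightarrow> (nat \<Rightarrow> 'a \<Rightarrow> nat set set) \<Rightarrow> nat \<Rightarrow> 'a measure" where
  "partition_algebra M \<pi> n = vimage_algebra (space M) (\<pi> n) (count_space (partitions_upto n))"

definition partition_algebra_limit :: "'a measure \<Rightarrow> (nat \<Rightarrow> 'a \<Rightarrow> nat set set) \<Rightarrow> 'a measure" where
  "partition_algebra_limit M \<pi> = sigma (space M) (\<Union>n\<in>{1..}. sets (partition_algebra M \<pi> n))"

definition blocks_of_size :: "nat set set \<Rightarrow> nat \<Rightarrow> nat" where
  "blocks_of_size P j = card {U \<in> P. card U = j}"

definition log_likelihood :: "nat \<Rightarrow> nat set set \<Rightarrow> real \<Rightarrow> real \<Rightarrow> real" where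
  "log_likelihood n P x y =
     (\<Sum>i = 1..card P - 1. ln (y + real i * x)) - (\<Sum>i = 1..n - 1. ln (y + real i))
     + (\<Sum>j = 2..n. real (blocks_of_size P j) * (\<Sum>i = 1..j - 1. ln (real i - x)))"

definition parameter_space :: "(real \<times> real) set" where
  "parameter_space = {(x, y). 0 < x \<and> x < 1 \<and> y > - x}"

abbreviation is_likelihood_maximizer :: "nat \<Rightarrow> nat set set \<Rightarrow> real \<times> real \<Rightarrow> bool" where
  "is_likelihood_maximizer n P \<equiv>
     is_arg_max (\<lambda>(x, y). log_likelihood n P x y) (\<lambda>q. q \<in> parameter_space)"

text \<open>
  An estimator maps the sample size and the observed partition to a pair of parameters.  Where the
  likelihood has no maximizer, its value is an arbitrary element of the parameter space.
\<close>

definition is_mle :: "(nat \<Rightarrow> nat set set \<Rightarrow> real \<times> real) \<Rightarrow> bool" where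
  "is_mle est \<longleftrightarrow> (\<forall>n\<ge>1. \<forall>P\<in>partitions_upto n.
     est n P \<in> parameter_space \<and>
     ((\<exists>q. is_likelihood_maximizer n P q) \<longrightarrow> is_likelihood_maximizer n P (est n P)))"

definition sibuya_pmf :: "real \<Rightarrow> nat \<Rightarrow> real" where
  "sibuya_pmf a j = a * (\<Prod>i = 1..j - 1. real i - a) / fact j"

definition sibuya_information :: "real \<Rightarrow> real" where
  "sibuya_information a =
     - (\<Sum>\<^sub>\<infinity>j\<in>{1..}. sibuya_pmf a j * (deriv ^^ 2) (\<lambda>x. ln (sibuya_pmf x j)) a)"

definition stable_convergence ::
    "'a measure \<Rightarrow> 'a measure \<Rightarrow> (nat \<Rightarrow> 'a \<Rightarrow> real) \<Rightarrow> ('a \<Rightarrow> real) \<Rightarrow> bool" where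
  "stable_convergence M G X Y \<longleftrightarrow>
     subalgebra M G \<and> (\<forall>\<^sub>F n in sequentially. X n \<in> borel_measurable M) \<and> Y \<in> borel_measurable M \<and>
     (\<forall>f h. integrable M f \<longrightarrow> continuous_on UNIV h \<longrightarrow> bounded (range h) \<longrightarrow>
        (\<lambda>n. \<integral>\<omega>. f \<omega> * real_cond_exp M G (\<lambda>\<omega>'. h (X n \<omega>')) \<omega> \<partial>M)
          \<longlonglongrightarrow> (\<integral>\<omega>. f \<omega> * real_cond_exp M G (\<lambda>\<omega>'. h (Y \<omega>')) \<omega> \<partial>M))"

definition independent_of_algebra :: "'a measure \<Rightarrow> 'a measure \<Rightarrow> ('a \<Rightarrow> real) \<Rightarrow> bool" where
  "independent_of_algebra M G Y \<longleftrightarrow>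
     prob_space.indep_set M (sets (vimage_algebra (space M) Y borel)) (sets G)"

definition mixing_convergence ::
    "'a measure \<Rightarrow> 'a measure \<Rightarrow> (nat \<Rightarrow> 'a \<Rightarrow> real) \<Rightarrow> ('a \<Rightarrow> real) \<Rightarrow> bool" where
  "mixing_convergence M G X Y \<longleftrightarrow> stable_convergence M G X Y \<and> independent_of_algebra M G Y"

definition std_normal_quantile :: "real \<Rightarrow> real" where
  "std_normal_quantile q = Inf {x. q \<le> cdf std_normal_distribution x}"

definition confidence_interval :: "real \<Rightarrow> real \<Rightarrow> nat \<Rightarrow> real set" where
  "confidence_interval p a k =
     (let r = std_normal_quantile (1 - p / 2) / sqrt (sibuya_information a * real k)
      in {a - r .. a + r})"

end

theory Submission
  imports Defs "HOL-Real_Asymp.Real_Asymp"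
begin

text \<open>
  Write \<open>G\<close> for \<open>total_score\<close>, the sum over all blocks \<open>U\<close> of the derivative in \<open>x\<close>, at \<open>x = \<alpha>\<close>, of
  \<open>ln p\<^sub>x(card U)\<close>, where \<open>p\<^sub>x\<close> is the Sibuya law, and \<open>J\<close> for \<open>total_info\<close>, the corresponding sum of
  negative second derivatives. Both are sums over blocks, and in both the contribution of a block
  grows term by term with its size: ball \<open>n + 1\<close> changes \<open>G\<close> by some \<open>d\<close> and \<open>J\<close> by exactly \<open>d\<^sup>2\<close>. The
  predictive probabilities make the conditional mean of \<open>d\<close> the deterministic number
  \<open>\<theta> / \<alpha> / (\<theta> + n)\<close>. These numbers add up to a logarithm only, so \<open>G\<close> is nearly a martingale with
  quadratic variation \<open>J\<close>, and its jumps are bounded.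

  The number of blocks \<open>K\<close>, shifted to \<open>K + \<theta> / \<alpha>\<close>, has explicit conditional first and second moments.
  Hence the value of \<open>K\<close> at time \<open>n\<close> is asymptotically equal to a prediction \<open>predicted_count\<close>
  made from the partition at a slowly growing burn-in time. A second-moment recursion in \<open>i\<close>
  shows that the proportion of blocks with more than \<open>i\<close> elements tends to the Sibuya tail, so
  \<open>J / K\<close> tends to the constant \<open>tail_info\<close>, which is the Fisher information \<open>I\<^sub>\<alpha>\<close>
  (\<open>sibuya_information_eq\<close>). Together these say \<open>J \<approx> c\<close>, where \<open>c = I\<^sub>\<alpha> * predicted_count\<close> is known at
  the burn-in time.

  For the central limit theorem (\<open>stable_clt_score\<close>) put \<open>s = u / sqrt c\<close>. The function
  \<open>exp (\<i> s G + s\<^sup>2 J / 2)\<close>, cut off once \<open>J > 2 c\<close>, changes in mean at each step only by the drift, a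
  third-order error and the effect of the cutoff; these errors telescope and tend to zero. At the burn-in time it is close to \<open>1\<close>, and at time \<open>n\<close>
  it is close to \<open>exp (\<i> s G) * exp (u\<^sup>2 / 2)\<close>. Since \<open>c\<close> depends on the early partition only, a bounded
  function of the early partition may be carried through the argument, and this gives asymptotic
  normality of \<open>G / sqrt c\<close> on every event of the early partition.

  For the estimator \<open>(x, y)\<close>, the two likelihood equations combine to
  \<open>x * score(x) = 1 + y * (\<Sum>i. 1 / (y + i))\<close>. The equation in \<open>y\<close> bounds \<open>y\<close> by a small power of \<open>n\<close>, so
  the score at the estimator is negligible against \<open>sqrt K\<close> (\<open>critical_point_location\<close>). The score is
  decreasing with slope close to \<open>- J\<close>, which yields consistency and then
  \<open>sqrt (I\<^sub>\<alpha> K) * (x - \<alpha>) \<approx> G / sqrt c\<close> (\<open>estimator_linearization\<close>). A maximizer exists with probability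
  tending to one, because the likelihood is small near every part of the boundary of the closed
  range \<open>0 \<le> x < 1\<close> except the line \<open>x = 0\<close>, and at a point of that line satisfying the equation for \<open>y\<close>
  its derivative in \<open>x\<close> is positive.

  Finally, Levy's continuity theorem under the conditional law on an event \<open>A\<close> of the early partition
  gives normal limits on \<open>A\<close>; a Dynkin argument extends them to all of the limit algebra, approximation
  in \<open>L\<^sup>1\<close> to all integrable \<open>f\<close>. Coverage of the confidence interval is the case \<open>A = space M\<close> with
  \<open>I\<^sub>\<alpha>\<close> replaced by its consistent estimate, \<open>tail_info\<close> being continuous.
\<close>

section \<open>Growing and restricting partitions\<close>

definition join_block_at :: "nat \<Rightarrow> nat set set \<Rightarrow> nat set \<Rightarrow> nat set set" where
  "join_block_at n P U = insert (insert (Suc n) U) (P - {U})"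

definition open_block :: "nat \<Rightarrow> nat set set \<Rightarrow> nat set set" where
  "open_block n P = insert {Suc n} P"

definition restrict_partition :: "nat \<Rightarrow> nat set set \<Rightarrow> nat set set" where
  "restrict_partition m P = (\<lambda>U. U \<inter> {1..m}) ` P - {{}}"

definition block_sum :: "(nat \<Rightarrow> real) \<Rightarrow> nat set set \<Rightarrow> real" where
  "block_sum g P = (\<Sum>U\<in>P. g (card U))"

lemma finite_partitions_upto: "finite (partitions_upto n)"
proof (rule finite_subset)
  show "partitions_upto n \<subseteq> Pow (Pow {1..n})"
    by (auto simp: partitions_upto_def partition_on_def)
qed auto

lemma partitions_uptoD:
  assumes "P \<in> partitions_upto n"
  shows "finite P" "\<Union>P = {1..n}" "{} \<notin> P" "\<And>U. U \<in> P \<Longrightarrow> finite U" "\<And>U. U \<in> P \<Longrightarrow> Suc n \<notin> U"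
    "\<And>U. U \<in> P \<Longrightarrow> card U \<ge> 1" "\<And>U. U \<in> P \<Longrightarrow> U \<subseteq> {1..n}"
    "\<And>U V. U \<in> P \<Longrightarrow> V \<in> P \<Longrightarrow> U \<noteq> V \<Longrightarrow> U \<inter> V = {}"
proof -
  have P: "partition_on {1..n} P"
    using assms by (simp add: partitions_upto_def)
  then show "finite P"
    using finite_elements by blast
  show U: "\<Union>P = {1..n}" "{} \<notin> P"
    using P by (auto simp: partition_on_def)
  show sub: "\<And>U. U \<in> P \<Longrightarrow> U \<subseteq> {1..n}"
    using U by blast
  then show fin: "\<And>U. U \<in> P \<Longrightarrow> finite U"
    using finite_subset by blast
  show "\<And>U. U \<in> P \<Longrightarrow> Suc n \<notin> U"
    using sub by fastforce
  show "\<And>U. U \<in> P \<Longrightarrow> card U \<ge> 1"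
    using fin U(2) by (metis One_nat_def Suc_leI card_gt_0_iff)
  show "\<And>U V. U \<in> P \<Longrightarrow> V \<in> P \<Longrightarrow> U \<noteq> V \<Longrightarrow> U \<inter> V = {}"
    using P by (auto simp: partition_on_def disjoint_def)
qed

lemma partitions_uptoI:
  assumes "\<Union>P = {1..n}" "{} \<notin> P" "\<And>U V. U \<in> P \<Longrightarrow> V \<in> P \<Longrightarrow> U \<noteq> V \<Longrightarrow> U \<inter> V = {}"
  shows "P \<in> partitions_upto n"
  using assms by (auto simp: partitions_upto_def partition_on_def disjoint_def)

lemma sum_card_blocks:
  assumes "P \<in> partitions_upto n"
  shows "(\<Sum>U\<in>P. card U) = n"
proof -
  have "card (\<Union>P) = (\<Sum>U\<in>P. card U)"
    by (rule card_Union_disjoint)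
       (use partitions_uptoD[OF assms] in \<open>auto simp: pairwise_def disjnt_def\<close>)
  then show ?thesis
    using partitions_uptoD(2)[OF assms] by simp
qed

lemma card_partition_bounds:
  assumes "P \<in> partitions_upto n"
  shows "card P \<le> n" "n \<ge> 1 \<Longrightarrow> card P \<ge> 1"
proof -
  have "(\<Sum>U\<in>P. 1) \<le> (\<Sum>U\<in>P. card U)"
    by (rule sum_mono) (use partitions_uptoD[OF assms] in auto)
  then show "card P \<le> n"
    using sum_card_blocks[OF assms] by simp
  assume "n \<ge> 1"
  then have "P \<noteq> {}"
    using partitions_uptoD(2)[OF assms] by auto
  then show "card P \<ge> 1"
    using partitions_uptoD(1)[OF assms] by (simp add: Suc_leI card_gt_0_iff)
qed

lemma block_size_le:
  assumes "P \<in> partitions_upto n" "U \<in> P"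
  shows "card U \<le> n"
  using partitions_uptoD(7)[OF assms] card_mono[of "{1..n}" U] by simp

lemma join_block_at_in:
  assumes "P \<in> partitions_upto n" "U \<in> P"
  shows "join_block_at n P U \<in> partitions_upto (Suc n)"
proof (rule partitions_uptoI)
  note P = partitions_uptoD[OF assms(1)]
  have "\<Union>(join_block_at n P U) = insert (Suc n) (\<Union>P)"
    using assms(2) by (auto simp: join_block_at_def)
  then show "\<Union>(join_block_at n P U) = {1..Suc n}"
    using P(2) by (simp add: atLeastAtMostSuc_conv)
  show "{} \<notin> join_block_at n P U"
    using P(3) by (auto simp: join_block_at_def)
  have disj: "V \<inter> insert (Suc n) U = {}" if "V \<in> P" "V \<noteq> U" for V
    using P(5)[OF that(1)] P(8)[OF that(1) assms(2) that(2)] by auto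
  fix V W assume *: "V \<in> join_block_at n P U" "W \<in> join_block_at n P U" "V \<noteq> W"
  then consider "V = insert (Suc n) U" "W \<in> P" "W \<noteq> U" | "W = insert (Suc n) U" "V \<in> P" "V \<noteq> U" | "V \<in> P" "W \<in> P"
    unfolding join_block_at_def by blast
  then show "V \<inter> W = {}"
    by cases (use disj[of V] disj[of W] P(8)[of V W] * in blast)+
qed

lemma open_block_in:
  assumes "P \<in> partitions_upto n"
  shows "open_block n P \<in> partitions_upto (Suc n)"
proof (rule partitions_uptoI)
  note P = partitions_uptoD[OF assms(1)]
  show "\<Union>(open_block n P) = {1..Suc n}"
    using P(2) by (simp add: open_block_def atLeastAtMostSuc_conv)
  show "{} \<notin> open_block n P"
    using P(3) by (auto simp: open_block_def)
  fix V W assume "V \<in> open_block n P" "W \<in> open_block n P" "V \<noteq> W"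
  then show "V \<inter> W = {}"
    using P(8)[of V W] P(5)[of V] P(5)[of W] unfolding open_block_def by blast
qed

lemma new_blocks_fresh:
  assumes "P \<in> partitions_upto n"
  shows "insert (Suc n) U \<notin> P" "{Suc n} \<notin> P"
  using partitions_uptoD(5)[OF assms] by auto

lemma inj_on_join_block_at:
  assumes "P \<in> partitions_upto n"
  shows "inj_on (join_block_at n P) P"
proof (rule inj_onI)
  fix U V assume *: "U \<in> P" "V \<in> P" "join_block_at n P U = join_block_at n P V"
  then have "insert (Suc n) U \<in> join_block_at n P V"
    by (metis insertI1 join_block_at_def)
  then have "insert (Suc n) U = insert (Suc n) V"
    using new_blocks_fresh[OF assms] by (auto simp: join_block_at_def)
  then show "U = V"
    using partitions_uptoD(5)[OF assms] * by (metis insert_ident)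
qed

lemma open_block_not_join:
  assumes "P \<in> partitions_upto n"
  shows "open_block n P \<notin> join_block_at n P ` P"
proof
  assume "open_block n P \<in> join_block_at n P ` P"
  then obtain U where U: "U \<in> P" "open_block n P = join_block_at n P U"
    by auto
  then have "{Suc n} \<in> join_block_at n P U"
    by (metis insertI1 open_block_def)
  then have "{Suc n} = insert (Suc n) U"
    using new_blocks_fresh[OF assms] by (auto simp: join_block_at_def)
  then have "U = {}"
    using partitions_uptoD(5)[OF assms U(1)] by auto
  then show False
    using partitions_uptoD(3)[OF assms] U by auto
qed

lemma card_join_block_at:
  assumes "P \<in> partitions_upto n" "U \<in> P"
  shows "card (join_block_at n P U) = card P"
proof -
  have "card (join_block_at n P U) = Suc (card (P - {U}))"
    unfolding join_block_at_def
    by (subst card_insert_disjoint) (use partitions_uptoD(1)[OF assms(1)] new_blocks_fresh[OF assms(1)] in auto)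
  then show ?thesis
    using card_Suc_Diff1[OF partitions_uptoD(1)[OF assms(1)] assms(2)] by simp
qed

lemma card_open_block:
  assumes "P \<in> partitions_upto n"
  shows "card (open_block n P) = Suc (card P)"
  using partitions_uptoD(1)[OF assms(1)] new_blocks_fresh[OF assms(1)]
  by (simp add: open_block_def)

text \<open>
  All the statistics that occur are sums over blocks of a function of the block size, and a new
  ball changes only one block. This is why the one-step analysis needs nothing beyond the increments
  \<open>g (u + 1) - g u\<close> and \<open>g 1\<close>.
\<close>

lemma block_sum_join:
  assumes "P \<in> partitions_upto n" "U \<in> P"
  shows "block_sum g (join_block_at n P U) = block_sum g P + (g (Suc (card U)) - g (card U))"
proof -
  note P = partitions_uptoD[OF assms(1)]
  have "block_sum g (join_block_at n P U) = g (card (insert (Suc n) U)) + (\<Sum>V\<in>P - {U}. g (card V))"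
    unfolding block_sum_def join_block_at_def
    by (subst sum.insert) (use P new_blocks_fresh[OF assms(1)] in auto)
  also have "card (insert (Suc n) U) = Suc (card U)"
    using P(4,5)[OF assms(2)] by simp
  also have "(\<Sum>V\<in>P - {U}. g (card V)) = block_sum g P - g (card U)"
    unfolding block_sum_def using P(1) assms(2) by (simp add: sum_diff1)
  finally show ?thesis by simp
qed

lemma block_sum_open:
  assumes "P \<in> partitions_upto n"
  shows "block_sum g (open_block n P) = block_sum g P + g 1"
  using partitions_uptoD(1)[OF assms(1)] new_blocks_fresh[OF assms(1)]
  by (simp add: open_block_def block_sum_def)

lemma block_sum_simps:
  "block_sum (\<lambda>u. f u + g u) P = block_sum f P + block_sum g P"
  "block_sum (\<lambda>u. f u - g u) P = block_sum f P - block_sum g P"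
  "block_sum (\<lambda>u. c * f u) P = c * block_sum f P"
  "block_sum (\<lambda>u. c) P = c * real (card P)"
  by (auto simp: block_sum_def sum.distrib sum_subtractf sum_distrib_left)

lemma block_sum_mono:
  assumes "P \<in> partitions_upto n" "\<And>u. u \<ge> 1 \<Longrightarrow> f u \<le> g u"
  shows "block_sum f P \<le> block_sum g P"
  unfolding block_sum_def by (rule sum_mono) (use assms partitions_uptoD in auto)

lemma abs_block_sum_le:
  assumes "P \<in> partitions_upto n" "\<And>u. u \<ge> 1 \<Longrightarrow> \<bar>f u\<bar> \<le> g u"
  shows "\<bar>block_sum f P\<bar> \<le> block_sum g P"
  unfolding block_sum_def by (rule order_trans[OF sum_abs], rule sum_mono) (use assms partitions_uptoD in auto)

lemma restrict_join:
  assumes "P \<in> partitions_upto n" "U \<in> P" "m \<le> n"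
  shows "restrict_partition m (join_block_at n P U) = restrict_partition m P"
proof -
  have *: "insert (Suc n) U \<inter> {1..m} = U \<inter> {1..m}"
    using assms(3) by auto
  have "(\<lambda>U. U \<inter> {1..m}) ` join_block_at n P U = (\<lambda>U. U \<inter> {1..m}) ` insert U (P - {U})"
    by (simp only: join_block_at_def image_insert *)
  then show ?thesis
    using assms(2) by (simp only: restrict_partition_def insert_Diff)
qed

lemma restrict_open:
  assumes "m \<le> n"
  shows "restrict_partition m (open_block n P) = restrict_partition m P"
proof -
  have "{Suc n} \<inter> {1..m} = {}"
    using assms by auto
  then show ?thesis
    by (simp add: restrict_partition_def open_block_def insert_Diff_if)
qed

lemma restrict_self:
  assumes "P \<in> partitions_upto n"
  shows "restrict_partition n P = P"
proof -
  have "(\<lambda>U. U \<inter> {1..n}) ` P = (\<lambda>U. U) ` P"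
    by (rule image_cong) (use partitions_uptoD(7)[OF assms] in auto)
  then show ?thesis
    using partitions_uptoD(3)[OF assms] by (simp add: restrict_partition_def)
qed

lemma restrict_restrict:
  assumes "m \<le> n"
  shows "restrict_partition m (restrict_partition n P) = restrict_partition m P"
proof -
  have *: "U \<inter> {1..n} \<inter> {1..m} = U \<inter> {1..m}" for U :: "nat set"
    using assms by auto
  have drop_empty: "f ` (A - {{}}) - {{}} = f ` A - {{}}" if "f {} = {}" for f :: "nat set \<Rightarrow> nat set" and A
    using that by auto
  show ?thesis
    unfolding restrict_partition_def by (subst drop_empty) (simp_all only: image_image * Int_empty_left)
qed

lemma restrict_in:
  assumes "P \<in> partitions_upto n" "m \<le> n"
  shows "restrict_partition m P \<in> partitions_upto m"
proof (rule partitions_uptoI)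
  note P = partitions_uptoD[OF assms(1)]
  have "\<Union>(restrict_partition m P) = \<Union>P \<inter> {1..m}"
    by (auto simp: restrict_partition_def)
  then show "\<Union>(restrict_partition m P) = {1..m}"
    using P(2) assms(2) by auto
  show "{} \<notin> restrict_partition m P"
    by (simp add: restrict_partition_def)
  fix U V assume "U \<in> restrict_partition m P" "V \<in> restrict_partition m P" "U \<noteq> V"
  then obtain U' V' where *: "U' \<in> P" "V' \<in> P" "U = U' \<inter> {1..m}" "V = V' \<inter> {1..m}"
    by (auto simp: restrict_partition_def)
  have "U' \<noteq> V'"
    using \<open>U \<noteq> V\<close> *(3,4) by blast
  from P(8)[OF *(1,2) this] show "U \<inter> V = {}"
    unfolding *(3,4) by blast
qed

section \<open>The law of the process and its transitions\<close>

locale ewens_pitman_process = ewens_pitman M \<alpha> \<theta> \<pi>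
  for M :: "'a measure" and \<alpha> \<theta> :: real and \<pi> :: "nat \<Rightarrow> 'a \<Rightarrow> nat set set" +
  assumes alpha_pos: "0 < \<alpha>" and alpha_less_1: "\<alpha> < 1" and theta_gt: "\<theta> > - \<alpha>"
begin

lemma denominator_pos: "n \<ge> 1 \<Longrightarrow> \<theta> + real n > 0"
  using theta_gt alpha_less_1 by linarith

definition law :: "nat \<Rightarrow> nat set set \<Rightarrow> real" where
  "law n P = prob {\<omega> \<in> space M. \<pi> n \<omega> = P}"

definition expect :: "nat \<Rightarrow> (nat set set \<Rightarrow> 'b::real_vector) \<Rightarrow> 'b" where
  "expect n f = (\<Sum>P\<in>partitions_upto n. law n P *\<^sub>R f P)"

definition step :: "nat \<Rightarrow> (nat set set \<Rightarrow> 'b::real_vector) \<Rightarrow> nat set set \<Rightarrow> 'b" where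
  "step n f P = (\<Sum>U\<in>P. ((real (card U) - \<alpha>) / (\<theta> + real n)) *\<^sub>R f (join_block_at n P U))
     + ((\<theta> + real (card P) * \<alpha>) / (\<theta> + real n)) *\<^sub>R f (open_block n P)"

lemma state_measurable [measurable]:
  "n \<ge> 1 \<Longrightarrow> (\<lambda>\<omega>. f (\<pi> n \<omega>)) \<in> M \<rightarrow>\<^sub>M borel"
  by (rule measurable_compose[OF random_partition[of n]]) (auto intro: borel_measurable_count_space)

lemma state_event [measurable]:
  assumes "n \<ge> 1"
  shows "{\<omega> \<in> space M. Q (\<pi> n \<omega>)} \<in> events"
proof -
  have "{\<omega> \<in> space M. Q (\<pi> n \<omega>)} = \<pi> n -` {P \<in> partitions_upto n. Q P} \<inter> space M"
    using measurable_space[OF random_partition[OF assms]] by auto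
  then show ?thesis
    using measurable_sets[OF random_partition[OF assms], of "{P \<in> partitions_upto n. Q P}"] by auto
qed

lemma state_in: "n \<ge> 1 \<Longrightarrow> \<omega> \<in> space M \<Longrightarrow> \<pi> n \<omega> \<in> partitions_upto n"
  using measurable_space[OF random_partition] by auto

lemma law_nonneg: "law n P \<ge> 0"
  by (simp add: law_def)

text \<open>
  There are finitely many partitions of \<open>{1..n}\<close>, so expectations of functions of \<open>\<pi> n\<close> are finite
  sums. Up to the final passage to limits all estimates are made for these sums.
\<close>

lemma expectation_state:
  fixes f :: "nat set set \<Rightarrow> 'b::{banach, second_countable_topology}"
  assumes "n \<ge> 1"
  shows "integrable M (\<lambda>\<omega>. f (\<pi> n \<omega>))" "integral\<^sup>L M (\<lambda>\<omega>. f (\<pi> n \<omega>)) = expect n f"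
proof -
  let ?A = "\<lambda>P. {\<omega> \<in> space M. \<pi> n \<omega> = P}"
  have eq: "(\<Sum>P\<in>partitions_upto n. indicator (?A P) \<omega> *\<^sub>R f P) = f (\<pi> n \<omega>)" if "\<omega> \<in> space M" for \<omega>
  proof -
    have "(\<Sum>P\<in>partitions_upto n. indicator (?A P) \<omega> *\<^sub>R f P) = (\<Sum>P\<in>{\<pi> n \<omega>}. indicator (?A P) \<omega> *\<^sub>R f P)"
      by (rule sum.mono_neutral_right)
         (use finite_partitions_upto state_in[OF assms that] in \<open>auto simp: indicator_def\<close>)
    then show ?thesis
      using that by simp
  qed
  have ind: "integrable M (\<lambda>\<omega>. indicator (?A P) \<omega> :: real)" for P
    by (rule integrable_real_indicator) (use state_event[OF assms, of "\<lambda>Q. Q = P"] in \<open>auto simp: emeasure_eq_measure\<close>)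
  have int: "integrable M (\<lambda>\<omega>. \<Sum>P\<in>partitions_upto n. indicator (?A P) \<omega> *\<^sub>R f P)"
    using ind by (intro Bochner_Integration.integrable_sum integrable_scaleR_left) auto
  then show "integrable M (\<lambda>\<omega>. f (\<pi> n \<omega>))"
    by (rule Bochner_Integration.integrable_cong[THEN iffD1, rotated -1]) (use eq in auto)
  have "integral\<^sup>L M (\<lambda>\<omega>. f (\<pi> n \<omega>)) = integral\<^sup>L M (\<lambda>\<omega>. \<Sum>P\<in>partitions_upto n. indicator (?A P) \<omega> *\<^sub>R f P)"
    by (rule Bochner_Integration.integral_cong) (use eq in auto)
  also have "\<dots> = (\<Sum>P\<in>partitions_upto n. integral\<^sup>L M (indicator (?A P)) *\<^sub>R f P)"
    using ind by (subst Bochner_Integration.integral_sum) auto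
  also have "\<dots> = expect n f"
    unfolding expect_def law_def
    by (intro sum.cong refl) (simp add: Int_absorb2)
  finally show "integral\<^sup>L M (\<lambda>\<omega>. f (\<pi> n \<omega>)) = expect n f" .
qed

lemma expect_const: "n \<ge> 1 \<Longrightarrow> expect n (\<lambda>_. c) = c" for c :: "'b::{banach, second_countable_topology}"
  using expectation_state(2)[of n "\<lambda>_. c"] by (simp add: prob_space)

lemma joint_join:
  assumes "n \<ge> 1" "P \<in> partitions_upto n" "U \<in> P"
  shows "prob {\<omega> \<in> space M. \<pi> (Suc n) \<omega> = join_block_at n P U \<and> \<pi> n \<omega> = P}
     = law n P * ((real (card U) - \<alpha>) / (\<theta> + real n))"
proof (cases "law n P > 0")
  case True
  then show ?thesis
    using join_block[OF assms(1,2) _ assms(3)]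
    by (simp add: cond_prob_def law_def join_block_at_def field_simps)
next
  case False
  then have 0: "law n P = 0"
    using law_nonneg[of n P] by simp
  have "prob {\<omega> \<in> space M. \<pi> (Suc n) \<omega> = join_block_at n P U \<and> \<pi> n \<omega> = P} \<le> law n P"
    unfolding law_def by (rule finite_measure_mono) (use state_event[OF assms(1), of "\<lambda>Q. Q = P"] in auto)
  then have "prob {\<omega> \<in> space M. \<pi> (Suc n) \<omega> = join_block_at n P U \<and> \<pi> n \<omega> = P} = 0"
    unfolding 0 by (simp add: measure_le_0_iff)
  then show ?thesis
    using 0 by simp
qed

lemma joint_open:
  assumes "n \<ge> 1" "P \<in> partitions_upto n"
  shows "prob {\<omega> \<in> space M. \<pi> (Suc n) \<omega> = open_block n P \<and> \<pi> n \<omega> = P}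
     = law n P * ((\<theta> + real (card P) * \<alpha>) / (\<theta> + real n))"
proof (cases "law n P > 0")
  case True
  then show ?thesis
    using new_block[OF assms(1,2)]
    by (simp add: cond_prob_def law_def open_block_def field_simps)
next
  case False
  then have 0: "law n P = 0"
    using law_nonneg[of n P] by simp
  have "prob {\<omega> \<in> space M. \<pi> (Suc n) \<omega> = open_block n P \<and> \<pi> n \<omega> = P} \<le> law n P"
    unfolding law_def by (rule finite_measure_mono) (use state_event[OF assms(1), of "\<lambda>Q. Q = P"] in auto)
  then have "prob {\<omega> \<in> space M. \<pi> (Suc n) \<omega> = open_block n P \<and> \<pi> n \<omega> = P} = 0"
    unfolding 0 by (simp add: measure_le_0_iff)
  then show ?thesis
    using 0 by simp
qed

lemma step_weights:
  assumes "n \<ge> 1" "P \<in> partitions_upto n"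
  shows "(\<Sum>U\<in>P. (real (card U) - \<alpha>) / (\<theta> + real n)) + (\<theta> + real (card P) * \<alpha>) / (\<theta> + real n) = 1"
    "\<And>U. U \<in> P \<Longrightarrow> (real (card U) - \<alpha>) / (\<theta> + real n) \<ge> 0"
    "(\<theta> + real (card P) * \<alpha>) / (\<theta> + real n) \<ge> 0" "\<theta> + real (card P) * \<alpha> > 0"
proof -
  have "(\<Sum>U\<in>P. real (card U) - \<alpha>) = real n - real (card P) * \<alpha>"
    using sum_card_blocks[OF assms(2)] by (simp add: sum_subtractf flip: of_nat_sum)
  then show "(\<Sum>U\<in>P. (real (card U) - \<alpha>) / (\<theta> + real n)) + (\<theta> + real (card P) * \<alpha>) / (\<theta> + real n) = 1"
    using denominator_pos[OF assms(1)]
    by (simp add: add_divide_distrib[symmetric] flip: sum_divide_distrib)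
  show "(real (card U) - \<alpha>) / (\<theta> + real n) \<ge> 0" if "U \<in> P" for U
  proof -
    have "real (card U) \<ge> 1"
      using partitions_uptoD(6)[OF assms(2) that] by simp
    then show ?thesis
      using denominator_pos[OF assms(1)] alpha_less_1 by simp
  qed
  have "real (card P) * \<alpha> \<ge> 1 * \<alpha>"
    using card_partition_bounds(2)[OF assms(2,1)] alpha_pos by (intro mult_right_mono) auto
  then show "\<theta> + real (card P) * \<alpha> > 0"
    using theta_gt by linarith
  then show "(\<theta> + real (card P) * \<alpha>) / (\<theta> + real n) \<ge> 0"
    using denominator_pos[OF assms(1)] by simp
qed

text \<open>
  The prescribed probabilities of joining a block and of opening one already add up to one, so no
  mass is left for any other transition. Therefore the given transition law, stated only for the listed
  successors, determines the joint law of two consecutive states. States of probability zero satisfy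
  both claims trivially.
\<close>

lemma joint_transition:
  fixes f :: "nat set set \<Rightarrow> 'b::real_vector"
  assumes "n \<ge> 1" "P \<in> partitions_upto n"
  defines "J \<equiv> \<lambda>Q. prob {\<omega> \<in> space M. \<pi> (Suc n) \<omega> = Q \<and> \<pi> n \<omega> = P}"
  shows "(\<Sum>Q\<in>partitions_upto (Suc n). J Q *\<^sub>R f Q) = law n P *\<^sub>R step n f P"
    "Q \<notin> insert (open_block n P) (join_block_at n P ` P) \<Longrightarrow> J Q = 0"
proof -
  let ?S = "insert (open_block n P) (join_block_at n P ` P)"
  note P = partitions_uptoD[OF assms(2)]
  have S: "?S \<subseteq> partitions_upto (Suc n)" "finite ?S"
    using join_block_at_in[OF assms(2)] open_block_in[OF assms(2)] P(1) by auto
  have J_meas: "{\<omega> \<in> space M. \<pi> (Suc n) \<omega> = Q \<and> \<pi> n \<omega> = P} \<in> events" for Q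
    using state_event[OF assms(1), of "\<lambda>Q. Q = P"] state_event[of "Suc n" "\<lambda>Q'. Q' = Q"]
    by (simp add: sets.sets_Collect_conj)
  have over_S: "(\<Sum>Q\<in>?S. J Q *\<^sub>R g Q) = law n P *\<^sub>R step n g P" for g :: "nat set set \<Rightarrow> 'c::real_vector"
  proof -
    have "(\<Sum>Q\<in>?S. J Q *\<^sub>R g Q) = J (open_block n P) *\<^sub>R g (open_block n P) + (\<Sum>U\<in>P. J (join_block_at n P U) *\<^sub>R g (join_block_at n P U))"
      using open_block_not_join[OF assms(2)] P(1)
      by (simp add: sum.reindex[OF inj_on_join_block_at[OF assms(2)]] o_def)
    also have "\<dots> = law n P *\<^sub>R step n g P"
      unfolding J_def step_def using joint_join[OF assms(1,2)] joint_open[OF assms(1,2)]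
      by (simp add: scaleR_right_distrib scaleR_sum_right)
    finally show ?thesis .
  qed
  have total: "(\<Sum>Q\<in>partitions_upto (Suc n). J Q) = law n P"
  proof -
    have "law n P = prob (\<Union>Q\<in>partitions_upto (Suc n). {\<omega> \<in> space M. \<pi> (Suc n) \<omega> = Q \<and> \<pi> n \<omega> = P})"
      unfolding law_def by (rule arg_cong[where f = prob]) (use state_in[of "Suc n"] in auto)
    also have "\<dots> = (\<Sum>Q\<in>partitions_upto (Suc n). J Q)"
      unfolding J_def
      by (rule finite_measure_finite_Union) (use J_meas finite_partitions_upto in \<open>auto simp: disjoint_family_on_def\<close>)
    finally show ?thesis by simp
  qed
  have "step n (\<lambda>_. 1::real) P = 1"
    using step_weights(1)[OF assms(1,2)] by (simp add: step_def)
  then have "(\<Sum>Q\<in>?S. J Q) = law n P"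
    using over_S[of "\<lambda>_. 1::real"] by simp
  then have "(\<Sum>Q\<in>partitions_upto (Suc n) - ?S. J Q) = 0"
    using total sum.subset_diff[OF S(1) finite_partitions_upto, of J] by simp
  then have zero: "J Q = 0" if "Q \<in> partitions_upto (Suc n) - ?S" for Q
    using that finite_partitions_upto by (subst (asm) sum_nonneg_eq_0_iff) (auto simp: J_def)
  have out: "J Q = 0" if "Q \<notin> partitions_upto (Suc n)" for Q
  proof -
    have "{\<omega> \<in> space M. \<pi> (Suc n) \<omega> = Q \<and> \<pi> n \<omega> = P} = {}"
      using state_in[of "Suc n"] that by auto
    then show ?thesis
      unfolding J_def by (simp only: measure_empty)
  qed
  show "Q \<notin> ?S \<Longrightarrow> J Q = 0"
    using zero out by blast
  have "(\<Sum>Q\<in>partitions_upto (Suc n). J Q *\<^sub>R f Q) = (\<Sum>Q\<in>?S. J Q *\<^sub>R f Q)"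
    by (rule sum.mono_neutral_right) (use zero S finite_partitions_upto in auto)
  then show "(\<Sum>Q\<in>partitions_upto (Suc n). J Q *\<^sub>R f Q) = law n P *\<^sub>R step n f P"
    using over_S by simp
qed

lemma law_Suc:
  assumes "n \<ge> 1"
  shows "law (Suc n) Q = (\<Sum>P\<in>partitions_upto n. prob {\<omega> \<in> space M. \<pi> (Suc n) \<omega> = Q \<and> \<pi> n \<omega> = P})"
proof -
  have J_meas: "{\<omega> \<in> space M. \<pi> (Suc n) \<omega> = Q \<and> \<pi> n \<omega> = P} \<in> events" for P
    using state_event[OF assms(1), of "\<lambda>Q. Q = P"] state_event[of "Suc n" "\<lambda>Q'. Q' = Q"]
    by (simp add: sets.sets_Collect_conj)
  have "law (Suc n) Q = prob (\<Union>P\<in>partitions_upto n. {\<omega> \<in> space M. \<pi> (Suc n) \<omega> = Q \<and> \<pi> n \<omega> = P})"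
    unfolding law_def by (rule arg_cong[where f = prob]) (use state_in[OF assms] in auto)
  also have "\<dots> = (\<Sum>P\<in>partitions_upto n. prob {\<omega> \<in> space M. \<pi> (Suc n) \<omega> = Q \<and> \<pi> n \<omega> = P})"
    by (rule finite_measure_finite_Union) (use J_meas finite_partitions_upto in \<open>auto simp: disjoint_family_on_def\<close>)
  finally show ?thesis .
qed

text \<open>
  The tower property in the form used everywhere below: an expectation at time \<open>n + 1\<close> is an
  expectation at time \<open>n\<close> of the one-step average.
\<close>

lemma expect_Suc:
  assumes "n \<ge> 1"
  shows "expect (Suc n) f = expect n (step n f)"
proof -
  let ?J = "\<lambda>P Q. prob {\<omega> \<in> space M. \<pi> (Suc n) \<omega> = Q \<and> \<pi> n \<omega> = P}"
  have "expect (Suc n) f = (\<Sum>Q\<in>partitions_upto (Suc n). \<Sum>P\<in>partitions_upto n. ?J P Q *\<^sub>R f Q)"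
    by (simp add: expect_def law_Suc[OF assms] scaleR_sum_left)
  also have "\<dots> = (\<Sum>P\<in>partitions_upto n. \<Sum>Q\<in>partitions_upto (Suc n). ?J P Q *\<^sub>R f Q)"
    by (rule sum.swap)
  also have "\<dots> = expect n (step n f)"
    unfolding expect_def by (intro sum.cong refl) (rule joint_transition(1)[OF assms])
  finally show ?thesis .
qed

lemma AE_restrict_Suc:
  assumes "n \<ge> 1"
  shows "AE \<omega> in M. restrict_partition n (\<pi> (Suc n) \<omega>) = \<pi> n \<omega>"
proof -
  let ?A = "\<lambda>P Q. {\<omega> \<in> space M. \<pi> (Suc n) \<omega> = Q \<and> \<pi> n \<omega> = P}"
  have never: "AE \<omega> in M. \<not> (\<pi> (Suc n) \<omega> = Q \<and> \<pi> n \<omega> = P)"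
    if P: "P \<in> partitions_upto n" and Q: "restrict_partition n Q \<noteq> P" for P Q
  proof -
    have meas: "?A P Q \<in> events"
      using state_event[OF assms(1), of "\<lambda>Q. Q = P"] state_event[of "Suc n" "\<lambda>Q'. Q' = Q"]
      by (simp add: sets.sets_Collect_conj)
    have "Q \<notin> insert (open_block n P) (join_block_at n P ` P)"
      using Q restrict_open[of n n P] restrict_join[OF P, of _ n] restrict_self[OF P] by auto
    then have "prob (?A P Q) = 0"
      by (rule joint_transition(2)[OF assms P])
    then have "AE \<omega> in M. \<omega> \<notin> ?A P Q"
      using meas by (simp add: prob_eq_0)
    then show ?thesis
      by (rule AE_mp) (rule AE_I2, auto)
  qed
  let ?bad = "{PQ \<in> partitions_upto n \<times> partitions_upto (Suc n). restrict_partition n (snd PQ) \<noteq> fst PQ}"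
  have "finite ?bad"
    by (rule finite_subset[OF _ finite_cartesian_product[OF finite_partitions_upto[of n] finite_partitions_upto[of "Suc n"]]]) auto
  then have "AE \<omega> in M. \<forall>PQ\<in>?bad. \<not> (\<pi> (Suc n) \<omega> = snd PQ \<and> \<pi> n \<omega> = fst PQ)"
    by (rule AE_finite_allI) (rule never, auto)
  then show ?thesis
    by (rule AE_mp) (rule AE_I2, use state_in[OF assms] state_in[of "Suc n"] in fastforce)
qed

text \<open>
  The process is only constrained through its transition probabilities; consistency of \<open>\<pi> n\<close> with
  \<open>\<pi> m\<close> therefore holds outside a null set and not pointwise.
\<close>

lemma AE_restrict:
  assumes "1 \<le> m" "m \<le> n"
  shows "AE \<omega> in M. restrict_partition m (\<pi> n \<omega>) = \<pi> m \<omega>"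
  using assms(2)
proof (induction n rule: dec_induct)
  case base
  show ?case
    by (rule AE_I2) (use state_in[OF assms(1)] restrict_self in auto)
next
  case (step n)
  have "AE \<omega> in M. restrict_partition n (\<pi> (Suc n) \<omega>) = \<pi> n \<omega>"
    by (rule AE_restrict_Suc) (use step assms in auto)
  then show ?case
    using step.IH
  proof eventually_elim
    case (elim \<omega>)
    then show ?case
      using restrict_restrict[OF step.hyps(1), of "\<pi> (Suc n) \<omega>"] by simp
  qed
qed

end

section \<open>Expectations and events of high probability\<close>

lemma one_plus_powr_le:
  fixes s a :: real
  assumes "s > -1" "0 \<le> a" "a \<le> 1"
  shows "(1 + s) powr a \<le> 1 + a * s"
  using Youngs_inequality_0[of a "1 - a" "1 + s" 1] assms by (simp add: algebra_simps)

context ewens_pitman_process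
begin

lemma expect_linear:
  "expect n (\<lambda>P. f P + g P) = expect n f + expect n g"
  "expect n (\<lambda>P. f P - g P) = expect n f - expect n g"
  "expect n (\<lambda>P. c *\<^sub>R f P) = c *\<^sub>R expect n f"
  by (auto simp: expect_def scaleR_right_distrib scaleR_right_diff_distrib sum.distrib sum_subtractf
      scaleR_sum_right mult.commute)

lemma expect_mult:
  "expect n (\<lambda>P. c * f P) = c * expect n f" "expect n (\<lambda>P. f P * c) = expect n f * c"
  "expect n (\<lambda>P. f P / c) = expect n f / c" for c :: real
  by (auto simp: expect_def sum_distrib_left sum_distrib_right sum_divide_distrib algebra_simps)

lemma expect_cong: "(\<And>P. P \<in> partitions_upto n \<Longrightarrow> f P = g P) \<Longrightarrow> expect n f = expect n g"
  by (simp add: expect_def)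

lemma expect_mono:
  fixes f g :: "nat set set \<Rightarrow> real"
  shows "(\<And>P. P \<in> partitions_upto n \<Longrightarrow> f P \<le> g P) \<Longrightarrow> expect n f \<le> expect n g"
  unfolding expect_def by (intro sum_mono) (simp add: mult_left_mono law_nonneg)

lemma expect_nonneg:
  fixes f :: "nat set set \<Rightarrow> real"
  shows "(\<And>P. P \<in> partitions_upto n \<Longrightarrow> 0 \<le> f P) \<Longrightarrow> 0 \<le> expect n f"
  unfolding expect_def by (intro sum_nonneg) (simp add: law_nonneg)

lemma norm_expect_le:
  fixes f :: "nat set set \<Rightarrow> 'b::real_normed_vector"
  shows "norm (expect n f) \<le> expect n (\<lambda>P. norm (f P))"
  unfolding expect_def by (rule norm_sum[THEN order_trans]) (simp add: law_nonneg)

lemma norm_expect_bound: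
  fixes f :: "nat set set \<Rightarrow> 'b::real_normed_vector"
  assumes "\<And>P. P \<in> partitions_upto n \<Longrightarrow> norm (f P) \<le> g P"
  shows "norm (expect n f) \<le> expect n g"
  using norm_expect_le expect_mono[OF assms] by (rule order_trans)

lemma step_linear:
  "step n (\<lambda>P. f P + g P) Q = step n f Q + step n g Q"
  "step n (\<lambda>P. f P - g P) Q = step n f Q - step n g Q"
  "step n (\<lambda>P. c *\<^sub>R f P) Q = c *\<^sub>R step n f Q"
  by (auto simp: step_def scaleR_right_distrib scaleR_right_diff_distrib sum.distrib sum_subtractf
      scaleR_sum_right mult.commute)

lemma step_cong:
  "f (open_block n P) = g (open_block n P) \<Longrightarrow>
    (\<And>U. U \<in> P \<Longrightarrow> f (join_block_at n P U) = g (join_block_at n P U)) \<Longrightarrow> step n f P = step n g P"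
  by (simp add: step_def)

lemma step_mono:
  fixes f g :: "nat set set \<Rightarrow> real"
  assumes "n \<ge> 1" "P \<in> partitions_upto n" "f (open_block n P) \<le> g (open_block n P)"
    "\<And>U. U \<in> P \<Longrightarrow> f (join_block_at n P U) \<le> g (join_block_at n P U)"
  shows "step n f P \<le> step n g P"
  unfolding step_def using assms step_weights(2,3)[OF assms(1,2)]
  by (intro add_mono sum_mono scaleR_left_mono) auto

lemma norm_step_le:
  fixes f :: "nat set set \<Rightarrow> 'b::real_normed_vector"
  assumes "n \<ge> 1" "P \<in> partitions_upto n"
  shows "norm (step n f P) \<le> step n (\<lambda>Q. norm (f Q)) P"
proof -
  have "norm (step n f P) \<le> norm (\<Sum>U\<in>P. ((real (card U) - \<alpha>) / (\<theta> + real n)) *\<^sub>R f (join_block_at n P U))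
     + norm (((\<theta> + real (card P) * \<alpha>) / (\<theta> + real n)) *\<^sub>R f (open_block n P))"
    unfolding step_def by (rule norm_triangle_ineq)
  also have "\<dots> \<le> step n (\<lambda>Q. norm (f Q)) P"
    unfolding step_def
  proof (rule add_mono)
    have "norm (\<Sum>U\<in>P. ((real (card U) - \<alpha>) / (\<theta> + real n)) *\<^sub>R f (join_block_at n P U))
      \<le> (\<Sum>U\<in>P. norm (((real (card U) - \<alpha>) / (\<theta> + real n)) *\<^sub>R f (join_block_at n P U)))"
      by (rule norm_sum)
    also have "\<dots> = (\<Sum>U\<in>P. ((real (card U) - \<alpha>) / (\<theta> + real n)) *\<^sub>R norm (f (join_block_at n P U)))"
      by (intro sum.cong refl) (use step_weights(2)[OF assms] in \<open>simp only: norm_scaleR real_scaleR_def abs_of_nonneg\<close>)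
    finally show "norm (\<Sum>U\<in>P. ((real (card U) - \<alpha>) / (\<theta> + real n)) *\<^sub>R f (join_block_at n P U))
      \<le> (\<Sum>U\<in>P. ((real (card U) - \<alpha>) / (\<theta> + real n)) *\<^sub>R norm (f (join_block_at n P U)))" .
  qed (use step_weights(3)[OF assms] in \<open>simp only: norm_scaleR real_scaleR_def abs_of_nonneg order_refl\<close>)
  finally show ?thesis .
qed

lemma step_const:
  assumes "n \<ge> 1" "P \<in> partitions_upto n"
  shows "step n (\<lambda>_. c) P = c"
  using step_weights(1)[OF assms] unfolding step_def
  by (simp add: scaleR_left_distrib[symmetric] flip: scaleR_sum_left)

text \<open>
  A function of the partition of the first \<open>m\<close> balls is a constant for the one-step average. This
  plays the role of taking out what is known in a conditional expectation.
\<close>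

lemma step_restrict:
  assumes "P \<in> partitions_upto n" "m \<le> n"
  shows "step n (\<lambda>Q. f (restrict_partition m Q) Q) P = step n (f (restrict_partition m P)) P"
  by (rule step_cong) (use assms restrict_open restrict_join in auto)

lemma step_block_sum:
  assumes "n \<ge> 1" "P \<in> partitions_upto n"
  shows "step n (block_sum g) P = block_sum g P +
    ((\<Sum>U\<in>P. (real (card U) - \<alpha>) * (g (Suc (card U)) - g (card U))) + (\<theta> + real (card P) * \<alpha>) * g 1) / (\<theta> + real n)"
proof -
  have "step n (block_sum g) P = step n (\<lambda>_. block_sum g P) P + step n (\<lambda>Q. block_sum g Q - block_sum g P) P"
    unfolding step_linear(1)[symmetric] by simp
  also have "step n (\<lambda>Q. block_sum g Q - block_sum g P) P =
      ((\<Sum>U\<in>P. (real (card U) - \<alpha>) * (g (Suc (card U)) - g (card U))) + (\<theta> + real (card P) * \<alpha>) * g 1) / (\<theta> + real n)"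
    unfolding step_def using block_sum_join[OF assms(2)] block_sum_open[OF assms(2)]
    by (simp add: add_divide_distrib sum_divide_distrib distrib_right)
  finally show ?thesis
    using step_const[OF assms] by simp
qed

lemma step_card:
  assumes "n \<ge> 1" "P \<in> partitions_upto n"
  shows "step n (\<lambda>Q. h (card Q)) P = h (card P) +
    ((\<theta> + real (card P) * \<alpha>) / (\<theta> + real n)) *\<^sub>R (h (Suc (card P)) - h (card P))"
proof -
  have "step n (\<lambda>Q. h (card Q)) P = step n (\<lambda>_. h (card P)) P + step n (\<lambda>Q. h (card Q) - h (card P)) P"
    unfolding step_linear(1)[symmetric] by simp
  also have "step n (\<lambda>Q. h (card Q) - h (card P)) P = ((\<theta> + real (card P) * \<alpha>) / (\<theta> + real n)) *\<^sub>R (h (Suc (card P)) - h (card P))"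
    unfolding step_def using card_join_block_at[OF assms(2)] card_open_block[OF assms(2)]
    by simp
  finally show ?thesis
    using step_const[OF assms] by simp
qed

text \<open>
  With high probability: the probability that \<open>A n (\<pi> n)\<close> fails tends to zero. The predicate is about
  the finite laws only, so no measurability side conditions arise.
\<close>

definition whp :: "(nat \<Rightarrow> nat set set \<Rightarrow> bool) \<Rightarrow> bool" where
  "whp A \<longleftrightarrow> (\<lambda>n. expect n (\<lambda>P. of_bool (\<not> A n P) :: real)) \<longlonglongrightarrow> 0"

lemma expect_tendsto_0_mono:
  fixes f g :: "nat \<Rightarrow> nat set set \<Rightarrow> real"
  assumes "(\<lambda>n. expect n (g n)) \<longlonglongrightarrow> 0"
    and "\<forall>\<^sub>F n in sequentially. \<forall>P\<in>partitions_upto n. 0 \<le> f n P \<and> f n P \<le> g n P"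
  shows "(\<lambda>n. expect n (f n)) \<longlonglongrightarrow> 0"
proof (rule tendsto_sandwich[OF _ _ tendsto_const assms(1)])
  show "\<forall>\<^sub>F n in sequentially. 0 \<le> expect n (f n)"
    using assms(2) by eventually_elim (rule expect_nonneg, auto)
  show "\<forall>\<^sub>F n in sequentially. expect n (f n) \<le> expect n (g n)"
    using assms(2) by eventually_elim (rule expect_mono, auto)
qed

lemma whp_mono:
  assumes "whp A" "\<forall>\<^sub>F n in sequentially. \<forall>P\<in>partitions_upto n. A n P \<longrightarrow> B n P"
  shows "whp B"
  unfolding whp_def
  by (rule expect_tendsto_0_mono[OF assms(1)[unfolded whp_def]])
     (use assms(2) in eventually_elim, auto)

lemma whp_conj:
  assumes "whp A" "whp B"
  shows "whp (\<lambda>n P. A n P \<and> B n P)"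
  unfolding whp_def
proof (rule expect_tendsto_0_mono)
  show "(\<lambda>n. expect n (\<lambda>P. of_bool (\<not> A n P) + of_bool (\<not> B n P) :: real)) \<longlonglongrightarrow> 0"
    unfolding expect_linear using tendsto_add[OF assms[unfolded whp_def]] by simp
qed auto

lemma whp_eventually:
  assumes "\<forall>\<^sub>F n in sequentially. \<forall>P\<in>partitions_upto n. B n P"
  shows "whp B"
proof (rule whp_mono)
  show "whp (\<lambda>n P. True)"
    by (simp add: whp_def expect_def)
qed (use assms in simp)

lemma whp_markov:
  fixes f :: "nat \<Rightarrow> nat set set \<Rightarrow> real"
  assumes "(\<lambda>n. expect n (f n)) \<longlonglongrightarrow> 0" "\<epsilon> > 0"
    and "\<forall>\<^sub>F n in sequentially. \<forall>P\<in>partitions_upto n. 0 \<le> f n P"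
  shows "whp (\<lambda>n P. f n P < \<epsilon>)"
  unfolding whp_def
proof (rule expect_tendsto_0_mono)
  show "(\<lambda>n. expect n (\<lambda>P. f n P / \<epsilon>)) \<longlonglongrightarrow> 0"
    unfolding expect_mult using tendsto_divide[OF assms(1) tendsto_const[of \<epsilon>]] assms(2) by simp
  show "\<forall>\<^sub>F n in sequentially. \<forall>P\<in>partitions_upto n. 0 \<le> (of_bool (\<not> f n P < \<epsilon>) :: real) \<and> of_bool (\<not> f n P < \<epsilon>) \<le> f n P / \<epsilon>"
    using assms(3) by eventually_elim (use assms(2) in \<open>auto simp: field_simps\<close>)
qed

section \<open>Moments of the number of blocks\<close>

text \<open>
  With this shift the probability of a new block is \<open>\<alpha> * shifted_count P / (\<theta> + n)\<close>, proportional
  to the quantity itself, and the moments of the number of blocks obey homogeneous recursions.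
\<close>

definition shifted_count :: "nat set set \<Rightarrow> real" where
  "shifted_count P = real (card P) + \<theta> / \<alpha>"

text \<open>
  The mean growth factors of \<open>X = shifted_count\<close> and of \<open>X * (X + 1)\<close>: divided by them, these two
  processes are martingales.
\<close>

definition growth :: "nat \<Rightarrow> real" where
  "growth n = (\<Prod>k = 1..<n. 1 + \<alpha> / (\<theta> + real k))"

definition growth2 :: "nat \<Rightarrow> real" where
  "growth2 n = (\<Prod>k = 1..<n. 1 + 2 * \<alpha> / (\<theta> + real k))"

lemma growth_Suc: "n \<ge> 1 \<Longrightarrow> growth (Suc n) = growth n * (1 + \<alpha> / (\<theta> + real n))"
  by (simp add: growth_def)

lemma growth2_Suc: "n \<ge> 1 \<Longrightarrow> growth2 (Suc n) = growth2 n * (1 + 2 * \<alpha> / (\<theta> + real n))"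
  by (simp add: growth2_def)

lemma growth_pos: "growth n > 0" "growth2 n > 0"
proof -
  have "\<alpha> / (\<theta> + real k) \<ge> 0" if "k \<ge> 1" for k
    using denominator_pos[OF that] alpha_pos by simp
  then show "growth n > 0" "growth2 n > 0"
    unfolding growth_def growth2_def
    by (auto intro!: prod_pos add_pos_nonneg simp flip: times_divide_eq_right)
qed

lemma growth_1: "growth (Suc 0) = 1"
  by (simp add: growth_def)

lemma min_shifted_pos: "1 + \<theta> / \<alpha> > 0"
  using theta_gt alpha_pos by (simp add: field_simps)

lemma shifted_count_ge:
  assumes "n \<ge> 1" "P \<in> partitions_upto n"
  shows "shifted_count P \<ge> 1 + \<theta> / \<alpha>" "shifted_count P > 0"
proof -
  show "shifted_count P \<ge> 1 + \<theta> / \<alpha>"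
    using card_partition_bounds(2)[OF assms(2,1)] by (simp add: shifted_count_def)
  then show "shifted_count P > 0"
    using min_shifted_pos by linarith
qed

lemma open_weight: "\<theta> + real (card P) * \<alpha> = \<alpha> * shifted_count P"
  using alpha_pos by (simp add: shifted_count_def field_simps)

lemma step_shifted_count:
  assumes "n \<ge> 1" "P \<in> partitions_upto n"
  shows "step n shifted_count P = shifted_count P * (1 + \<alpha> / (\<theta> + real n))"
    "step n (\<lambda>Q. shifted_count Q * (shifted_count Q + 1)) P = shifted_count P * (shifted_count P + 1) * (1 + 2 * \<alpha> / (\<theta> + real n))"
    "step n (\<lambda>Q. 1 / shifted_count Q) P = 1 / shifted_count P - \<alpha> / ((\<theta> + real n) * (shifted_count P + 1))"
proof -
  have *: "step n (\<lambda>Q. h (shifted_count Q)) P = h (shifted_count P) + (\<alpha> * shifted_count P / (\<theta> + real n)) * (h (shifted_count P + 1) - h (shifted_count P))" for h :: "real \<Rightarrow> real"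
    using step_card[OF assms, of "\<lambda>k. h (real k + \<theta> / \<alpha>)"]
    unfolding open_weight by (simp add: shifted_count_def add_ac)
  show "step n shifted_count P = shifted_count P * (1 + \<alpha> / (\<theta> + real n))"
    using *[of "\<lambda>x. x"] by (simp add: algebra_simps)
  show "step n (\<lambda>Q. shifted_count Q * (shifted_count Q + 1)) P = shifted_count P * (shifted_count P + 1) * (1 + 2 * \<alpha> / (\<theta> + real n))"
    using *[of "\<lambda>x. x * (x + 1)"] denominator_pos[OF assms(1)] by (simp add: field_simps)
  show "step n (\<lambda>Q. 1 / shifted_count Q) P = 1 / shifted_count P - \<alpha> / ((\<theta> + real n) * (shifted_count P + 1))"
  proof -
    let ?x = "shifted_count P"
    have x: "?x > 0" "\<theta> + real n > 0"
      using denominator_pos[OF assms(1)] shifted_count_ge(2)[OF assms] by auto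
    then have "1 / (?x + 1) - 1 / ?x = - (1 / (?x * (?x + 1)))"
      by (simp add: field_simps)
    moreover have "\<alpha> * ?x / (\<theta> + real n) * - (1 / (?x * (?x + 1))) = - (\<alpha> / ((\<theta> + real n) * (?x + 1)))"
      using x by simp
    ultimately show ?thesis
      using *[of "\<lambda>x. 1 / x"] by simp
  qed
qed

text \<open>
  The martingale property of \<open>f / r\<close>, tested against a function of an earlier partition.
\<close>

lemma expect_restrict_multiplicative:
  fixes f :: "nat set set \<Rightarrow> real"
  assumes "1 \<le> m" "m \<le> n"
    and step_f: "\<And>k P. m \<le> k \<Longrightarrow> P \<in> partitions_upto k \<Longrightarrow> step k f P = f P * (r (Suc k) / r k)"
    and r: "\<And>k. r k \<noteq> 0"
  shows "expect n (\<lambda>P. \<phi> (restrict_partition m P) * f P) = expect m (\<lambda>P. \<phi> P * f P) * (r n / r m)"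
  using assms(2)
proof (induction n rule: dec_induct)
  case base
  show ?case
    using r restrict_self by (simp add: expect_def)
next
  case (step n)
  have "expect (Suc n) (\<lambda>P. \<phi> (restrict_partition m P) * f P) = expect n (step n (\<lambda>P. \<phi> (restrict_partition m P) * f P))"
    by (rule expect_Suc) (use step assms in auto)
  also have "\<dots> = expect n (\<lambda>P. \<phi> (restrict_partition m P) * f P * (r (Suc n) / r n))"
  proof (rule expect_cong)
    fix P assume P: "P \<in> partitions_upto n"
    show "step n (\<lambda>P. \<phi> (restrict_partition m P) * f P) P = \<phi> (restrict_partition m P) * f P * (r (Suc n) / r n)"
      using step_restrict[OF P step.hyps(1), of "\<lambda>R Q. \<phi> R * f Q"] step_linear(3)[of n "\<phi> (restrict_partition m P)" f P]
        step_f[OF step.hyps(1) P] by simp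
  qed
  also have "\<dots> = expect n (\<lambda>P. \<phi> (restrict_partition m P) * f P) * (r (Suc n) / r n)"
    by (rule expect_mult)
  also have "\<dots> = expect m (\<lambda>P. \<phi> P * f P) * (r (Suc n) / r m)"
    unfolding step.IH using r[of n] by simp
  finally show ?case .
qed

lemma growth2_le:
  assumes "1 \<le> m" "m \<le> n"
  shows "growth2 n / growth2 m \<le> (growth n / growth m)\<^sup>2"
  using assms(2)
proof (induction n rule: dec_induct)
  case base
  show ?case using growth_pos[of m] by simp
next
  case (step n)
  let ?t = "\<alpha> / (\<theta> + real n)"
  have t: "?t \<ge> 0"
    using denominator_pos[of n] step assms alpha_pos by simp
  have n: "n \<ge> 1" using step assms by simp
  have "growth2 (Suc n) / growth2 m = growth2 n / growth2 m * (1 + 2 * ?t)"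
    using growth2_Suc[OF n] by simp
  also have "\<dots> \<le> (growth n / growth m)\<^sup>2 * (1 + ?t)\<^sup>2"
  proof (rule mult_mono)
    show "1 + 2 * ?t \<le> (1 + ?t)\<^sup>2"
      unfolding power2_sum by simp
    show "0 \<le> 1 + 2 * ?t"
      using t by linarith
  qed (use step.IH in auto)
  also have "\<dots> = (growth (Suc n) / growth m)\<^sup>2"
    using growth_Suc[OF n] by (simp add: power_mult_distrib power_divide)
  finally show ?case .
qed

definition count_ratio :: "nat \<Rightarrow> nat \<Rightarrow> nat set set \<Rightarrow> real" where
  "count_ratio m n P = shifted_count P / shifted_count (restrict_partition m P) * (growth m / growth n)"

text \<open>
  Given the partition at time \<open>m\<close>, the ratio has mean one exactly, and its second moment is at most
  \<open>1 + 1 / X\<close> with \<open>X\<close> the shifted count at time \<open>m\<close>, because \<open>growth2\<close> grows no faster than the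
  square of \<open>growth\<close>. Hence the relative variance accumulated after time \<open>m\<close> is of order \<open>1 / X\<close>, and
  the future number of blocks is predictable once many blocks are present.
\<close>

lemma count_ratio_deviation:
  assumes "1 \<le> m" "m \<le> n"
  shows "expect n (\<lambda>P. (count_ratio m n P - 1)\<^sup>2) \<le> expect m (\<lambda>P. 1 / shifted_count P)"
proof -
  define r where "r = growth m / growth n"
  let ?x = shifted_count
  let ?y = "\<lambda>P. shifted_count (restrict_partition m P)"
  have r: "r > 0" using growth_pos by (simp add: r_def)
  have 1: "expect n (\<lambda>P. \<phi> (restrict_partition m P) * ?x P) = expect m (\<lambda>P. \<phi> P * ?x P) * (growth n / growth m)" for \<phi>
    by (rule expect_restrict_multiplicative[OF assms])
       (use step_shifted_count(1) growth_Suc growth_pos(1) assms in \<open>auto simp: less_imp_neq[symmetric]\<close>)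
  have 2: "expect n (\<lambda>P. \<phi> (restrict_partition m P) * (?x P * (?x P + 1))) = expect m (\<lambda>P. \<phi> P * (?x P * (?x P + 1))) * (growth2 n / growth2 m)" for \<phi>
    by (rule expect_restrict_multiplicative[OF assms])
       (use step_shifted_count(2) growth2_Suc growth_pos(2) assms in \<open>auto simp: less_imp_neq[symmetric]\<close>)
  have pos: "?x P > 0" if "P \<in> partitions_upto m" for P
    using shifted_count_ge(2)[OF assms(1) that] .
  have n: "n \<ge> 1" using assms by simp
  have one: "expect m (\<lambda>P. 1 / ?x P * ?x P) = 1"
  proof -
    have "expect m (\<lambda>P. 1 / ?x P * ?x P) = expect m (\<lambda>P. 1)"
      by (rule expect_cong) (use pos in \<open>auto simp: less_imp_neq[symmetric]\<close>)
    then show ?thesis using expect_const[OF assms(1), of "1::real"] by simp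
  qed
  have A: "expect n (\<lambda>P. 1 / ?y P * ?x P) = 1 / r"
    using 1[of "\<lambda>P. 1 / ?x P"] one by (simp add: r_def)
  have "expect n (\<lambda>P. 1 / (?y P)\<^sup>2 * (?x P * (?x P + 1))) = expect m (\<lambda>P. 1 / (?x P)\<^sup>2 * (?x P * (?x P + 1))) * (growth2 n / growth2 m)"
    using 2[of "\<lambda>P. 1 / (?x P)\<^sup>2"] by simp
  also have "expect m (\<lambda>P. 1 / (?x P)\<^sup>2 * (?x P * (?x P + 1))) = expect m (\<lambda>P. 1 + 1 / ?x P)"
    by (rule expect_cong) (use pos in \<open>auto simp: less_imp_neq[symmetric] power2_eq_square field_simps\<close>)
  also have "\<dots> = 1 + expect m (\<lambda>P. 1 / ?x P)"
    using expect_const[OF assms(1), of "1::real"] by (simp add: expect_linear)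
  finally have B: "expect n (\<lambda>P. 1 / (?y P)\<^sup>2 * (?x P * (?x P + 1))) = (1 + expect m (\<lambda>P. 1 / ?x P)) * (growth2 n / growth2 m)" .
  have inv_nonneg: "expect m (\<lambda>P. 1 / ?x P) \<ge> 0"
    by (rule expect_nonneg) (use pos less_imp_le in auto)
  have "r\<^sup>2 * (growth2 n / growth2 m) \<le> r\<^sup>2 * (growth n / growth m)\<^sup>2"
    by (rule mult_left_mono[OF growth2_le[OF assms]]) simp
  also have "\<dots> = 1"
    using growth_pos(1)[of m] growth_pos(1)[of n] by (simp add: r_def power_divide)
  finally have C: "r\<^sup>2 * (growth2 n / growth2 m) \<le> 1" .
  have "expect n (\<lambda>P. (count_ratio m n P - 1)\<^sup>2)
      \<le> expect n (\<lambda>P. r\<^sup>2 * (1 / (?y P)\<^sup>2 * (?x P * (?x P + 1))) - 2 * r * (1 / ?y P * ?x P) + 1)"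
  proof (rule expect_mono)
    fix P assume P: "P \<in> partitions_upto n"
    then have "?x P > 0" "?y P > 0"
      using shifted_count_ge(2)[OF n] pos[OF restrict_in[OF P assms(2)]] by auto
    moreover have "r\<^sup>2 * (1 / (?y P)\<^sup>2 * (?x P * (?x P + 1))) - 2 * r * (1 / ?y P * ?x P) + 1
        = (count_ratio m n P - 1)\<^sup>2 + r\<^sup>2 * (1 / (?y P)\<^sup>2 * ?x P)"
      by (simp add: count_ratio_def flip: r_def) (simp add: power2_eq_square algebra_simps add_divide_distrib)
    ultimately show "(count_ratio m n P - 1)\<^sup>2 \<le> r\<^sup>2 * (1 / (?y P)\<^sup>2 * (?x P * (?x P + 1))) - 2 * r * (1 / ?y P * ?x P) + 1"
      by simp
  qed
  also have "\<dots> = r\<^sup>2 * ((1 + expect m (\<lambda>P. 1 / ?x P)) * (growth2 n / growth2 m)) - 2 * r * (1 / r) + 1"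
    unfolding expect_linear expect_mult(1)[of n "r\<^sup>2"] expect_mult(1)[of n "2 * r"] A B expect_const[OF n] ..
  also have "\<dots> = (r\<^sup>2 * (growth2 n / growth2 m)) * (1 + expect m (\<lambda>P. 1 / ?x P)) - 1"
    using r by (simp add: mult_ac)
  also have "\<dots> \<le> 1 * (1 + expect m (\<lambda>P. 1 / ?x P)) - 1"
    using mult_right_mono[OF C, of "1 + expect m (\<lambda>P. 1 / ?x P)"] inv_nonneg by simp
  finally show ?thesis by simp
qed

lemma expect_shifted_count:
  assumes "n \<ge> 1"
  shows "expect n shifted_count = expect 1 shifted_count * growth n"
  using expect_restrict_multiplicative[of 1 n shifted_count growth "\<lambda>_. 1"] assms
    step_shifted_count(1) growth_Suc growth_pos(1)
  by (auto simp: less_imp_neq[symmetric] growth_1)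

text \<open>
  One factor \<open>1 + \<alpha> / t\<close> lies between two quotients of consecutive powers with exponent \<open>\<alpha>\<close>,
  by Bernoulli's inequality \<open>(1 + s) powr \<alpha> \<le> 1 + \<alpha> * s\<close> applied with a negative and with a
  positive \<open>s\<close>; the bounds telescope.
\<close>

lemma growth_upper:
  assumes "n \<ge> 1"
  shows "growth n \<le> ((\<theta> + real n + \<alpha> - 1) / (\<theta> + \<alpha>)) powr \<alpha>"
  using assms
proof (induction n rule: dec_induct)
  case base
  show ?case using theta_gt by (simp add: growth_def)
next
  case (step n)
  let ?t = "\<theta> + real n"
  have t: "?t > 0" "?t + \<alpha> - 1 > 0" "?t + \<alpha> > 0"
    using denominator_pos[OF step.hyps(1)] step.hyps theta_gt alpha_pos by auto
  have "(1 - 1 / (?t + \<alpha>)) powr \<alpha> \<le> 1 - \<alpha> / (?t + \<alpha>)"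
    using one_plus_powr_le[of "- 1 / (?t + \<alpha>)" \<alpha>] t alpha_pos alpha_less_1 by simp
  then have "((?t + \<alpha> - 1) / (?t + \<alpha>)) powr \<alpha> \<le> ?t / (?t + \<alpha>)"
    using t by (simp add: field_simps)
  then have "1 + \<alpha> / ?t \<le> ((?t + \<alpha>) / (?t + \<alpha> - 1)) powr \<alpha>"
    using t by (simp add: field_simps powr_divide)
  then have "growth (Suc n) \<le> ((?t + \<alpha> - 1) / (\<theta> + \<alpha>)) powr \<alpha> * ((?t + \<alpha>) / (?t + \<alpha> - 1)) powr \<alpha>"
    unfolding growth_Suc[OF step.hyps(1)] using step.IH t alpha_pos
    by (intro mult_mono) auto
  also have "\<dots> = ((\<theta> + real (Suc n) + \<alpha> - 1) / (\<theta> + \<alpha>)) powr \<alpha>"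
    using t theta_gt by (simp add: powr_divide add_ac)
  finally show ?case .
qed

lemma growth_lower:
  assumes "n \<ge> 1"
  shows "growth n \<ge> ((\<theta> + real n) / (\<theta> + 1)) powr \<alpha>"
  using assms
proof (induction n rule: dec_induct)
  case base
  show ?case using denominator_pos[of 1] by (simp add: growth_def)
next
  case (step n)
  let ?t = "\<theta> + real n"
  have t: "?t > 0" "\<theta> + 1 > 0"
    using denominator_pos[OF step.hyps(1)] denominator_pos[of 1] by auto
  have "((?t + 1) / ?t) powr \<alpha> \<le> 1 + \<alpha> / ?t"
    using one_plus_powr_le[of "1 / ?t" \<alpha>] t alpha_pos alpha_less_1 by (simp add: field_simps)
  then have "(?t / (\<theta> + 1)) powr \<alpha> * ((?t + 1) / ?t) powr \<alpha> \<le> growth (Suc n)"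
    unfolding growth_Suc[OF step.hyps(1)] using step.IH t alpha_pos growth_pos(1)[of n]
    by (intro mult_mono) auto
  also have "(?t / (\<theta> + 1)) powr \<alpha> * ((?t + 1) / ?t) powr \<alpha> = ((\<theta> + real (Suc n)) / (\<theta> + 1)) powr \<alpha>"
    using t by (simp add: powr_divide add_ac)
  finally show ?case .
qed

text \<open>
  Since \<open>X \<ge> c = 1 + \<theta> / \<alpha> > 0\<close>, one has \<open>1 / (X + 1) \<ge> c / (c + 1) * (1 / X)\<close>, so the
  expectation of \<open>1 / X\<close> shrinks by the factor \<open>1 - \<delta> / (\<theta> + n)\<close> at each step and decays like a
  power of \<open>n\<close>.
\<close>

lemma expect_inverse_count: "(\<lambda>n. expect n (\<lambda>P. 1 / shifted_count P)) \<longlonglongrightarrow> 0"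
proof -
  define c where "c = 1 + \<theta> / \<alpha>"
  define \<delta> where "\<delta> = \<alpha> * (c / (c + 1))"
  have c: "c > 0" using min_shifted_pos by (simp add: c_def)
  have "c / (c + 1) \<le> 1" using c by simp
  then have \<delta>: "\<delta> > 0" "\<delta> \<le> 1"
    unfolding \<delta>_def using c alpha_pos alpha_less_1 mult_le_one[of \<alpha> "c / (c + 1)"] by auto
  define e where "e n = expect n (\<lambda>P. 1 / shifted_count P)" for n
  have e_nonneg: "e n \<ge> 0" if "n \<ge> 1" for n
    unfolding e_def by (rule expect_nonneg) (use shifted_count_ge(2)[OF that] less_imp_le in auto)
  have rec: "e (Suc n) \<le> e n * (1 - \<delta> / (\<theta> + real n))" if "n \<ge> 1" for n
  proof -
    have "e (Suc n) \<le> expect n (\<lambda>P. 1 / shifted_count P * (1 - \<delta> / (\<theta> + real n)))"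
      unfolding e_def expect_Suc[OF that]
    proof (rule expect_mono)
      fix P assume P: "P \<in> partitions_upto n"
      let ?x = "shifted_count P"
      have x: "?x \<ge> c" "?x > 0" using shifted_count_ge[OF that P] by (auto simp: c_def)
      have "1 / (?x + 1) - c / (c + 1) * (1 / ?x) = (?x - c) / ((c + 1) * ?x * (?x + 1))"
        using x c by (simp add: divide_simps) (simp add: algebra_simps)
      moreover have "(?x - c) / ((c + 1) * ?x * (?x + 1)) \<ge> 0"
        using x c by simp
      ultimately have "c / (c + 1) * (1 / ?x) \<le> 1 / (?x + 1)"
        by linarith
      then have "\<alpha> / (\<theta> + real n) * (c / (c + 1) * (1 / ?x)) \<le> \<alpha> / (\<theta> + real n) * (1 / (?x + 1))"
        using alpha_pos denominator_pos[OF that] by (intro mult_left_mono) auto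
      then show "step n (\<lambda>P. 1 / shifted_count P) P \<le> 1 / ?x * (1 - \<delta> / (\<theta> + real n))"
        unfolding step_shifted_count(3)[OF that P] \<delta>_def by (simp add: algebra_simps)
    qed
    then show ?thesis by (simp only: e_def expect_mult(2))
  qed
  have bound: "e n * (\<theta> + real n) powr \<delta> \<le> e 1 * (\<theta> + 1) powr \<delta>" if "n \<ge> 1" for n
    using that
  proof (induction n rule: dec_induct)
    case base show ?case by simp
  next
    case (step n)
    let ?t = "\<theta> + real n"
    have t: "?t > 0" using denominator_pos[OF step.hyps(1)] .
    have "e (Suc n) * (\<theta> + real (Suc n)) powr \<delta> \<le> e n * (1 - \<delta> / ?t) * (?t * (1 + 1 / ?t)) powr \<delta>"
    proof -
      have "\<theta> + real (Suc n) = ?t * (1 + 1 / ?t)"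
        using t by (simp add: distrib_left)
      then show ?thesis
        using mult_right_mono[OF rec[OF step.hyps(1)], of "(\<theta> + real (Suc n)) powr \<delta>"] by simp
    qed
    also have "\<dots> = e n * ?t powr \<delta> * ((1 - \<delta> / ?t) * (1 + 1 / ?t) powr \<delta>)"
      using t by (simp add: powr_mult)
    also have "\<dots> \<le> e n * ?t powr \<delta> * 1"
    proof (rule mult_left_mono)
      have "(1 - \<delta> / ?t) * (1 + 1 / ?t) powr \<delta> \<le> 1"
      proof (cases "1 - \<delta> / ?t \<ge> 0")
        case True
        have "(1 - \<delta> / ?t) * (1 + 1 / ?t) powr \<delta> \<le> (1 - \<delta> / ?t) * (1 + \<delta> * (1 / ?t))"
          using one_plus_powr_le[of "1 / ?t" \<delta>] True \<delta> t by (intro mult_left_mono) (auto simp: less_le_trans[of "-1" 0])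
        also have "\<dots> = 1 - (\<delta> / ?t)\<^sup>2" by (simp add: power2_eq_square algebra_simps)
        also have "\<dots> \<le> 1" by simp
        finally show ?thesis .
      next
        case False
        then have "(1 - \<delta> / ?t) * (1 + 1 / ?t) powr \<delta> \<le> 0"
          by (intro mult_nonpos_nonneg) auto
        then show ?thesis by simp
      qed
      then show "(1 - \<delta> / ?t) * (1 + 1 / ?t) powr \<delta> \<le> 1" .
      show "0 \<le> e n * ?t powr \<delta>" using e_nonneg[OF step.hyps(1)] by simp
    qed
    finally show ?case using step.IH by simp
  qed
  have lim: "(\<lambda>n. e 1 * (\<theta> + 1) powr \<delta> * (\<theta> + real n) powr (- \<delta>)) \<longlonglongrightarrow> 0"
    using \<delta>(1) by real_asymp
  have "e \<longlonglongrightarrow> 0"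
  proof (rule tendsto_sandwich[OF _ _ tendsto_const lim])
    show "\<forall>\<^sub>F n in sequentially. 0 \<le> e n"
      using eventually_ge_at_top[of 1] by eventually_elim (rule e_nonneg)
    show "\<forall>\<^sub>F n in sequentially. e n \<le> e 1 * (\<theta> + 1) powr \<delta> * (\<theta> + real n) powr (- \<delta>)"
      using eventually_ge_at_top[of 1]
    proof eventually_elim
      case (elim n)
      show ?case
        using bound[OF elim] denominator_pos[OF elim] by (simp add: powr_minus field_simps)
    qed
  qed
  then show ?thesis unfolding e_def[abs_def] .
qed

end

section \<open>Predicting the number of blocks from a burn-in time\<close>

text \<open>
  Any time tending to infinity makes the number of blocks predictable afterwards. Logarithmic growth
  keeps the score at that time, which is at most proportional to the number of balls, negligible.
\<close>

definition burn_in :: "nat \<Rightarrow> nat" where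
  "burn_in n = nat \<lfloor>ln (real n)\<rfloor> + 1"

lemma burn_in_bounds:
  assumes "n \<ge> 1"
  shows "burn_in n \<ge> 1" "real (burn_in n) \<le> 1 + ln (real n)" "burn_in n \<le> n" "real (burn_in n) \<ge> ln (real n)"
proof -
  have ln: "ln (real n) \<ge> 0" "ln (real n) \<le> real n - 1"
    using assms ln_le_minus_one[of "real n"] by auto
  show "burn_in n \<ge> 1"
    by (simp add: burn_in_def)
  have b: "real (burn_in n) = of_int \<lfloor>ln (real n)\<rfloor> + 1"
    using ln by (simp add: burn_in_def)
  show up: "real (burn_in n) \<le> 1 + ln (real n)" and "real (burn_in n) \<ge> ln (real n)"
    unfolding b by linarith+
  have "real (burn_in n) \<le> real n"
    using up ln by linarith
  then show "burn_in n \<le> n"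
    by simp
qed

lemma filterlim_burn_in: "filterlim burn_in at_top sequentially"
proof -
  have "filterlim (\<lambda>n. real (burn_in n)) at_top sequentially"
  proof (rule filterlim_at_top_mono)
    show "filterlim (\<lambda>n. ln (real n)) at_top sequentially"
      by real_asymp
    show "\<forall>\<^sub>F n in sequentially. ln (real n) \<le> real (burn_in n)"
      using eventually_ge_at_top[of 1] by eventually_elim (rule burn_in_bounds(4))
  qed
  then show ?thesis
    using filterlim_sequentially_iff_filterlim_real by blast
qed

context ewens_pitman_process
begin

lemma growth_ge_powr: "\<exists>c>0. \<forall>n\<ge>2. c * real n powr \<alpha> \<le> growth n"
proof (intro exI conjI allI impI)
  have t: "\<theta> + 1 > 0"
    using denominator_pos[of 1] by simp
  then show "(1 / (2 * (\<theta> + 1))) powr \<alpha> > 0"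
    by simp
  fix n :: nat assume n: "n \<ge> 2"
  have "(1 / (2 * (\<theta> + 1))) powr \<alpha> * real n powr \<alpha> = ((real n / 2) / (\<theta> + 1)) powr \<alpha>"
    using t by (simp add: powr_mult[symmetric])
  also have "\<dots> \<le> ((\<theta> + real n) / (\<theta> + 1)) powr \<alpha>"
    using t alpha_pos n by (intro powr_mono2 divide_right_mono) auto
  also have "\<dots> \<le> growth n"
    by (rule growth_lower) (use n in simp)
  finally show "(1 / (2 * (\<theta> + 1))) powr \<alpha> * real n powr \<alpha> \<le> growth n" .
qed

lemma growth_le_powr: "\<exists>C>0. \<forall>n\<ge>1. growth n \<le> C * real n powr \<alpha>"
proof (intro exI conjI allI impI)
  have t: "\<theta> + \<alpha> > 0"
    using theta_gt by simp
  then show "((\<bar>\<theta>\<bar> + 1) / (\<theta> + \<alpha>)) powr \<alpha> > 0"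
    by simp
  fix n :: nat assume n: "n \<ge> 1"
  have le: "\<bar>\<theta>\<bar> * 1 \<le> \<bar>\<theta>\<bar> * real n"
    using n by (intro mult_left_mono) auto
  have "growth n \<le> ((\<theta> + real n + \<alpha> - 1) / (\<theta> + \<alpha>)) powr \<alpha>"
    by (rule growth_upper[OF n])
  also have "\<dots> \<le> ((\<bar>\<theta>\<bar> + 1) * real n / (\<theta> + \<alpha>)) powr \<alpha>"
    using t alpha_pos alpha_less_1 n le
    by (intro powr_mono2 divide_right_mono divide_nonneg_pos) (auto simp: algebra_simps)
  also have "\<dots> = ((\<bar>\<theta>\<bar> + 1) / (\<theta> + \<alpha>)) powr \<alpha> * real n powr \<alpha>"
    using t by (simp add: powr_mult[symmetric] mult_ac)
  finally show "growth n \<le> ((\<bar>\<theta>\<bar> + 1) / (\<theta> + \<alpha>)) powr \<alpha> * real n powr \<alpha>" .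
qed

text \<open>
  The conditional mean of \<open>shifted_count\<close> at time \<open>n\<close> given the partition at the burn-in time. It
  depends on that early partition only.
\<close>

definition predicted_count :: "nat \<Rightarrow> nat set set \<Rightarrow> real" where
  "predicted_count n P = shifted_count (restrict_partition (burn_in n) P) * (growth n / growth (burn_in n))"

lemma predicted_count_ge:
  "\<exists>c>0. \<forall>\<^sub>F n in sequentially. \<forall>P\<in>partitions_upto n. c * (real n powr \<alpha> / (1 + ln (real n))) \<le> predicted_count n P"
proof -
  obtain c where c: "c > 0" "\<And>n. n \<ge> 2 \<Longrightarrow> c * real n powr \<alpha> \<le> growth n"
    using growth_ge_powr by auto
  obtain C where C: "C > 0" "\<And>n. n \<ge> 1 \<Longrightarrow> growth n \<le> C * real n powr \<alpha>"
    using growth_le_powr by auto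
  define x where "x = 1 + \<theta> / \<alpha>"
  have x: "x > 0" using min_shifted_pos by (simp add: x_def)
  show ?thesis
  proof (intro exI conjI)
    show "x * c / C > 0" using x c C by simp
    show "\<forall>\<^sub>F n in sequentially. \<forall>P\<in>partitions_upto n. x * c / C * (real n powr \<alpha> / (1 + ln (real n))) \<le> predicted_count n P"
      using eventually_ge_at_top[of 2]
    proof eventually_elim
      case (elim n)
      then have n: "n \<ge> 1" by simp
      note b = burn_in_bounds[OF n]
      have ln: "ln (real n) \<ge> 0" using n by simp
      show ?case
      proof
        fix P assume P: "P \<in> partitions_upto n"
        have "growth (burn_in n) \<le> C * real (burn_in n) powr \<alpha>"
          by (rule C(2)[OF b(1)])
        also have "\<dots> \<le> C * (1 + ln (real n)) powr \<alpha>"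
          using C b alpha_pos by (intro mult_left_mono powr_mono2) auto
        also have "\<dots> \<le> C * (1 + ln (real n)) powr 1"
          using C ln alpha_less_1 by (intro mult_left_mono powr_mono) auto
        finally have *: "growth (burn_in n) \<le> C * (1 + ln (real n))"
          using ln by simp
        have "x * c / C * (real n powr \<alpha> / (1 + ln (real n))) = x * ((c * real n powr \<alpha>) / (C * (1 + ln (real n))))"
          by simp
        also have "\<dots> \<le> x * (growth n / growth (burn_in n))"
          using * c(2)[OF elim] growth_pos(1) x C(1) ln less_imp_le[OF growth_pos(1)[of n]] by (intro mult_left_mono frac_le) auto
        also have "\<dots> \<le> predicted_count n P"
          unfolding predicted_count_def x_def
          using shifted_count_ge(1)[OF b(1) restrict_in[OF P b(3)]] less_imp_le[OF growth_pos(1)[of n]] less_imp_le[OF growth_pos(1)[of "burn_in n"]]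
          by (intro mult_right_mono divide_nonneg_nonneg) auto
        finally show "x * c / C * (real n powr \<alpha> / (1 + ln (real n))) \<le> predicted_count n P" .
      qed
    qed
  qed
qed

text \<open>
  The bound is deterministic: already the smallest possible prediction exceeds a multiple of
  \<open>n powr \<alpha> / (1 + ln n)\<close>.
\<close>

lemma predicted_count_large:
  assumes "(\<lambda>n. f n * ((1 + ln (real n)) / real n powr \<alpha>)) \<longlonglongrightarrow> 0" "\<epsilon> > 0"
  shows "\<forall>\<^sub>F n in sequentially. \<forall>P\<in>partitions_upto n. 0 < predicted_count n P \<and> \<bar>f n\<bar> < \<epsilon> * predicted_count n P"
proof -
  obtain c where c: "c > 0" "\<forall>\<^sub>F n in sequentially. \<forall>P\<in>partitions_upto n. c * (real n powr \<alpha> / (1 + ln (real n))) \<le> predicted_count n P"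
    using predicted_count_ge by auto
  have "\<forall>\<^sub>F n in sequentially. dist (f n * ((1 + ln (real n)) / real n powr \<alpha>)) 0 < \<epsilon> * c"
    by (rule tendstoD[OF assms(1)]) (use c assms in simp)
  then show ?thesis
    using c(2) eventually_ge_at_top[of 1]
  proof eventually_elim
    case (elim n)
    have pos: "real n powr \<alpha> / (1 + ln (real n)) > 0"
      using elim(3) by (auto intro!: divide_pos_pos add_pos_nonneg)
    then have "real n powr \<alpha> \<noteq> 0" "1 + ln (real n) \<noteq> 0"
      using elim(3) by auto
    then have "(1 + ln (real n)) / real n powr \<alpha> * (real n powr \<alpha> / (1 + ln (real n))) = 1"
      by simp
    then have "f n = f n * ((1 + ln (real n)) / real n powr \<alpha>) * (real n powr \<alpha> / (1 + ln (real n)))"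
      by (metis mult.assoc mult.right_neutral)
    then have "\<bar>f n\<bar> = \<bar>f n * ((1 + ln (real n)) / real n powr \<alpha>)\<bar> * (real n powr \<alpha> / (1 + ln (real n)))"
      using pos by (metis abs_mult abs_of_pos)
    also have "\<dots> < \<epsilon> * c * (real n powr \<alpha> / (1 + ln (real n)))"
      using elim(1) pos by (intro mult_strict_right_mono) auto
    finally have *: "\<bar>f n\<bar> < \<epsilon> * (c * (real n powr \<alpha> / (1 + ln (real n))))"
      by simp
    show ?case
    proof (intro ballI conjI)
      fix P assume P: "P \<in> partitions_upto n"
      then show "predicted_count n P > 0"
        using elim(2) pos c(1) by (meson less_le_trans mult_pos_pos)
      have "\<epsilon> * (c * (real n powr \<alpha> / (1 + ln (real n)))) \<le> \<epsilon> * predicted_count n P"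
        using elim(2) P assms(2) by (intro mult_left_mono) auto
      then show "\<bar>f n\<bar> < \<epsilon> * predicted_count n P"
        using * by linarith
    qed
  qed
qed

lemma whp_count_ratio:
  assumes "\<epsilon> > 0"
  shows "whp (\<lambda>n P. \<bar>shifted_count P / predicted_count n P - 1\<bar> < \<epsilon>)"
proof -
  have "whp (\<lambda>n P. (shifted_count P / predicted_count n P - 1)\<^sup>2 < \<epsilon>\<^sup>2)"
  proof (rule whp_markov)
    show "(\<lambda>n. expect n (\<lambda>P. (shifted_count P / predicted_count n P - 1)\<^sup>2)) \<longlonglongrightarrow> 0"
    proof (rule tendsto_sandwich[OF _ _ tendsto_const filterlim_compose[OF expect_inverse_count filterlim_burn_in]])
      show "\<forall>\<^sub>F n in sequentially. 0 \<le> expect n (\<lambda>P. (shifted_count P / predicted_count n P - 1)\<^sup>2)"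
        by (intro always_eventually allI expect_nonneg) simp
      show "\<forall>\<^sub>F n in sequentially. expect n (\<lambda>P. (shifted_count P / predicted_count n P - 1)\<^sup>2) \<le> expect (burn_in n) (\<lambda>P. 1 / shifted_count P)"
        using eventually_ge_at_top[of 1]
      proof eventually_elim
        case (elim n)
        have "shifted_count P / predicted_count n P = count_ratio (burn_in n) n P" for P
          by (simp add: predicted_count_def count_ratio_def)
        then show ?case
          using count_ratio_deviation[OF burn_in_bounds(1)[OF elim] burn_in_bounds(3)[OF elim]] by simp
      qed
    qed
  qed (use assms in auto)
  then show ?thesis
    by (rule whp_mono) (use assms in \<open>auto intro!: always_eventually dest: power2_less_imp_less[of "\<bar>_\<bar>" \<epsilon>, simplified]\<close>)
qed

lemma whp_predicted_count:
  assumes "\<epsilon> > 0"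
  shows "whp (\<lambda>n P. \<bar>real (card P) / predicted_count n P - 1\<bar> < \<epsilon>)"
proof (rule whp_mono[OF whp_count_ratio[of "\<epsilon> / 2"]])
  have "(\<lambda>n. \<theta> / \<alpha> * ((1 + ln (real n)) / real n powr \<alpha>)) \<longlonglongrightarrow> 0"
    using alpha_pos by real_asymp
  from predicted_count_large[OF this, of "\<epsilon> / 2"] assms
  have "\<forall>\<^sub>F n in sequentially. \<forall>P\<in>partitions_upto n. 0 < predicted_count n P \<and> \<bar>\<theta> / \<alpha>\<bar> < \<epsilon> / 2 * predicted_count n P"
    by simp
  then show "\<forall>\<^sub>F n in sequentially. \<forall>P\<in>partitions_upto n.
      \<bar>shifted_count P / predicted_count n P - 1\<bar> < \<epsilon> / 2 \<longrightarrow> \<bar>real (card P) / predicted_count n P - 1\<bar> < \<epsilon>"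
  proof eventually_elim
    case (elim n)
    show ?case
    proof (intro ballI impI)
      fix P assume P: "P \<in> partitions_upto n" and *: "\<bar>shifted_count P / predicted_count n P - 1\<bar> < \<epsilon> / 2"
      let ?p = "predicted_count n P"
      have p: "?p > 0" "\<bar>\<theta> / \<alpha>\<bar> < \<epsilon> / 2 * ?p" using elim P by auto
      then have "\<bar>\<theta> / \<alpha> / ?p\<bar> < \<epsilon> / 2"
        unfolding abs_divide[of "\<theta> / \<alpha>"] abs_of_pos[OF p(1)] using pos_divide_less_eq[OF p(1)] by blast
      moreover have "real (card P) / ?p = shifted_count P / ?p - \<theta> / \<alpha> / ?p"
        unfolding shifted_count_def add_divide_distrib by simp
      ultimately show "\<bar>real (card P) / ?p - 1\<bar> < \<epsilon>"
        using * by linarith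
    qed
  qed
qed (use assms in simp)

lemma expect_shifted_count_le:
  "\<exists>C>0. \<forall>n\<ge>1. expect n shifted_count \<le> C * growth n"
proof (intro exI conjI allI impI)
  show "\<bar>expect 1 shifted_count\<bar> + 1 > 0" by simp
  fix n :: nat assume "n \<ge> 1"
  then show "expect n shifted_count \<le> (\<bar>expect 1 shifted_count\<bar> + 1) * growth n"
    unfolding expect_shifted_count[OF \<open>n \<ge> 1\<close>] using growth_pos(1)[of n] by (intro mult_right_mono) auto
qed

text \<open>
  The exact order \<open>n powr \<alpha>\<close> has a random factor; with a little room \<open>\<eta>\<close> in the exponent,
  deterministic bounds on the number of blocks suffice for locating the estimator.
\<close>

lemma whp_count_upper:
  assumes "\<eta> > 0"
  shows "whp (\<lambda>n P. real (card P) \<le> real n powr (\<alpha> + \<eta>))"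
proof -
  obtain C where C: "C > 0" "\<And>n. n \<ge> 1 \<Longrightarrow> expect n shifted_count \<le> C * growth n"
    using expect_shifted_count_le by auto
  obtain D where D: "D > 0" "\<And>n. n \<ge> 1 \<Longrightarrow> growth n \<le> D * real n powr \<alpha>"
    using growth_le_powr by auto
  have "whp (\<lambda>n P. shifted_count P / real n powr (\<alpha> + \<eta> / 2) < 1)"
  proof (rule whp_markov)
    have lim: "(\<lambda>n. C * (D * real n powr \<alpha>) / real n powr (\<alpha> + \<eta> / 2)) \<longlonglongrightarrow> 0"
      using assms alpha_pos by real_asymp
    show "(\<lambda>n. expect n (\<lambda>P. shifted_count P / real n powr (\<alpha> + \<eta> / 2))) \<longlonglongrightarrow> 0"
      unfolding expect_mult
    proof (rule tendsto_sandwich[OF _ _ tendsto_const lim])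
      show "\<forall>\<^sub>F n in sequentially. 0 \<le> expect n shifted_count / real n powr (\<alpha> + \<eta> / 2)"
        using eventually_ge_at_top[of 1]
        by eventually_elim (intro divide_nonneg_nonneg expect_nonneg less_imp_le[OF shifted_count_ge(2)], auto)
      show "\<forall>\<^sub>F n in sequentially. expect n shifted_count / real n powr (\<alpha> + \<eta> / 2) \<le> C * (D * real n powr \<alpha>) / real n powr (\<alpha> + \<eta> / 2)"
        using eventually_ge_at_top[of 1]
      proof eventually_elim
        case (elim n)
        have "C * growth n \<le> C * (D * real n powr \<alpha>)"
          using C D elim by (intro mult_left_mono) auto
        then show ?case
          using C(2)[OF elim] by (intro divide_right_mono) auto
      qed
    qed
    show "\<forall>\<^sub>F n in sequentially. \<forall>P\<in>partitions_upto n. 0 \<le> shifted_count P / real n powr (\<alpha> + \<eta> / 2)"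
      using eventually_ge_at_top[of 1]
      by eventually_elim (intro ballI divide_nonneg_nonneg less_imp_le[OF shifted_count_ge(2)], auto)
  qed simp
  then show ?thesis
  proof (rule whp_mono)
    have "\<forall>\<^sub>F n in sequentially. real n powr (\<alpha> + \<eta> / 2) + \<bar>\<theta> / \<alpha>\<bar> \<le> real n powr (\<alpha> + \<eta>)"
      using assms alpha_pos by real_asymp
    then show "\<forall>\<^sub>F n in sequentially. \<forall>P\<in>partitions_upto n. shifted_count P / real n powr (\<alpha> + \<eta> / 2) < 1 \<longrightarrow> real (card P) \<le> real n powr (\<alpha> + \<eta>)"
      using eventually_ge_at_top[of 1]
    proof eventually_elim
      case (elim n)
      show ?case
      proof (intro ballI impI)
        fix P assume "shifted_count P / real n powr (\<alpha> + \<eta> / 2) < 1"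
        then have "shifted_count P < real n powr (\<alpha> + \<eta> / 2)"
          using elim by (simp add: divide_less_eq)
        then show "real (card P) \<le> real n powr (\<alpha> + \<eta>)"
          using elim unfolding shifted_count_def by linarith
      qed
    qed
  qed
qed

lemma whp_count_lower:
  assumes "\<eta> > 0"
  shows "whp (\<lambda>n P. real n powr (\<alpha> - \<eta>) \<le> real (card P))"
proof (rule whp_mono[OF whp_predicted_count[of "1 / 2"]])
  have "(\<lambda>n. real n powr (\<alpha> - \<eta>) * ((1 + ln (real n)) / real n powr \<alpha>)) \<longlonglongrightarrow> 0"
    using assms alpha_pos by real_asymp
  from predicted_count_large[OF this, of "1 / 2"]
  have "\<forall>\<^sub>F n in sequentially. \<forall>P\<in>partitions_upto n. 0 < predicted_count n P \<and> real n powr (\<alpha> - \<eta>) < 1 / 2 * predicted_count n P"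
    by simp
  then show "\<forall>\<^sub>F n in sequentially. \<forall>P\<in>partitions_upto n.
      \<bar>real (card P) / predicted_count n P - 1\<bar> < 1 / 2 \<longrightarrow> real n powr (\<alpha> - \<eta>) \<le> real (card P)"
  proof eventually_elim
    case (elim n)
    show ?case
    proof (intro ballI impI)
      fix P assume P: "P \<in> partitions_upto n" and *: "\<bar>real (card P) / predicted_count n P - 1\<bar> < 1 / 2"
      let ?p = "predicted_count n P"
      have p: "?p > 0" "real n powr (\<alpha> - \<eta>) < 1 / 2 * ?p" using elim P by auto
      have "1 / 2 < real (card P) / ?p"
        using * by linarith
      then have "1 / 2 * ?p < real (card P)"
        using p(1) by (simp add: less_divide_eq)
      then show "real n powr (\<alpha> - \<eta>) \<le> real (card P)"
        using p(2) by linarith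
    qed
  qed
qed simp

end

lemma harm_upper: "n \<ge> 1 \<Longrightarrow> (\<Sum>k = 1..n. 1 / real k) \<le> 1 + ln (real n)"
  using decseqD[OF decseq_harm_diff_ln, of 0 "n - 1"]
  by (simp add: harm_def harm_expand divide_inverse)

section \<open>Score and information of the Sibuya law\<close>

text \<open>
  For \<open>u \<ge> 1\<close> this is the derivative in \<open>x\<close> of \<open>ln (sibuya_pmf x u)\<close>: the term \<open>i = 0\<close> equals
  \<open>1 / x\<close> and comes from the leading factor \<open>x\<close> of the probability. Keeping it inside the sum makes the
  increments of \<open>score\<close> and \<open>info\<close> a number and its square.
\<close>

definition score :: "real \<Rightarrow> nat \<Rightarrow> real" where
  "score x u = - (\<Sum>i<u. 1 / (real i - x))"

definition info :: "real \<Rightarrow> nat \<Rightarrow> real" where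
  "info x u = (\<Sum>i<u. 1 / (real i - x)\<^sup>2)"

text \<open>
  The probability that a Sibuya variable with parameter \<open>a\<close> exceeds \<open>i\<close>.
\<close>

definition sibuya_tail :: "real \<Rightarrow> nat \<Rightarrow> real" where
  "sibuya_tail a i = (\<Prod>k = 1..i. 1 - a / real k)"

text \<open>
  The Fisher information of the Sibuya law after summation by parts. All terms are nonnegative and
  continuous in \<open>a\<close>, which makes this form convenient for limits and continuity.
\<close>

definition tail_info :: "real \<Rightarrow> real" where
  "tail_info a = (\<Sum>i. sibuya_tail a i / (real i - a)\<^sup>2)"

lemma sibuya_tail_bounds:
  assumes "0 \<le> a" "a < 1"
  shows "0 < sibuya_tail a i" "sibuya_tail a i \<le> 1"
proof -
  have f: "0 < 1 - a / real k" "1 - a / real k \<le> 1" if "k \<ge> 1" for k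
  proof -
    have "a / real k \<le> a / 1"
      using assms that by (intro divide_left_mono) auto
    then show "0 < 1 - a / real k" "1 - a / real k \<le> 1"
      using assms by auto
  qed
  show "0 < sibuya_tail a i"
    unfolding sibuya_tail_def using f by (intro prod_pos) auto
  show "sibuya_tail a i \<le> 1"
    unfolding sibuya_tail_def using f less_imp_le by (intro prod_le_1) force
qed

lemma sibuya_tail_rec:
  "sibuya_tail a 0 = 1" "i \<ge> 1 \<Longrightarrow> real i * sibuya_tail a i = (real i - a) * sibuya_tail a (i - 1)"
proof -
  show "sibuya_tail a 0 = 1" by (simp add: sibuya_tail_def)
  assume "i \<ge> 1"
  then obtain k where k: "i = Suc k" using not0_implies_Suc[of i] by auto
  have "sibuya_tail a i = sibuya_tail a k * (1 - a / real i)"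
    by (simp add: sibuya_tail_def k)
  then show "real i * sibuya_tail a i = (real i - a) * sibuya_tail a (i - 1)"
    using k by (simp add: field_simps)
qed

lemma inverse_square_bound:
  assumes "0 < a" "a \<le> b" "b < 1"
  shows "1 / (real i - a)\<^sup>2 \<le> (if i = 0 then 1 / a\<^sup>2 else 1 / (1 - b)\<^sup>2 * (1 / (real i)\<^sup>2))"
proof (cases "i = 0")
  case False
  then have i: "real i \<ge> 1" by simp
  then have "real i - b = real i * (1 - b) + b * (real i - 1)"
    by (simp add: algebra_simps)
  then have "real i * (1 - b) \<le> real i - a"
    using assms i mult_nonneg_nonneg[of b "real i - 1"] by linarith
  then have "(real i * (1 - b))\<^sup>2 \<le> (real i - a)\<^sup>2"
    using assms i by (intro power_mono) auto
  then have "1 / (real i - a)\<^sup>2 \<le> 1 / (real i * (1 - b))\<^sup>2"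
    using assms i by (intro divide_left_mono) (auto intro!: mult_pos_pos)
  then show ?thesis
    using False by (simp add: power_mult_distrib mult.commute)
qed simp

lemma summable_inverse_square:
  assumes "0 < a" "a < 1"
  shows "summable (\<lambda>i. 1 / (real i - a)\<^sup>2)"
proof (rule summable_comparison_test_ev)
  show "summable (\<lambda>i. 1 / (1 - a)\<^sup>2 * (1 / (real i)\<^sup>2))"
    using inverse_power_summable[of 2, where 'a = real] by (intro summable_mult) (simp add: divide_inverse)
  show "\<forall>\<^sub>F i in sequentially. norm (1 / (real i - a)\<^sup>2) \<le> 1 / (1 - a)\<^sup>2 * (1 / (real i)\<^sup>2)"
    using eventually_ge_at_top[of 1]
  proof eventually_elim
    case (elim i)
    then show ?case using inverse_square_bound[of a a i] assms by simp
  qed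
qed

lemma summable_tail_info:
  assumes "0 < a" "a < 1"
  shows "summable (\<lambda>i. sibuya_tail a i / (real i - a)\<^sup>2)"
proof (rule summable_comparison_test[OF _ summable_inverse_square[OF assms]])
  show "\<exists>N. \<forall>i\<ge>N. norm (sibuya_tail a i / (real i - a)\<^sup>2) \<le> 1 / (real i - a)\<^sup>2"
    using sibuya_tail_bounds[of a] assms by (auto intro!: divide_right_mono simp: abs_of_pos)
qed

lemma tail_info_ge:
  assumes "0 < a" "a < 1"
  shows "tail_info a \<ge> 1 / a\<^sup>2"
proof -
  have "(\<Sum>i\<in>{0}. sibuya_tail a i / (real i - a)\<^sup>2) \<le> tail_info a"
    unfolding tail_info_def
    by (rule sum_le_suminf[OF summable_tail_info[OF assms]])
       (use sibuya_tail_bounds(1)[of a] assms less_imp_le in \<open>auto intro!: divide_nonneg_nonneg simp: less_imp_le\<close>)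
  then show ?thesis by (simp add: sibuya_tail_rec)
qed

context ewens_pitman_process
begin

section \<open>Convergence in probability\<close>

definition tends_in_prob :: "(nat \<Rightarrow> nat set set \<Rightarrow> 'b::metric_space) \<Rightarrow> 'b \<Rightarrow> bool" where
  "tends_in_prob f l \<longleftrightarrow> (\<forall>\<epsilon>>0. whp (\<lambda>n P. dist (f n P) l < \<epsilon>))"

lemma tends_in_prob_cont:
  assumes "tends_in_prob f l" "isCont g l"
  shows "tends_in_prob (\<lambda>n P. g (f n P)) (g l)"
  unfolding tends_in_prob_def
proof (intro allI impI)
  fix \<epsilon> :: real assume "\<epsilon> > 0"
  then obtain \<delta> where d: "\<delta> > 0" "\<And>x. dist x l < \<delta> \<Longrightarrow> dist (g x) (g l) < \<epsilon>"
    using assms(2) unfolding continuous_at_eps_delta by blast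
  then show "whp (\<lambda>n P. dist (g (f n P)) (g l) < \<epsilon>)"
    using assms(1) whp_mono[of "\<lambda>n P. dist (f n P) l < \<delta>"] by (auto simp: tends_in_prob_def)
qed

lemma tends_in_prob_Pair:
  assumes "tends_in_prob f l" "tends_in_prob g k"
  shows "tends_in_prob (\<lambda>n P. (f n P, g n P)) (l, k)"
  unfolding tends_in_prob_def
proof (intro allI impI)
  fix \<epsilon> :: real assume e: "\<epsilon> > 0"
  have "whp (\<lambda>n P. dist (f n P) l < \<epsilon> / 2 \<and> dist (g n P) k < \<epsilon> / 2)"
    using assms[unfolded tends_in_prob_def, rule_format, of "\<epsilon> / 2"] e by (intro whp_conj) auto
  then show "whp (\<lambda>n P. dist (f n P, g n P) (l, k) < \<epsilon>)"
  proof (rule whp_mono, intro always_eventually allI ballI impI)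
    fix n P assume "dist (f n P) l < \<epsilon> / 2 \<and> dist (g n P) k < \<epsilon> / 2"
    moreover have "dist (f n P, g n P) (l, k) \<le> dist (f n P) l + dist (g n P) k"
      unfolding dist_Pair_Pair by (intro sqrt_sum_squares_le_sum) auto
    ultimately show "dist (f n P, g n P) (l, k) < \<epsilon>" by simp
  qed
qed

lemma tends_in_prob_cong:
  assumes "tends_in_prob f l" "whp (\<lambda>n P. f n P = g n P)"
  shows "tends_in_prob g l"
  unfolding tends_in_prob_def
proof (intro allI impI)
  fix \<epsilon> :: real assume "\<epsilon> > 0"
  then have "whp (\<lambda>n P. dist (f n P) l < \<epsilon> \<and> f n P = g n P)"
    using assms(1)[unfolded tends_in_prob_def, rule_format, of \<epsilon>] by (intro whp_conj assms(2))
  then show "whp (\<lambda>n P. dist (g n P) l < \<epsilon>)"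
    by (rule whp_mono) (intro always_eventually allI ballI impI, auto)
qed

lemma tends_in_prob_eventually:
  assumes "\<And>\<epsilon>. \<epsilon> > 0 \<Longrightarrow> \<forall>\<^sub>F n in sequentially. \<forall>P\<in>partitions_upto n. dist (f n P) l < \<epsilon>"
  shows "tends_in_prob f l"
  unfolding tends_in_prob_def by (intro allI impI whp_eventually assms)

lemma tends_in_prob_const: "tends_in_prob (\<lambda>n P. l) l"
  by (rule tends_in_prob_eventually) simp

lemma tends_in_prob_mult:
  fixes f g :: "nat \<Rightarrow> nat set set \<Rightarrow> 'b::real_normed_algebra"
  assumes "tends_in_prob f l" "tends_in_prob g k"
  shows "tends_in_prob (\<lambda>n P. f n P * g n P) (l * k)"
proof -
  have "isCont (\<lambda>z. fst z * snd z) (l, k)"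
    by (intro continuous_intros)
  from tends_in_prob_cont[OF tends_in_prob_Pair[OF assms] this] show ?thesis
    by simp
qed

lemma tends_in_prob_add:
  fixes f g :: "nat \<Rightarrow> nat set set \<Rightarrow> 'b::real_normed_vector"
  assumes "tends_in_prob f l" "tends_in_prob g k"
  shows "tends_in_prob (\<lambda>n P. f n P + g n P) (l + k)"
proof -
  have "isCont (\<lambda>z. fst z + snd z) (l, k)"
    by (intro continuous_intros)
  from tends_in_prob_cont[OF tends_in_prob_Pair[OF assms] this] show ?thesis
    by simp
qed

lemma tends_in_prob_bounded_by:
  fixes f :: "nat \<Rightarrow> nat set set \<Rightarrow> 'b::real_normed_vector" and g :: "nat \<Rightarrow> nat set set \<Rightarrow> real"
  assumes "tends_in_prob g 0" "whp (\<lambda>n P. norm (f n P) \<le> g n P)"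
  shows "tends_in_prob f 0"
  unfolding tends_in_prob_def
proof (intro allI impI)
  fix \<epsilon> :: real assume "\<epsilon> > 0"
  then have "whp (\<lambda>n P. dist (g n P) 0 < \<epsilon> \<and> norm (f n P) \<le> g n P)"
    using assms(1)[unfolded tends_in_prob_def, rule_format, of \<epsilon>] by (intro whp_conj assms(2))
  then show "whp (\<lambda>n P. dist (f n P) 0 < \<epsilon>)"
    by (rule whp_mono) (intro always_eventually allI ballI impI, auto)
qed

text \<open>
  Bounded convergence for convergence in probability.
\<close>

lemma expect_tendsto_in_prob:
  fixes f :: "nat \<Rightarrow> nat set set \<Rightarrow> 'b::real_normed_vector"
  assumes "tends_in_prob f 0" "\<forall>\<^sub>F n in sequentially. \<forall>P\<in>partitions_upto n. norm (f n P) \<le> B"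
  shows "(\<lambda>n. expect n (f n)) \<longlonglongrightarrow> 0"
proof (rule tendsto_norm_zero_cancel, rule order_tendstoI)
  fix a :: real assume "a < 0"
  then show "\<forall>\<^sub>F n in sequentially. a < norm (expect n (f n))"
    by (intro always_eventually allI) (meson less_le_trans norm_ge_zero)
next
  fix a :: real assume a: "0 < a"
  let ?A = "\<lambda>n P. dist (f n P) 0 < a / 2"
  have "(\<lambda>n. expect n (\<lambda>P. of_bool (\<not> ?A n P) :: real)) \<longlonglongrightarrow> 0"
    using assms(1)[unfolded tends_in_prob_def whp_def, rule_format, of "a / 2"] a by simp
  from tendsto_mult_right[OF this, of "\<bar>B\<bar>"]
  have "(\<lambda>n. expect n (\<lambda>P. of_bool (\<not> ?A n P)) * \<bar>B\<bar>) \<longlonglongrightarrow> 0" by simp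
  then have "\<forall>\<^sub>F n in sequentially. expect n (\<lambda>P. of_bool (\<not> ?A n P)) * \<bar>B\<bar> < a / 2"
    using a by (intro order_tendstoD(2)) auto
  then show "\<forall>\<^sub>F n in sequentially. norm (expect n (f n)) < a"
    using assms(2) eventually_ge_at_top[of 1]
  proof eventually_elim
    case (elim n)
    have "norm (expect n (f n)) \<le> expect n (\<lambda>P. of_bool (\<not> ?A n P) * \<bar>B\<bar> + a / 2)"
    proof (rule norm_expect_bound)
      fix P assume "P \<in> partitions_upto n"
      then have "norm (f n P) \<le> \<bar>B\<bar>"
        using elim(2) by (meson abs_ge_self order_trans)
      then show "norm (f n P) \<le> of_bool (\<not> ?A n P) * \<bar>B\<bar> + a / 2"
        using a by (cases "?A n P") auto
    qed
    also have "\<dots> = expect n (\<lambda>P. of_bool (\<not> ?A n P)) * \<bar>B\<bar> + a / 2"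
      using expect_const[OF elim(3), of "a / 2"] by (simp add: expect_linear expect_mult)
    finally show ?case using elim(1) by linarith
  qed
qed

lemma whp_ball:
  assumes "finite A" "\<And>i. i \<in> A \<Longrightarrow> whp (B i)"
  shows "whp (\<lambda>n P. \<forall>i\<in>A. B i n P)"
  using assms
proof (induction A rule: finite_induct)
  case empty
  then show ?case by (intro whp_eventually) simp
next
  case (insert i A)
  have "whp (\<lambda>n P. B i n P \<and> (\<forall>i\<in>A. B i n P))"
    using insert by (intro whp_conj) auto
  then show ?case by simp
qed

section \<open>Second moments of block sums\<close>

definition successors :: "nat \<Rightarrow> nat set set \<Rightarrow> nat set set set" where
  "successors n P = insert (open_block n P) (join_block_at n P ` P)"

lemma step_cong_succ: "(\<And>Q. Q \<in> successors n P \<Longrightarrow> f Q = g Q) \<Longrightarrow> step n f P = step n g P"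
  by (rule step_cong) (auto simp: successors_def)

lemma step_mono_succ:
  fixes f g :: "nat set set \<Rightarrow> real"
  assumes "n \<ge> 1" "P \<in> partitions_upto n" "\<And>Q. Q \<in> successors n P \<Longrightarrow> f Q \<le> g Q"
  shows "step n f P \<le> step n g P"
  by (rule step_mono[OF assms(1,2)]) (auto intro!: assms(3) simp: successors_def)

lemma step_square:
  fixes f :: "nat set set \<Rightarrow> real"
  assumes "n \<ge> 1" "P \<in> partitions_upto n"
  shows "step n (\<lambda>Q. (f Q - c)\<^sup>2) P
    = (f P - c)\<^sup>2 + 2 * (f P - c) * (step n f P - f P) + step n (\<lambda>Q. (f Q - f P)\<^sup>2) P"
proof -
  have "step n (\<lambda>Q. (f Q - c)\<^sup>2) P
      = step n (\<lambda>Q. (f P - c)\<^sup>2 + ((2 * (f P - c)) *\<^sub>R (f Q - f P) + (f Q - f P)\<^sup>2)) P"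
    by (rule step_cong_succ) (simp add: power2_eq_square algebra_simps)
  also have "\<dots> = (f P - c)\<^sup>2 + ((2 * (f P - c)) *\<^sub>R (step n f P - f P) + step n (\<lambda>Q. (f Q - f P)\<^sup>2) P)"
    unfolding step_linear step_const[OF assms] ..
  finally show ?thesis by simp
qed

lemma step_block_sum_increment:
  assumes "P \<in> partitions_upto n"
  shows "step n (\<lambda>Q. h (block_sum g Q - block_sum g P)) P
    = (\<Sum>U\<in>P. ((real (card U) - \<alpha>) / (\<theta> + real n)) *\<^sub>R h (g (Suc (card U)) - g (card U)))
      + ((\<theta> + real (card P) * \<alpha>) / (\<theta> + real n)) *\<^sub>R h (g 1)"
  unfolding step_def using block_sum_join[OF assms] block_sum_open[OF assms]
  by (intro arg_cong2[where f = "(+)"] sum.cong) auto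

lemma card_le_shifted:
  "\<exists>\<kappa>>0. \<forall>n\<ge>1. \<forall>P\<in>partitions_upto n. real (card P) \<le> \<kappa> * shifted_count P"
proof (intro exI conjI allI impI ballI)
  let ?c = "1 + \<theta> / \<alpha>"
  have c: "?c > 0" by (rule min_shifted_pos)
  show "1 + \<bar>\<theta> / \<alpha>\<bar> / ?c > 0"
    by (rule add_pos_nonneg[OF zero_less_one divide_nonneg_pos[OF abs_ge_zero c]])
  fix n P assume nP: "n \<ge> (1::nat)" "P \<in> partitions_upto n"
  have "\<bar>\<theta> / \<alpha>\<bar> / ?c * ?c \<le> \<bar>\<theta> / \<alpha>\<bar> / ?c * shifted_count P"
    using shifted_count_ge(1)[OF nP] c by (intro mult_left_mono) auto
  then have "\<bar>\<theta> / \<alpha>\<bar> \<le> \<bar>\<theta> / \<alpha>\<bar> / ?c * shifted_count P"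
    using c by simp
  moreover have "real (card P) \<le> shifted_count P + \<bar>\<theta> / \<alpha>\<bar>"
    unfolding shifted_count_def by linarith
  ultimately show "real (card P) \<le> (1 + \<bar>\<theta> / \<alpha>\<bar> / ?c) * shifted_count P"
    by (simp add: distrib_right)
qed

text \<open>
  The error term is \<open>C / \<alpha>\<close> times the increment of \<open>growth\<close>, so the recursion can be summed.
\<close>

lemma growth_accumulation:
  assumes "\<And>n. n \<ge> 1 \<Longrightarrow> e (Suc n) \<le> e n + C * growth n / (\<theta> + real n)" "C \<ge> 0"
  shows "\<exists>D>0. \<forall>n\<ge>1. e n \<le> D * growth n"
proof (intro exI conjI allI impI)
  show "\<bar>e 1\<bar> + C / \<alpha> + 1 > 0"
    using assms(2) alpha_pos by (intro add_nonneg_pos add_nonneg_nonneg) auto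
  fix n :: nat assume "n \<ge> 1"
  then show "e n \<le> (\<bar>e 1\<bar> + C / \<alpha> + 1) * growth n"
  proof (induction n rule: dec_induct)
    case base
    have "C / \<alpha> \<ge> 0" using assms(2) alpha_pos by simp
    then show ?case by (simp add: growth_1)
  next
    case (step n)
    let ?D = "\<bar>e 1\<bar> + C / \<alpha> + 1"
    have "C * growth n / (\<theta> + real n) = C / \<alpha> * (growth n * (\<alpha> / (\<theta> + real n)))"
      using alpha_pos by simp
    also have "\<dots> \<le> ?D * (growth n * (\<alpha> / (\<theta> + real n)))"
      using growth_pos(1)[of n] denominator_pos[OF step.hyps(1)] alpha_pos
      by (intro mult_right_mono) auto
    finally have "e (Suc n) \<le> ?D * growth n + ?D * (growth n * (\<alpha> / (\<theta> + real n)))"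
      using assms(1)[OF step.hyps(1)] step.IH by linarith
    then show ?case
      by (simp add: growth_Suc[OF step.hyps(1)] algebra_simps)
  qed
qed

section \<open>Law of large numbers for the block sizes\<close>

text \<open>
  The number of blocks with more than \<open>i\<close> elements, centred by its limiting share of all blocks.
\<close>

definition tail_deviation :: "nat \<Rightarrow> nat set set \<Rightarrow> real" where
  "tail_deviation i = block_sum (\<lambda>u. of_bool (i < u) - sibuya_tail \<alpha> i)"

lemma abs_tail_deviation_le:
  assumes "P \<in> partitions_upto n"
  shows "\<bar>tail_deviation i P\<bar> \<le> real (card P)"
proof -
  have "\<bar>tail_deviation i P\<bar> \<le> block_sum (\<lambda>_. 1) P"
    unfolding tail_deviation_def
    by (rule abs_block_sum_le[OF assms]) (use sibuya_tail_bounds[of \<alpha> i] alpha_pos alpha_less_1 in \<open>auto simp: of_bool_def\<close>)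
  then show ?thesis by (simp add: block_sum_simps)
qed

lemma tail_deviation_0:
  assumes "P \<in> partitions_upto n"
  shows "tail_deviation 0 P = 0"
  unfolding tail_deviation_def block_sum_def
proof (intro sum.neutral ballI)
  fix U assume "U \<in> P"
  then have "0 < card U"
    using partitions_uptoD(6)[OF assms] by fastforce
  then show "of_bool (0 < card U) - sibuya_tail \<alpha> 0 = 0"
    by (simp add: sibuya_tail_rec)
qed

text \<open>
  Only blocks of size \<open>i\<close> can cross the level \<open>i\<close>, each with weight \<open>i - \<alpha>\<close>, and their number is a
  difference of two tail counts. The recursion \<open>i * q i = (i - \<alpha>) * q (i - 1)\<close> of the Sibuya tail
  cancels all terms proportional to the number of blocks and leaves a mean-reverting drift driven by
  the deviation at level \<open>i - 1\<close>.
\<close>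

lemma tail_deviation_drift:
  assumes "n \<ge> 1" "P \<in> partitions_upto n" "i \<ge> 1"
  shows "step n (tail_deviation i) P - tail_deviation i P
    = ((real i - \<alpha>) * (tail_deviation (i - 1) P - tail_deviation i P) - \<theta> * sibuya_tail \<alpha> i) / (\<theta> + real n)"
proof -
  let ?q = "sibuya_tail \<alpha>"
  let ?K = "real (card P)"
  have "(\<Sum>U\<in>P. (real (card U) - \<alpha>) * ((of_bool (i < Suc (card U)) - ?q i) - (of_bool (i < card U) - ?q i)))
      = (\<Sum>U\<in>P. (real i - \<alpha>) * (of_bool (i - 1 < card U) - of_bool (i < card U)))"
    by (rule sum.cong) (use assms(3) in \<open>auto simp: of_bool_def\<close>)
  also have "\<dots> = (real i - \<alpha>) * block_sum (\<lambda>u. of_bool (i - 1 < u) - of_bool (i < u)) P"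
    by (simp add: block_sum_def sum_distrib_left)
  also have "block_sum (\<lambda>u. of_bool (i - 1 < u) - of_bool (i < u)) P
      = tail_deviation (i - 1) P - tail_deviation i P + (?q (i - 1) - ?q i) * ?K"
    by (simp add: tail_deviation_def block_sum_simps algebra_simps)
  finally have *: "step n (tail_deviation i) P - tail_deviation i P
     = ((real i - \<alpha>) * (tail_deviation (i - 1) P - tail_deviation i P + (?q (i - 1) - ?q i) * ?K) - (\<theta> + ?K * \<alpha>) * ?q i) / (\<theta> + real n)"
    using step_block_sum[OF assms(1,2), of "\<lambda>u. of_bool (i < u) - ?q i"] assms(3)
    by (simp flip: tail_deviation_def)
  have "(real i - \<alpha>) * (?q (i - 1) - ?q i) = \<alpha> * ?q i"
    using sibuya_tail_rec(2)[OF assms(3), of \<alpha>] by (simp add: algebra_simps)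
  then have "(real i - \<alpha>) * ((?q (i - 1) - ?q i) * ?K) = \<alpha> * ?q i * ?K"
    by (metis mult.assoc)
  then show ?thesis
    unfolding * by (simp add: algebra_simps)
qed

lemma tail_deviation_variance:
  assumes "n \<ge> 1" "P \<in> partitions_upto n" "i \<ge> 1"
  shows "step n (\<lambda>Q. (tail_deviation i Q - tail_deviation i P)\<^sup>2) P
    \<le> (real i * real (card P) + \<alpha> * shifted_count P) / (\<theta> + real n)"
proof -
  let ?q = "sibuya_tail \<alpha>"
  have t: "\<theta> + real n > 0" by (rule denominator_pos[OF assms(1)])
  have q: "0 \<le> ?q i" "?q i \<le> 1"
    using sibuya_tail_bounds[of \<alpha> i] alpha_pos alpha_less_1 by auto
  have "step n (\<lambda>Q. (tail_deviation i Q - tail_deviation i P)\<^sup>2) P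
    = (\<Sum>U\<in>P. ((real (card U) - \<alpha>) / (\<theta> + real n)) * ((of_bool (i < Suc (card U)) - ?q i) - (of_bool (i < card U) - ?q i))\<^sup>2)
      + ((\<theta> + real (card P) * \<alpha>) / (\<theta> + real n)) * (of_bool (i < 1) - ?q i)\<^sup>2"
    unfolding tail_deviation_def
    by (subst step_block_sum_increment[OF assms(2), of "\<lambda>x. x\<^sup>2"]) simp
  also have "\<dots> \<le> (\<Sum>U\<in>P. real i / (\<theta> + real n)) + (\<alpha> * shifted_count P / (\<theta> + real n)) * 1"
    unfolding open_weight
  proof (intro add_mono sum_mono mult_left_mono)
    fix U assume "U \<in> P"
    show "((real (card U) - \<alpha>) / (\<theta> + real n)) * ((of_bool (i < Suc (card U)) - ?q i) - (of_bool (i < card U) - ?q i))\<^sup>2 \<le> real i / (\<theta> + real n)"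
      using t alpha_pos by (auto simp: of_bool_def intro!: divide_right_mono)
  next
    show "(of_bool (i < 1) - ?q i)\<^sup>2 \<le> 1"
      using q assms(3) by (auto simp: power_le_one)
    show "0 \<le> \<alpha> * shifted_count P / (\<theta> + real n)"
      using t alpha_pos shifted_count_ge(2)[OF assms(1,2)] by simp
  qed
  finally show ?thesis by (simp add: add_divide_distrib mult.commute)
qed

text \<open>
  Induction on the level. In the recursion for the square the cross term
  \<open>2 * d * (e - d)\<close> is at most \<open>e\<^sup>2\<close>, so mean reversion absorbs the unknown deviation \<open>d\<close> and only the
  deviation \<open>e\<close> of the previous level and a term of order \<open>K\<close> remain.
\<close>

lemma expect_tail_deviation_sq: "\<exists>D>0. \<forall>n\<ge>1. expect n (\<lambda>P. (tail_deviation i P)\<^sup>2) \<le> D * growth n"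
proof (induction i)
  case 0
  show ?case
  proof (intro exI conjI allI impI)
    fix n :: nat
    have "expect n (\<lambda>P. (tail_deviation 0 P)\<^sup>2) = expect n (\<lambda>P. 0)"
      by (rule expect_cong) (simp add: tail_deviation_0)
    also have "\<dots> = 0" by (simp add: expect_def)
    finally show "expect n (\<lambda>P. (tail_deviation 0 P)\<^sup>2) \<le> 1 * growth n"
      using growth_pos(1)[of n] by simp
  qed simp
next
  case (Suc j)
  define i where "i = Suc j"
  have i: "i \<ge> 1" "i - 1 = j" by (auto simp: i_def)
  obtain D where D: "D > 0" "\<And>n. n \<ge> 1 \<Longrightarrow> expect n (\<lambda>P. (tail_deviation j P)\<^sup>2) \<le> D * growth n"
    using Suc by auto
  obtain C where C: "C > 0" "\<And>n. n \<ge> 1 \<Longrightarrow> expect n shifted_count \<le> C * growth n"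
    using expect_shifted_count_le by auto
  obtain k where k: "k > 0" "\<And>n P. n \<ge> 1 \<Longrightarrow> P \<in> partitions_upto n \<Longrightarrow> real (card P) \<le> k * shifted_count P"
    using card_le_shifted by auto
  define c where "c = (2 * \<bar>\<theta>\<bar> + real i) * k + \<alpha>"
  have c: "c \<ge> 0" using k alpha_pos by (simp add: c_def)
  have "\<exists>D>0. \<forall>n\<ge>1. expect n (\<lambda>P. (tail_deviation i P)\<^sup>2) \<le> D * growth n"
  proof (rule growth_accumulation)
    show "real i * D + c * C \<ge> 0" using D C c by simp
    fix n :: nat assume n: "n \<ge> 1"
    have t: "\<theta> + real n > 0" by (rule denominator_pos[OF n])
    have "expect (Suc n) (\<lambda>P. (tail_deviation i P)\<^sup>2)
        \<le> expect n (\<lambda>P. (tail_deviation i P)\<^sup>2 + (real i * (tail_deviation j P)\<^sup>2 + c * shifted_count P) / (\<theta> + real n))"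
      unfolding expect_Suc[OF n]
    proof (rule expect_mono)
      fix P assume P: "P \<in> partitions_upto n"
      let ?d = "tail_deviation i P" and ?e = "tail_deviation j P"
      have q: "0 \<le> sibuya_tail \<alpha> i" "sibuya_tail \<alpha> i \<le> 1"
        using sibuya_tail_bounds[of \<alpha> i] alpha_pos alpha_less_1 by auto
      have "?d * (?e - ?d) = ?e\<^sup>2 / 4 - (?e / 2 - ?d)\<^sup>2"
        by (simp add: power2_eq_square algebra_simps)
      then have "2 * (?d * (?e - ?d)) \<le> ?e\<^sup>2"
        using zero_le_power2[of "?e / 2 - ?d"] zero_le_power2[of ?e] by linarith
      then have "(real i - \<alpha>) * (2 * (?d * (?e - ?d))) \<le> (real i - \<alpha>) * ?e\<^sup>2"
        using i alpha_less_1 by (intro mult_left_mono) auto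
      also have "\<dots> \<le> real i * ?e\<^sup>2"
        using alpha_pos by (intro mult_right_mono) auto
      finally have 1: "2 * ?d * ((real i - \<alpha>) * (?e - ?d)) \<le> real i * ?e\<^sup>2"
        by (simp add: mult_ac)
      have "\<bar>2 * ?d * (\<theta> * sibuya_tail \<alpha> i)\<bar> = 2 * \<bar>\<theta>\<bar> * (\<bar>?d\<bar> * sibuya_tail \<alpha> i)"
        using q by (simp add: abs_mult mult_ac)
      also have "\<dots> \<le> 2 * \<bar>\<theta>\<bar> * (real (card P) * 1)"
        using abs_tail_deviation_le[OF P, of i] q by (intro mult_left_mono mult_mono) auto
      finally have "- 2 * ?d * (\<theta> * sibuya_tail \<alpha> i) \<le> 2 * \<bar>\<theta>\<bar> * real (card P)"
        by linarith
      then have "2 * ?d * ((real i - \<alpha>) * (?e - ?d) - \<theta> * sibuya_tail \<alpha> i) + (real i * real (card P) + \<alpha> * shifted_count P)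
          \<le> real i * ?e\<^sup>2 + (2 * \<bar>\<theta>\<bar> + real i) * real (card P) + \<alpha> * shifted_count P"
        using 1 by (simp add: algebra_simps)
      also have "\<dots> \<le> real i * ?e\<^sup>2 + (2 * \<bar>\<theta>\<bar> + real i) * (k * shifted_count P) + \<alpha> * shifted_count P"
        using k(2)[OF n P] by (intro add_mono mult_left_mono order_refl) auto
      also have "\<dots> = real i * ?e\<^sup>2 + c * shifted_count P"
        by (simp add: c_def algebra_simps)
      finally have "(2 * ?d * ((real i - \<alpha>) * (?e - ?d) - \<theta> * sibuya_tail \<alpha> i) + (real i * real (card P) + \<alpha> * shifted_count P)) / (\<theta> + real n)
         \<le> (real i * ?e\<^sup>2 + c * shifted_count P) / (\<theta> + real n)"
        using t by (intro divide_right_mono) auto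
      moreover have "step n (\<lambda>P. (tail_deviation i P)\<^sup>2) P \<le> ?d\<^sup>2
          + (2 * ?d * ((real i - \<alpha>) * (?e - ?d) - \<theta> * sibuya_tail \<alpha> i) + (real i * real (card P) + \<alpha> * shifted_count P)) / (\<theta> + real n)"
        using step_square[OF n P, of "tail_deviation i" 0] tail_deviation_drift[OF n P i(1)] tail_deviation_variance[OF n P i(1)]
        unfolding i(2) by (simp add: add_divide_distrib)
      ultimately show "step n (\<lambda>P. (tail_deviation i P)\<^sup>2) P \<le> ?d\<^sup>2 + (real i * ?e\<^sup>2 + c * shifted_count P) / (\<theta> + real n)"
        by linarith
    qed
    also have "\<dots> = expect n (\<lambda>P. (tail_deviation i P)\<^sup>2)
        + (real i * expect n (\<lambda>P. (tail_deviation j P)\<^sup>2) + c * expect n shifted_count) / (\<theta> + real n)"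
      unfolding expect_mult(3) expect_linear expect_mult(1) ..
    also have "\<dots> \<le> expect n (\<lambda>P. (tail_deviation i P)\<^sup>2)
        + (real i * (D * growth n) + c * (C * growth n)) / (\<theta> + real n)"
      using D(2)[OF n] C(2)[OF n] t c by (intro add_mono divide_right_mono mult_left_mono order_refl) auto
    finally show "expect (Suc n) (\<lambda>P. (tail_deviation i P)\<^sup>2)
      \<le> expect n (\<lambda>P. (tail_deviation i P)\<^sup>2) + (real i * D + c * C) * growth n / (\<theta> + real n)"
      by (simp add: algebra_simps)
  qed
  then show ?case by (simp only: i_def)
qed

lemma whp_tail_deviation:
  assumes "\<epsilon> > 0"
  shows "whp (\<lambda>n P. \<bar>tail_deviation i P\<bar> \<le> \<epsilon> * real (card P))"
proof -
  obtain D where D: "D > 0" "\<And>n. n \<ge> 1 \<Longrightarrow> expect n (\<lambda>P. (tail_deviation i P)\<^sup>2) \<le> D * growth n"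
    using expect_tail_deviation_sq by auto
  obtain C where C: "C > 0" "\<And>n. n \<ge> 1 \<Longrightarrow> growth n \<le> C * real n powr \<alpha>"
    using growth_le_powr by auto
  \<comment> \<open>The standard deviation is of order \<open>n powr (\<alpha> / 2)\<close>; any exponent strictly between \<open>\<alpha> / 2\<close> and \<open>\<alpha>\<close> serves.\<close>
  let ?r = "\<lambda>n. real n powr (\<alpha> - \<alpha> / 4)"
  have "whp (\<lambda>n P. (tail_deviation i P)\<^sup>2 / (?r n)\<^sup>2 < \<epsilon>\<^sup>2)"
  proof (rule whp_markov)
    have lim: "(\<lambda>n. D * (C * real n powr \<alpha>) / (?r n)\<^sup>2) \<longlonglongrightarrow> 0"
      using alpha_pos by real_asymp
    show "(\<lambda>n. expect n (\<lambda>P. (tail_deviation i P)\<^sup>2 / (?r n)\<^sup>2)) \<longlonglongrightarrow> 0"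
      unfolding expect_mult
    proof (rule tendsto_sandwich[OF _ _ tendsto_const lim])
      show "\<forall>\<^sub>F n in sequentially. 0 \<le> expect n (\<lambda>P. (tail_deviation i P)\<^sup>2) / (?r n)\<^sup>2"
        by (intro always_eventually allI divide_nonneg_nonneg expect_nonneg) auto
      show "\<forall>\<^sub>F n in sequentially. expect n (\<lambda>P. (tail_deviation i P)\<^sup>2) / (?r n)\<^sup>2 \<le> D * (C * real n powr \<alpha>) / (?r n)\<^sup>2"
        using eventually_ge_at_top[of 1]
      proof eventually_elim
        case (elim n)
        have "D * growth n \<le> D * (C * real n powr \<alpha>)"
          using C(2)[OF elim] D(1) by (intro mult_left_mono) auto
        then show ?case
          using D(2)[OF elim] by (intro divide_right_mono) auto
      qed
    qed
  qed (use assms in auto)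
  then have "whp (\<lambda>n P. (tail_deviation i P)\<^sup>2 / (?r n)\<^sup>2 < \<epsilon>\<^sup>2 \<and> ?r n \<le> real (card P))"
    by (rule whp_conj) (rule whp_count_lower, use alpha_pos in simp)
  then show ?thesis
  proof (rule whp_mono)
    show "\<forall>\<^sub>F n in sequentially. \<forall>P\<in>partitions_upto n. (tail_deviation i P)\<^sup>2 / (?r n)\<^sup>2 < \<epsilon>\<^sup>2 \<and> ?r n \<le> real (card P)
        \<longrightarrow> \<bar>tail_deviation i P\<bar> \<le> \<epsilon> * real (card P)"
      using eventually_ge_at_top[of 1]
    proof eventually_elim
      case (elim n)
      show ?case
      proof (intro ballI impI)
        fix P assume *: "(tail_deviation i P)\<^sup>2 / (?r n)\<^sup>2 < \<epsilon>\<^sup>2 \<and> ?r n \<le> real (card P)"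
        have r: "?r n > 0" using elim by simp
        have "(tail_deviation i P)\<^sup>2 < (\<epsilon> * ?r n)\<^sup>2"
          using * r by (simp add: divide_less_eq power_mult_distrib)
        then have "\<bar>tail_deviation i P\<bar> < \<epsilon> * ?r n"
          using assms r by (intro power2_less_imp_less[of "\<bar>_\<bar>"]) auto
        also have "\<dots> \<le> \<epsilon> * real (card P)"
          using * assms by (intro mult_left_mono) auto
        finally show "\<bar>tail_deviation i P\<bar> \<le> \<epsilon> * real (card P)" by simp
      qed
    qed
  qed
qed

text \<open>
  Interchanging sums, the total information is the sum over \<open>i\<close> of the weight
  \<open>1 / (i - \<alpha>)\<^sup>2\<close> times the number of blocks with more than \<open>i\<close> elements. The weights are summable, so
  a finite number of levels determines the sum up to a small multiple of the number of blocks.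
\<close>

lemma whp_info:
  assumes "\<epsilon> > 0"
  shows "whp (\<lambda>n P. \<bar>block_sum (info \<alpha>) P - tail_info \<alpha> * real (card P)\<bar> \<le> \<epsilon> * real (card P))"
proof -
  let ?w = "\<lambda>i. 1 / (real i - \<alpha>)\<^sup>2" and ?q = "sibuya_tail \<alpha>"
  have sw: "summable ?w" by (rule summable_inverse_square[OF alpha_pos alpha_less_1])
  have sq: "summable (\<lambda>i. ?q i / (real i - \<alpha>)\<^sup>2)"
    by (rule summable_tail_info[OF alpha_pos alpha_less_1])
  have q: "0 \<le> ?q i" "?q i \<le> 1" for i
    using sibuya_tail_bounds[of \<alpha> i] alpha_pos alpha_less_1 by auto
  have "(\<lambda>L. \<Sum>i. ?w (i + L)) \<longlonglongrightarrow> 0"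
    by (rule suminf_exist_split2[OF sw])
  then have "\<forall>\<^sub>F L in sequentially. (\<Sum>i. ?w (i + L)) < \<epsilon> / 2"
    using assms by (intro order_tendstoD) auto
  then obtain L where L: "(\<Sum>i. ?w (i + L)) < \<epsilon> / 2"
    by (auto simp: eventually_sequentially)
  define W where "W = (\<Sum>i<L. ?w i) + 1"
  have W: "W > 0" unfolding W_def by (intro add_nonneg_pos sum_nonneg) auto
  have "whp (\<lambda>n P. \<forall>i\<in>{..<L}. \<bar>tail_deviation i P\<bar> \<le> \<epsilon> / 2 / W * real (card P))"
    by (rule whp_ball[OF _ whp_tail_deviation]) (use assms W in auto)
  then show ?thesis
  proof (rule whp_mono, intro always_eventually allI ballI impI)
    fix n P assume P: "P \<in> partitions_upto n"
      and small: "\<forall>i\<in>{..<L}. \<bar>tail_deviation i P\<bar> \<le> \<epsilon> / 2 / W * real (card P)"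
    define v where "v i u = (of_bool (i < u) - ?q i) * ?w i" for i u
    have v_abs: "\<bar>v i u\<bar> \<le> ?w i" for i u
    proof -
      have "\<bar>of_bool (i < u) - ?q i\<bar> \<le> 1"
        using q[of i] by (auto simp: of_bool_def)
      from mult_right_mono[OF this, of "?w i"] show ?thesis
        by (simp add: v_def abs_mult)
    qed
    have sv: "summable (\<lambda>i. v i u)" for u
      by (rule summable_comparison_test[OF _ sw]) (use v_abs in auto)
    have fin: "(\<lambda>i. of_bool (i < u) * ?w i) sums info \<alpha> u" for u
    proof -
      have "(\<lambda>i. of_bool (i < u) * ?w i) sums (\<Sum>i<u. of_bool (i < u) * ?w i)"
        by (rule sums_finite) auto
      also have "(\<Sum>i<u. of_bool (i < u) * ?w i) = info \<alpha> u"
        unfolding info_def by (rule sum.cong) auto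
      finally show ?thesis .
    qed
    have "(\<lambda>i. of_bool (i < u) * ?w i - ?q i / (real i - \<alpha>)\<^sup>2) sums (info \<alpha> u - tail_info \<alpha>)" for u
      unfolding tail_info_def by (rule sums_diff[OF fin summable_sums[OF sq]])
    then have sums_v: "(\<lambda>i. v i u) sums (info \<alpha> u - tail_info \<alpha>)" for u
      by (simp add: v_def diff_divide_distrib)
    have tail: "\<bar>(info \<alpha> u - tail_info \<alpha>) - (\<Sum>i<L. v i u)\<bar> \<le> \<epsilon> / 2" for u
    proof -
      have "(info \<alpha> u - tail_info \<alpha>) - (\<Sum>i<L. v i u) = (\<Sum>i. v (i + L) u)"
        using suminf_minus_initial_segment[OF sv[of u], of L] sums_unique[OF sums_v[of u]] by simp
      also have "\<bar>\<dots>\<bar> \<le> (\<Sum>i. ?w (i + L))"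
        by (rule norm_suminf_le[where 'a = real, unfolded real_norm_def, OF v_abs summable_ignore_initial_segment[OF sw, of L]])
      finally show ?thesis using L by linarith
    qed
    have "\<bar>block_sum (\<lambda>u. (info \<alpha> u - tail_info \<alpha>) - (\<Sum>i<L. v i u)) P\<bar> \<le> block_sum (\<lambda>_. \<epsilon> / 2) P"
      by (rule abs_block_sum_le[OF P]) (rule tail)
    then have 1: "\<bar>block_sum (info \<alpha>) P - tail_info \<alpha> * real (card P) - block_sum (\<lambda>u. \<Sum>i<L. v i u) P\<bar> \<le> \<epsilon> / 2 * real (card P)"
      by (simp add: block_sum_simps)
    have "block_sum (\<lambda>u. \<Sum>i<L. v i u) P = (\<Sum>i<L. tail_deviation i P * ?w i)"
      unfolding block_sum_def tail_deviation_def v_def sum_distrib_right by (rule sum.swap)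
    also have "\<bar>\<dots>\<bar> \<le> (\<Sum>i<L. \<bar>tail_deviation i P\<bar> * ?w i)"
      by (rule order_trans[OF sum_abs]) (simp add: abs_mult)
    also have "\<dots> \<le> (\<Sum>i<L. \<epsilon> / 2 / W * real (card P) * ?w i)"
      using small by (intro sum_mono mult_right_mono) auto
    also have "\<dots> = \<epsilon> / 2 * real (card P) * ((\<Sum>i<L. ?w i) / W)"
      by (simp add: sum_distrib_left sum_divide_distrib mult_ac)
    also have "\<dots> \<le> \<epsilon> / 2 * real (card P) * 1"
      using assms W by (intro mult_left_mono) (auto simp: W_def)
    finally show "\<bar>block_sum (info \<alpha>) P - tail_info \<alpha> * real (card P)\<bar> \<le> \<epsilon> * real (card P)"
      using 1 by linarith
  qed
qed

end

section \<open>The score as a process with quadratic variation\<close>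

text \<open>
  The expansion of \<open>exp (\<i> x + x\<^sup>2 / 2)\<close> has no second-order term, as \<open>(\<i> x)\<^sup>2 / 2\<close> and \<open>x\<^sup>2 / 2\<close> cancel.
\<close>

lemma exp_compensated_increment:
  fixes x :: real
  assumes "\<bar>x\<bar> \<le> 1"
  shows "norm (exp (Complex (x\<^sup>2 / 2) x) - 1 - \<i> * x) \<le> 4 * \<bar>x\<bar> ^ 3"
proof -
  define w where "w = Complex (x\<^sup>2 / 2) x"
  have w: "w = \<i> * x + x\<^sup>2 / 2"
    by (simp add: w_def complex_eq_iff power2_eq_square)
  have x2: "x\<^sup>2 \<le> \<bar>x\<bar>"
    using mult_right_mono[OF assms, of "\<bar>x\<bar>"] by (simp add: power2_eq_square abs_mult[symmetric])
  have "norm w \<le> \<bar>x\<bar> + x\<^sup>2 / 2"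
    unfolding w by (rule norm_triangle_le) (simp add: norm_mult norm_power norm_divide)
  then have nw: "norm w \<le> 3 / 2 * \<bar>x\<bar>"
    using x2 by linarith
  have re: "\<bar>Re w\<bar> \<le> 1 / 2"
    using x2 assms by (simp add: w_def)
  have "exp (1 / 2) \<le> (1 + 1 / 2 + (1 / 2)\<^sup>2 :: real)"
    by (rule exp_bound) auto
  also have "(1 + 1 / 2 + (1 / 2)\<^sup>2 :: real) = 7 / 4"
    by (simp add: power2_eq_square)
  finally have e: "exp \<bar>Re w\<bar> \<le> (7 / 4 :: real)"
    using re by (meson exp_le_cancel_iff order_trans)
  have "norm (exp w - (\<Sum>k\<le>2. w ^ k / fact k)) \<le> exp \<bar>Re w\<bar> * norm w ^ Suc 2 / fact 2"
    by (rule Taylor_exp)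
  also have "\<dots> \<le> 7 / 4 * (3 / 2 * \<bar>x\<bar>) ^ Suc 2 / fact 2"
    using e nw by (intro divide_right_mono mult_mono power_mono) auto
  also have "\<dots> = 189 / 64 * \<bar>x\<bar> ^ 3"
    by (simp only: power_mult_distrib Suc_numeral add_num_simps) (simp add: power_divide)
  also have "\<dots> \<le> 3 * \<bar>x\<bar> ^ 3"
    by (rule mult_right_mono) auto
  finally have 1: "norm (exp w - (1 + w + w\<^sup>2 / 2)) \<le> 3 * \<bar>x\<bar> ^ 3"
    by (simp add: numeral_2_eq_2 add_ac)
  have "1 + w + w\<^sup>2 / 2 - 1 - \<i> * x = \<i> * x ^ 3 / 2 + x ^ 4 / 8"
    unfolding w by (simp add: complex_eq_iff power2_eq_square power3_eq_cube power4_eq_xxxx) (simp add: field_simps)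
  also have "norm \<dots> \<le> \<bar>x\<bar> ^ 3 / 2 + \<bar>x\<bar> ^ 4 / 8"
    by (rule norm_triangle_le) (simp add: norm_mult norm_divide norm_power)
  also have "\<bar>x\<bar> ^ 4 \<le> \<bar>x\<bar> ^ 3"
    using assms by (intro power_decreasing) auto
  finally have 2: "norm (1 + w + w\<^sup>2 / 2 - 1 - \<i> * x) \<le> \<bar>x\<bar> ^ 3"
    using zero_le_power_abs[of x 3] by linarith
  have "exp w - 1 - \<i> * x = (exp w - (1 + w + w\<^sup>2 / 2)) + (1 + w + w\<^sup>2 / 2 - 1 - \<i> * x)"
    by simp
  also have "norm \<dots> \<le> 3 * \<bar>x\<bar> ^ 3 + \<bar>x\<bar> ^ 3"
    using 1 2 by (rule norm_triangle_mono)
  finally show ?thesis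
    unfolding w_def by simp
qed

lemma score_Suc: "score x (Suc u) - score x u = - (1 / (real u - x))" "score x 1 = 1 / x"
  by (auto simp: score_def divide_inverse)

lemma info_Suc: "info x (Suc u) - info x u = 1 / (real u - x)\<^sup>2" "info x 1 = 1 / x\<^sup>2"
  by (auto simp: info_def)

context ewens_pitman_process
begin

definition total_score :: "nat set set \<Rightarrow> real" where
  "total_score = block_sum (score \<alpha>)"

definition total_info :: "nat set set \<Rightarrow> real" where
  "total_info = block_sum (info \<alpha>)"

definition jump_bound :: real where
  "jump_bound = 1 / \<alpha> + 1 / (1 - \<alpha>)"

lemma jump_bound_pos: "jump_bound > 0"
  using alpha_pos alpha_less_1 by (simp add: jump_bound_def add_pos_pos)

lemma abs_score_jump: "\<bar>1 / (real i - \<alpha>)\<bar> \<le> jump_bound"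
proof (cases "i = 0")
  case True
  then show ?thesis using alpha_pos alpha_less_1 by (simp add: jump_bound_def)
next
  case False
  then have i: "real i - \<alpha> \<ge> 1 - \<alpha>" "1 - \<alpha> > 0" using alpha_less_1 by auto
  then have "1 / (real i - \<alpha>) \<le> 1 / (1 - \<alpha>)"
    by (intro divide_left_mono) auto
  moreover have "0 \<le> 1 / (real i - \<alpha>)" "0 \<le> 1 / \<alpha>"
    using i alpha_pos by auto
  ultimately show ?thesis unfolding jump_bound_def by linarith
qed

text \<open>
  The quadratic variation of the score is the information, path by path and not only in mean.
  This is what makes the exponential in the definition of \<open>tilted\<close> work with exact increments.
\<close>

lemma successor_increment:
  assumes "P \<in> partitions_upto n" "Q \<in> successors n P"
  shows "total_info Q = total_info P + (total_score Q - total_score P)\<^sup>2"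
    "\<bar>total_score Q - total_score P\<bar> \<le> jump_bound"
proof -
  have "total_info Q = total_info P + (total_score Q - total_score P)\<^sup>2 \<and> \<bar>total_score Q - total_score P\<bar> \<le> jump_bound"
  proof (cases "Q = open_block n P")
    case True
    then show ?thesis
      using block_sum_open[OF assms(1)] score_Suc(2)[of \<alpha>] info_Suc(2)[of \<alpha>] abs_score_jump[of 0]
      by (simp add: total_info_def total_score_def power_divide)
  next
    case False
    then obtain U where U: "U \<in> P" "Q = join_block_at n P U"
      using assms(2) by (auto simp: successors_def)
    then show ?thesis
      using block_sum_join[OF assms(1) U(1)] score_Suc(1)[of \<alpha> "card U"] info_Suc(1)[of \<alpha> "card U"] abs_score_jump[of "card U"]
      by (simp add: total_info_def total_score_def power_divide)
  qed
  then show "total_info Q = total_info P + (total_score Q - total_score P)\<^sup>2"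
    "\<bar>total_score Q - total_score P\<bar> \<le> jump_bound" by auto
qed

text \<open>
  A block of size \<open>u\<close> is joined with weight \<open>u - \<alpha>\<close>, which cancels the denominator of the score
  increment; the sum of these losses, one for each block, is compensated by the gain of a new block up to
  \<open>\<theta> / \<alpha>\<close>.
\<close>

lemma step_total_score:
  assumes "n \<ge> 1" "P \<in> partitions_upto n"
  shows "step n total_score P = total_score P + \<theta> / \<alpha> / (\<theta> + real n)"
proof -
  have "(\<Sum>U\<in>P. (real (card U) - \<alpha>) * (score \<alpha> (Suc (card U)) - score \<alpha> (card U))) = (\<Sum>U\<in>P. - 1)"
  proof (rule sum.cong[OF refl])
    fix U assume "U \<in> P"
    then have "real (card U) - \<alpha> \<noteq> 0"
      using partitions_uptoD(6)[OF assms(2), of U] alpha_less_1 by auto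
    then show "(real (card U) - \<alpha>) * (score \<alpha> (Suc (card U)) - score \<alpha> (card U)) = - 1"
      unfolding score_Suc by simp
  qed
  moreover have "(\<theta> + real (card P) * \<alpha>) * score \<alpha> 1 = \<theta> / \<alpha> + real (card P)"
    unfolding score_Suc using alpha_pos by (simp add: field_simps)
  ultimately show ?thesis
    using step_block_sum[OF assms, of "score \<alpha>"] by (simp add: total_score_def)
qed

lemma step_score_increment_square:
  assumes "n \<ge> 1" "P \<in> partitions_upto n"
  shows "step n (\<lambda>Q. (total_score Q - total_score P)\<^sup>2) P = step n total_info P - total_info P"
proof -
  have "step n (\<lambda>Q. (total_score Q - total_score P)\<^sup>2) P = step n (\<lambda>Q. total_info Q - total_info P) P"
    by (rule step_cong_succ) (simp add: successor_increment(1)[OF assms(2)])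
  then show ?thesis
    by (simp add: step_linear step_const[OF assms])
qed

definition compensator :: "nat \<Rightarrow> real" where
  "compensator n = (\<Sum>k = 1..<n. \<theta> / \<alpha> / (\<theta> + real k))"

lemma sum_inverse_denominator: "\<exists>D>0. \<forall>m n. 1 \<le> m \<longrightarrow> 1 \<le> n \<longrightarrow> (\<Sum>k = m..<n. \<bar>\<theta> / \<alpha> / (\<theta> + real k)\<bar>) \<le> D * (1 + ln (real n))"
proof (intro exI conjI allI impI)
  define b where "b = min 1 (1 + \<theta>)"
  have b: "b > 0" using denominator_pos[of 1] by (simp add: b_def)
  show "\<bar>\<theta> / \<alpha>\<bar> / b + 1 > 0" using b by (intro add_nonneg_pos divide_nonneg_pos) auto
  fix m n :: nat assume mn: "1 \<le> m" "1 \<le> n"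
  have le: "\<bar>\<theta> / \<alpha> / (\<theta> + real k)\<bar> \<le> \<bar>\<theta> / \<alpha>\<bar> / b * (1 / real k)" if "k \<ge> 1" for k
  proof -
    have "b * real k \<le> \<theta> + real k"
    proof (cases "\<theta> \<ge> 0")
      case True
      have "b * real k \<le> 1 * real k" by (rule mult_right_mono) (auto simp: b_def)
      then show ?thesis using True by simp
    next
      case False
      have "b * real k = real k + \<theta> * real k" using False by (simp add: b_def algebra_simps)
      moreover have "\<theta> * real k \<le> \<theta> * 1" using False that by (intro mult_left_mono_neg) auto
      ultimately show ?thesis by simp
    qed
    then have "\<bar>\<theta> / \<alpha>\<bar> / (\<theta> + real k) \<le> \<bar>\<theta> / \<alpha>\<bar> / (b * real k)"
      using b that denominator_pos[OF that] by (intro divide_left_mono) auto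
    then show ?thesis
      using denominator_pos[OF that] by (simp add: abs_divide abs_mult mult.assoc)
  qed
  have "(\<Sum>k = m..<n. \<bar>\<theta> / \<alpha> / (\<theta> + real k)\<bar>) \<le> (\<Sum>k = m..<n. \<bar>\<theta> / \<alpha>\<bar> / b * (1 / real k))"
    by (rule sum_mono) (use mn in \<open>auto intro!: le[simplified]\<close>)
  also have "\<dots> \<le> (\<Sum>k = 1..n. \<bar>\<theta> / \<alpha>\<bar> / b * (1 / real k))"
    using mn b by (intro sum_mono2) auto
  also have "\<dots> = \<bar>\<theta> / \<alpha>\<bar> / b * (\<Sum>k = 1..n. 1 / real k)"
    by (simp add: sum_distrib_left)
  also have "\<dots> \<le> \<bar>\<theta> / \<alpha>\<bar> / b * (1 + ln (real n))"
    using b by (intro mult_left_mono harm_upper mn) auto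
  also have "\<dots> \<le> (\<bar>\<theta> / \<alpha>\<bar> / b + 1) * (1 + ln (real n))"
    using mn by (intro mult_right_mono) auto
  finally show "(\<Sum>k = m..<n. \<bar>\<theta> / \<alpha> / (\<theta> + real k)\<bar>) \<le> (\<bar>\<theta> / \<alpha>\<bar> / b + 1) * (1 + ln (real n))" .
qed

text \<open>
  Bounds linear in the number of balls suffice at the burn-in time, which is logarithmic.
\<close>

lemma crude_bounds:
  assumes "P \<in> partitions_upto n"
  shows "\<bar>total_score P\<bar> \<le> jump_bound * real n" "\<bar>total_info P\<bar> \<le> jump_bound\<^sup>2 * real n" "total_info P \<ge> 0"
proof -
  have n: "block_sum (\<lambda>u. c * real u) P = c * real n" for c
    using sum_card_blocks[OF assms] by (simp add: block_sum_def flip: sum_distrib_left of_nat_sum)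
  have "\<bar>score \<alpha> u\<bar> \<le> jump_bound * real u" for u
  proof -
    have "\<bar>score \<alpha> u\<bar> \<le> (\<Sum>i<u. \<bar>1 / (real i - \<alpha>)\<bar>)"
      unfolding score_def abs_minus_cancel by (rule sum_abs)
    also have "\<dots> \<le> (\<Sum>i<u. jump_bound)" by (rule sum_mono) (rule abs_score_jump)
    finally show ?thesis by (simp add: mult.commute)
  qed
  then show "\<bar>total_score P\<bar> \<le> jump_bound * real n"
    unfolding total_score_def n[symmetric] by (intro abs_block_sum_le[OF assms])
  have "\<bar>info \<alpha> u\<bar> \<le> jump_bound\<^sup>2 * real u" for u
  proof -
    have "\<bar>info \<alpha> u\<bar> \<le> (\<Sum>i<u. \<bar>1 / (real i - \<alpha>)\<bar>\<^sup>2)"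
      unfolding info_def by (rule order_trans[OF sum_abs]) (simp add: power_divide)
    also have "\<dots> \<le> (\<Sum>i<u. jump_bound\<^sup>2)" by (intro sum_mono power_mono abs_score_jump) auto
    finally show ?thesis by (simp add: mult.commute)
  qed
  then show "\<bar>total_info P\<bar> \<le> jump_bound\<^sup>2 * real n"
    unfolding total_info_def n[symmetric] by (intro abs_block_sum_le[OF assms])
  show "total_info P \<ge> 0"
    unfolding total_info_def block_sum_def info_def by (intro sum_nonneg) auto
qed

lemma total_info_le_card: "P \<in> partitions_upto n \<Longrightarrow> total_info P \<le> (\<Sum>i. 1 / (real i - \<alpha>)\<^sup>2) * real (card P)"
proof -
  assume P: "P \<in> partitions_upto n"
  have "total_info P \<le> block_sum (\<lambda>_. \<Sum>i. 1 / (real i - \<alpha>)\<^sup>2) P"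
    unfolding total_info_def info_def
    by (rule block_sum_mono[OF P], rule sum_le_suminf[OF summable_inverse_square[OF alpha_pos alpha_less_1]]) auto
  then show ?thesis by (simp add: block_sum_simps)
qed

lemma expect_restrict:
  fixes f :: "nat set set \<Rightarrow> 'b::real_vector"
  assumes "1 \<le> m" "m \<le> n"
  shows "expect n (\<lambda>P. f (restrict_partition m P)) = expect m f"
  using assms(2)
proof (induction n rule: dec_induct)
  case base
  show ?case by (rule expect_cong) (simp add: restrict_self)
next
  case (step n)
  have "expect (Suc n) (\<lambda>P. f (restrict_partition m P)) = expect n (\<lambda>P. f (restrict_partition m P))"
    unfolding expect_Suc[OF order_trans[OF assms(1) step.hyps(1)]]
    by (rule expect_cong)
       (simp add: step_restrict[OF _ step.hyps(1), of _ "\<lambda>R Q. f R"] step_const[OF order_trans[OF assms(1) step.hyps(1)]])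
  then show ?case using step.IH by simp
qed

text \<open>
  Bounds that hold for the restrictions of all partitions at time \<open>n\<close> thereby hold for all partitions
  at time \<open>m\<close>.
\<close>

lemma restrict_surjective:
  assumes "R \<in> partitions_upto m" "m \<le> n"
  shows "\<exists>P\<in>partitions_upto n. restrict_partition m P = R"
  using assms(2)
proof (induction n rule: dec_induct)
  case base
  show ?case using assms(1) restrict_self by blast
next
  case (step n)
  then obtain P where "P \<in> partitions_upto n" "restrict_partition m P = R" by auto
  then show ?case
    using open_block_in[of P n] restrict_open[OF step.hyps(1), of P] by auto
qed

lemma step_cmult: "step n (\<lambda>Q. c * f Q) P = c * step n f P" for c :: complex
  by (simp add: step_def sum_distrib_left algebra_simps)

lemma step_of_real: "step n (\<lambda>Q. complex_of_real (f Q)) P = of_real (step n f P)"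
  by (simp add: step_def scaleR_conv_of_real)

section \<open>The tilted characteristic function\<close>

text \<open>
  The characteristic function of the score, compensated by its quadratic variation. The cutoff keeps
  the modulus below \<open>exp (s\<^sup>2 * c)\<close>; as the information never decreases, the function
  stays zero once it has been cut off.
\<close>

definition tilted :: "real \<Rightarrow> real \<Rightarrow> nat set set \<Rightarrow> complex" where
  "tilted s c Q = of_bool (total_info Q \<le> 2 * c) * exp (Complex (s\<^sup>2 * total_info Q / 2) (s * total_score Q))"

text \<open>
  Three errors occur: the drift of the score, the third-order remainder of the exponential, and the
  loss of the value when the cutoff is crossed. The second is written through the increment of the information
  (stopped just above the cutoff, which it overshoots by at most \<open>jump_bound\<^sup>2\<close>) and the third through
  the increment of the indicator of having crossed, so that both telescope.
\<close>

lemma tilted_one_step: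
  assumes n: "n \<ge> 1" and P: "P \<in> partitions_upto n" and c: "c \<ge> 0" and s: "\<bar>s\<bar> * jump_bound \<le> 1"
  defines "h \<equiv> \<lambda>Q. min (total_info Q) (2 * c + jump_bound\<^sup>2)"
    and "over \<equiv> \<lambda>Q. of_bool (2 * c < total_info Q) :: real"
  shows "norm (step n (tilted s c) P - tilted s c P)
    \<le> exp (s\<^sup>2 * c) * (\<bar>s\<bar> * \<bar>\<theta> / \<alpha> / (\<theta> + real n)\<bar> + 4 * \<bar>s\<bar> ^ 3 * jump_bound * (step n h P - h P))
      + exp (s\<^sup>2 * c + 1 / 2) * (step n over P - over P)"
proof -
  note incr = successor_increment[OF P]
  have mono: "total_info P \<le> total_info Q" if "Q \<in> successors n P" for Q
    using incr(1)[OF that] by simp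
  have h_mono: "h P \<le> step n h P"
  proof -
    have "step n (\<lambda>_. h P) P \<le> step n h P"
      by (rule step_mono_succ[OF n P]) (use mono in \<open>fastforce simp: h_def min_def\<close>)
    then show ?thesis by (simp add: step_const[OF n P])
  qed
  have sB: "s\<^sup>2 * jump_bound\<^sup>2 \<le> 1"
    using power_mono[OF s, of 2] jump_bound_pos by (simp add: power_mult_distrib)
  show ?thesis
  proof (cases "total_info P \<le> 2 * c")
    case False
    then have "step n (tilted s c) P = step n (\<lambda>_. 0) P"
      by (intro step_cong_succ) (use mono in \<open>force simp: tilted_def\<close>)
    moreover have "step n over P = step n (\<lambda>_. 1) P"
      by (intro step_cong_succ) (use mono False in \<open>force simp: over_def\<close>)
    moreover have "tilted s c P = 0" "over P = 1"
      using False by (auto simp: tilted_def over_def)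
    ultimately show ?thesis
      using h_mono jump_bound_pos by (simp add: step_const[OF n P])
  next
    case True
    define E where "E Q = exp (Complex (s\<^sup>2 * total_info Q / 2) (s * total_score Q))" for Q
    \<comment> \<open>The remainder after the linear term in one step.\<close>
    define \<rho> where "\<rho> Q = exp (Complex ((s * (total_score Q - total_score P))\<^sup>2 / 2) (s * (total_score Q - total_score P))) - 1
      - \<i> * complex_of_real (s * (total_score Q - total_score P))" for Q
    have nE: "norm (E Q) = exp (s\<^sup>2 * total_info Q / 2)" for Q
      by (simp add: E_def)
    have EQ: "E Q = E P * (1 + \<i> * complex_of_real (s * (total_score Q - total_score P)) + \<rho> Q)" if "Q \<in> successors n P" for Q
    proof -
      have "Complex (s\<^sup>2 * total_info Q / 2) (s * total_score Q)
          = Complex (s\<^sup>2 * total_info P / 2) (s * total_score P)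
          + Complex ((s * (total_score Q - total_score P))\<^sup>2 / 2) (s * (total_score Q - total_score P))"
        unfolding incr(1)[OF that] power_mult_distrib
        by (simp add: complex_eq_iff add_divide_distrib distrib_left right_diff_distrib)
      then show ?thesis by (simp add: E_def \<rho>_def exp_add)
    qed
    have tQ: "tilted s c Q = E P + E P * \<i> * s * complex_of_real (total_score Q - total_score P) + E P * \<rho> Q - over Q *\<^sub>R E Q"
      if "Q \<in> successors n P" for Q
    proof -
      have t: "tilted s c Q = E Q - over Q *\<^sub>R E Q"
        by (simp add: tilted_def E_def over_def of_bool_def)
      have e: "E P + E P * \<i> * s * complex_of_real (total_score Q - total_score P) + E P * \<rho> Q = E Q"
        unfolding EQ[OF that] by (simp add: algebra_simps)
      show ?thesis unfolding t e ..
    qed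
    have "step n (tilted s c) P = step n (\<lambda>Q. E P + E P * \<i> * s * complex_of_real (total_score Q - total_score P) + E P * \<rho> Q - over Q *\<^sub>R E Q) P"
      by (rule step_cong_succ) (rule tQ)
    also have "\<dots> = E P + E P * \<i> * s * of_real (step n total_score P - total_score P) + E P * step n \<rho> P - step n (\<lambda>Q. over Q *\<^sub>R E Q) P"
      unfolding step_linear step_cmult step_of_real step_const[OF n P] ..
    finally have "step n (tilted s c) P - tilted s c P
      = E P * \<i> * s * of_real (\<theta> / \<alpha> / (\<theta> + real n)) + E P * step n \<rho> P - step n (\<lambda>Q. over Q *\<^sub>R E Q) P"
      using True step_total_score[OF n P] by (simp add: tilted_def E_def)
    also have "norm \<dots> \<le> norm (E P * \<i> * s * of_real (\<theta> / \<alpha> / (\<theta> + real n))) + norm (E P * step n \<rho> P) + norm (step n (\<lambda>Q. over Q *\<^sub>R E Q) P)"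
      using norm_triangle_ineq4[of "E P * \<i> * s * of_real (\<theta> / \<alpha> / (\<theta> + real n)) + E P * step n \<rho> P" "step n (\<lambda>Q. over Q *\<^sub>R E Q) P"]
        norm_triangle_ineq[of "E P * \<i> * s * of_real (\<theta> / \<alpha> / (\<theta> + real n))" "E P * step n \<rho> P"] by linarith
    also have "\<dots> \<le> exp (s\<^sup>2 * c) * (\<bar>s\<bar> * \<bar>\<theta> / \<alpha> / (\<theta> + real n)\<bar>) + exp (s\<^sup>2 * c) * (4 * \<bar>s\<bar> ^ 3 * jump_bound * (step n h P - h P))
        + exp (s\<^sup>2 * c + 1 / 2) * (step n over P - over P)"
    proof (intro add_mono)
      have EP: "norm (E P) \<le> exp (s\<^sup>2 * c)"
        unfolding nE using True mult_left_mono[OF True, of "s\<^sup>2"] by simp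
      show "norm (E P * \<i> * s * of_real (\<theta> / \<alpha> / (\<theta> + real n))) \<le> exp (s\<^sup>2 * c) * (\<bar>s\<bar> * \<bar>\<theta> / \<alpha> / (\<theta> + real n)\<bar>)"
      proof -
        have "norm (E P * \<i> * s * of_real x) = norm (E P) * (\<bar>s\<bar> * \<bar>x\<bar>)" for x
          by (simp add: norm_mult mult.assoc)
        then show ?thesis
          using mult_right_mono[OF EP, of "\<bar>s\<bar> * \<bar>\<theta> / \<alpha> / (\<theta> + real n)\<bar>"] by (simp only: mult_nonneg_nonneg abs_ge_zero)
      qed
      have rho: "norm (\<rho> Q) \<le> (4 * \<bar>s\<bar> ^ 3 * jump_bound) *\<^sub>R (h Q - h P)" if "Q \<in> successors n P" for Q
      proof -
        let ?d = "total_score Q - total_score P"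
        have d: "\<bar>?d\<bar> \<le> jump_bound" by (rule incr(2)[OF that])
        have "\<bar>s * ?d\<bar> \<le> 1"
          using mult_left_mono[OF d, of "\<bar>s\<bar>"] s by (simp add: abs_mult)
        then have "norm (\<rho> Q) \<le> 4 * \<bar>s * ?d\<bar> ^ 3"
          unfolding \<rho>_def by (rule exp_compensated_increment)
        also have "\<dots> = 4 * \<bar>s\<bar> ^ 3 * (\<bar>?d\<bar> * ?d\<^sup>2)"
        proof -
          have "\<bar>?d\<bar> ^ 3 = \<bar>?d\<bar> * \<bar>?d\<bar>\<^sup>2"
            by (simp only: power3_eq_cube power2_eq_square mult.assoc)
          then show ?thesis
            by (simp only: abs_mult power_mult_distrib power2_abs mult.assoc)
        qed
        also have "\<dots> \<le> 4 * \<bar>s\<bar> ^ 3 * (jump_bound * ?d\<^sup>2)"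
          using d by (intro mult_left_mono mult_right_mono) auto
        also have "?d\<^sup>2 = h Q - h P"
        proof -
          have "?d\<^sup>2 \<le> jump_bound\<^sup>2"
            using d by (metis abs_le_square_iff abs_of_pos jump_bound_pos)
          moreover have "total_info P \<le> 2 * c + jump_bound\<^sup>2"
            using True zero_le_power2[of jump_bound] by linarith
          ultimately show ?thesis
            using incr(1)[OF that] True by (simp add: h_def min_absorb1)
        qed
        finally show ?thesis by simp
      qed
      have "norm (step n \<rho> P) \<le> step n (\<lambda>Q. (4 * \<bar>s\<bar> ^ 3 * jump_bound) *\<^sub>R (h Q - h P)) P"
        by (rule order_trans[OF norm_step_le[OF n P] step_mono_succ[OF n P rho]])
      also have "\<dots> = 4 * \<bar>s\<bar> ^ 3 * jump_bound * (step n h P - h P)"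
        unfolding step_linear step_const[OF n P] by simp
      finally show "norm (E P * step n \<rho> P) \<le> exp (s\<^sup>2 * c) * (4 * \<bar>s\<bar> ^ 3 * jump_bound * (step n h P - h P))"
        unfolding norm_mult using EP by (intro mult_mono) auto
      have "norm (over Q *\<^sub>R E Q) \<le> exp (s\<^sup>2 * c + 1 / 2) *\<^sub>R over Q" if "Q \<in> successors n P" for Q
      proof -
        have "(total_score Q - total_score P)\<^sup>2 \<le> jump_bound\<^sup>2"
          using incr(2)[OF that] by (metis abs_le_square_iff abs_of_pos jump_bound_pos)
        then have "total_info Q \<le> 2 * c + jump_bound\<^sup>2"
          using incr(1)[OF that] True by linarith
        then have "s\<^sup>2 * total_info Q \<le> s\<^sup>2 * (2 * c + jump_bound\<^sup>2)"
          by (rule mult_left_mono) simp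
        then have "s\<^sup>2 * total_info Q / 2 \<le> s\<^sup>2 * c + 1 / 2"
          using sB by (simp add: algebra_simps)
        then show ?thesis by (simp add: nE over_def of_bool_def)
      qed
      then have "norm (step n (\<lambda>Q. over Q *\<^sub>R E Q) P) \<le> step n (\<lambda>Q. exp (s\<^sup>2 * c + 1 / 2) *\<^sub>R over Q) P"
        by (intro order_trans[OF norm_step_le[OF n P] step_mono_succ[OF n P]])
      also have "\<dots> = exp (s\<^sup>2 * c + 1 / 2) * (step n over P - over P)"
        using True unfolding step_linear by (simp add: over_def)
      finally show "norm (step n (\<lambda>Q. over Q *\<^sub>R E Q) P) \<le> exp (s\<^sup>2 * c + 1 / 2) * (step n over P - over P)" .
    qed
    finally show ?thesis by (simp add: distrib_left)
  qed
qed

text \<open>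
  The potential \<open>\<Psi>\<close> collects the three one-step errors. Its one-step increment in mean dominates the
  change of the expectation, so the total change is bounded by the mean of \<open>\<Psi>\<close> at the end. The
  parameters \<open>s\<close> and \<open>c\<close> and the weight \<open>\<phi>\<close> may depend on the partition at time \<open>m\<close>.
\<close>

lemma tilted_telescope:
  fixes s c \<phi> :: "nat set set \<Rightarrow> real"
  assumes m: "1 \<le> m" "m \<le> n"
    and c: "\<And>R. R \<in> partitions_upto m \<Longrightarrow> c R \<ge> 0"
    and s: "\<And>R. R \<in> partitions_upto m \<Longrightarrow> \<bar>s R\<bar> * jump_bound \<le> 1"
    and \<phi>: "\<And>R. R \<in> partitions_upto m \<Longrightarrow> \<bar>\<phi> R\<bar> \<le> 1"
  defines "\<Psi> \<equiv> \<lambda>k R Q. exp ((s R)\<^sup>2 * c R) * (\<bar>s R\<bar> * (\<Sum>j = m..<k. \<bar>\<theta> / \<alpha> / (\<theta> + real j)\<bar>)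
        + 4 * \<bar>s R\<bar> ^ 3 * jump_bound * min (total_info Q) (2 * c R + jump_bound\<^sup>2))
      + exp ((s R)\<^sup>2 * c R + 1 / 2) * of_bool (2 * c R < total_info Q)"
  shows "norm (expect n (\<lambda>P. \<phi> (restrict_partition m P) *\<^sub>R tilted (s (restrict_partition m P)) (c (restrict_partition m P)) P)
       - expect m (\<lambda>R. \<phi> R *\<^sub>R tilted (s R) (c R) R))
    \<le> expect n (\<lambda>P. \<Psi> n (restrict_partition m P) P)"
  using m(2)
proof (induction n rule: dec_induct)
  case base
  have "expect m (\<lambda>P. \<phi> (restrict_partition m P) *\<^sub>R tilted (s (restrict_partition m P)) (c (restrict_partition m P)) P)
       = expect m (\<lambda>R. \<phi> R *\<^sub>R tilted (s R) (c R) R)"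
    by (rule expect_cong) (simp add: restrict_self)
  moreover have "0 \<le> expect m (\<lambda>P. \<Psi> m (restrict_partition m P) P)"
  proof (rule expect_nonneg)
    fix P assume P: "P \<in> partitions_upto m"
    have "0 \<le> min (total_info P) (2 * c P + jump_bound\<^sup>2)"
      using crude_bounds(3)[OF P] c[OF P] by simp
    then show "0 \<le> \<Psi> m (restrict_partition m P) P"
      unfolding \<Psi>_def restrict_self[OF P] using jump_bound_pos by (intro add_nonneg_nonneg mult_nonneg_nonneg) auto
  qed
  ultimately show ?case by simp
next
  case (step n)
  let ?R = "restrict_partition m"
  let ?V = "\<lambda>n. expect n (\<lambda>P. \<phi> (?R P) *\<^sub>R tilted (s (?R P)) (c (?R P)) P)"
  have n: "n \<ge> 1" using m step by simp
  have "norm (?V (Suc n) - ?V n) \<le> expect n (\<lambda>P. step n (\<lambda>P. \<Psi> (Suc n) (?R P) P) P - \<Psi> n (?R P) P)"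
    unfolding expect_Suc[OF n] expect_linear(2)[symmetric]
  proof (rule norm_expect_bound)
    fix P assume P: "P \<in> partitions_upto n"
    define R where "R = ?R P"
    have R: "R \<in> partitions_upto m" unfolding R_def by (rule restrict_in[OF P step.hyps(1)])
    have "step n (\<lambda>P. \<phi> (?R P) *\<^sub>R tilted (s (?R P)) (c (?R P)) P) P = \<phi> R *\<^sub>R step n (tilted (s R) (c R)) P"
      using step_restrict[OF P step.hyps(1), of "\<lambda>R Q. \<phi> R *\<^sub>R tilted (s R) (c R) Q"]
      by (simp add: R_def step_linear)
    then have "norm (step n (\<lambda>P. \<phi> (?R P) *\<^sub>R tilted (s (?R P)) (c (?R P)) P) P - \<phi> R *\<^sub>R tilted (s R) (c R) P)
      = \<bar>\<phi> R\<bar> * norm (step n (tilted (s R) (c R)) P - tilted (s R) (c R) P)"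
      by (simp flip: scaleR_diff_right)
    also have "\<dots> \<le> norm (step n (tilted (s R) (c R)) P - tilted (s R) (c R) P)"
      using \<phi>[OF R] by (intro mult_left_le_one_le) auto
    also note tilted_one_step[OF n P c[OF R] s[OF R]]
    also have "exp ((s R)\<^sup>2 * c R) * (\<bar>s R\<bar> * \<bar>\<theta> / \<alpha> / (\<theta> + real n)\<bar> + 4 * \<bar>s R\<bar> ^ 3 * jump_bound *
          (step n (\<lambda>Q. min (total_info Q) (2 * c R + jump_bound\<^sup>2)) P - min (total_info P) (2 * c R + jump_bound\<^sup>2)))
        + exp ((s R)\<^sup>2 * c R + 1 / 2) * (step n (\<lambda>Q. of_bool (2 * c R < total_info Q)) P - of_bool (2 * c R < total_info P))
      = step n (\<lambda>P. \<Psi> (Suc n) R P) P - \<Psi> n R P"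
    proof -
      have "step n (\<lambda>P. \<Psi> (Suc n) R P) P = step n (\<lambda>P. exp ((s R)\<^sup>2 * c R) * (\<bar>s R\<bar> * (\<Sum>j = m..<Suc n. \<bar>\<theta> / \<alpha> / (\<theta> + real j)\<bar>))
           + (exp ((s R)\<^sup>2 * c R) * (4 * \<bar>s R\<bar> ^ 3 * jump_bound)) *\<^sub>R min (total_info P) (2 * c R + jump_bound\<^sup>2)
           + exp ((s R)\<^sup>2 * c R + 1 / 2) *\<^sub>R of_bool (2 * c R < total_info P)) P"
        unfolding \<Psi>_def by (simp add: algebra_simps)
      also have "\<dots> = exp ((s R)\<^sup>2 * c R) * (\<bar>s R\<bar> * (\<Sum>j = m..<Suc n. \<bar>\<theta> / \<alpha> / (\<theta> + real j)\<bar>))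
           + (exp ((s R)\<^sup>2 * c R) * (4 * \<bar>s R\<bar> ^ 3 * jump_bound)) *\<^sub>R step n (\<lambda>P. min (total_info P) (2 * c R + jump_bound\<^sup>2)) P
           + exp ((s R)\<^sup>2 * c R + 1 / 2) *\<^sub>R step n (\<lambda>P. of_bool (2 * c R < total_info P)) P"
        unfolding step_linear step_const[OF n P] ..
      finally show ?thesis
        using step.hyps(1) unfolding \<Psi>_def by (simp add: algebra_simps)
    qed
    also have "step n (\<lambda>P. \<Psi> (Suc n) R P) P = step n (\<lambda>P. \<Psi> (Suc n) (?R P) P) P"
      using step_restrict[OF P step.hyps(1), of "\<Psi> (Suc n)"] by (simp add: R_def)
    finally show "norm (step n (\<lambda>P. \<phi> (?R P) *\<^sub>R tilted (s (?R P)) (c (?R P)) P) P - \<phi> (?R P) *\<^sub>R tilted (s (?R P)) (c (?R P)) P)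
        \<le> step n (\<lambda>P. \<Psi> (Suc n) (?R P) P) P - \<Psi> n (?R P) P"
      by (simp add: R_def)
  qed
  then have "norm (?V (Suc n) - ?V n) \<le> expect (Suc n) (\<lambda>P. \<Psi> (Suc n) (?R P) P) - expect n (\<lambda>P. \<Psi> n (?R P) P)"
    by (simp add: expect_linear expect_Suc[OF n])
  then show ?case
    using step.IH norm_triangle_ineq[of "?V (Suc n) - ?V n" "?V n - expect m (\<lambda>R. \<phi> R *\<^sub>R tilted (s R) (c R) R)"] by simp
qed

section \<open>Stable central limit theorem for the score\<close>

lemma tail_info_pos: "tail_info \<alpha> > 0"
  using tail_info_ge[OF alpha_pos alpha_less_1] alpha_pos by (meson less_le_trans zero_less_divide_1_iff zero_less_power)

text \<open>
  The asymptotic value of the quadratic variation of the score, known at the burn-in time.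
\<close>

definition norming :: "nat \<Rightarrow> nat set set \<Rightarrow> real" where
  "norming n P = tail_info \<alpha> * predicted_count n P"

lemma norming_large:
  assumes "\<epsilon> > 0"
  shows "\<forall>\<^sub>F n in sequentially. \<forall>P\<in>partitions_upto n. norming n P > 0 \<and> (1 + ln (real n)) / sqrt (norming n P) < \<epsilon>"
proof -
  have "(\<lambda>n. (1 + ln (real n))\<^sup>2 * ((1 + ln (real n)) / real n powr \<alpha>)) \<longlonglongrightarrow> 0"
    using alpha_pos by real_asymp
  from predicted_count_large[OF this, of "\<epsilon>\<^sup>2 * tail_info \<alpha>"] assms tail_info_pos
  have "\<forall>\<^sub>F n in sequentially. \<forall>P\<in>partitions_upto n. 0 < predicted_count n P \<and> \<bar>(1 + ln (real n))\<^sup>2\<bar> < \<epsilon>\<^sup>2 * tail_info \<alpha> * predicted_count n P"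
    by simp
  then show ?thesis
    using eventually_ge_at_top[of 1]
  proof eventually_elim
    case (elim n)
    show ?case
    proof
      fix P assume P: "P \<in> partitions_upto n"
      have pos: "norming n P > 0" and lt: "(1 + ln (real n))\<^sup>2 < \<epsilon>\<^sup>2 * norming n P"
        using elim(1) P tail_info_pos by (auto simp: norming_def mult.assoc)
      have "(1 + ln (real n))\<^sup>2 < (\<epsilon> * sqrt (norming n P))\<^sup>2"
        using lt pos by (simp add: power_mult_distrib)
      then have "1 + ln (real n) < \<epsilon> * sqrt (norming n P)"
        by (rule power2_less_imp_less) (use assms pos in auto)
      then show "norming n P > 0 \<and> (1 + ln (real n)) / sqrt (norming n P) < \<epsilon>"
        using pos by (simp add: divide_less_eq)
    qed
  qed
qed

lemma tends_in_prob_ln_norming: "tends_in_prob (\<lambda>n P. (1 + ln (real n)) / sqrt (norming n P)) 0"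
proof (rule tends_in_prob_eventually)
  fix \<epsilon> :: real assume "\<epsilon> > 0"
  from norming_large[OF this] eventually_ge_at_top[of 1]
  show "\<forall>\<^sub>F n in sequentially. \<forall>P\<in>partitions_upto n. dist ((1 + ln (real n)) / sqrt (norming n P)) 0 < \<epsilon>"
    by eventually_elim (auto simp: abs_of_nonneg)
qed

lemma tends_in_prob_count: "tends_in_prob (\<lambda>n P. real (card P) / predicted_count n P) 1"
  unfolding tends_in_prob_def dist_real_def using whp_predicted_count by blast

lemma tends_in_prob_info: "tends_in_prob (\<lambda>n P. total_info P / real (card P)) (tail_info \<alpha>)"
  unfolding tends_in_prob_def
proof (intro allI impI)
  fix \<epsilon> :: real assume e: "\<epsilon> > 0"
  show "whp (\<lambda>n P. dist (total_info P / real (card P)) (tail_info \<alpha>) < \<epsilon>)"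
  proof (rule whp_mono[OF whp_info[of "\<epsilon> / 2"]])
    show "\<forall>\<^sub>F n in sequentially. \<forall>P\<in>partitions_upto n.
        \<bar>block_sum (info \<alpha>) P - tail_info \<alpha> * real (card P)\<bar> \<le> \<epsilon> / 2 * real (card P) \<longrightarrow>
        dist (total_info P / real (card P)) (tail_info \<alpha>) < \<epsilon>"
      using eventually_ge_at_top[of 1]
    proof eventually_elim
      case (elim n)
      show ?case
      proof (intro ballI impI)
        fix P assume P: "P \<in> partitions_upto n"
          and *: "\<bar>block_sum (info \<alpha>) P - tail_info \<alpha> * real (card P)\<bar> \<le> \<epsilon> / 2 * real (card P)"
        have K: "real (card P) > 0"
          using card_partition_bounds(2)[OF P elim] by simp
        then have "total_info P / real (card P) - tail_info \<alpha> = (total_info P - tail_info \<alpha> * real (card P)) / real (card P)"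
          by (simp add: field_simps)
        then have "dist (total_info P / real (card P)) (tail_info \<alpha>) = \<bar>total_info P - tail_info \<alpha> * real (card P)\<bar> / real (card P)"
          using K by (simp add: dist_real_def abs_divide)
        also have "\<dots> \<le> \<epsilon> / 2"
          using * K by (simp add: total_info_def pos_divide_le_eq)
        finally show "dist (total_info P / real (card P)) (tail_info \<alpha>) < \<epsilon>"
          using e by simp
      qed
    qed
  qed (use e in simp)
qed

lemma whp_card_pos: "whp (\<lambda>n P. real (card P) > 0)"
  by (rule whp_eventually, rule eventually_mono[OF eventually_ge_at_top[of 1]])
     (use card_partition_bounds(2) in fastforce)

lemma tends_in_prob_info_norming: "tends_in_prob (\<lambda>n P. total_info P / norming n P) 1"
proof (rule tends_in_prob_cong)
  show "tends_in_prob (\<lambda>n P. (1 / tail_info \<alpha>) * (total_info P / real (card P)) * (real (card P) / predicted_count n P)) 1"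
    using tends_in_prob_mult[OF tends_in_prob_mult[OF tends_in_prob_const[of "1 / tail_info \<alpha>"] tends_in_prob_info] tends_in_prob_count]
      tail_info_pos by simp
  show "whp (\<lambda>n P. 1 / tail_info \<alpha> * (total_info P / real (card P)) * (real (card P) / predicted_count n P) = total_info P / norming n P)"
    by (rule whp_mono[OF whp_card_pos]) (auto simp: norming_def)
qed

lemma tends_in_prob_of_bool:
  assumes "whp A" shows "tends_in_prob (\<lambda>n P. of_bool (A n P) :: real) 1"
  by (rule tends_in_prob_cong[OF tends_in_prob_const[of 1] whp_mono[OF assms]]) (auto intro!: always_eventually)

lemma tends_in_prob_of_bool_not:
  assumes "whp A" shows "tends_in_prob (\<lambda>n P. of_bool (\<not> A n P) :: real) 0"
  by (rule tends_in_prob_cong[OF tends_in_prob_const[of 0] whp_mono[OF assms]]) (auto intro!: always_eventually)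

lemma whp_total_info_le: "whp (\<lambda>n P. total_info P \<le> 2 * norming n P)"
proof (rule whp_mono)
  show "whp (\<lambda>n P. dist (total_info P / norming n P) 1 < 1)"
    using tends_in_prob_info_norming by (auto simp: tends_in_prob_def)
  show "\<forall>\<^sub>F n in sequentially. \<forall>P\<in>partitions_upto n. dist (total_info P / norming n P) 1 < 1 \<longrightarrow> total_info P \<le> 2 * norming n P"
    using norming_large[of 1, OF zero_less_one]
  proof eventually_elim
    case (elim n)
    show ?case
    proof (intro ballI impI)
      fix P assume P: "P \<in> partitions_upto n" and *: "dist (total_info P / norming n P) 1 < 1"
      have "total_info P / norming n P < 2"
        using * unfolding dist_real_def by linarith
      then show "total_info P \<le> 2 * norming n P"
        using elim P by (simp add: divide_less_eq)
    qed
  qed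
qed

text \<open>
  The tilted expectation is compared at the burn-in time, where it is the mean of the weight, and at
  time \<open>n\<close>, where it is \<open>exp (u\<^sup>2 / 2)\<close> times the characteristic function of the normalized score.
  Because the weight is an arbitrary bounded function of the early partition, the limit law does not see
  the past; this is the source of mixing.
\<close>

theorem stable_clt_score:
  assumes \<phi>: "\<And>n R. \<bar>\<phi> n R\<bar> \<le> 1"
  shows "(\<lambda>n. expect n (\<lambda>P. \<phi> n (restrict_partition (burn_in n) P) *\<^sub>R iexp (u * (total_score P / sqrt (norming n P))))
      - of_real (exp (- u\<^sup>2 / 2)) * expect n (\<lambda>P. complex_of_real (\<phi> n (restrict_partition (burn_in n) P)))) \<longlonglongrightarrow> 0"
proof -
  define R where "R n P = restrict_partition (burn_in n) P" for n P
  define c where "c n Q = tail_info \<alpha> * (shifted_count Q * (growth n / growth (burn_in n)))" for n Q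
  define s where "s n Q = u / sqrt (c n Q)" for n Q
  have cR: "c n (R n P) = norming n P" for n P
    by (simp add: c_def R_def norming_def predicted_count_def)
  define z where "z n P = (1 + ln (real n)) / sqrt (norming n P)" for n P
  define T where "T n P = tilted (s n (R n P)) (c n (R n P)) P" for n P
  define E where "E n P = iexp (u * (total_score P / sqrt (norming n P)))" for n P
  define \<Phi> where "\<Phi> n P = \<phi> n (R n P)" for n P
  define V where "V n = expect (burn_in n) (\<lambda>Q. \<phi> n Q *\<^sub>R tilted (s n Q) (c n Q) Q)" for n
  note B = jump_bound_pos
  have z0: "tends_in_prob z 0"
    using tends_in_prob_ln_norming unfolding z_def .
  obtain D where D: "D > 0" "\<And>m n. 1 \<le> m \<Longrightarrow> 1 \<le> n \<Longrightarrow> (\<Sum>k = m..<n. \<bar>\<theta> / \<alpha> / (\<theta> + real k)\<bar>) \<le> D * (1 + ln (real n))"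
    using sum_inverse_denominator by blast
  \<comment> \<open>Chosen such that \<open>z < \<epsilon>\<close> forces \<open>\<bar>s\<bar> * jump_bound \<le> 1\<close>, as the expansion of the exponential requires.\<close>
  define \<epsilon> where "\<epsilon> = 1 / ((\<bar>u\<bar> + 1) * (jump_bound + 1))"
  have e: "\<epsilon> > 0" "\<epsilon> \<le> 1" "\<bar>u\<bar> * \<epsilon> * jump_bound \<le> 1"
  proof -
    show "\<epsilon> > 0" using B by (simp add: \<epsilon>_def)
    have "1 * 1 \<le> (\<bar>u\<bar> + 1) * (jump_bound + 1)" using B by (intro mult_mono) auto
    then show "\<epsilon> \<le> 1" by (simp add: \<epsilon>_def)
    have "\<bar>u\<bar> * jump_bound \<le> (\<bar>u\<bar> + 1) * (jump_bound + 1)" using B by (intro mult_mono) auto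
    moreover have "(\<bar>u\<bar> + 1) * (jump_bound + 1) > 0" using B by simp
    ultimately show "\<bar>u\<bar> * \<epsilon> * jump_bound \<le> 1" by (simp add: \<epsilon>_def)
  qed
  have good: "\<forall>\<^sub>F n in sequentially. n \<ge> 1 \<and> (\<forall>P\<in>partitions_upto n. norming n P > 0 \<and> z n P < \<epsilon>)"
    using norming_large[OF e(1)] eventually_ge_at_top[of 1] by eventually_elim (simp add: z_def)
  have s_z: "\<bar>s n (R n P)\<bar> \<le> \<bar>u\<bar> * z n P" if "n \<ge> 1" "norming n P > 0" for n P
  proof -
    have "\<bar>s n (R n P)\<bar> = \<bar>u\<bar> * (1 / sqrt (norming n P))"
      using that by (simp add: s_def cR abs_divide)
    also have "\<dots> \<le> \<bar>u\<bar> * z n P"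
      unfolding z_def using that by (intro mult_left_mono divide_right_mono) auto
    finally show ?thesis .
  qed
  have s2c: "(s n (R n P))\<^sup>2 * c n (R n P) = u\<^sup>2" if "norming n P > 0" for n P
    using that by (simp add: s_def cR power_divide)

  \<comment> \<open>The tilted expectation hardly changes after the burn-in time.\<close>
  define K where "K = exp (u\<^sup>2) * (\<bar>u\<bar> * D + 4 * (2 * u\<^sup>2 + 1) * jump_bound * \<bar>u\<bar>)"
  have K: "K \<ge> 0"
    unfolding K_def using B D(1) by (intro mult_nonneg_nonneg add_nonneg_nonneg) auto
  \<comment> \<open>A bound for the potential of the telescoping estimate: of order \<open>z\<close>, apart from the event that the cutoff is reached.\<close>
  define g where "g n P = K * z n P
    + exp (u\<^sup>2 + 1 / 2) * of_bool (\<not> total_info P \<le> 2 * norming n P)" for n P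
  have g0: "(\<lambda>n. expect n (g n)) \<longlonglongrightarrow> 0"
  proof (rule expect_tendsto_in_prob)
    show "tends_in_prob g 0"
      using tends_in_prob_add[OF tends_in_prob_mult[OF tends_in_prob_const z0]
          tends_in_prob_mult[OF tends_in_prob_const tends_in_prob_of_bool_not[OF whp_total_info_le]],
          of K "exp (u\<^sup>2 + 1 / 2)"]
      unfolding g_def by simp
    show "\<forall>\<^sub>F n in sequentially. \<forall>P\<in>partitions_upto n. norm (g n P) \<le>
        K * 1 + exp (u\<^sup>2 + 1 / 2) * 1"
      using good
    proof eventually_elim
      case (elim n)
      show ?case
      proof
        fix P assume P: "P \<in> partitions_upto n"
        have "z n P < \<epsilon>" "0 \<le> z n P"
          using elim P by (auto simp: z_def)
        then have z: "0 \<le> z n P" "z n P \<le> 1"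
          using e(2) by auto
        have "g n P \<ge> 0"
          unfolding g_def using K z by (intro add_nonneg_nonneg mult_nonneg_nonneg) auto
        moreover have "g n P \<le> K * 1 + exp (u\<^sup>2 + 1 / 2) * 1"
          unfolding g_def using K z by (intro add_mono mult_left_mono) auto
        ultimately show "norm (g n P) \<le> K * 1 + exp (u\<^sup>2 + 1 / 2) * 1"
          by simp
      qed
    qed
  qed
  have tele: "\<forall>\<^sub>F n in sequentially. norm (expect n (\<lambda>P. \<Phi> n P *\<^sub>R T n P) - V n) \<le> expect n (g n)"
    using good
  proof eventually_elim
    case (elim n)
    note b = burn_in_bounds[OF conjunct1[OF elim]]
    have onR: "c n Q > 0 \<and> \<bar>s n Q\<bar> * jump_bound \<le> 1" if Q: "Q \<in> partitions_upto (burn_in n)" for Q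
    proof -
      obtain P where P: "P \<in> partitions_upto n" "R n P = Q"
        using restrict_surjective[OF Q b(3)] by (auto simp: R_def)
      have "\<bar>s n Q\<bar> \<le> \<bar>u\<bar> * \<epsilon>"
        using s_z[of n P] elim P by (force intro: order_trans mult_left_mono)
      then have "\<bar>s n Q\<bar> * jump_bound \<le> \<bar>u\<bar> * \<epsilon> * jump_bound"
        using B by (intro mult_right_mono) auto
      then show ?thesis
        using elim P cR[of n P] e(3) by auto
    qed
    have "norm (expect n (\<lambda>P. \<Phi> n P *\<^sub>R T n P) - V n) \<le>
      expect n (\<lambda>P. exp ((s n (R n P))\<^sup>2 * c n (R n P)) * (\<bar>s n (R n P)\<bar> * (\<Sum>j = burn_in n..<n. \<bar>\<theta> / \<alpha> / (\<theta> + real j)\<bar>)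
        + 4 * \<bar>s n (R n P)\<bar> ^ 3 * jump_bound * min (total_info P) (2 * c n (R n P) + jump_bound\<^sup>2))
      + exp ((s n (R n P))\<^sup>2 * c n (R n P) + 1 / 2) * of_bool (2 * c n (R n P) < total_info P))"
      unfolding \<Phi>_def T_def V_def R_def
      by (rule tilted_telescope[OF b(1) b(3)]) (simp_all add: onR \<phi> less_imp_le)
    also have "\<dots> \<le> expect n (g n)"
    proof (rule expect_mono)
      fix P assume P: "P \<in> partitions_upto n"
      have pos: "norming n P > 0" "z n P < \<epsilon>" using elim P by auto
      let ?s = "s n (R n P)"
      have sB: "\<bar>?s\<bar> * jump_bound \<le> 1"
        using onR restrict_in[OF P b(3)] by (simp add: R_def)
      have sz: "\<bar>?s\<bar> \<le> \<bar>u\<bar> * z n P" using s_z elim pos by simp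
      have "?s\<^sup>2 * jump_bound\<^sup>2 \<le> 1"
        using power_mono[OF sB, of 2] B by (simp add: power_mult_distrib)
      then have s2: "?s\<^sup>2 * (2 * norming n P + jump_bound\<^sup>2) \<le> 2 * u\<^sup>2 + 1"
        using s2c[OF pos(1)] by (simp add: cR algebra_simps)
      have "\<bar>?s\<bar> ^ 3 * min (total_info P) (2 * norming n P + jump_bound\<^sup>2) \<le> \<bar>?s\<bar> ^ 3 * (2 * norming n P + jump_bound\<^sup>2)"
        by (intro mult_left_mono) auto
      also have "\<dots> = \<bar>?s\<bar> * (?s\<^sup>2 * (2 * norming n P + jump_bound\<^sup>2))"
        by (simp only: power3_eq_cube power2_abs[of ?s, symmetric] power2_eq_square mult.assoc)
      also have "\<dots> \<le> (\<bar>u\<bar> * z n P) * (2 * u\<^sup>2 + 1)"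
        using sz s2 pos by (intro mult_mono) auto
      finally have "4 * jump_bound * (\<bar>?s\<bar> ^ 3 * min (total_info P) (2 * norming n P + jump_bound\<^sup>2))
          \<le> 4 * jump_bound * ((\<bar>u\<bar> * z n P) * (2 * u\<^sup>2 + 1))"
        by (rule mult_left_mono) (use B in simp)
      then have 1: "4 * \<bar>?s\<bar> ^ 3 * jump_bound * min (total_info P) (2 * norming n P + jump_bound\<^sup>2)
          \<le> 4 * jump_bound * ((\<bar>u\<bar> * z n P) * (2 * u\<^sup>2 + 1))"
        by (simp only: mult_ac)
      have "\<bar>?s\<bar> = \<bar>u\<bar> * (1 / sqrt (norming n P))"
        using pos by (simp add: s_def cR abs_divide)
      then have "\<bar>?s\<bar> * (\<Sum>j = burn_in n..<n. \<bar>\<theta> / \<alpha> / (\<theta> + real j)\<bar>) \<le> \<bar>u\<bar> * (1 / sqrt (norming n P)) * (D * (1 + ln (real n)))"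
        using D(2)[OF b(1), of n] elim pos by (simp only:) (intro mult_left_mono, auto)
      then have 2: "\<bar>?s\<bar> * (\<Sum>j = burn_in n..<n. \<bar>\<theta> / \<alpha> / (\<theta> + real j)\<bar>) \<le> \<bar>u\<bar> * D * z n P"
        by (simp add: z_def mult_ac)
      have "\<bar>?s\<bar> * (\<Sum>j = burn_in n..<n. \<bar>\<theta> / \<alpha> / (\<theta> + real j)\<bar>)
          + 4 * \<bar>?s\<bar> ^ 3 * jump_bound * min (total_info P) (2 * norming n P + jump_bound\<^sup>2)
          \<le> (\<bar>u\<bar> * D + 4 * (2 * u\<^sup>2 + 1) * jump_bound * \<bar>u\<bar>) * z n P"
        using add_mono[OF 2 1] by (simp add: algebra_simps)
      then show "exp (?s\<^sup>2 * c n (R n P)) * (\<bar>?s\<bar> * (\<Sum>j = burn_in n..<n. \<bar>\<theta> / \<alpha> / (\<theta> + real j)\<bar>)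
          + 4 * \<bar>?s\<bar> ^ 3 * jump_bound * min (total_info P) (2 * c n (R n P) + jump_bound\<^sup>2))
          + exp (?s\<^sup>2 * c n (R n P) + 1 / 2) * of_bool (2 * c n (R n P) < total_info P) \<le> g n P"
        unfolding cR s2c[OF pos(1), unfolded cR] g_def K_def not_le mult.assoc[of "exp (u\<^sup>2)"]
        by (intro add_right_mono mult_left_mono) auto
    qed
    finally show ?case .
  qed
  have lim1: "(\<lambda>n. expect n (\<lambda>P. \<Phi> n P *\<^sub>R T n P) - V n) \<longlonglongrightarrow> 0"
    by (rule Lim_null_comparison[OF tele g0])

  \<comment> \<open>At the burn-in time the tilted function is still close to 1.\<close>
  have lim2: "(\<lambda>n. V n - expect n (\<lambda>P. complex_of_real (\<Phi> n P))) \<longlonglongrightarrow> 0"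
  proof -
    define T0 where "T0 n P = tilted (s n (R n P)) (c n (R n P)) (R n P)" for n P
    define y where "y n P = total_info (R n P) / norming n P" for n P
    define x where "x n P = u * (total_score (R n P) / sqrt (norming n P))" for n P
    have y_bd: "whp (\<lambda>n P. norm (y n P) \<le> jump_bound\<^sup>2 * (z n P * z n P))"
    proof (rule whp_eventually, use good in eventually_elim)
      case (elim n)
      show ?case
      proof
        fix P assume P: "P \<in> partitions_upto n"
        note b = burn_in_bounds[OF conjunct1[OF elim]]
        have pos: "norming n P > 0" using elim P by auto
        have ln: "1 + ln (real n) \<ge> 1" using elim by simp
        have "\<bar>total_info (R n P)\<bar> \<le> jump_bound\<^sup>2 * real (burn_in n)"
          unfolding R_def by (rule crude_bounds(2)[OF restrict_in[OF P b(3)]])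
        also have "\<dots> \<le> jump_bound\<^sup>2 * ((1 + ln (real n)) * (1 + ln (real n)))"
        proof (rule mult_left_mono)
          have "1 * (1 + ln (real n)) \<le> (1 + ln (real n)) * (1 + ln (real n))"
            using ln by (intro mult_right_mono) auto
          then show "real (burn_in n) \<le> (1 + ln (real n)) * (1 + ln (real n))"
            unfolding mult_1_left by (rule order_trans[OF b(2)])
        qed simp
        finally have "\<bar>total_info (R n P)\<bar> / norming n P \<le> jump_bound\<^sup>2 * ((1 + ln (real n)) * (1 + ln (real n))) / norming n P"
          using pos by (intro divide_right_mono) auto
        also have "\<dots> = jump_bound\<^sup>2 * (z n P * z n P)"
          using pos by (simp add: z_def)
        finally show "norm (y n P) \<le> jump_bound\<^sup>2 * (z n P * z n P)"
          using pos by (simp add: y_def abs_divide)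
      qed
    qed
    have x_bd: "whp (\<lambda>n P. norm (x n P) \<le> (\<bar>u\<bar> * jump_bound) * z n P)"
    proof (rule whp_eventually, use good in eventually_elim)
      case (elim n)
      show ?case
      proof
        fix P assume P: "P \<in> partitions_upto n"
        note b = burn_in_bounds[OF conjunct1[OF elim]]
        have pos: "norming n P > 0" using elim P by auto
        have "\<bar>total_score (R n P)\<bar> \<le> jump_bound * real (burn_in n)"
          unfolding R_def by (rule crude_bounds(1)[OF restrict_in[OF P b(3)]])
        also have "\<dots> \<le> jump_bound * (1 + ln (real n))"
          using b(2) B by (intro mult_left_mono) auto
        finally have "\<bar>u\<bar> * (\<bar>total_score (R n P)\<bar> / sqrt (norming n P)) \<le> \<bar>u\<bar> * (jump_bound * (1 + ln (real n)) / sqrt (norming n P))"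
          using pos by (intro mult_left_mono divide_right_mono) auto
        then show "norm (x n P) \<le> (\<bar>u\<bar> * jump_bound) * z n P"
          using pos by (simp add: x_def z_def abs_mult abs_divide)
      qed
    qed
    have y0: "tends_in_prob y 0"
      by (rule tends_in_prob_bounded_by[OF _ y_bd])
         (use tends_in_prob_mult[OF tends_in_prob_const tends_in_prob_mult[OF z0 z0], of "jump_bound\<^sup>2"] in simp)
    have x0: "tends_in_prob x 0"
      by (rule tends_in_prob_bounded_by[OF _ x_bd])
         (use tends_in_prob_mult[OF tends_in_prob_const z0, of "\<bar>u\<bar> * jump_bound"] in simp)
    have "tends_in_prob (\<lambda>n P. exp (Complex (u\<^sup>2 / 2 * snd (x n P, y n P)) (fst (x n P, y n P))) - 1)
        (exp (Complex (u\<^sup>2 / 2 * snd (0::real, 0::real)) (fst (0::real, 0::real))) - 1)"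
      by (rule tends_in_prob_cont[OF tends_in_prob_Pair[OF x0 y0]], unfold Complex_eq) (intro continuous_intros)
    then have F0: "tends_in_prob (\<lambda>n P. exp (Complex (u\<^sup>2 / 2 * y n P) (x n P)) - 1) 0"
      by (simp add: Complex_eq)
    have T00: "tends_in_prob (\<lambda>n P. T0 n P - 1) 0"
    proof (rule tends_in_prob_cong[OF F0])
      have "whp (\<lambda>n P. dist (y n P) 0 < 2)"
        using y0 by (auto simp: tends_in_prob_def)
      then show "whp (\<lambda>n P. exp (Complex (u\<^sup>2 / 2 * y n P) (x n P)) - 1 = T0 n P - 1)"
      proof (rule whp_mono, use good in eventually_elim)
        case (elim n)
        show ?case
        proof (intro ballI impI)
          fix P assume P: "P \<in> partitions_upto n" and "dist (y n P) 0 < 2"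
          then have pos: "norming n P > 0" and "y n P \<le> 2" using elim by auto
          then have "total_info (R n P) \<le> 2 * norming n P"
            by (simp add: y_def divide_le_eq)
          then show "exp (Complex (u\<^sup>2 / 2 * y n P) (x n P)) - 1 = T0 n P - 1"
            using pos by (simp add: T0_def tilted_def cR s_def y_def x_def power_divide mult.commute)
        qed
      qed
    qed
    have "(\<lambda>n. expect n (\<lambda>P. \<Phi> n P *\<^sub>R (T0 n P - 1))) \<longlonglongrightarrow> 0"
    proof (rule expect_tendsto_in_prob)
      show "tends_in_prob (\<lambda>n P. \<Phi> n P *\<^sub>R (T0 n P - 1)) 0"
      proof (rule tends_in_prob_bounded_by)
        show "tends_in_prob (\<lambda>n P. norm (T0 n P - 1)) 0"
          using tends_in_prob_cont[OF T00, of norm] by simp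
        show "whp (\<lambda>n P. norm (\<Phi> n P *\<^sub>R (T0 n P - 1)) \<le> norm (T0 n P - 1))"
          by (rule whp_eventually) (auto intro!: always_eventually mult_left_le_one_le simp: \<Phi>_def \<phi>)
      qed
      show "\<forall>\<^sub>F n in sequentially. \<forall>P\<in>partitions_upto n. norm (\<Phi> n P *\<^sub>R (T0 n P - 1)) \<le> 1 * (exp (u\<^sup>2) + 1)"
        using good
      proof eventually_elim
        case (elim n)
        show ?case
        proof
          fix P assume P: "P \<in> partitions_upto n"
          then have pos: "norming n P > 0" using elim by auto
          have "norm (T0 n P) \<le> exp (u\<^sup>2)"
          proof (cases "total_info (R n P) \<le> 2 * norming n P")
            case True
            then have "u\<^sup>2 * (total_info (R n P) / norming n P) \<le> u\<^sup>2 * 2"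
              using pos by (intro mult_left_mono) (auto simp: divide_le_eq)
            then show ?thesis
              using True pos by (simp add: T0_def tilted_def cR s_def power_divide)
          qed (simp add: T0_def tilted_def cR)
          then have "norm (T0 n P - 1) \<le> exp (u\<^sup>2) + 1"
            using norm_triangle_ineq4[of "T0 n P" 1] by simp
          then show "norm (\<Phi> n P *\<^sub>R (T0 n P - 1)) \<le> 1 * (exp (u\<^sup>2) + 1)"
            unfolding norm_scaleR \<Phi>_def by (intro mult_mono \<phi>) auto
        qed
      qed
    qed
    moreover have "\<forall>\<^sub>F n in sequentially. expect n (\<lambda>P. \<Phi> n P *\<^sub>R (T0 n P - 1)) = V n - expect n (\<lambda>P. complex_of_real (\<Phi> n P))"
      using good
    proof eventually_elim
      case (elim n)
      note b = burn_in_bounds[OF conjunct1[OF elim]]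
      have "V n = expect n (\<lambda>P. \<Phi> n P *\<^sub>R T0 n P)"
        unfolding V_def \<Phi>_def T0_def R_def
        by (rule expect_restrict[OF b(1) b(3), symmetric])
      then show ?case
        by (simp add: expect_linear(2)[symmetric] algebra_simps scaleR_conv_of_real)
    qed
    ultimately show ?thesis
      by (rule Lim_transform_eventually)
  qed

  \<comment> \<open>At time \<open>n\<close> the tilting factor is nearly deterministic.\<close>
  have lim3: "(\<lambda>n. expect n (\<lambda>P. \<Phi> n P *\<^sub>R (T n P - of_real (exp (u\<^sup>2 / 2)) * E n P))) \<longlonglongrightarrow> 0"
  proof -
    define y where "y n P = total_info P / norming n P" for n P
    define w where "w n P = of_bool (total_info P \<le> 2 * norming n P) * exp (u\<^sup>2 / 2 * y n P)" for n P
    have y1: "tends_in_prob y 1"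
      using tends_in_prob_info_norming unfolding y_def .
    have "isCont (\<lambda>y. exp (u\<^sup>2 / 2 * y)) 1" by (intro continuous_intros)
    from tends_in_prob_mult[OF tends_in_prob_of_bool[OF whp_total_info_le] tends_in_prob_cont[OF y1 this]]
    have "tends_in_prob w (1 * exp (u\<^sup>2 / 2 * 1))" unfolding w_def[abs_def] .
    then have w1: "tends_in_prob w (exp (u\<^sup>2 / 2))" by simp
    from tends_in_prob_cont[OF w1, of "\<lambda>v. \<bar>v - exp (u\<^sup>2 / 2)\<bar>"]
    have w0: "tends_in_prob (\<lambda>n P. \<bar>w n P - exp (u\<^sup>2 / 2)\<bar>) 0"
      by (simp add: continuous_intros)
    have diff: "norm (\<Phi> n P *\<^sub>R (T n P - of_real (exp (u\<^sup>2 / 2)) * E n P)) \<le> \<bar>w n P - exp (u\<^sup>2 / 2)\<bar>"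
      if pos: "norming n P > 0" for n P
    proof -
      have polar: "exp (Complex a b) = of_real (exp a) * iexp b" for a b
        by (simp add: Complex_eq exp_add exp_of_real)
      have "(s n (R n P))\<^sup>2 * total_info P / 2 = u\<^sup>2 / 2 * y n P" "s n (R n P) * total_score P = u * (total_score P / sqrt (norming n P))"
        using pos by (auto simp: s_def cR y_def power_divide)
      then have "T n P = of_real (w n P) * E n P"
        unfolding T_def tilted_def cR w_def E_def polar by simp
      then have "norm (T n P - of_real (exp (u\<^sup>2 / 2)) * E n P) = norm (of_real (w n P - exp (u\<^sup>2 / 2)) * E n P)"
        by (simp add: left_diff_distrib)
      also have "\<dots> = \<bar>w n P - exp (u\<^sup>2 / 2)\<bar>"
        unfolding norm_mult norm_of_real E_def by (simp only: norm_exp_i_times mult_1_right)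
      finally show ?thesis
        by (simp add: mult_left_le_one_le \<Phi>_def \<phi>)
    qed
    show ?thesis
    proof (rule expect_tendsto_in_prob)
      show "tends_in_prob (\<lambda>n P. \<Phi> n P *\<^sub>R (T n P - of_real (exp (u\<^sup>2 / 2)) * E n P)) 0"
        by (rule tends_in_prob_bounded_by[OF w0], rule whp_eventually, use good in eventually_elim) (intro ballI diff, auto)
      show "\<forall>\<^sub>F n in sequentially. \<forall>P\<in>partitions_upto n. norm (\<Phi> n P *\<^sub>R (T n P - of_real (exp (u\<^sup>2 / 2)) * E n P)) \<le> exp (u\<^sup>2) + exp (u\<^sup>2 / 2)"
        using good
      proof eventually_elim
        case (elim n)
        show ?case
        proof
          fix P assume P: "P \<in> partitions_upto n"
          then have pos: "norming n P > 0" using elim by auto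
          have "0 \<le> w n P" by (simp add: w_def)
          moreover have "w n P \<le> exp (u\<^sup>2)"
          proof (cases "total_info P \<le> 2 * norming n P")
            case True
            then have "u\<^sup>2 * y n P \<le> u\<^sup>2 * 2"
              using pos by (intro mult_left_mono) (auto simp: divide_le_eq y_def)
            then show ?thesis using True by (simp add: w_def)
          qed (simp add: w_def)
          moreover have "exp (u\<^sup>2 / 2) > 0" by simp
          ultimately have "\<bar>w n P - exp (u\<^sup>2 / 2)\<bar> \<le> exp (u\<^sup>2) + exp (u\<^sup>2 / 2)" by linarith
          then show "norm (\<Phi> n P *\<^sub>R (T n P - of_real (exp (u\<^sup>2 / 2)) * E n P)) \<le> exp (u\<^sup>2) + exp (u\<^sup>2 / 2)"
            using diff[OF pos] by linarith
        qed
      qed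
    qed
  qed
  define q where "q = complex_of_real (exp (u\<^sup>2 / 2))"
  have q: "of_real (exp (- u\<^sup>2 / 2)) * q = 1"
    unfolding q_def by (simp flip: of_real_mult exp_add)
  have "expect n (\<lambda>P. \<Phi> n P *\<^sub>R (T n P - q * E n P)) = expect n (\<lambda>P. \<Phi> n P *\<^sub>R T n P) - q * expect n (\<lambda>P. \<Phi> n P *\<^sub>R E n P)" for n
  proof -
    have "q * expect n (\<lambda>P. \<Phi> n P *\<^sub>R E n P) = expect n (\<lambda>P. \<Phi> n P *\<^sub>R (q * E n P))"
      unfolding expect_def by (simp add: sum_distrib_left mult_ac)
    then show ?thesis
      by (simp add: expect_linear(2)[symmetric] scaleR_diff_right)
  qed
  then have lim: "(\<lambda>n. of_real (exp (- u\<^sup>2 / 2)) * ((expect n (\<lambda>P. \<Phi> n P *\<^sub>R T n P) - V n) + (V n - expect n (\<lambda>P. complex_of_real (\<Phi> n P)))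
      - (expect n (\<lambda>P. \<Phi> n P *\<^sub>R T n P) - q * expect n (\<lambda>P. \<Phi> n P *\<^sub>R E n P)))) \<longlonglongrightarrow> of_real (exp (- u\<^sup>2 / 2)) * (0 + 0 - 0)"
    using lim3 unfolding q_def[symmetric] by (intro tendsto_intros lim1 lim2) simp
  have eq: "of_real (exp (- u\<^sup>2 / 2)) * ((expect n (\<lambda>P. \<Phi> n P *\<^sub>R T n P) - V n) + (V n - expect n (\<lambda>P. complex_of_real (\<Phi> n P)))
      - (expect n (\<lambda>P. \<Phi> n P *\<^sub>R T n P) - q * expect n (\<lambda>P. \<Phi> n P *\<^sub>R E n P)))
     = (of_real (exp (- u\<^sup>2 / 2)) * q) * expect n (\<lambda>P. \<Phi> n P *\<^sub>R E n P) - of_real (exp (- u\<^sup>2 / 2)) * expect n (\<lambda>P. complex_of_real (\<Phi> n P))" for n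
    by (simp add: algebra_simps)
  show ?thesis
    using lim[unfolded eq] unfolding q mult_1_left \<Phi>_def E_def R_def add_0_left diff_zero mult_zero_right .
qed

section \<open>Tightness of the normalized score\<close>

definition tight_in_prob :: "(nat \<Rightarrow> nat set set \<Rightarrow> real) \<Rightarrow> bool" where
  "tight_in_prob Y \<longleftrightarrow> (\<forall>\<delta>>0. \<exists>L>0. \<forall>\<^sub>F n in sequentially. expect n (\<lambda>P. of_bool (\<not> \<bar>Y n P\<bar> \<le> L) :: real) < \<delta>)"

lemma tight_in_probI:
  assumes "\<forall>\<^sub>F n in sequentially. expect n (\<lambda>P. (Y n P)\<^sup>2) \<le> C"
  shows "tight_in_prob Y"
  unfolding tight_in_prob_def
proof (intro allI impI)
  fix \<delta> :: real assume d: "\<delta> > 0"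
  define L where "L = sqrt ((\<bar>C\<bar> + 1) / \<delta>)"
  have L: "L > 0" "L\<^sup>2 = (\<bar>C\<bar> + 1) / \<delta>" using d by (auto simp: L_def)
  have "\<forall>\<^sub>F n in sequentially. expect n (\<lambda>P. of_bool (\<not> \<bar>Y n P\<bar> \<le> L) :: real) < \<delta>"
    using assms
  proof eventually_elim
    case (elim n)
    have "expect n (\<lambda>P. of_bool (\<not> \<bar>Y n P\<bar> \<le> L) :: real) \<le> expect n (\<lambda>P. (Y n P)\<^sup>2 / L\<^sup>2)"
    proof (rule expect_mono)
      fix P
      show "of_bool (\<not> \<bar>Y n P\<bar> \<le> L) \<le> (Y n P)\<^sup>2 / L\<^sup>2"
      proof (cases "\<bar>Y n P\<bar> \<le> L")
        case False
        then have "L\<^sup>2 \<le> \<bar>Y n P\<bar>\<^sup>2" using L by (intro power_mono) auto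
        then show ?thesis using L(1) False by (simp add: le_divide_eq)
      qed simp
    qed
    also have "\<dots> = expect n (\<lambda>P. (Y n P)\<^sup>2) / L\<^sup>2" by (rule expect_mult)
    also have "\<dots> \<le> \<bar>C\<bar> / L\<^sup>2" using elim by (intro divide_right_mono) auto
    also have "\<dots> = \<delta> * (\<bar>C\<bar> / (\<bar>C\<bar> + 1))" unfolding L(2) by simp
    also have "\<dots> < \<delta> * 1" using d by (intro mult_strict_left_mono) auto
    finally show ?case by simp
  qed
  then show "\<exists>L>0. \<forall>\<^sub>F n in sequentially. expect n (\<lambda>P. of_bool (\<not> \<bar>Y n P\<bar> \<le> L) :: real) < \<delta>"
    using L(1) by blast
qed

lemma tends_in_prob_tight_mult:
  assumes "tends_in_prob X 0" "tight_in_prob Y"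
  shows "tends_in_prob (\<lambda>n P. X n P * Y n P) (0 :: real)"
  unfolding tends_in_prob_def
proof (intro allI impI)
  fix \<epsilon> :: real assume e: "\<epsilon> > 0"
  show "whp (\<lambda>n P. dist (X n P * Y n P) 0 < \<epsilon>)"
    unfolding whp_def
  proof (rule order_tendstoI)
    fix a :: real assume "a < 0"
    then show "\<forall>\<^sub>F n in sequentially. a < expect n (\<lambda>P. of_bool (\<not> dist (X n P * Y n P) 0 < \<epsilon>))"
      by (intro always_eventually allI) (rule less_le_trans[OF _ expect_nonneg], auto)
  next
    fix a :: real assume a: "0 < a"
    then obtain L where L: "L > 0" "\<forall>\<^sub>F n in sequentially. expect n (\<lambda>P. of_bool (\<not> \<bar>Y n P\<bar> \<le> L) :: real) < a / 2"
      using assms(2)[unfolded tight_in_prob_def, rule_format, of "a / 2"] by auto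
    have "(\<lambda>n. expect n (\<lambda>P. of_bool (\<not> dist (X n P) 0 < \<epsilon> / L) :: real)) \<longlonglongrightarrow> 0"
      using assms(1)[unfolded tends_in_prob_def whp_def, rule_format, of "\<epsilon> / L"] e L by simp
    then have "\<forall>\<^sub>F n in sequentially. expect n (\<lambda>P. of_bool (\<not> dist (X n P) 0 < \<epsilon> / L) :: real) < a / 2"
      by (rule order_tendstoD(2)) (use a in simp)
    then show "\<forall>\<^sub>F n in sequentially. expect n (\<lambda>P. of_bool (\<not> dist (X n P * Y n P) 0 < \<epsilon>)) < a"
      using L(2)
    proof eventually_elim
      case (elim n)
      have "expect n (\<lambda>P. of_bool (\<not> dist (X n P * Y n P) 0 < \<epsilon>) :: real)
          \<le> expect n (\<lambda>P. of_bool (\<not> dist (X n P) 0 < \<epsilon> / L) + of_bool (\<not> \<bar>Y n P\<bar> \<le> L))"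
      proof (rule expect_mono)
        fix P
        have "\<bar>X n P * Y n P\<bar> < \<epsilon>" if "\<bar>X n P\<bar> < \<epsilon> / L" "\<bar>Y n P\<bar> \<le> L"
        proof -
          have "\<bar>X n P\<bar> * \<bar>Y n P\<bar> \<le> \<bar>X n P\<bar> * L" using that by (intro mult_left_mono) auto
          also have "\<dots> < \<epsilon>" using that L(1) by (simp add: pos_less_divide_eq)
          finally show ?thesis by (simp add: abs_mult)
        qed
        then show "of_bool (\<not> dist (X n P * Y n P) 0 < \<epsilon>) \<le> (of_bool (\<not> dist (X n P) 0 < \<epsilon> / L) + of_bool (\<not> \<bar>Y n P\<bar> \<le> L) :: real)"
          by (auto simp: of_bool_def)
      qed
      then show ?case using elim by (simp add: expect_linear)
    qed
  qed
qed

text \<open>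
  The square of the centred score minus its quadratic variation loses the square of the drift at
  each step. The weight is a function of the partition at time \<open>m\<close>, so the division by the norming can
  be carried through.
\<close>

lemma score_supermartingale:
  assumes m: "1 \<le> m" "m \<le> n" and \<phi>: "\<And>R. R \<in> partitions_upto m \<Longrightarrow> \<phi> R \<ge> 0"
  shows "expect n (\<lambda>P. \<phi> (restrict_partition m P) * ((total_score P - compensator n)\<^sup>2 - total_info P))
     \<le> expect m (\<lambda>P. \<phi> P * ((total_score P - compensator m)\<^sup>2 - total_info P))"
  using m(2)
proof (induction n rule: dec_induct)
  case base
  show ?case by (rule expect_mono) (simp add: restrict_self)
next
  case (step n)
  have n: "n \<ge> 1" using m step by simp
  have "expect (Suc n) (\<lambda>P. \<phi> (restrict_partition m P) * ((total_score P - compensator (Suc n))\<^sup>2 - total_info P))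
    \<le> expect n (\<lambda>P. \<phi> (restrict_partition m P) * ((total_score P - compensator n)\<^sup>2 - total_info P))"
    unfolding expect_Suc[OF n]
  proof (rule expect_mono)
    fix P assume P: "P \<in> partitions_upto n"
    let ?d = "\<theta> / \<alpha> / (\<theta> + real n)" and ?a = "total_score P - compensator n"
    have comp: "compensator (Suc n) = compensator n + ?d"
      using n by (simp add: compensator_def)
    have "step n (\<lambda>P. \<phi> (restrict_partition m P) * ((total_score P - compensator (Suc n))\<^sup>2 - total_info P)) P
      = step n (\<lambda>Q. \<phi> (restrict_partition m P) *\<^sub>R ((total_score Q - compensator (Suc n))\<^sup>2 - total_info Q)) P"
      using step_restrict[OF P step.hyps(1), of "\<lambda>R Q. \<phi> R * ((total_score Q - compensator (Suc n))\<^sup>2 - total_info Q)"] by simp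
    also have "\<dots> = \<phi> (restrict_partition m P) * (step n (\<lambda>Q. (total_score Q - compensator (Suc n))\<^sup>2) P - step n total_info P)"
      unfolding step_linear by simp
    also have "step n (\<lambda>Q. (total_score Q - compensator (Suc n))\<^sup>2) P = (?a - ?d)\<^sup>2 + 2 * (?a - ?d) * ?d + (step n total_info P - total_info P)"
      using step_square[OF n P, of total_score "compensator (Suc n)"]
      unfolding step_score_increment_square[OF n P] step_total_score[OF n P] comp by (simp add: algebra_simps)
    also have "(?a - ?d)\<^sup>2 + 2 * (?a - ?d) * ?d = ?a\<^sup>2 - ?d\<^sup>2"
      by (simp add: power2_eq_square algebra_simps)
    also have "\<phi> (restrict_partition m P) * (?a\<^sup>2 - ?d\<^sup>2 + (step n total_info P - total_info P) - step n total_info P)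
        \<le> \<phi> (restrict_partition m P) * (?a\<^sup>2 - total_info P)"
      using \<phi>[OF restrict_in[OF P step.hyps(1)]] by (intro mult_left_mono) auto
    finally show "step n (\<lambda>P. \<phi> (restrict_partition m P) * ((total_score P - compensator (Suc n))\<^sup>2 - total_info P)) P
        \<le> \<phi> (restrict_partition m P) * (?a\<^sup>2 - total_info P)" .
  qed
  then show ?case using step.IH by linarith
qed

text \<open>
  Second moments: the supermartingale inequality reduces the square of the score, divided by the
  norming, to its value at the burn-in time and to the information, and the latter is at most a multiple of
  the number of blocks.
\<close>

lemma tight_score: "tight_in_prob (\<lambda>n P. total_score P / sqrt (norming n P))"
proof -
  obtain D where D: "D > 0" "\<And>m n. 1 \<le> m \<Longrightarrow> 1 \<le> n \<Longrightarrow> (\<Sum>k = m..<n. \<bar>\<theta> / \<alpha> / (\<theta> + real k)\<bar>) \<le> D * (1 + ln (real n))"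
    using sum_inverse_denominator by blast
  obtain k where k: "k > 0" "\<And>n P. n \<ge> 1 \<Longrightarrow> P \<in> partitions_upto n \<Longrightarrow> real (card P) \<le> k * shifted_count P"
    using card_le_shifted by auto
  define W where "W = (\<Sum>i. 1 / (real i - \<alpha>)\<^sup>2)"
  have W: "W \<ge> 0"
    unfolding W_def by (rule suminf_nonneg[OF summable_inverse_square[OF alpha_pos alpha_less_1]]) simp
  have comp: "\<bar>compensator j\<bar> \<le> D * (1 + ln (real n))" if "1 \<le> j" "j \<le> n" for j n
  proof -
    have "\<bar>compensator j\<bar> \<le> (\<Sum>k = 1..<j. \<bar>\<theta> / \<alpha> / (\<theta> + real k)\<bar>)"
      unfolding compensator_def by (rule sum_abs)
    also have "\<dots> \<le> D * (1 + ln (real j))" using D(2)[of 1 j] that by simp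
    also have "\<dots> \<le> D * (1 + ln (real n))" using that D(1) by (intro mult_left_mono) auto
    finally show ?thesis .
  qed
  define B where "B = jump_bound + D"
  have B: "B > 0" using jump_bound_pos D by (simp add: B_def)
  define x0 where "x0 = 1 + \<theta> / \<alpha>"
  have x0: "x0 > 0" using min_shifted_pos by (simp add: x0_def)
  \<comment> \<open>The second moment of the ratio controls its mean, since \<open>r \<le> (r - 1)\<^sup>2 + 2\<close>.\<close>
  have ratio: "\<forall>\<^sub>F n in sequentially. expect n (\<lambda>P. shifted_count P / predicted_count n P) \<le> 1 / x0 + 2"
    using eventually_ge_at_top[of 1]
  proof eventually_elim
    case (elim n)
    note b = burn_in_bounds[OF elim]
    have "expect n (\<lambda>P. shifted_count P / predicted_count n P) \<le> expect n (\<lambda>P. (count_ratio (burn_in n) n P - 1)\<^sup>2 + 2)"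
    proof (rule expect_mono)
      fix P
      have eq: "shifted_count P / predicted_count n P = count_ratio (burn_in n) n P"
        by (simp add: predicted_count_def count_ratio_def)
      have "0 \<le> (count_ratio (burn_in n) n P - 3 / 2)\<^sup>2" by simp
      then show "shifted_count P / predicted_count n P \<le> (count_ratio (burn_in n) n P - 1)\<^sup>2 + 2"
        unfolding eq by (simp add: power2_eq_square algebra_simps)
    qed
    also have "\<dots> = expect n (\<lambda>P. (count_ratio (burn_in n) n P - 1)\<^sup>2) + 2"
      using expect_const[OF elim, of "2::real"] by (simp add: expect_linear)
    also have "\<dots> \<le> expect (burn_in n) (\<lambda>P. 1 / shifted_count P) + 2"
      using count_ratio_deviation[OF b(1) b(3)] by simp
    also have "expect (burn_in n) (\<lambda>P. 1 / shifted_count P) \<le> expect (burn_in n) (\<lambda>P. 1 / x0)"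
      by (rule expect_mono, rule divide_left_mono) (use shifted_count_ge[OF b(1)] x0 in \<open>auto simp: x0_def\<close>)
    also have "\<dots> = 1 / x0" by (rule expect_const[OF b(1)])
    finally show ?case by simp
  qed
  define C where "C = 2 * (1 + W * k / tail_info \<alpha> * (1 / x0 + 2) + 1)"
  show ?thesis
  proof (rule tight_in_probI)
    show "\<forall>\<^sub>F n in sequentially. expect n (\<lambda>P. (total_score P / sqrt (norming n P))\<^sup>2) \<le> C"
      using norming_large[of "1 / B", OF divide_pos_pos[OF zero_less_one B]] ratio eventually_ge_at_top[of 1]
    proof eventually_elim
      case (elim n)
      note b = burn_in_bounds[OF elim(3)]
      let ?R = "restrict_partition (burn_in n)"
      define \<phi> where "\<phi> Q = 1 / (tail_info \<alpha> * (shifted_count Q * (growth n / growth (burn_in n))))" for Q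
      have \<phi>R: "\<phi> (?R P) = 1 / norming n P" for P
        by (simp add: \<phi>_def norming_def predicted_count_def)
      have \<phi>: "\<phi> Q \<ge> 0" if "Q \<in> partitions_upto (burn_in n)" for Q
        unfolding \<phi>_def using shifted_count_ge(2)[OF b(1) that] tail_info_pos growth_pos(1)[of n] growth_pos(1)[of "burn_in n"]
        by (intro divide_nonneg_nonneg mult_nonneg_nonneg) auto
      have z: "v\<^sup>2 / norming n P \<le> 1" if "P \<in> partitions_upto n" "\<bar>v\<bar> \<le> B * (1 + ln (real n))" for P v
      proof -
        have pos: "norming n P > 0" and lt: "(1 + ln (real n)) / sqrt (norming n P) < 1 / B"
          using elim(1) that(1) by auto
        have "B * (1 + ln (real n)) < sqrt (norming n P)"
          using lt pos B by (simp add: field_simps)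
        then have "\<bar>v\<bar>\<^sup>2 \<le> (sqrt (norming n P))\<^sup>2"
          using that(2) by (intro power_mono) auto
        then show ?thesis using pos by simp
      qed
      have "expect n (\<lambda>P. \<phi> (?R P) * ((total_score P - compensator n)\<^sup>2 - total_info P))
          \<le> expect (burn_in n) (\<lambda>P. \<phi> P * ((total_score P - compensator (burn_in n))\<^sup>2 - total_info P))"
        by (rule score_supermartingale[OF b(1) b(3), of \<phi>, OF \<phi>])
      also have "\<dots> \<le> expect (burn_in n) (\<lambda>P. \<phi> P * (total_score P - compensator (burn_in n))\<^sup>2)"
        by (rule expect_mono) (use crude_bounds(3) \<phi> in \<open>auto intro!: mult_left_mono\<close>)
      also have "\<dots> = expect n (\<lambda>P. \<phi> (?R P) * (total_score (?R P) - compensator (burn_in n))\<^sup>2)"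
        using expect_restrict[OF b(1) b(3), of "\<lambda>Q. \<phi> Q * (total_score Q - compensator (burn_in n))\<^sup>2"] by (rule sym)
      also have "\<dots> \<le> expect n (\<lambda>P. 1)"
      proof (rule expect_mono)
        fix P assume P: "P \<in> partitions_upto n"
        have "\<bar>total_score (?R P)\<bar> \<le> jump_bound * real (burn_in n)"
          by (rule crude_bounds(1)[OF restrict_in[OF P b(3)]])
        also have "\<dots> \<le> jump_bound * (1 + ln (real n))"
          using b(2) jump_bound_pos by (intro mult_left_mono) auto
        finally have "\<bar>total_score (?R P) - compensator (burn_in n)\<bar> \<le> B * (1 + ln (real n))"
          using comp[OF b(1) b(3)] unfolding B_def distrib_right by linarith
        from z[OF P this] show "\<phi> (?R P) * (total_score (?R P) - compensator (burn_in n))\<^sup>2 \<le> 1"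
          unfolding \<phi>R by simp
      qed
      also have "\<dots> = 1" by (rule expect_const[OF elim(3)])
      finally have 1: "expect n (\<lambda>P. \<phi> (?R P) * ((total_score P - compensator n)\<^sup>2 - total_info P)) \<le> 1" .
      have "expect n (\<lambda>P. (total_score P / sqrt (norming n P))\<^sup>2)
        \<le> expect n (\<lambda>P. 2 * (\<phi> (?R P) * ((total_score P - compensator n)\<^sup>2 - total_info P) + W * k / tail_info \<alpha> * (shifted_count P / predicted_count n P) + 1))"
      proof (rule expect_mono)
        fix P assume P: "P \<in> partitions_upto n"
        let ?N = "norming n P"
        have pos: "?N > 0" using elim(1) P by auto
        have "\<bar>compensator n\<bar> \<le> D * (1 + ln (real n))"
          using comp[OF elim(3) order_refl] .
        also have "\<dots> \<le> B * (1 + ln (real n))"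
          using elim(3) jump_bound_pos by (intro mult_right_mono) (auto simp: B_def)
        finally have c1: "(compensator n)\<^sup>2 / ?N \<le> 1"
          by (rule z[OF P])
        have "total_info P \<le> W * (k * shifted_count P)"
          using total_info_le_card[OF P] mult_left_mono[OF k(2)[OF elim(3) P] W] by (simp add: W_def)
        then have "total_info P / ?N \<le> W * (k * shifted_count P) / ?N"
          using pos by (intro divide_right_mono) auto
        then have J: "total_info P / ?N \<le> W * k / tail_info \<alpha> * (shifted_count P / predicted_count n P)"
          by (simp add: norming_def mult.assoc)
        have "0 \<le> (total_score P - 2 * compensator n)\<^sup>2" by simp
        then have "(total_score P)\<^sup>2 \<le> 2 * ((total_score P - compensator n)\<^sup>2 + (compensator n)\<^sup>2)"
          by (simp add: power2_eq_square algebra_simps)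
        then have "(total_score P)\<^sup>2 / ?N \<le> 2 * ((total_score P - compensator n)\<^sup>2 + (compensator n)\<^sup>2) / ?N"
          using pos by (intro divide_right_mono) auto
        also have "\<dots> = 2 * ((total_score P - compensator n)\<^sup>2 / ?N - total_info P / ?N + total_info P / ?N + (compensator n)\<^sup>2 / ?N)"
          by (simp add: add_divide_distrib)
        also have "\<dots> \<le> 2 * ((total_score P - compensator n)\<^sup>2 / ?N - total_info P / ?N + W * k / tail_info \<alpha> * (shifted_count P / predicted_count n P) + 1)"
          using c1 J by (intro mult_left_mono add_mono order_refl) auto
        finally show "(total_score P / sqrt ?N)\<^sup>2 \<le> 2 * (\<phi> (?R P) * ((total_score P - compensator n)\<^sup>2 - total_info P) + W * k / tail_info \<alpha> * (shifted_count P / predicted_count n P) + 1)"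
          using pos unfolding \<phi>R by (simp add: power_divide diff_divide_distrib)
      qed
      also have "\<dots> = 2 * (expect n (\<lambda>P. \<phi> (?R P) * ((total_score P - compensator n)\<^sup>2 - total_info P))
          + W * k / tail_info \<alpha> * expect n (\<lambda>P. shifted_count P / predicted_count n P) + 1)"
        unfolding expect_mult(1) expect_linear expect_const[OF elim(3)] ..
      also have "\<dots> \<le> 2 * (1 + W * k / tail_info \<alpha> * (1 / x0 + 2) + 1)"
        using 1 elim(2) W k(1) tail_info_pos by (intro mult_left_mono add_mono) auto
      finally show ?case by (simp add: C_def)
    qed
  qed
qed

end

section \<open>The likelihood equations\<close>

text \<open>
  Minus the derivative in \<open>x\<close> of the part of the log-likelihood that depends on the block sizes.
\<close>

definition inner_sum :: "real \<Rightarrow> nat set set \<Rightarrow> real" where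
  "inner_sum x = block_sum (\<lambda>u. \<Sum>i = 1..u - 1. 1 / (real i - x))"

lemma sum_blocks_of_size:
  assumes "P \<in> partitions_upto n" "f 1 = 0"
  shows "(\<Sum>j = 2..n. real (blocks_of_size P j) * f j) = block_sum f P"
proof -
  note P = partitions_uptoD[OF assms(1)]
  have img: "card ` P \<subseteq> {1..n}"
    using P(6) block_size_le[OF assms(1)] by auto
  have "block_sum f P = (\<Sum>j = 1..n. \<Sum>U\<in>{U \<in> P. card U = j}. f (card U))"
    unfolding block_sum_def by (rule sum.group[OF P(1) _ img, symmetric]) simp
  also have "\<dots> = (\<Sum>j = 1..n. real (blocks_of_size P j) * f j)"
    by (intro sum.cong) (auto simp: blocks_of_size_def)
  also have "\<dots> = (\<Sum>j = 2..n. real (blocks_of_size P j) * f j)"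
    by (rule sum.mono_neutral_right) (use assms(2) in \<open>auto simp: not_le numeral_2_eq_2 less_Suc_eq_le dest: le_antisym\<close>)
  finally show ?thesis by simp
qed

lemma log_likelihood_eq:
  assumes "P \<in> partitions_upto n"
  shows "log_likelihood n P x y = (\<Sum>i = 1..card P - 1. ln (y + real i * x)) - (\<Sum>i = 1..n - 1. ln (y + real i))
     + block_sum (\<lambda>u. \<Sum>i = 1..u - 1. ln (real i - x)) P"
  unfolding log_likelihood_def by (subst sum_blocks_of_size[OF assms]) auto

lemma arguments_pos:
  assumes "0 \<le> x" "x < 1" "y > - x" "i \<ge> 1"
  shows "y + real i * x > 0" "y + real i > 0" "real i - x > 0"
proof -
  have "1 * x \<le> real i * x" using assms by (intro mult_right_mono) auto
  then show "y + real i * x > 0" using assms by linarith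
  have "real i \<ge> 1" using assms by simp
  then show "y + real i > 0" "real i - x > 0" using assms by auto
qed

lemma log_likelihood_deriv_x:
  assumes "P \<in> partitions_upto n" "0 \<le> x" "x < 1" "y > - x"
  shows "((\<lambda>x. log_likelihood n P x y) has_real_derivative
     (\<Sum>i = 1..card P - 1. real i / (y + real i * x)) - inner_sum x P) (at x)"
  unfolding log_likelihood_eq[OF assms(1)]
proof -
  have A: "((\<lambda>x. \<Sum>U\<in>P. \<Sum>i = 1..card U - 1. ln (real i - x)) has_real_derivative
      (\<Sum>U\<in>P. \<Sum>i = 1..card U - 1. - (1 / (real i - x)))) (at x)"
    by (intro DERIV_sum, rule derivative_eq_intros refl) (use arguments_pos[OF assms(2-4)] in \<open>auto intro!: derivative_eq_intros simp: divide_inverse\<close>)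
  have B: "((\<lambda>x. \<Sum>i = 1..card P - 1. ln (y + real i * x)) has_real_derivative
      (\<Sum>i = 1..card P - 1. real i / (y + real i * x))) (at x)"
    by (intro DERIV_sum, rule derivative_eq_intros refl) (use arguments_pos[OF assms(2-4)] in \<open>auto intro!: derivative_eq_intros simp: divide_inverse\<close>)
  show "((\<lambda>x. (\<Sum>i = 1..card P - 1. ln (y + real i * x)) - (\<Sum>i = 1..n - 1. ln (y + real i))
     + block_sum (\<lambda>u. \<Sum>i = 1..u - 1. ln (real i - x)) P) has_real_derivative
     (\<Sum>i = 1..card P - 1. real i / (y + real i * x)) - inner_sum x P) (at x)"
    unfolding block_sum_def inner_sum_def
    by (rule DERIV_cong[OF DERIV_add[OF DERIV_diff[OF B DERIV_const] A]]) (simp add: sum_negf)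
qed

lemma log_likelihood_deriv_y:
  assumes "P \<in> partitions_upto n" "0 \<le> x" "x < 1" "y > - x"
  shows "((\<lambda>y. log_likelihood n P x y) has_real_derivative
     (\<Sum>i = 1..card P - 1. 1 / (y + real i * x)) - (\<Sum>i = 1..n - 1. 1 / (y + real i))) (at y)"
  unfolding log_likelihood_eq[OF assms(1)]
proof -
  have A: "((\<lambda>y. \<Sum>i = 1..card P - 1. ln (y + real i * x)) has_real_derivative
      (\<Sum>i = 1..card P - 1. 1 / (y + real i * x))) (at y)"
    by (intro DERIV_sum, rule derivative_eq_intros refl) (use arguments_pos[OF assms(2-4)] in \<open>auto intro!: derivative_eq_intros simp: divide_inverse\<close>)
  have B: "((\<lambda>y. \<Sum>i = 1..n - 1. ln (y + real i)) has_real_derivative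
      (\<Sum>i = 1..n - 1. 1 / (y + real i))) (at y)"
    by (intro DERIV_sum, rule derivative_eq_intros refl) (use arguments_pos[OF assms(2-4)] in \<open>auto intro!: derivative_eq_intros simp: divide_inverse\<close>)
  show "((\<lambda>y. (\<Sum>i = 1..card P - 1. ln (y + real i * x)) - (\<Sum>i = 1..n - 1. ln (y + real i))
     + block_sum (\<lambda>u. \<Sum>i = 1..u - 1. ln (real i - x)) P) has_real_derivative
     (\<Sum>i = 1..card P - 1. 1 / (y + real i * x)) - (\<Sum>i = 1..n - 1. 1 / (y + real i))) (at y)"
    by (rule DERIV_cong[OF DERIV_add[OF DERIV_diff[OF A B] DERIV_const]]) simp
qed

lemma critical_equation_y:
  assumes "P \<in> partitions_upto n" "0 \<le> x" "x < 1" "y > - x"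
    and max: "\<And>y'. y' > - x \<Longrightarrow> log_likelihood n P x y' \<le> log_likelihood n P x y"
  shows "(\<Sum>i = 1..card P - 1. 1 / (y + real i * x)) = (\<Sum>i = 1..n - 1. 1 / (y + real i))"
proof -
  have "(\<Sum>i = 1..card P - 1. 1 / (y + real i * x)) - (\<Sum>i = 1..n - 1. 1 / (y + real i)) = 0"
    by (rule DERIV_local_max[OF log_likelihood_deriv_y[OF assms(1-4)], of "y + x"]) (use assms(4) max in auto)
  then show ?thesis by simp
qed

lemma critical_equation_x:
  assumes "P \<in> partitions_upto n" "0 < x" "x < 1" "y > - x"
    and max: "\<And>x'. 0 < x' \<Longrightarrow> x' < 1 \<Longrightarrow> y > - x' \<Longrightarrow> log_likelihood n P x' y \<le> log_likelihood n P x y"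
  shows "(\<Sum>i = 1..card P - 1. real i / (y + real i * x)) = inner_sum x P"
proof -
  have "(\<Sum>i = 1..card P - 1. real i / (y + real i * x)) - inner_sum x P = 0"
    by (rule DERIV_local_max[OF log_likelihood_deriv_x[OF assms(1) _ assms(3,4)], of "min x (min (1 - x) (y + x))"])
       (use assms(2-4) in \<open>auto intro!: max\<close>)
  then show ?thesis by simp
qed

text \<open>
  Each summand is \<open>(y + i * x) / (y + i * x)\<close>. Inserting the two likelihood equations on the left turns
  this identity into \<open>x * score(x) = 1 + y * (\<Sum>i. 1 / (y + i))\<close>.
\<close>

lemma combined_equation:
  assumes "0 \<le> x" "x < 1" "y > - x"
  shows "y * (\<Sum>i = 1..k. 1 / (y + real i * x)) + x * (\<Sum>i = 1..k. real i / (y + real i * x)) = real k"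
proof -
  have "y * (1 / (y + real i * x)) + x * (real i / (y + real i * x)) = 1" if "i \<in> {1..k}" for i
  proof -
    have "y + real i * x > 0" using arguments_pos(1)[OF assms, of i] that by simp
    moreover have "y * (1 / (y + real i * x)) + x * (real i / (y + real i * x)) = (y + real i * x) / (y + real i * x)"
      by (simp only: times_divide_eq_right mult_1_right mult.commute[of x] add_divide_distrib)
    ultimately show ?thesis by simp
  qed
  then have "(\<Sum>i = 1..k. y * (1 / (y + real i * x)) + x * (real i / (y + real i * x))) = (\<Sum>i = 1..k. 1)"
    by (rule sum.cong[OF refl])
  then show ?thesis
    unfolding sum_distrib_left sum.distrib by simp
qed

section \<open>Existence of a maximizer on the closed parameter range\<close>

text \<open>
  Cancelling the factors \<open>y + i * x\<close> against \<open>y + i\<close> and estimating harmless factors by \<open>n\<close> leaves four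
  logarithms that detect the boundary. The coefficient two of \<open>ln (1 - x)\<close>, which needs two blocks with at
  least two elements, outweighs \<open>- ln (y + 1)\<close>, the only term that can grow as \<open>y\<close> tends to \<open>- 1\<close>.
\<close>

lemma log_likelihood_upper:
  assumes P: "P \<in> partitions_upto n" and K: "card P \<ge> 2" "card P < n"
    and N: "card {U \<in> P. card U \<ge> 2} \<ge> 2" and xy: "0 \<le> x" "x < 1" "y > - x"
  shows "log_likelihood n P x y \<le> real n * ln (real n) + 2 * ln (1 - x) + ln (y + x) - ln (y + 1) - ln (y + real (n - 1))"
proof -
  define k where "k = card P - 1"
  define m where "m = n - 1"
  have km: "1 \<le> k" "k < m" using K by (auto simp: k_def m_def)
  note pos = arguments_pos[OF xy]
  have 1: "(\<Sum>i = 1..k. ln (y + real i * x)) \<le> ln (y + x) + (\<Sum>i = 2..k. ln (y + real i))"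
  proof -
    have "(\<Sum>i = 1..k. ln (y + real i * x)) = ln (y + x) + (\<Sum>i = 2..k. ln (y + real i * x))"
      using km by (simp add: sum.atLeast_Suc_atMost numeral_2_eq_2)
    moreover have "(\<Sum>i = 2..k. ln (y + real i * x)) \<le> (\<Sum>i = 2..k. ln (y + real i))"
    proof (rule sum_mono)
      fix i assume "i \<in> {2..k}"
      then have i: "i \<ge> 1" by simp
      have "real i * x \<le> real i * 1" using xy by (intro mult_left_mono) auto
      then show "ln (y + real i * x) \<le> ln (y + real i)" using pos[OF i] by simp
    qed
    ultimately show ?thesis by simp
  qed
  have 2: "(\<Sum>i = 1..m. ln (y + real i)) \<ge> ln (y + 1) + (\<Sum>i = 2..k. ln (y + real i)) + ln (y + real m)"
  proof -
    have "(\<Sum>i = 1..m. ln (y + real i)) = ln (y + 1) + (\<Sum>i = 2..m. ln (y + real i))"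
      using km by (simp add: sum.atLeast_Suc_atMost numeral_2_eq_2)
    moreover have "(\<Sum>i = 2..m. ln (y + real i)) = (\<Sum>i\<in>insert m {2..k}. ln (y + real i)) + (\<Sum>i\<in>{2..m} - insert m {2..k}. ln (y + real i))"
      by (rule sum.subset_diff[THEN trans, OF _ _ add.commute]) (use km in auto)
    moreover have "(\<Sum>i\<in>insert m {2..k}. ln (y + real i)) = ln (y + real m) + (\<Sum>i = 2..k. ln (y + real i))"
      using km by simp
    moreover have "0 \<le> (\<Sum>i\<in>{2..m} - insert m {2..k}. ln (y + real i))"
      by (rule sum_nonneg) (use xy in auto)
    ultimately show ?thesis by linarith
  qed
  have 3: "block_sum (\<lambda>u. \<Sum>i = 1..u - 1. ln (real i - x)) P \<le> real n * ln (real n) + 2 * ln (1 - x)"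
  proof -
    have n: "n \<ge> 1" using K by simp
    have "block_sum (\<lambda>u. \<Sum>i = 1..u - 1. ln (real i - x)) P
        \<le> (\<Sum>U\<in>P. of_bool (card U \<ge> 2) * ln (1 - x) + real (card U) * ln (real n))"
      unfolding block_sum_def
    proof (rule sum_mono)
      fix U assume U: "U \<in> P"
      let ?u = "card U"
      have u: "?u \<ge> 1" "?u \<le> n"
        using partitions_uptoD(6)[OF P U] block_size_le[OF P U] by auto
      show "(\<Sum>i = 1..?u - 1. ln (real i - x)) \<le> of_bool (?u \<ge> 2) * ln (1 - x) + real ?u * ln (real n)"
      proof (cases "?u \<ge> 2")
        case True
        then have "(\<Sum>i = 1..?u - 1. ln (real i - x)) = ln (1 - x) + (\<Sum>i = 2..?u - 1. ln (real i - x))"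
          by (simp add: sum.atLeast_Suc_atMost numeral_2_eq_2)
        also have "(\<Sum>i = 2..?u - 1. ln (real i - x)) \<le> (\<Sum>i = 2..?u - 1. ln (real n))"
          using pos(3) xy u by (intro sum_mono) auto
        also have "\<dots> = real (?u - 2) * ln (real n)" by (simp add: numeral_2_eq_2)
        also have "\<dots> \<le> real ?u * ln (real n)" using n by (intro mult_right_mono) auto
        finally show ?thesis using True by simp
      next
        case False
        then have "?u = 1" using u by simp
        then show ?thesis using n by simp
      qed
    qed
    also have "\<dots> = real (card {U \<in> P. card U \<ge> 2}) * ln (1 - x) + real n * ln (real n)"
      using sum_card_blocks[OF P] partitions_uptoD(1)[OF P]
      by (simp add: sum.distrib flip: sum_distrib_right of_nat_sum) (simp add: Int_def)
    also have "real (card {U \<in> P. card U \<ge> 2}) * ln (1 - x) \<le> 2 * ln (1 - x)"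
      using N xy by (intro mult_right_mono_neg) auto
    finally show ?thesis by simp
  qed
  show ?thesis
    unfolding log_likelihood_eq[OF P] k_def[symmetric] m_def[symmetric] using 1 2 3 by linarith
qed

text \<open>
  By the upper bound the parameters at which the likelihood is at least its value at \<open>(1 / 2, 0)\<close> lie
  in a compact subset of the range: bounded \<open>y\<close>, and \<open>1 - x\<close> and \<open>y + x\<close> bounded away from zero.
\<close>

lemma extended_maximizer_exists:
  assumes P: "P \<in> partitions_upto n" and K: "card P \<ge> 2" "card P < n"
    and N: "card {U \<in> P. card U \<ge> 2} \<ge> 2"
  shows "\<exists>x y. 0 \<le> x \<and> x < 1 \<and> y > - x \<and>
    (\<forall>x' y'. 0 \<le> x' \<longrightarrow> x' < 1 \<longrightarrow> y' > - x' \<longrightarrow> log_likelihood n P x' y' \<le> log_likelihood n P x y)"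
proof -
  define v where "v = log_likelihood n P (1 / 2) 0"
  \<comment> \<open>\<open>A\<close> and \<open>d\<close> are read off from the upper bound by exponentiating: any parameter at least as good as \<open>(1 / 2, 0)\<close> has \<open>y \<le> A\<close> and \<open>1 - x\<close>, \<open>y + x\<close> at least \<open>d\<close>.\<close>
  define A where "A = exp (real n * ln (real n) - v)"
  define d where "d = exp (v - real n * ln (real n))"
  have d: "d > 0" by (simp add: d_def)
  define C where "C = ({0..1 - d} \<times> {- 1..A}) \<inter> {q::real \<times> real. d \<le> snd q + fst q}"
  have "compact C"
    unfolding C_def by (intro compact_Int_closed compact_Times compact_Icc closed_Collect_le continuous_intros)
  have inC: "(x, y) \<in> C" if xy: "0 \<le> x" "x < 1" "y > - x" and v: "v \<le> log_likelihood n P x y" for x y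
  proof -
    have le: "v - real n * ln (real n) \<le> 2 * ln (1 - x) + ln (y + x) - ln (y + 1) - ln (y + real (n - 1))"
      using v log_likelihood_upper[OF P K N xy] by linarith
    have m: "real (n - 1) \<ge> 2" using K by simp
    have l: "ln (1 - x) \<le> 0" "ln (y + x) \<le> ln (y + 1)" "ln (1 - x) \<le> ln (y + 1)" "ln (y + x) \<le> ln (y + real (n - 1))" "ln (y + real (n - 1)) \<ge> 0"
      using xy m by auto
    have "ln (y + real (n - 1)) \<le> real n * ln (real n) - v" using le l by linarith
    then have "y + real (n - 1) \<le> A"
      unfolding A_def using xy m exp_le_cancel_iff[of "ln (y + real (n - 1))"] by (simp del: exp_le_cancel_iff)
    moreover have "v - real n * ln (real n) \<le> ln (1 - x)" using le l by linarith
    then have "d \<le> 1 - x"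
      unfolding d_def using xy exp_le_cancel_iff[of _ "ln (1 - x)"] by (simp del: exp_le_cancel_iff)
    moreover have "v - real n * ln (real n) \<le> ln (y + x)" using le l by linarith
    then have "d \<le> y + x"
      unfolding d_def using xy exp_le_cancel_iff[of _ "ln (y + x)"] by (simp del: exp_le_cancel_iff)
    ultimately show ?thesis using xy m by (simp add: C_def)
  qed
  have C_pos: "0 \<le> x \<and> x < 1 \<and> y > - x" if "(x, y) \<in> C" for x y
    using that d by (auto simp: C_def)
  have cont: "continuous_on C (\<lambda>q. log_likelihood n P (fst q) (snd q))"
    unfolding log_likelihood_eq[OF P] block_sum_def
    by (intro continuous_intros ballI)
       (use arguments_pos C_pos in \<open>force dest: less_imp_neq[symmetric]\<close>)+
  have q0: "(1 / 2, 0) \<in> C"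
    by (rule inC) (auto simp: v_def)
  then have "C \<noteq> {}" by auto
  from continuous_attains_sup[OF \<open>compact C\<close> this cont]
  obtain q where q: "q \<in> C" "\<And>q'. q' \<in> C \<Longrightarrow> log_likelihood n P (fst q') (snd q') \<le> log_likelihood n P (fst q) (snd q)"
    by auto
  have "log_likelihood n P x' y' \<le> log_likelihood n P (fst q) (snd q)" if "0 \<le> x'" "x' < 1" "y' > - x'" for x' y'
  proof (cases "v \<le> log_likelihood n P x' y'")
    case True
    then show ?thesis using q(2)[OF inC[OF that True]] by simp
  next
    case False
    then show ?thesis using q(2)[OF q0] by (simp add: v_def)
  qed
  then show ?thesis
    using C_pos[of "fst q" "snd q"] q(1) by (intro exI[of _ "fst q"] exI[of _ "snd q"]) auto
qed

section \<open>Monotonicity of the score\<close>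

lemma score_eq:
  assumes "u \<ge> 1" "x \<noteq> 0"
  shows "score x u = 1 / x - (\<Sum>i = 1..u - 1. 1 / (real i - x))"
proof -
  obtain k where k: "u = Suc k" using assms(1) not0_implies_Suc[of u] by auto
  have "(\<Sum>i<Suc k. 1 / (real i - x)) = 1 / (0 - x) + (\<Sum>i = 1..k. 1 / (real i - x))"
    unfolding sum.lessThan_Suc_shift by (simp add: sum.atLeast1_atMost_eq)
  then show ?thesis by (simp add: score_def k)
qed

lemma block_sum_score:
  assumes "P \<in> partitions_upto n" "x \<noteq> 0"
  shows "x * block_sum (score x) P = real (card P) - x * inner_sum x P"
proof -
  have "block_sum (score x) P = block_sum (\<lambda>u. 1 / x - (\<Sum>i = 1..u - 1. 1 / (real i - x))) P"
    unfolding block_sum_def by (intro sum.cong refl score_eq partitions_uptoD(6)[OF assms(1)] assms(2))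
  also have "\<dots> = 1 / x * real (card P) - inner_sum x P"
    unfolding block_sum_simps inner_sum_def ..
  finally show ?thesis
    using assms(2) by (simp add: right_diff_distrib)
qed

lemma inner_sum_mono:
  assumes "0 \<le> x" "x \<le> x'" "x' < 1"
  shows "inner_sum x P \<le> inner_sum x' P" "0 \<le> inner_sum x P"
  unfolding inner_sum_def block_sum_def using assms
  by (auto intro!: sum_mono sum_nonneg divide_left_mono mult_pos_pos)

text \<open>
  The factor \<open>x\<close> removes the singularity of the score at zero, so this version of monotonicity is
  useful for parameters of any size, whereas \<open>score_slope\<close> is quantitative.
\<close>

lemma scaled_score_antimono:
  assumes "P \<in> partitions_upto n" "0 < x" "x \<le> x'" "x' < 1"
  shows "x' * block_sum (score x') P \<le> x * block_sum (score x) P"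
proof -
  have "x * inner_sum x P \<le> x' * inner_sum x' P"
    using assms inner_sum_mono[of x x'] inner_sum_mono(2)[of x x'] by (intro mult_mono) auto
  then show ?thesis
    using block_sum_score[OF assms(1), of x] block_sum_score[OF assms(1), of x'] assms by simp
qed

lemma score_slope:
  assumes "P \<in> partitions_upto n" "0 < x" "x \<le> x'" "x' < 1"
  shows "block_sum (score x') P + (x' - x) * real (card P) \<le> block_sum (score x) P"
proof -
  have "score x' u + (x' - x) \<le> score x u" if u: "u \<ge> 1" for u
  proof -
    have "(\<Sum>i = 1..u - 1. 1 / (real i - x)) \<le> (\<Sum>i = 1..u - 1. 1 / (real i - x'))"
      using assms by (auto intro!: sum_mono divide_left_mono mult_pos_pos)
    moreover have "x' - x \<le> 1 / x - 1 / x'"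
    proof -
      have "x * x' \<le> 1" using assms by (intro mult_le_one) auto
      then have "(x' - x) * 1 \<le> (x' - x) * (1 / (x * x'))"
        using assms by (intro mult_left_mono) auto
      also have "\<dots> = 1 / x - 1 / x'" using assms by (simp add: field_simps)
      finally show ?thesis by simp
    qed
    ultimately show ?thesis using score_eq[OF u, of x] score_eq[OF u, of x'] assms by simp
  qed
  then have "block_sum (\<lambda>u. score x' u + (x' - x)) P \<le> block_sum (score x) P"
    by (rule block_sum_mono[OF assms(1)])
  then show ?thesis by (simp only: block_sum_simps left_diff_distrib)
qed

section \<open>Logarithmic sums\<close>

lemma ln_difference_bounds:
  fixes a b :: real
  assumes "0 < a" "a < b"
  shows "(b - a) / b \<le> ln b - ln a" "ln b - ln a \<le> (b - a) / a"
  using ln_diff_le[of a b] ln_diff_le[of b a] assms by (auto simp: field_simps)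

lemma sum_inverse_ge_ln:
  assumes "y > -1" "n \<ge> 1"
  shows "ln (y + real n) - ln (y + 1) \<le> (\<Sum>i = 1..n - 1. 1 / (y + real i))"
  using assms(2)
proof (induction n rule: dec_induct)
  case base show ?case by simp
next
  case (step n)
  have "(\<Sum>i = 1..Suc n - 1. 1 / (y + real i)) = (\<Sum>i = 1..n - 1. 1 / (y + real i)) + 1 / (y + real n)"
    using step.hyps by (cases n) auto
  moreover have "ln (y + real n + 1) - ln (y + real n) \<le> 1 / (y + real n)"
    using ln_difference_bounds(2)[of "y + real n" "y + real n + 1"] assms(1) step.hyps by simp
  ultimately show ?case using step.IH by (simp add: add_ac)
qed

lemma sum_inverse_le_ln:
  assumes "y > 0" "x > 0"
  shows "x * (\<Sum>i = 1..k. 1 / (y + real i * x)) \<le> ln (y + real k * x) - ln y"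
proof (induction k)
  case (Suc k)
  have pos: "y + real k * x > 0" using assms by (intro add_pos_nonneg) auto
  have "x * (1 / (y + real (Suc k) * x)) \<le> ln (y + real (Suc k) * x) - ln (y + real k * x)"
    using ln_difference_bounds(1)[of "y + real k * x" "y + real (Suc k) * x"] pos assms by (simp add: algebra_simps)
  then show ?case using Suc by (simp add: distrib_left)
qed simp

lemma weighted_sum_inverse_mono:
  assumes "0 < y" "y \<le> y'"
  shows "y * (\<Sum>i = 1..k. 1 / (y + real i)) \<le> y' * (\<Sum>i = 1..k. 1 / (y' + real i))"
  unfolding sum_distrib_left
proof (rule sum_mono)
  fix i assume "i \<in> {1..k}"
  then have "y * (y' + real i) \<le> y' * (y + real i)"
    using assms by (simp add: algebra_simps mult_left_mono)
  then show "y * (1 / (y + real i)) \<le> y' * (1 / (y' + real i))"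
    using assms by (simp add: divide_le_eq le_divide_eq field_simps)
qed

lemma sum_inverse_upper:
  assumes "y \<ge> 0" "n \<ge> 1"
  shows "(\<Sum>i = 1..n - 1. 1 / (y + real i)) \<le> 1 + ln (real n)"
proof -
  have "(\<Sum>i = 1..n - 1. 1 / (y + real i)) \<le> (\<Sum>i = 1..n - 1. 1 / real i)"
    using assms by (intro sum_mono divide_left_mono) auto
  also have "\<dots> \<le> (\<Sum>i = 1..n. 1 / real i)"
    by (intro sum_mono2) auto
  also have "\<dots> \<le> 1 + ln (real n)" by (rule harm_upper[OF assms(2)])
  finally show ?thesis .
qed

section \<open>Location of the maximizers\<close>

text \<open>
  The inequalities between powers and logarithms of \<open>n\<close> that the location of the maximizer uses. They
  are collected so that the analysis of a single partition is free of limits. The exponents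
  \<open>a - \<delta> / 2\<close> and \<open>a + \<delta> / 2\<close> bound the number of blocks; \<open>a / 4\<close> is the bound on the score that
  will be reached, anything below \<open>a / 2\<close> being negligible against \<open>sqrt K\<close>.
\<close>

definition large_sample :: "real \<Rightarrow> real \<Rightarrow> nat \<Rightarrow> bool" where
  "large_sample a \<delta> n \<longleftrightarrow> n \<ge> 2 \<and>
     2 \<le> (1 - a) / 4 * real n powr (a - \<delta> / 2) \<and>
     8 / (1 - a) + ln (real n) + 1 \<le> real n powr (a / 4) \<and>
     real n powr (a / 4) < a * \<delta> / 4 * real n powr (a - \<delta> / 2) \<and>
     16 / a < ln (real n / (2 * real n powr (a + \<delta> / 2))) \<and>
     1 + exp (4 * ln 2 / (1 - a)) * real n powr (a - a * (1 - a) / 32) * (1 + ln (real n)) < a * \<delta> / 4 * real n powr (a - \<delta> / 2) \<and>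
     1 + exp (4 * ln 2 / (1 - a)) * real n powr (a / 8) * (1 + ln (real n)) \<le> real n powr (a / 4) \<and>
     real n powr (a + \<delta> / 2) < real n"

text \<open>
  All that is needed of the randomness: bounds for the number of blocks and for the score at the true
  parameter, and a positive share of blocks that are not singletons.
\<close>

definition typical_partition :: "real \<Rightarrow> real \<Rightarrow> nat \<Rightarrow> nat set set \<Rightarrow> bool" where
  "typical_partition a \<delta> n P \<longleftrightarrow> real n powr (a - \<delta> / 2) \<le> real (card P) \<and> real (card P) \<le> real n powr (a + \<delta> / 2) \<and>
     \<bar>block_sum (score a) P\<bar> \<le> \<delta> / 2 * real (card P) \<and> (1 - a) / 2 * real (card P) \<le> real (card {U \<in> P. card U \<ge> 2})"

lemma eventually_powr_ln_less:
  fixes p q C D :: real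
  assumes "p < q" "0 < q" "0 < D"
  shows "\<forall>\<^sub>F n in sequentially. 1 + C * real n powr p * (1 + ln (real n)) < D * real n powr q"
proof -
  have "(\<lambda>n. C * (real n powr (p - q) * (1 + ln (real n))) + real n powr (- q)) \<longlonglongrightarrow> C * 0 + 0"
  proof (intro tendsto_add tendsto_mult_left)
    have "p - q < 0" using assms by simp
    then show "(\<lambda>n. real n powr (p - q) * (1 + ln (real n))) \<longlonglongrightarrow> 0" by real_asymp
    show "(\<lambda>n. real n powr (- q)) \<longlonglongrightarrow> 0" using assms by real_asymp
  qed
  then have "\<forall>\<^sub>F n in sequentially. C * (real n powr (p - q) * (1 + ln (real n))) + real n powr (- q) < D"
    using assms by (intro order_tendstoD(2)) auto
  then show ?thesis
    using eventually_ge_at_top[of 1]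
  proof eventually_elim
    case (elim n)
    have n: "real n powr q > 0" using elim by simp
    have "(C * (real n powr (p - q) * (1 + ln (real n))) + real n powr (- q)) * real n powr q < D * real n powr q"
      using elim n by (intro mult_strict_right_mono) auto
    moreover have "real n powr (p - q) * real n powr q = real n powr p" "real n powr (- q) * real n powr q = 1"
      using elim by (simp_all flip: powr_add)
    moreover have "(C * (real n powr (p - q) * (1 + ln (real n))) + real n powr (- q)) * real n powr q
        = C * ((real n powr (p - q) * real n powr q) * (1 + ln (real n))) + real n powr (- q) * real n powr q"
      by (simp only: distrib_left distrib_right mult_ac)
    ultimately show ?case by (simp add: mult.assoc)
  qed
qed

lemma eventually_large_sample:
  assumes a: "0 < a" "a < 1" and d: "0 < \<delta>" "\<delta> \<le> a * (1 - a) / 64"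
  shows "\<forall>\<^sub>F n in sequentially. large_sample a \<delta> n"
proof -
  have aa: "0 < a * (1 - a)" "a * (1 - a) < a" "a * (1 - a) < 1 - a"
    using a mult_strict_left_mono[of "1 - a" 1 a] mult_strict_right_mono[of a 1 "1 - a"] by auto
  define p where "p = a - \<delta> / 2"
  define q where "q = a + \<delta> / 2"
  define r where "r = a - a * (1 - a) / 32"
  have p: "p > 0" "a / 4 < p" "r < p" "q < 1" "q > 0" and r: "a / 8 < a / 4" "0 < a / 4"
    using a aa d by (auto simp: p_def q_def r_def)
  have 1: "\<forall>\<^sub>F n in sequentially. 2 \<le> (1 - a) / 4 * real n powr p"
    using a p by real_asymp
  have 2: "\<forall>\<^sub>F n in sequentially. 8 / (1 - a) + ln (real n) + 1 \<le> real n powr (a / 4)"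
    using a by real_asymp
  have 3: "\<forall>\<^sub>F n in sequentially. 1 + 1 * real n powr (a / 4) * (1 + ln (real n)) < a * \<delta> / 4 * real n powr p"
    by (rule eventually_powr_ln_less) (use a d p in auto)
  have 4: "\<forall>\<^sub>F n in sequentially. 16 / a < ln (real n / (2 * real n powr q))"
    using p by real_asymp
  have 5: "\<forall>\<^sub>F n in sequentially. 1 + exp (4 * ln 2 / (1 - a)) * real n powr r * (1 + ln (real n)) < a * \<delta> / 4 * real n powr p"
    by (rule eventually_powr_ln_less) (use a d p in auto)
  have 6: "\<forall>\<^sub>F n in sequentially. 1 + exp (4 * ln 2 / (1 - a)) * real n powr (a / 8) * (1 + ln (real n)) < 1 * real n powr (a / 4)"
    by (rule eventually_powr_ln_less) (use r in auto)
  have 7: "\<forall>\<^sub>F n in sequentially. real n powr q < real n"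
    using p by real_asymp
  show ?thesis
    using 1 2 3 4 5 6 7 eventually_ge_at_top[of 2]
  proof eventually_elim
    case (elim n)
    have "0 \<le> ln (real n)" using elim(8) by simp
    then have "real n powr (a / 4) * 1 \<le> real n powr (a / 4) * (1 + ln (real n))"
      by (intro mult_left_mono) auto
    then have "real n powr (a / 4) < a * \<delta> / 4 * real n powr p"
      using elim(3) by simp
    then show ?case
      using elim unfolding large_sample_def p_def[symmetric] q_def[symmetric] r_def[symmetric] by simp
  qed
qed

text \<open>
  The function \<open>y * (\<Sum>i. 1 / (y + i))\<close> increases in \<open>y\<close>, and at \<open>a * K / 16\<close> it exceeds \<open>K\<close> because
  the sum is at least \<open>ln (n / (2 * K)) > 16 / a\<close>.
\<close>

lemma y_bound:
  assumes a: "0 < a" "a < 1" and K: "2 \<le> K" "K \<le> real n" and n: "16 / a < ln (real n / (2 * K))"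
    and y: "y > 0" "y * (\<Sum>i = 1..n - 1. 1 / (y + real i)) \<le> K"
  shows "y < a * K / 16"
proof (rule ccontr)
  assume "\<not> y < a * K / 16"
  define z where "z = a * K / 16"
  have aK: "a * K \<le> 1 * K" using a K by (intro mult_right_mono) auto
  have z: "0 < z" "z \<le> y"
    using \<open>\<not> y < a * K / 16\<close> a K by (auto simp: z_def)
  have z2: "z + 1 \<le> 2 * K"
    using aK K unfolding z_def by linarith
  have n1: "n \<ge> 1" using K by (cases n) auto
  have "real n / (2 * K) \<le> (z + real n) / (z + 1)"
    using z z2 K by (intro frac_le) auto
  then have "16 / a < ln ((z + real n) / (z + 1))"
    using n z K n1 by (smt (verit) divide_pos_pos ln_le_cancel_iff of_nat_0_less_iff)
  also have "\<dots> = ln (z + real n) - ln (z + 1)"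
    using z n1 by (simp add: ln_div)
  also have "\<dots> \<le> (\<Sum>i = 1..n - 1. 1 / (z + real i))"
    by (rule sum_inverse_ge_ln) (use z n1 in auto)
  finally have "z * (16 / a) < z * (\<Sum>i = 1..n - 1. 1 / (z + real i))"
    using z by (intro mult_strict_left_mono) auto
  also have "\<dots> \<le> y * (\<Sum>i = 1..n - 1. 1 / (y + real i))"
    by (rule weighted_sum_inverse_mono) (use z in auto)
  also have "\<dots> \<le> K" by (rule y)
  finally show False using a by (simp add: z_def)
qed

lemma sum_real_upto: "(\<Sum>i = 1..k. real i) = real k * (real k + 1) / 2"
  by (induction k) (auto simp: field_simps)

lemma typical_facts:
  assumes a: "0 < a" "a < 1" and d: "0 < \<delta>" "\<delta> \<le> a * (1 - a) / 64"
    and L: "large_sample a \<delta> n" and T: "typical_partition a \<delta> n P"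
  shows "8 \<le> real (card P)" "real (card P) < real n" "16 / a < ln (real n / (2 * real (card P)))"
    "8 / (1 - a) + ln (real n) + 1 \<le> real (card P)" "2 \<le> card {U \<in> P. card U \<ge> 2}"
    "(1 - a) / 4 * real (card P) \<le> real (card {U \<in> P. card U \<ge> 2}) - 1"
    "real n powr (a / 4) < a * \<delta> / 4 * real (card P)"
    "1 + exp (4 * ln 2 / (1 - a)) * real n powr (a - a * (1 - a) / 32) * (1 + ln (real n)) < a * \<delta> / 4 * real (card P)"
    "\<bar>block_sum (score a) P\<bar> \<le> \<delta> / 2 * real (card P)"
proof -
  let ?K = "real (card P)"
  have aa: "0 < a * (1 - a)" "a * (1 - a) < a" "a * (1 - a) < 1 - a"
    using a mult_strict_left_mono[of "1 - a" 1 a] mult_strict_right_mono[of a 1 "1 - a"] by auto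
  have lo: "real n powr (a - \<delta> / 2) \<le> ?K" and hi: "?K \<le> real n powr (a + \<delta> / 2)"
    using T by (auto simp: typical_partition_def)
  have two: "2 \<le> (1 - a) / 4 * ?K"
  proof (rule order_trans[OF _ mult_left_mono[OF lo]])
    show "2 \<le> (1 - a) / 4 * real n powr (a - \<delta> / 2)"
      using L unfolding large_sample_def by blast
  qed (use a in simp)
  have "(1 - a) / 4 * ?K \<le> 1 / 4 * ?K"
    using a by (intro mult_right_mono) auto
  then show K8: "8 \<le> ?K" using two by linarith
  show "?K < real n" using L hi by (auto simp: large_sample_def)
  have "real n / (2 * real n powr (a + \<delta> / 2)) \<le> real n / (2 * ?K)"
    using hi K8 order.strict_trans2[of 0 "real (card P)" "real n powr (a + \<delta> / 2)"] by (intro divide_left_mono mult_pos_pos) auto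
  moreover have "0 < real n / (2 * real n powr (a + \<delta> / 2))"
    using L by (auto simp: large_sample_def)
  ultimately have "ln (real n / (2 * real n powr (a + \<delta> / 2))) \<le> ln (real n / (2 * ?K))"
    by simp
  then show "16 / a < ln (real n / (2 * ?K))"
    using L by (auto simp: large_sample_def)
  have c: "0 < a * \<delta> / 4" "a * \<delta> / 4 \<le> 1"
  proof -
    show "0 < a * \<delta> / 4" using a d by simp
    have "\<delta> \<le> 1" using d aa a by linarith
    then have "a * \<delta> \<le> 1" using a d by (intro mult_le_one) auto
    then show "a * \<delta> / 4 \<le> 1" by simp
  qed
  have cK: "a * \<delta> / 4 * real n powr (a - \<delta> / 2) \<le> a * \<delta> / 4 * ?K"
    using c lo by (intro mult_left_mono) auto
  then show small: "real n powr (a / 4) < a * \<delta> / 4 * ?K"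
    using L by (auto simp: large_sample_def)
  show "1 + exp (4 * ln 2 / (1 - a)) * real n powr (a - a * (1 - a) / 32) * (1 + ln (real n)) < a * \<delta> / 4 * ?K"
    using L cK by (auto simp: large_sample_def)
  have "a * \<delta> / 4 * ?K \<le> 1 * ?K"
    using c by (intro mult_right_mono) auto
  then show "8 / (1 - a) + ln (real n) + 1 \<le> ?K"
    using L small by (auto simp: large_sample_def)
  have N: "(1 - a) / 2 * ?K \<le> real (card {U \<in> P. card U \<ge> 2})"
    using T by (auto simp: typical_partition_def)
  have "(1 - a) / 2 * ?K = (1 - a) / 4 * ?K + (1 - a) / 4 * ?K"
    by (simp add: field_simps)
  then show "(1 - a) / 4 * ?K \<le> real (card {U \<in> P. card U \<ge> 2}) - 1" and "2 \<le> card {U \<in> P. card U \<ge> 2}"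
    using N two by linarith+
  show "\<bar>block_sum (score a) P\<bar> \<le> \<delta> / 2 * ?K"
    using T by (auto simp: typical_partition_def)
qed

text \<open>
  At \<open>x = a\<close> the bound on the score says that \<open>a * inner_sum a P\<close> is within a multiple of \<open>K\<close> of
  \<open>K\<close>, and \<open>inner_sum\<close> increases in \<open>x\<close>.
\<close>

lemma inner_sum_small:
  assumes a: "0 < a" "a < 1" and x: "0 \<le> x" "x \<le> a" and P: "P \<in> partitions_upto n"
    and S: "\<bar>block_sum (score a) P\<bar> \<le> real (card P)"
  shows "inner_sum x P \<le> 2 * real (card P) / a"
proof -
  have "a * inner_sum a P = real (card P) - a * block_sum (score a) P"
    using block_sum_score[OF P, of a] a by simp
  also have "\<dots> \<le> real (card P) + 1 * real (card P)"
  proof -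
    have "a * (- block_sum (score a) P) \<le> a * real (card P)"
      using S a by (intro mult_left_mono) auto
    also have "\<dots> \<le> 1 * real (card P)" using a by (intro mult_right_mono) auto
    finally show ?thesis by simp
  qed
  finally have "inner_sum a P \<le> 2 * real (card P) / a"
    using a by (simp add: pos_le_divide_eq mult.commute)
  then show ?thesis
    using inner_sum_mono(1)[OF x, of P] a by linarith
qed

text \<open>
  The score at \<open>a\<close> is small, and between \<open>a\<close> and \<open>a \<plusminus> \<delta>\<close> it changes by at least \<open>\<delta> * K\<close>;
  beyond that, monotonicity takes over.
\<close>

lemma score_root_location:
  assumes a: "0 < a" "a < 1" and d: "0 < \<delta>" "\<delta> \<le> a / 2" "\<delta> < 1 - a" and P: "P \<in> partitions_upto n"
    and S: "\<bar>block_sum (score a) P\<bar> \<le> \<delta> / 2 * real (card P)" and x: "0 < x" "x < 1"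
  shows "- (a * \<delta> / 4) * real (card P) < x * block_sum (score x) P \<Longrightarrow> x < a + \<delta>"
    "x * block_sum (score x) P < a * \<delta> / 4 * real (card P) \<Longrightarrow> a - \<delta> < x"
proof -
  let ?K = "real (card P)"
  assume *: "- (a * \<delta> / 4) * ?K < x * block_sum (score x) P"
  show "x < a + \<delta>"
  proof (rule ccontr)
    assume "\<not> x < a + \<delta>"
    then have "x * block_sum (score x) P \<le> (a + \<delta>) * block_sum (score (a + \<delta>)) P"
      using scaled_score_antimono[OF P, of "a + \<delta>" x] a d x by simp
    also have "\<dots> \<le> (a + \<delta>) * (- (\<delta> / 2) * ?K)"
      using score_slope[OF P, of a "a + \<delta>"] a d S by (intro mult_left_mono) auto
    also have "\<dots> \<le> a * (- (\<delta> / 2) * ?K)"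
      using a d by (intro mult_right_mono_neg) (auto intro!: mult_nonpos_nonneg)
    also have "\<dots> \<le> - (a * \<delta> / 4) * ?K"
      using a d by (simp add: field_simps)
    finally show False using * by simp
  qed
next
  let ?K = "real (card P)"
  assume *: "x * block_sum (score x) P < a * \<delta> / 4 * ?K"
  show "a - \<delta> < x"
  proof (rule ccontr)
    assume "\<not> a - \<delta> < x"
    have "a * \<delta> / 4 * ?K = a / 2 * (\<delta> / 2 * ?K)" by simp
    also have "\<dots> \<le> (a - \<delta>) * (\<delta> / 2 * ?K)"
      using d by (intro mult_right_mono) auto
    also have "\<dots> \<le> (a - \<delta>) * block_sum (score (a - \<delta>)) P"
      using score_slope[OF P, of "a - \<delta>" a] a d S by (intro mult_left_mono) auto
    also have "\<dots> \<le> x * block_sum (score x) P"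
      using scaled_score_antimono[OF P, of x "a - \<delta>"] \<open>\<not> a - \<delta> < x\<close> a d x by simp
    finally show False using * by simp
  qed
qed

text \<open>
  Let \<open>h\<close> be the common value of the two sums in the equation for \<open>y\<close>. Then \<open>x * score(x) = 1 + y * h\<close>.
  If \<open>y \<le> 0\<close>, then \<open>y > - x\<close>, and \<open>- y * h\<close> is at most \<open>x / (1 - x)\<close> plus a logarithm; the blocks that are
  not singletons keep \<open>x / (1 - x)\<close> bounded. If \<open>y > 0\<close>, then \<open>h\<close> is at most logarithmic and only the size
  of \<open>y\<close> matters. The score is nonnegative, so \<open>x < a + \<delta>\<close>, and the equation for \<open>y\<close> gives
  \<open>(1 - x) * ln y \<le> (a + \<delta> / 2 - x) * ln n\<close> up to a constant. This is used twice: once with the rough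
  bound \<open>x \<ge> a / 16\<close>, which yields \<open>x > a - \<delta>\<close>, and then with this better bound.
\<close>

lemma critical_point_location:
  assumes a: "0 < a" "a < 1" and d: "0 < \<delta>" "\<delta> \<le> a * (1 - a) / 64"
    and L: "large_sample a \<delta> n" and T: "typical_partition a \<delta> n P" and P: "P \<in> partitions_upto n"
    and x: "0 < x" "x < 1" and y: "y > - x"
    and eq_y: "(\<Sum>i = 1..card P - 1. 1 / (y + real i * x)) = (\<Sum>i = 1..n - 1. 1 / (y + real i))"
    and eq_x: "(\<Sum>i = 1..card P - 1. real i / (y + real i * x)) = inner_sum x P"
  shows "\<bar>x - a\<bar> < \<delta>" "\<bar>x * block_sum (score x) P\<bar> \<le> real n powr (a / 4)"
proof -
  let ?K = "real (card P)" and ?N = "real (card {U \<in> P. card U \<ge> 2})"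
  define h where "h = (\<Sum>i = 1..n - 1. 1 / (y + real i))"
  define H where "H = x * block_sum (score x) P"
  note F = typical_facts[OF a d L T]
  have aa: "0 < a * (1 - a)" "a * (1 - a) < a" "a * (1 - a) < 1 - a"
    using a mult_strict_left_mono[of "1 - a" 1 a] mult_strict_right_mono[of a 1 "1 - a"] by auto
  have d': "\<delta> \<le> a / 2" "\<delta> < 1 - a" "\<delta> \<le> (1 - a) / 2" using d aa by auto
  have n: "n \<ge> 2" "n \<ge> 1" using L by (auto simp: large_sample_def)
  have ln: "0 \<le> ln (real n)" using n by simp
  have p4: "8 / (1 - a) + ln (real n) + 1 \<le> real n powr (a / 4)"
    using L by (auto simp: large_sample_def)
  have c8: "8 / (1 - a) \<ge> 0" using a by simp
  have K1: "real (card P - 1) = ?K - 1" using F(1) by (simp add: of_nat_diff)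
  have H1: "H = ?K - x * inner_sum x P"
    using block_sum_score[OF P, of x] x by (simp add: H_def)
  have comb: "y * h + x * inner_sum x P = ?K - 1"
    using combined_equation[of x y "card P - 1"] x y eq_y eq_x K1 by (simp add: h_def)
  have H2: "H = 1 + y * h" using H1 comb by simp
  note loc = score_root_location[OF a d(1) d'(1,2) P F(9) x, folded H_def]
  have "\<bar>H\<bar> \<le> real n powr (a / 4)"
  proof (cases "y \<le> 0")
    case True
    define v where "v = - y"
    have v: "0 \<le> v" "v < x" using True y by (auto simp: v_def)
    have vh: "v * h \<le> x / (1 - x) + (1 + ln (real n))"
    proof -
      have "v * h \<le> x * (1 / (1 - x)) + (\<Sum>i = 2..n - 1. 1 * (1 / (real i - 1)))"
      proof -
        have "v * h = v * (1 / (1 - v)) + (\<Sum>i = 2..n - 1. v * (1 / (real i - v)))"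
        proof -
          have "h = (\<Sum>i = 1..n - 1. 1 / (real i - v))"
            by (simp add: h_def v_def add.commute)
          also have "\<dots> = 1 / (1 - v) + (\<Sum>i = 2..n - 1. 1 / (real i - v))"
            using n by (simp add: sum.atLeast_Suc_atMost numeral_2_eq_2)
          finally show ?thesis by (simp only: distrib_left sum_distrib_left)
        qed
        also have "\<dots> \<le> x * (1 / (1 - x)) + (\<Sum>i = 2..n - 1. 1 * (1 / (real i - 1)))"
          using v x by (intro add_mono sum_mono mult_mono divide_left_mono) auto
        finally show ?thesis .
      qed
      also have "(\<Sum>i = 2..n - 1. 1 * (1 / (real i - 1))) = (\<Sum>i = 1..n - 2. 1 / real i)"
        using sum.shift_bounds_cl_Suc_ivl[of "\<lambda>i. 1 / (real i - 1)" 1 "n - 2"] n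
        by (simp add: numeral_2_eq_2 Suc_diff_Suc)
      also have "\<dots> \<le> (\<Sum>i = 1..n. 1 / real i)"
        by (rule sum_mono2) auto
      also have "\<dots> \<le> 1 + ln (real n)" by (rule harm_upper[OF n(2)])
      finally show ?thesis by simp
    qed
    have lower: "?N * (x / (1 - x)) \<le> x * inner_sum x P"
    proof -
      have "?N * c = (\<Sum>U\<in>P. of_bool (card U \<ge> 2) * c)" for c :: real
        using partitions_uptoD(1)[OF P] by (simp add: Int_def flip: sum_distrib_right)
      then have "?N * (x / (1 - x)) = (\<Sum>U\<in>P. of_bool (card U \<ge> 2) * (x / (1 - x)))" .
      also have "\<dots> \<le> (\<Sum>U\<in>P. x * (\<Sum>i = 1..card U - 1. 1 / (real i - x)))"
      proof (rule sum_mono)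
        fix U assume "U \<in> P"
        show "of_bool (card U \<ge> 2) * (x / (1 - x)) \<le> x * (\<Sum>i = 1..card U - 1. 1 / (real i - x))"
        proof (cases "card U \<ge> 2")
          case True
          then have "(\<Sum>i\<in>{1}. 1 / (real i - x)) \<le> (\<Sum>i = 1..card U - 1. 1 / (real i - x))"
            using x by (intro sum_mono2) auto
          then show ?thesis using True x mult_left_mono[of "1 / (1 - x)" _ x] by simp
        next
          case False
          then show ?thesis using x by (auto intro!: mult_nonneg_nonneg sum_nonneg)
        qed
      qed
      also have "\<dots> = x * inner_sum x P"
        by (simp add: inner_sum_def block_sum_def sum_distrib_left)
      finally show ?thesis .
    qed
    define w where "w = x / (1 - x)"
    have w: "w \<ge> 0" using x by (simp add: w_def)
    have "x * inner_sum x P = ?K - 1 + v * h" using comb by (simp add: v_def)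
    then have "?N * w \<le> ?K - 1 + (w + (1 + ln (real n)))"
      using lower vh by (simp add: w_def)
    then have "(?N - 1) * w \<le> ?K + ln (real n)" by (simp add: algebra_simps)
    moreover have "(1 - a) / 4 * ?K * w \<le> (?N - 1) * w"
      by (rule mult_right_mono[OF F(6) w])
    ultimately have "(1 - a) / 4 * ?K * w \<le> 2 * ?K"
      using F(4) c8 by linarith
    then have "?K * ((1 - a) / 4 * w) \<le> ?K * 2" by (simp add: mult_ac)
    then have "(1 - a) / 4 * w \<le> 2" using F(1) by (simp add: mult_le_cancel_left)
    then have "w \<le> 8 / (1 - a)" using a by (simp add: field_simps)
    moreover have "0 \<le> v * h"
      unfolding h_def using v arguments_pos(2)[of x y] x y by (intro mult_nonneg_nonneg sum_nonneg) (auto intro: less_imp_le)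
    moreover have "H = 1 - v * h" using H2 by (simp add: v_def)
    ultimately show ?thesis
      using vh p4 ln c8 unfolding w_def by linarith
  next
    case False
    then have y0: "y > 0" by simp
    have h0: "h \<ge> 0" unfolding h_def using y0 by (intro sum_nonneg) auto
    have hup: "h \<le> 1 + ln (real n)" unfolding h_def by (rule sum_inverse_upper) (use y0 n in auto)
    have yh: "0 \<le> y * h" using y0 h0 by simp
    have cK: "0 < a * \<delta> / 4 * ?K" using a d F(1) by simp
    have x_up: "x < a + \<delta>"
      by (rule loc(1)) (use H2 yh cK in linarith)
    have "0 \<le> x * inner_sum x P" using x inner_sum_mono(2)[of x x P] by simp
    then have yhK: "y * h \<le> ?K" using comb by simp
    have yK: "y < a * ?K / 16"
      by (rule y_bound[OF a _ _ F(3) y0]) (use F(1,2) yhK in \<open>auto simp: h_def\<close>)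
    \<comment> \<open>For smaller \<open>x\<close> all denominators \<open>y + i * x\<close> are below \<open>a * K / 8\<close>, and the sum in the equation for \<open>x\<close> would be too large.\<close>
    have x_lo: "a / 16 \<le> x"
    proof (rule ccontr)
      assume "\<not> a / 16 \<le> x"
      then have xa: "x < a / 16" by simp
      have "\<delta> / 2 * ?K \<le> 1 * ?K" using d' a by (intro mult_right_mono) auto
      then have T2: "inner_sum x P \<le> 2 * ?K / a"
        using inner_sum_small[OF a, of x P n] x xa a P F(9) by simp
      define D where "D = y + ?K * x"
      have D0: "D > 0" using y0 x F(1) by (simp add: D_def add_pos_pos)
      have "?K * x \<le> ?K * (a / 16)" using xa by (intro mult_left_mono) auto
      moreover have "?K * (a / 16) = a * ?K / 16" by simp
      ultimately have D: "D < a * ?K / 8" using yK unfolding D_def by linarith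
      have "(\<Sum>i = 1..card P - 1. real i / D) \<le> (\<Sum>i = 1..card P - 1. real i / (y + real i * x))"
      proof (rule sum_mono)
        fix i assume i: "i \<in> {1..card P - 1}"
        then have "real i \<le> ?K" by auto
        then have "real i * x \<le> ?K * x" using x by (intro mult_right_mono) auto
        moreover have "0 < y + real i * x" using i x y0 by (simp add: add_pos_pos)
        ultimately show "real i / D \<le> real i / (y + real i * x)"
          unfolding D_def by (intro divide_left_mono) (auto intro!: mult_pos_pos)
      qed
      moreover have "(\<Sum>i = 1..card P - 1. real i / D) = (?K - 1) * ?K / 2 / D"
        unfolding sum_divide_distrib[symmetric] sum_real_upto K1 by simp
      ultimately have "(?K - 1) * ?K / 2 / D \<le> 2 * ?K / a"
        using eq_x T2 by linarith
      then have "?K * ((?K - 1) * a) \<le> ?K * (4 * D)"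
        using D0 a by (simp add: field_simps)
      then have "(?K - 1) * a \<le> 4 * D" using F(1) by (simp add: mult_le_cancel_left)
      also have "\<dots> < a * ?K / 2" using D by simp
      finally have "a * (?K - 1) < a * (?K / 2)" by (simp add: mult.commute)
      then show False using a F(1) by (simp add: mult_less_cancel_left)
    qed
    show ?thesis
    proof (cases "y \<le> 1")
      case True
      have "y * h \<le> 1 * (1 + ln (real n))" using True y0 h0 hup by (intro mult_mono) auto
      moreover have "8 / (1 - a) \<ge> 1" using a by simp
      ultimately have "H \<le> 8 / (1 - a) + ln (real n) + 1" using H2 by simp
      moreover have "0 \<le> H" using H2 yh by simp
      ultimately show ?thesis using p4 by simp
    next
      case False
      define l where "l = ln (real n)"
      have l: "l > 0" using n by (simp add: l_def)
      \<comment> \<open>Both sums in the equation for \<open>y\<close> are replaced by logarithms: \<open>x * ln (n / (2 * y)) \<le> ln (2 * K / y)\<close>.\<close>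
      have log_ineq: "(1 - x) * ln y \<le> (a + \<delta> / 2 - x) * l + 2 * ln 2"
      proof -
        have "x * (ln (y + real n) - ln (y + 1)) \<le> x * (\<Sum>i = 1..card P - 1. 1 / (y + real i * x))"
          unfolding eq_y using x y0 n by (intro mult_left_mono sum_inverse_ge_ln) auto
        also have "\<dots> \<le> ln (y + real (card P - 1) * x) - ln y"
          by (rule sum_inverse_le_ln[OF y0 x(1)])
        also have "ln (y + real (card P - 1) * x) \<le> ln (2 * ?K)"
        proof -
          have "real (card P - 1) * x \<le> ?K * 1" using x by (intro mult_mono) auto
          moreover have "a * ?K / 16 \<le> 1 * ?K" using a F(1) by simp
          ultimately have "y + real (card P - 1) * x \<le> 2 * ?K" using yK by linarith
          moreover have "0 < y + real (card P - 1) * x" using y0 x by (intro add_pos_nonneg) auto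
          ultimately show ?thesis by (blast intro: ln_mono)
        qed
        also have "ln (2 * ?K) = ln 2 + ln ?K" using F(1) by (simp add: ln_mult)
        also have "ln ?K \<le> (a + \<delta> / 2) * l"
        proof -
          have "ln ?K \<le> ln (real n powr (a + \<delta> / 2))"
            using T F(1) n by (subst ln_le_cancel_iff) (auto simp: typical_partition_def)
          then show ?thesis using n by (simp add: ln_powr l_def)
        qed
        finally have 1: "x * (ln (y + real n) - ln (y + 1)) \<le> ln 2 + (a + \<delta> / 2) * l - ln y" by simp
        have "l \<le> ln (y + real n)" unfolding l_def using y0 n by simp
        moreover have "ln (y + 1) \<le> ln (2 * y)" using False by simp
        moreover have "ln (2 * y) = ln 2 + ln y" using y0 by (simp add: ln_mult)
        ultimately have "x * (l - (ln 2 + ln y)) \<le> x * (ln (y + real n) - ln (y + 1))"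
          using x by (intro mult_left_mono) auto
        moreover have "x * ln 2 \<le> 1 * ln (2::real)" using x by (intro mult_right_mono) auto
        moreover have "(1 - x) * Y \<le> (t - x) * l + 2 * b"
          if "x * (A - B) \<le> b + t * l - Y" "x * (l - (b + Y)) \<le> x * (A - B)" "x * b \<le> 1 * b" for A B b t Y :: real
          using that by (simp add: algebra_simps)
        ultimately show ?thesis using 1 by blast
      qed
      have x1: "(1 - a) / 2 \<le> 1 - x" "0 < 1 - x" using x_up d'(3) x by auto
      have c2: "2 * ln 2 / (1 - x) \<le> 4 * ln 2 / (1 - a)"
      proof -
        have "2 * ln 2 / (1 - x) \<le> 2 * ln 2 / ((1 - a) / 2)"
          using x1 a by (intro divide_left_mono) auto
        then show ?thesis by simp
      qed
      have y_le: "y \<le> exp (4 * ln 2 / (1 - a)) * real n powr e" if "(a + \<delta> / 2 - x) \<le> e * (1 - x)" for e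
      proof -
        have "(1 - x) * ln y \<le> e * (1 - x) * l + 2 * ln 2"
          using log_ineq mult_right_mono[OF that, of l] l by linarith
        then have "ln y \<le> e * l + 2 * ln 2 / (1 - x)"
          using x1 by (simp add: field_simps)
        then have "ln y \<le> 4 * ln 2 / (1 - a) + e * l" using c2 by linarith
        then have "exp (ln y) \<le> exp (4 * ln 2 / (1 - a) + e * l)" by simp
        then show ?thesis
          using y0 n by (simp add: exp_add powr_def l_def)
      qed
      have R_le: "H \<le> 1 + exp (4 * ln 2 / (1 - a)) * real n powr e * (1 + ln (real n))" if "(a + \<delta> / 2 - x) \<le> e * (1 - x)" for e
        unfolding H2 using mult_mono[OF y_le[OF that] hup] y0 h0 by (simp add: mult_nonneg_nonneg)
      \<comment> \<open>First round: an exponent strictly below \<open>a\<close>, so that the score is small compared with \<open>K\<close>.\<close>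
      have "a + \<delta> / 2 - x \<le> (a - a * (1 - a) / 32) * (1 - x)"
      proof -
        define c where "c = a * (1 - a) / 32"
        have "a / 16 * (1 - a) \<le> x * (1 - a)" using x_lo a by (intro mult_right_mono) auto
        moreover have "a / 16 * (1 - a) = 2 * c" by (simp add: c_def)
        moreover have "c * (1 - x) \<le> c * 1"
          using aa x by (intro mult_left_mono) (auto simp: c_def)
        moreover have "\<delta> / 2 \<le> c" using d aa by (simp add: c_def)
        moreover have "(a - c) * (1 - x) = a - x + x * (1 - a) - c * (1 - x)" by (simp add: algebra_simps)
        ultimately show ?thesis unfolding c_def[symmetric] by linarith
      qed
      from R_le[OF this] have "H < a * \<delta> / 4 * ?K" using F(8) by linarith
      then have x_near: "a - \<delta> < x" by (rule loc(2))
      \<comment> \<open>Second round: now \<open>x\<close> is within \<open>\<delta>\<close> of \<open>a\<close>, and the exponent drops to \<open>a / 8\<close>.\<close>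
      have "a + \<delta> / 2 - x \<le> a / 8 * (1 - x)"
      proof -
        have "a / 8 * ((1 - a) / 2) \<le> a / 8 * (1 - x)" using x1 a by (intro mult_left_mono) auto
        moreover have "a / 8 * ((1 - a) / 2) = a * (1 - a) / 16" by simp
        ultimately show ?thesis using x_near d aa by linarith
      qed
      from R_le[OF this] have "H \<le> real n powr (a / 4)"
        using L unfolding large_sample_def by linarith
      then show ?thesis using H2 yh by simp
    qed
  qed
  then show le: "\<bar>x * block_sum (score x) P\<bar> \<le> real n powr (a / 4)" by (simp add: H_def)
  then have "\<bar>H\<bar> < a * \<delta> / 4 * ?K" using F(7) by (simp add: H_def)
  then have "- (a * \<delta> / 4) * ?K < H" "H < a * \<delta> / 4 * ?K" by linarith+
  then show "\<bar>x - a\<bar> < \<delta>"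
    using loc by (simp add: abs_less_iff)
qed

text \<open>
  A maximizer over the closed range \<open>0 \<le> x < 1\<close> exists; it remains to exclude \<open>x = 0\<close>. There the
  equation for \<open>y\<close> forces \<open>y < a * K / 16\<close>, hence the sum of \<open>i / y\<close> over \<open>i < K\<close> dominates
  \<open>inner_sum 0 P\<close> and the likelihood increases to the right of \<open>x = 0\<close>.
\<close>

lemma maximizer_exists:
  assumes a: "0 < a" "a < 1" and d: "0 < \<delta>" "\<delta> \<le> a * (1 - a) / 64"
    and L: "large_sample a \<delta> n" and T: "typical_partition a \<delta> n P" and P: "P \<in> partitions_upto n"
  shows "\<exists>q. is_likelihood_maximizer n P q"
proof -
  let ?K = "real (card P)"
  note F = typical_facts[OF a d L T]
  have aa: "0 < a * (1 - a)" "a * (1 - a) < a" "a * (1 - a) < 1 - a"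
    using a mult_strict_left_mono[of "1 - a" 1 a] mult_strict_right_mono[of a 1 "1 - a"] by auto
  have "card P \<ge> 2" "card P < n" using F(1,2) by auto
  from extended_maximizer_exists[OF P this F(5)]
  obtain x y where xy: "0 \<le> x" "x < 1" "y > - x"
    and max: "\<And>x' y'. 0 \<le> x' \<Longrightarrow> x' < 1 \<Longrightarrow> y' > - x' \<Longrightarrow> log_likelihood n P x' y' \<le> log_likelihood n P x y"
    by blast
  have "x \<noteq> 0"
  proof
    assume x0: "x = 0"
    then have y0: "y > 0" using xy by simp
    have "(\<Sum>i = 1..card P - 1. 1 / (y + real i * 0)) = (\<Sum>i = 1..n - 1. 1 / (y + real i))"
      by (rule critical_equation_y[OF P]) (use xy max x0 in auto)
    then have e: "(\<Sum>i = 1..n - 1. 1 / (y + real i)) = real (card P - 1) / y"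
      by simp
    have "y * (\<Sum>i = 1..n - 1. 1 / (y + real i)) = real (card P - 1)"
      unfolding e using y0 by simp
    also have "\<dots> \<le> ?K" by simp
    finally have yK: "y < a * ?K / 16"
      by (intro y_bound[OF a _ _ F(3) y0]) (use F(1,2) in auto)
    have "\<delta> / 2 \<le> 1" using d aa a by linarith
    then have "\<delta> / 2 * ?K \<le> 1 * ?K" by (intro mult_right_mono) auto
    then have T2: "inner_sum 0 P \<le> 2 * ?K / a"
      using inner_sum_small[OF a, of 0 P n] a P F(9) by simp
    have K1: "real (card P - 1) = ?K - 1" using F(1) by (simp add: of_nat_diff)
    have "(\<Sum>i = 1..card P - 1. real i / (y + real i * 0)) = (?K - 1) * ?K / 2 / y"
      unfolding mult_zero_right add_0_right sum_divide_distrib[symmetric] sum_real_upto K1 by simp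
    moreover have "2 * ?K / a < (?K - 1) * ?K / 2 / y"
    proof -
      have "4 * y < (?K - 1) * a"
      proof -
        have "a * 8 \<le> a * ?K" using F(1) a by (intro mult_left_mono) auto
        moreover have "(?K - 1) * a = a * ?K - a" by (simp add: algebra_simps)
        ultimately show ?thesis using yK a by linarith
      qed
      then have "?K * (4 * y) < ?K * ((?K - 1) * a)" using F(1) by (intro mult_strict_left_mono) auto
      then show ?thesis using y0 a by (simp add: field_simps)
    qed
    ultimately have pos: "0 < (\<Sum>i = 1..card P - 1. real i / (y + real i * 0)) - inner_sum 0 P"
      using T2 by linarith
    have "((\<lambda>x. log_likelihood n P x y) has_real_derivative (\<Sum>i = 1..card P - 1. real i / (y + real i * 0)) - inner_sum 0 P) (at 0)"
      by (rule log_likelihood_deriv_x[OF P]) (use y0 in auto)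
    from DERIV_pos_inc_right[OF this pos] obtain e where e: "e > 0" "\<And>h. 0 < h \<Longrightarrow> h < e \<Longrightarrow> log_likelihood n P 0 y < log_likelihood n P (0 + h) y"
      by auto
    define h where "h = min (e / 2) (1 / 2)"
    have "0 < h" "h < e" "h < 1" using e by (auto simp: h_def)
    then show False
      using e(2)[of h] max[of h y] x0 y0 by simp
  qed
  then have "is_likelihood_maximizer n P (x, y)"
    using xy max unfolding is_arg_max_linorder parameter_space_def by auto
  then show ?thesis by blast
qed

lemma maximizer_location:
  assumes a: "0 < a" "a < 1" and d: "0 < \<delta>" "\<delta> \<le> a * (1 - a) / 64"
    and L: "large_sample a \<delta> n" and T: "typical_partition a \<delta> n P" and P: "P \<in> partitions_upto n"
    and q: "is_likelihood_maximizer n P q"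
  shows "\<bar>fst q - a\<bar> < \<delta>" "\<bar>fst q * block_sum (score (fst q)) P\<bar> \<le> real n powr (a / 4)" "0 < fst q" "fst q < 1"
proof -
  obtain x y where xy: "q = (x, y)" by fastforce
  have p: "0 < x" "x < 1" "y > - x"
    and max: "\<And>x' y'. 0 < x' \<Longrightarrow> x' < 1 \<Longrightarrow> y' > - x' \<Longrightarrow> log_likelihood n P x' y' \<le> log_likelihood n P x y"
    using q unfolding xy is_arg_max_linorder parameter_space_def by auto
  have "(\<Sum>i = 1..card P - 1. 1 / (y + real i * x)) = (\<Sum>i = 1..n - 1. 1 / (y + real i))"
    by (rule critical_equation_y[OF P]) (use p max in auto)
  moreover have "(\<Sum>i = 1..card P - 1. real i / (y + real i * x)) = inner_sum x P"
    by (rule critical_equation_x[OF P]) (use p max in auto)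
  ultimately show "\<bar>fst q - a\<bar> < \<delta>" "\<bar>fst q * block_sum (score (fst q)) P\<bar> \<le> real n powr (a / 4)"
    "0 < fst q" "fst q < 1"
    using critical_point_location[OF a d L T P p] p by (auto simp: xy)
qed

section \<open>The Sibuya information\<close>

text \<open>
  The factors are at most \<open>exp (- a / k)\<close>, and the harmonic series diverges.
\<close>

lemma sibuya_tail_tendsto_0:
  assumes "0 < a" "a < 1"
  shows "sibuya_tail a \<longlonglongrightarrow> 0"
proof (rule tendsto_sandwich[OF _ _ tendsto_const])
  show "\<forall>\<^sub>F n in sequentially. 0 \<le> sibuya_tail a n"
    using sibuya_tail_bounds(1)[of a] assms by (auto intro!: always_eventually less_imp_le)
  show "(\<lambda>n. exp (- a * ln (real n + 1))) \<longlonglongrightarrow> 0"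
    using assms by real_asymp
  show "\<forall>\<^sub>F n in sequentially. sibuya_tail a n \<le> exp (- a * ln (real n + 1))"
  proof (intro always_eventually allI)
    fix n
    have "sibuya_tail a n \<le> (\<Prod>k = 1..n. exp (- a * inverse (real k)))"
      unfolding sibuya_tail_def
    proof (rule prod_mono, intro conjI)
      fix k assume "k \<in> {1..n}"
      then have "a / real k \<le> a / 1" using assms by (intro divide_left_mono) auto
      then show "0 \<le> 1 - a / real k" using assms by simp
      show "1 - a / real k \<le> exp (- a * inverse (real k))"
        using exp_ge_add_one_self[of "- a * inverse (real k)"] by (simp add: divide_inverse)
    qed
    also have "\<dots> = exp (- a * harm n)"
      unfolding harm_def by (simp add: exp_sum sum_distrib_left)
    also have "\<dots> \<le> exp (- a * ln (real n + 1))"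
      using ln_le_harm[of n] assms by simp
    finally show "sibuya_tail a n \<le> exp (- a * ln (real n + 1))" .
  qed
qed

lemma sibuya_pmf_eq:
  assumes "j \<ge> 1"
  shows "sibuya_pmf a j = sibuya_tail a (j - 1) - sibuya_tail a j"
proof -
  have prod_eq: "(\<Prod>i = 1..k. real i - a) = fact k * sibuya_tail a k" for k
  proof (induction k)
    case (Suc k)
    have "real (Suc k) * (1 - a / real (Suc k)) = real (Suc k) - a"
      by (simp add: field_simps)
    then have eq: "fact (Suc k) * sibuya_tail a (Suc k) = (fact k * sibuya_tail a k) * (real (Suc k) - a)"
      by (simp add: sibuya_tail_def mult_ac)
    have "(\<Prod>i = 1..Suc k. real i - a) = (\<Prod>i = 1..k. real i - a) * (real (Suc k) - a)"
      by simp
    then show ?case unfolding eq Suc.IH .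
  qed (simp add: sibuya_tail_def)
  obtain k where k: "j = Suc k" using assms not0_implies_Suc[of j] by auto
  have "sibuya_pmf a j = a * (fact k * sibuya_tail a k) / fact (Suc k)"
    unfolding sibuya_pmf_def k diff_Suc_1 prod_eq ..
  also have "\<dots> = sibuya_tail a k * (a / real (Suc k))"
    by (simp add: divide_simps)
  also have "\<dots> = sibuya_tail a k - sibuya_tail a (Suc k)"
    by (simp add: sibuya_tail_def algebra_simps)
  finally show ?thesis by (simp add: k)
qed

lemma sibuya_pmf_pos:
  assumes "0 < x" "x < 1"
  shows "sibuya_pmf x j > 0"
  unfolding sibuya_pmf_def using assms by (intro divide_pos_pos mult_pos_pos prod_pos) auto

lemma ln_sibuya_pmf_deriv:
  assumes "j \<ge> 1" "0 < x" "x < 1"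
  shows "((\<lambda>x. ln (sibuya_pmf x j)) has_real_derivative score x j) (at x)"
proof -
  have "((\<lambda>x. ln x + (\<Sum>i = 1..j - 1. ln (real i - x)) - ln (fact j)) has_real_derivative
      1 / x + (\<Sum>i = 1..j - 1. - (1 / (real i - x))) - 0) (at x)"
    by (intro DERIV_add DERIV_diff DERIV_sum DERIV_const, use assms in \<open>auto intro!: derivative_eq_intros simp: divide_inverse\<close>)
  then have d: "((\<lambda>x. ln x + (\<Sum>i = 1..j - 1. ln (real i - x)) - ln (fact j)) has_real_derivative score x j) (at x)"
    using score_eq[of j x] assms by (simp add: sum_negf)
  have eq: "ln z + (\<Sum>i = 1..j - 1. ln (real i - z)) - ln (fact j) = ln (sibuya_pmf z j)" if "z \<in> {0<..<1}" for z
  proof -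
    have pos: "z > 0" "(\<Prod>i = 1..j - 1. real i - z) > 0"
      using that by (auto intro!: prod_pos)
    have "ln (\<Prod>i = 1..j - 1. real i - z) = (\<Sum>i = 1..j - 1. ln (real i - z))"
      using that by (intro ln_prod) auto
    moreover have "ln (v * p / f) = ln v + ln p - ln f" if "v > 0" "p > 0" "f > 0" for v p f :: real
      using that by (simp add: ln_div ln_mult)
    from this[OF pos fact_gt_zero[of j]]
    have "ln (sibuya_pmf z j) = ln z + ln (\<Prod>i = 1..j - 1. real i - z) - ln (fact j)"
      unfolding sibuya_pmf_def .
    ultimately show ?thesis by simp
  qed
  show ?thesis
    by (rule has_field_derivative_transform_within_open[OF d, of "{0<..<1}"]) (use assms eq in auto)
qed

lemma score_deriv:
  assumes "0 < x" "x < 1"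
  shows "((\<lambda>x. score x j) has_real_derivative - info x j) (at x)"
proof -
  have ne: "real i - x \<noteq> 0" for i using assms by (cases i) auto
  have "((\<lambda>x. \<Sum>i<j. 1 / (real i - x)) has_real_derivative (\<Sum>i<j. 1 / (real i - x)\<^sup>2)) (at x)"
    by (intro DERIV_sum) (use ne in \<open>auto intro!: derivative_eq_intros simp: divide_inverse power2_eq_square\<close>)
  then show ?thesis
    unfolding score_def info_def by (rule DERIV_minus)
qed

lemma second_log_derivative:
  assumes "j \<ge> 1" "0 < a" "a < 1"
  shows "(deriv ^^ 2) (\<lambda>x. ln (sibuya_pmf x j)) a = - info a j"
proof -
  have "(deriv ^^ 2) (\<lambda>x. ln (sibuya_pmf x j)) a = deriv (deriv (\<lambda>x. ln (sibuya_pmf x j))) a"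
    by (simp add: numeral_2_eq_2)
  also have "\<dots> = deriv (\<lambda>x. score x j) a"
  proof (rule deriv_cong_ev)
    have "\<forall>\<^sub>F x in nhds a. x \<in> {0<..<1}"
      by (rule eventually_nhds_in_open) (use assms in auto)
    then show "\<forall>\<^sub>F x in nhds a. deriv (\<lambda>x. ln (sibuya_pmf x j)) x = score x j"
      by eventually_elim (intro DERIV_imp_deriv ln_sibuya_pmf_deriv assms, auto)
  qed simp
  also have "\<dots> = - info a j"
    by (rule DERIV_imp_deriv[OF score_deriv[OF assms(2,3)]])
  finally show ?thesis .
qed

text \<open>
  Summation by parts turns the mean of \<open>info\<close> into the sum of tail probabilities against its increments.
\<close>

lemma sums_sibuya_information:
  assumes "0 < a" "a < 1"
  shows "(\<lambda>k. sibuya_pmf a (Suc k) * info a (Suc k)) sums tail_info a"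
proof -
  let ?q = "sibuya_tail a" and ?w = "\<lambda>i. 1 / (real i - a)\<^sup>2"
  have abel: "(\<Sum>k<n. sibuya_pmf a (Suc k) * info a (Suc k)) = (\<Sum>i<n. ?q i / (real i - a)\<^sup>2) - ?q n * info a n" for n
  proof (induction n)
    case (Suc n)
    have i: "info a (Suc n) = info a n + ?w n" by (simp add: info_def)
    have p: "sibuya_pmf a (Suc n) = ?q n - ?q (Suc n)" by (simp add: sibuya_pmf_eq)
    show ?case
      unfolding sum.lessThan_Suc Suc.IH p i by (simp add: algebra_simps diff_divide_distrib)
  qed (simp add: info_def)
  have "(\<lambda>n. info a n) \<longlonglongrightarrow> (\<Sum>i. ?w i)"
    unfolding info_def using summable_inverse_square[OF assms] by (rule summable_LIMSEQ)
  then have "(\<lambda>n. (\<Sum>i<n. ?q i / (real i - a)\<^sup>2) - ?q n * info a n) \<longlonglongrightarrow> tail_info a - 0 * (\<Sum>i. ?w i)"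
    unfolding tail_info_def
    by (intro tendsto_diff tendsto_mult summable_LIMSEQ summable_tail_info assms sibuya_tail_tendsto_0)
  then show ?thesis
    by (simp add: sums_def abel)
qed

lemma sibuya_information_eq:
  assumes "0 < a" "a < 1"
  shows "sibuya_information a = tail_info a"
proof -
  have nonneg: "0 \<le> sibuya_pmf a (Suc k) * info a (Suc k)" for k
    using sibuya_pmf_pos[OF assms, of "Suc k"] unfolding info_def by (intro mult_nonneg_nonneg sum_nonneg) auto
  have "((\<lambda>k. sibuya_pmf a (Suc k) * info a (Suc k)) has_sum tail_info a) UNIV"
    by (rule sums_nonneg_imp_has_sum[OF sums_sibuya_information[OF assms]]) (use nonneg in auto)
  then have "((\<lambda>j. sibuya_pmf a j * info a j) has_sum tail_info a) (range Suc)"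
    by (subst has_sum_reindex) (auto simp: o_def)
  also have "range Suc = {1..}"
    by (auto simp: image_iff) (metis Suc_le_D)
  finally have "(\<Sum>\<^sub>\<infinity>j\<in>{1..}. sibuya_pmf a j * info a j) = tail_info a"
    by (rule infsumI)
  moreover have "(\<Sum>\<^sub>\<infinity>j\<in>{1..}. sibuya_pmf a j * (deriv ^^ 2) (\<lambda>x. ln (sibuya_pmf x j)) a)
      = (\<Sum>\<^sub>\<infinity>j\<in>{1..}. - (sibuya_pmf a j * info a j))"
    by (rule infsum_cong) (simp add: second_log_derivative[OF _ assms])
  ultimately show ?thesis
    by (simp add: sibuya_information_def infsum_uminus)
qed

text \<open>
  The series converges uniformly on a compact neighbourhood of \<open>a\<close> inside the open unit interval.
\<close>

lemma isCont_tail_info: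
  assumes "0 < a" "a < 1"
  shows "isCont tail_info a"
proof -
  define S where "S = {a / 2..(1 + a) / 2}"
  have S: "0 < x \<and> x < 1 \<and> a / 2 \<le> x \<and> x \<le> (1 + a) / 2" if "x \<in> S" for x
    using that assms by (auto simp: S_def)
  define m where "m i = (if i = 0 then 4 / a\<^sup>2 else 4 / (1 - a)\<^sup>2 * (1 / (real i)\<^sup>2))" for i :: nat
  have "summable (\<lambda>i. 4 / (1 - a)\<^sup>2 * (1 / (real i)\<^sup>2))"
    using inverse_power_summable[of 2, where 'a = real] by (intro summable_mult) (simp add: divide_inverse)
  then have sm: "summable m"
    by (rule summable_cong[THEN iffD1, rotated]) (auto simp: m_def eventually_sequentially intro!: exI[of _ 1])
  have "uniform_limit S (\<lambda>n x. \<Sum>i<n. sibuya_tail x i / (real i - x)\<^sup>2) (\<lambda>x. \<Sum>i. sibuya_tail x i / (real i - x)\<^sup>2) sequentially"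
  proof (rule Weierstrass_m_test[OF _ sm])
    fix i x assume x: "x \<in> S"
    have q: "0 < sibuya_tail x i" "sibuya_tail x i \<le> 1"
      using sibuya_tail_bounds[of x i] S[OF x] by auto
    have "norm (sibuya_tail x i / (real i - x)\<^sup>2) \<le> 1 / (real i - x)\<^sup>2"
      using q by (simp add: divide_right_mono)
    also have "\<dots> \<le> (if i = 0 then 1 / x\<^sup>2 else 1 / (1 - (1 + a) / 2)\<^sup>2 * (1 / (real i)\<^sup>2))"
      by (rule inverse_square_bound) (use S[OF x] assms in auto)
    also have "\<dots> \<le> m i"
    proof (cases "i = 0")
      case True
      have "1 / x\<^sup>2 \<le> 1 / (a / 2)\<^sup>2"
        using S[OF x] assms by (intro divide_left_mono power_mono mult_pos_pos) auto
      then show ?thesis using True by (simp add: m_def power_divide)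
    next
      case False
      have h: "1 - (1 + a) / 2 = (1 - a) / 2" by (simp add: field_simps)
      have "1 / (1 - (1 + a) / 2)\<^sup>2 = 4 / (1 - a)\<^sup>2" unfolding h by (simp add: power_divide)
      then show ?thesis using False by (simp only: m_def if_False order_refl)
    qed
    finally show "norm (sibuya_tail x i / (real i - x)\<^sup>2) \<le> m i" .
  qed
  then have "continuous_on S (\<lambda>x. \<Sum>i. sibuya_tail x i / (real i - x)\<^sup>2)"
  proof (rule uniform_limit_theorem[rotated])
    have ne: "real i - x \<noteq> 0" if "x \<in> S" for i x using S[OF that] by (cases i) auto
    have "continuous_on S (\<lambda>x. sibuya_tail x i)" for i
      unfolding sibuya_tail_def by (intro continuous_intros) auto
    then show "\<forall>\<^sub>F n in sequentially. continuous_on S (\<lambda>x. \<Sum>i<n. sibuya_tail x i / (real i - x)\<^sup>2)"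
      using ne by (intro always_eventually allI continuous_intros) auto
  qed simp
  then have "continuous_on S tail_info"
    unfolding tail_info_def[abs_def] .
  moreover have "a \<in> interior S"
    using assms by (simp add: S_def)
  ultimately show ?thesis
    by (rule continuous_on_interior)
qed

section \<open>From the score to the estimator\<close>

lemma score_difference:
  assumes "0 < a" "a < 1" "0 < x" "x < 1"
  shows "block_sum (score a) P - block_sum (score x) P
    = (x - a) * block_sum (\<lambda>u. \<Sum>i<u. 1 / ((real i - a) * (real i - x))) P"
proof -
  have ne: "real i - z \<noteq> 0" if "0 < z" "z < 1" for i z using that by (cases i) auto
  have "score a u - score x u = (x - a) * (\<Sum>i<u. 1 / ((real i - a) * (real i - x)))" for u
  proof -
    have "1 / (real i - x) - 1 / (real i - a) = (x - a) * (1 / ((real i - a) * (real i - x)))" for i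
      using ne[OF assms(1,2), of i] ne[OF assms(3,4), of i] by (simp add: divide_simps)
    then have "(\<Sum>i<u. 1 / (real i - x) - 1 / (real i - a)) = (\<Sum>i<u. (x - a) * (1 / ((real i - a) * (real i - x))))"
      by simp
    then show ?thesis
      by (simp add: score_def sum_subtractf sum_distrib_left)
  qed
  then have "block_sum (\<lambda>u. score a u - score x u) P = block_sum (\<lambda>u. (x - a) * (\<Sum>i<u. 1 / ((real i - a) * (real i - x)))) P"
    by simp
  then show ?thesis by (simp only: block_sum_simps)
qed

text \<open>
  Replacing one of the two factors \<open>i - a\<close> by \<open>i - x\<close> changes each term by a relative error of at most
  \<open>\<bar>x - a\<bar> / m\<close>, uniformly in \<open>i\<close>, since \<open>m\<close> bounds the distance of \<open>x\<close> to the integers.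
\<close>

lemma mean_slope_close:
  assumes P: "P \<in> partitions_upto n" and a: "0 < a" "a < 1" and x: "0 < x" "x < 1"
    and m: "0 < m" "m \<le> x" "m \<le> 1 - x"
  shows "\<bar>block_sum (\<lambda>u. \<Sum>i<u. 1 / ((real i - a) * (real i - x))) P - block_sum (info a) P\<bar> \<le> \<bar>x - a\<bar> / m * block_sum (info a) P"
proof -
  have "\<bar>block_sum (\<lambda>u. (\<Sum>i<u. 1 / ((real i - a) * (real i - x))) - info a u) P\<bar> \<le> block_sum (\<lambda>u. \<bar>x - a\<bar> / m * info a u) P"
  proof (rule abs_block_sum_le[OF P])
    fix u :: nat
    have "\<bar>(\<Sum>i<u. 1 / ((real i - a) * (real i - x))) - info a u\<bar> = \<bar>\<Sum>i<u. 1 / ((real i - a) * (real i - x)) - 1 / (real i - a)\<^sup>2\<bar>"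
      by (simp add: info_def sum_subtractf)
    also have "\<dots> \<le> (\<Sum>i<u. \<bar>1 / ((real i - a) * (real i - x)) - 1 / (real i - a)\<^sup>2\<bar>)"
      by (rule sum_abs)
    also have "\<dots> \<le> (\<Sum>i<u. \<bar>x - a\<bar> / m * (1 / (real i - a)\<^sup>2))"
    proof (rule sum_mono)
      fix i
      have ne: "real i - a \<noteq> 0" using a by (cases i) auto
      have ge: "m \<le> \<bar>real i - x\<bar>" using x m by (cases i) auto
      then have ne2: "real i - x \<noteq> 0" using m by auto
      have "1 / ((real i - a) * (real i - x)) - 1 / (real i - a)\<^sup>2 = (x - a) / (real i - x) * (1 / (real i - a)\<^sup>2)"
        using ne ne2 by (simp add: divide_simps power2_eq_square)
      then have "\<bar>1 / ((real i - a) * (real i - x)) - 1 / (real i - a)\<^sup>2\<bar> = \<bar>x - a\<bar> / \<bar>real i - x\<bar> * (1 / (real i - a)\<^sup>2)"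
        by (simp add: abs_mult)
      also have "\<dots> \<le> \<bar>x - a\<bar> / m * (1 / (real i - a)\<^sup>2)"
        using ge m by (intro mult_right_mono divide_left_mono) auto
      finally show "\<bar>1 / ((real i - a) * (real i - x)) - 1 / (real i - a)\<^sup>2\<bar> \<le> \<bar>x - a\<bar> / m * (1 / (real i - a)\<^sup>2)" .
    qed
    finally show "\<bar>(\<Sum>i<u. 1 / ((real i - a) * (real i - x))) - info a u\<bar> \<le> \<bar>x - a\<bar> / m * info a u"
      by (simp add: info_def sum_distrib_left)
  qed
  then show ?thesis by (simp only: block_sum_simps)
qed

context ewens_pitman_process
begin

lemma tends_in_prob_over_sqrt_norming:
  assumes "(\<lambda>n. (f n)\<^sup>2 * ((1 + ln (real n)) / real n powr \<alpha>)) \<longlonglongrightarrow> 0"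
  shows "tends_in_prob (\<lambda>n P. f n / sqrt (norming n P)) 0"
proof (rule tends_in_prob_eventually)
  fix \<epsilon> :: real assume e: "\<epsilon> > 0"
  from predicted_count_large[OF assms, of "\<epsilon>\<^sup>2 * tail_info \<alpha>"] e tail_info_pos
  have "\<forall>\<^sub>F n in sequentially. \<forall>P\<in>partitions_upto n. 0 < predicted_count n P \<and> \<bar>(f n)\<^sup>2\<bar> < \<epsilon>\<^sup>2 * tail_info \<alpha> * predicted_count n P"
    by simp
  then show "\<forall>\<^sub>F n in sequentially. \<forall>P\<in>partitions_upto n. dist (f n / sqrt (norming n P)) 0 < \<epsilon>"
  proof eventually_elim
    case (elim n)
    show ?case
    proof
      fix P assume P: "P \<in> partitions_upto n"
      have pos: "norming n P > 0" and lt: "(f n)\<^sup>2 < \<epsilon>\<^sup>2 * norming n P"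
        using elim P tail_info_pos by (auto simp: norming_def mult.assoc)
      have "\<bar>f n\<bar>\<^sup>2 < (\<epsilon> * sqrt (norming n P))\<^sup>2"
        using lt pos by (simp add: power_mult_distrib)
      then have "\<bar>f n\<bar> < \<epsilon> * sqrt (norming n P)"
        by (rule power2_less_imp_less) (use e pos in auto)
      then show "dist (f n / sqrt (norming n P)) 0 < \<epsilon>"
        using pos by (simp add: abs_divide divide_less_eq)
    qed
  qed
qed

lemma tends_in_prob_inverse:
  fixes f :: "nat \<Rightarrow> nat set set \<Rightarrow> real"
  assumes "tends_in_prob f l" "l \<noteq> 0"
  shows "tends_in_prob (\<lambda>n P. 1 / f n P) (1 / l)"
  by (rule tends_in_prob_cont[OF assms(1), of "\<lambda>x. 1 / x"]) (use assms(2) in \<open>intro continuous_intros\<close>)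

lemma tends_in_prob_sqrt:
  fixes f :: "nat \<Rightarrow> nat set set \<Rightarrow> real"
  assumes "tends_in_prob f l"
  shows "tends_in_prob (\<lambda>n P. sqrt (f n P)) (sqrt l)"
  by (rule tends_in_prob_cont[OF assms]) (intro continuous_intros)

lemma tends_in_prob_norming_count: "tends_in_prob (\<lambda>n P. norming n P / real (card P)) (tail_info \<alpha>)"
proof (rule tends_in_prob_cong)
  show "tends_in_prob (\<lambda>n P. tail_info \<alpha> * (1 / (real (card P) / predicted_count n P))) (tail_info \<alpha>)"
    using tends_in_prob_mult[OF tends_in_prob_const tends_in_prob_inverse[OF tends_in_prob_count], of "tail_info \<alpha>"] by simp
  show "whp (\<lambda>n P. tail_info \<alpha> * (1 / (real (card P) / predicted_count n P)) = norming n P / real (card P))"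
    by (rule whp_mono[OF whp_card_pos]) (auto simp: norming_def intro!: always_eventually)
qed

lemma whp_norming_pos: "whp (\<lambda>n P. norming n P > 0)"
  by (rule whp_eventually, use norming_large[OF zero_less_one] in eventually_elim) auto

lemma tends_in_prob_score_count: "tends_in_prob (\<lambda>n P. total_score P / real (card P)) 0"
proof (rule tends_in_prob_cong)
  have "(\<lambda>n. 1\<^sup>2 * ((1 + ln (real n)) / real n powr \<alpha>)) \<longlonglongrightarrow> 0"
    using alpha_pos by real_asymp
  then have "tends_in_prob (\<lambda>n P. 1 / sqrt (norming n P)) 0"
    by (rule tends_in_prob_over_sqrt_norming)
  from tends_in_prob_mult[OF tends_in_prob_norming_count this]
  have "tends_in_prob (\<lambda>n P. norming n P / real (card P) * (1 / sqrt (norming n P))) 0" by simp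
  then show "tends_in_prob (\<lambda>n P. norming n P / real (card P) * (1 / sqrt (norming n P)) * (total_score P / sqrt (norming n P))) 0"
    by (rule tends_in_prob_tight_mult[OF _ tight_score])
  show "whp (\<lambda>n P. norming n P / real (card P) * (1 / sqrt (norming n P)) * (total_score P / sqrt (norming n P)) = total_score P / real (card P))"
  proof (rule whp_mono[OF whp_norming_pos], intro always_eventually allI ballI impI)
    fix n P assume pos: "norming n P > 0"
    then have "norming n P = sqrt (norming n P) * sqrt (norming n P)" "sqrt (norming n P) \<noteq> 0" by auto
    then show "norming n P / real (card P) * (1 / sqrt (norming n P)) * (total_score P / sqrt (norming n P)) = total_score P / real (card P)"
      by (simp add: divide_simps)
  qed
qed

text \<open>
  The share of blocks that are not singletons tends to \<open>1 - \<alpha>\<close>, the Sibuya tail at \<open>1\<close>; half of it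
  is kept as a margin.
\<close>

lemma whp_typical_partition:
  assumes "\<delta> > 0"
  shows "whp (typical_partition \<alpha> \<delta>)"
proof -
  have s: "whp (\<lambda>n P. dist (total_score P / real (card P)) 0 < \<delta> / 2)"
    using tends_in_prob_score_count[unfolded tends_in_prob_def, rule_format, of "\<delta> / 2"] assms by simp
  have t: "whp (\<lambda>n P. \<bar>tail_deviation 1 P\<bar> \<le> (1 - \<alpha>) / 2 * real (card P))"
    using alpha_less_1 by (intro whp_tail_deviation) simp
  have l: "whp (\<lambda>n P. real n powr (\<alpha> - \<delta> / 2) \<le> real (card P))"
    using assms by (intro whp_count_lower) simp
  have u: "whp (\<lambda>n P. real (card P) \<le> real n powr (\<alpha> + \<delta> / 2))"
    using assms by (intro whp_count_upper) simp
  show ?thesis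
  proof (rule whp_mono[OF whp_conj[OF whp_conj[OF l u] whp_conj[OF whp_conj[OF s t] whp_card_pos]]],
      intro always_eventually allI ballI impI)
    fix n P assume P: "P \<in> partitions_upto n"
      and *: "(real n powr (\<alpha> - \<delta> / 2) \<le> real (card P) \<and> real (card P) \<le> real n powr (\<alpha> + \<delta> / 2)) \<and>
        (dist (total_score P / real (card P)) 0 < \<delta> / 2 \<and> \<bar>tail_deviation 1 P\<bar> \<le> (1 - \<alpha>) / 2 * real (card P)) \<and> 0 < real (card P)"
    have K: "0 < real (card P)" using * by auto
    have "\<bar>total_score P\<bar> / real (card P) < \<delta> / 2" using * K by (simp add: abs_divide)
    then have 1: "\<bar>block_sum (score \<alpha>) P\<bar> \<le> \<delta> / 2 * real (card P)"
      using pos_divide_less_eq[OF K] by (simp add: total_score_def)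
    have "tail_deviation 1 P = real (card {U \<in> P. card U \<ge> 2}) - (1 - \<alpha>) * real (card P)"
    proof -
      have "block_sum (\<lambda>u. of_bool (1 < u)) P = real (card {U \<in> P. card U \<ge> 2})"
        using partitions_uptoD(1)[OF P] by (simp add: block_sum_def Int_def Suc_le_eq numeral_2_eq_2)
      then show ?thesis
        by (simp add: tail_deviation_def block_sum_simps sibuya_tail_def algebra_simps)
    qed
    moreover have "(1 - \<alpha>) * real (card P) = (1 - \<alpha>) / 2 * real (card P) + (1 - \<alpha>) / 2 * real (card P)"
      by (simp add: field_simps)
    ultimately have "(1 - \<alpha>) / 2 * real (card P) \<le> real (card {U \<in> P. card U \<ge> 2})"
      using * by linarith
    then show "typical_partition \<alpha> \<delta> n P"
      using * 1 by (simp add: typical_partition_def)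
  qed
qed

lemma whp_estimate:
  assumes est: "is_mle est" and d: "0 < \<delta>" "\<delta> \<le> \<alpha> * (1 - \<alpha>) / 64"
  shows "whp (\<lambda>n P. \<bar>fst (est n P) - \<alpha>\<bar> < \<delta> \<and>
    \<bar>fst (est n P) * block_sum (score (fst (est n P))) P\<bar> \<le> real n powr (\<alpha> / 4) \<and> 0 < fst (est n P) \<and> fst (est n P) < 1)"
proof (rule whp_mono[OF whp_typical_partition[OF d(1)]])
  show "\<forall>\<^sub>F n in sequentially. \<forall>P\<in>partitions_upto n. typical_partition \<alpha> \<delta> n P \<longrightarrow>
    \<bar>fst (est n P) - \<alpha>\<bar> < \<delta> \<and> \<bar>fst (est n P) * block_sum (score (fst (est n P))) P\<bar> \<le> real n powr (\<alpha> / 4) \<and> 0 < fst (est n P) \<and> fst (est n P) < 1"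
    using eventually_large_sample[OF alpha_pos alpha_less_1 d] eventually_ge_at_top[of 1]
  proof eventually_elim
    case (elim n)
    show ?case
    proof (intro ballI impI)
      fix P assume P: "P \<in> partitions_upto n" and T: "typical_partition \<alpha> \<delta> n P"
      have "is_likelihood_maximizer n P (est n P)"
        using est[unfolded is_mle_def, rule_format, OF elim(2) P] maximizer_exists[OF alpha_pos alpha_less_1 d elim(1) T P] by blast
      from maximizer_location[OF alpha_pos alpha_less_1 d elim(1) T P this]
      show "\<bar>fst (est n P) - \<alpha>\<bar> < \<delta> \<and> \<bar>fst (est n P) * block_sum (score (fst (est n P))) P\<bar> \<le> real n powr (\<alpha> / 4) \<and> 0 < fst (est n P) \<and> fst (est n P) < 1"
        by blast
    qed
  qed
qed

lemma consistent_estimate: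
  assumes "is_mle est"
  shows "tends_in_prob (\<lambda>n P. fst (est n P)) \<alpha>"
  unfolding tends_in_prob_def
proof (intro allI impI)
  fix \<epsilon> :: real assume e: "\<epsilon> > 0"
  define \<delta> where "\<delta> = min \<epsilon> (\<alpha> * (1 - \<alpha>) / 64)"
  have d: "0 < \<delta>" "\<delta> \<le> \<alpha> * (1 - \<alpha>) / 64" "\<delta> \<le> \<epsilon>"
    using e alpha_pos alpha_less_1 by (auto simp: \<delta>_def)
  show "whp (\<lambda>n P. dist (fst (est n P)) \<alpha> < \<epsilon>)"
    by (rule whp_mono[OF whp_estimate[OF assms d(1,2)]]) (use d(3) in \<open>auto simp: dist_real_def intro!: always_eventually\<close>)
qed

text \<open>
  Let \<open>x\<close> be the estimate. The score changes between \<open>\<alpha>\<close> and \<open>x\<close> by \<open>x - \<alpha>\<close> times a mean slope, which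
  is asymptotically the information and hence the norming; the score at \<open>x\<close> itself is negligible. The
  information is replaced by any consistent \<open>V\<close>, to cover both the known constant and its estimate.
\<close>

theorem estimator_linearization:
  assumes est: "is_mle est" and V: "tends_in_prob V (tail_info \<alpha>)"
  shows "tends_in_prob (\<lambda>n P. sqrt (V n P * real (card P)) * (fst (est n P) - \<alpha>) - total_score P / sqrt (norming n P)) 0"
proof -
  define x where "x n P = fst (est n P)" for n P
  define Q where "Q n P = block_sum (\<lambda>u. \<Sum>i<u. 1 / ((real i - \<alpha>) * (real i - x n P))) P" for n P
  define \<delta> where "\<delta> = \<alpha> * (1 - \<alpha>) / 64"
  define m where "m = min (\<alpha> / 2) ((1 - \<alpha>) / 2)"
  have aa: "0 < \<alpha> * (1 - \<alpha>)" "\<alpha> * (1 - \<alpha>) < \<alpha>" "\<alpha> * (1 - \<alpha>) < 1 - \<alpha>"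
    using alpha_pos alpha_less_1 mult_strict_left_mono[of "1 - \<alpha>" 1 \<alpha>] mult_strict_right_mono[of \<alpha> 1 "1 - \<alpha>"] by auto
  have m: "m > 0" using alpha_pos alpha_less_1 by (simp add: m_def)
  have d: "0 < \<delta>" "\<delta> \<le> \<alpha> * (1 - \<alpha>) / 64" using aa by (auto simp: \<delta>_def)
  have near: "whp (\<lambda>n P. (0 < x n P \<and> x n P < 1 \<and> m \<le> x n P \<and> m \<le> 1 - x n P) \<and> \<bar>x n P * block_sum (score (x n P)) P\<bar> \<le> real n powr (\<alpha> / 4))"
  proof (rule whp_mono[OF whp_estimate[OF est d]], intro always_eventually allI ballI impI)
    fix n P
    assume *: "\<bar>fst (est n P) - \<alpha>\<bar> < \<delta> \<and> \<bar>fst (est n P) * block_sum (score (fst (est n P))) P\<bar> \<le> real n powr (\<alpha> / 4) \<and> 0 < fst (est n P) \<and> fst (est n P) < 1"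
    then have "\<bar>x n P - \<alpha>\<bar> < \<delta>" by (simp add: x_def)
    then have "\<alpha> - \<delta> < x n P" "x n P < \<alpha> + \<delta>" by (auto simp: abs_less_iff)
    moreover have "m \<le> \<alpha> / 2" "m \<le> (1 - \<alpha>) / 2"
      unfolding m_def by (rule min.cobounded1, rule min.cobounded2)
    moreover have "\<delta> \<le> \<alpha> / 2" "\<delta> \<le> (1 - \<alpha>) / 2" using aa by (auto simp: \<delta>_def)
    ultimately have "m \<le> x n P" "m \<le> 1 - x n P"
      by (auto simp: field_simps)
    then show "(0 < x n P \<and> x n P < 1 \<and> m \<le> x n P \<and> m \<le> 1 - x n P) \<and> \<bar>x n P * block_sum (score (x n P)) P\<bar> \<le> real n powr (\<alpha> / 4)"
      using * by (simp add: x_def)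
  qed
  have x_lim: "tends_in_prob x \<alpha>"
    using consistent_estimate[OF est] unfolding x_def .
  have J_pos: "whp (\<lambda>n P. total_info P > 0 \<and> norming n P > 0)"
  proof (rule whp_mono[OF whp_conj[OF _ whp_norming_pos]])
    show "whp (\<lambda>n P. dist (total_info P / norming n P) 1 < 1)"
      using tends_in_prob_info_norming by (auto simp: tends_in_prob_def)
    show "\<forall>\<^sub>F n in sequentially. \<forall>P\<in>partitions_upto n. dist (total_info P / norming n P) 1 < 1 \<and> 0 < norming n P \<longrightarrow> 0 < total_info P \<and> 0 < norming n P"
    proof (intro always_eventually allI ballI impI)
      fix n P assume *: "dist (total_info P / norming n P) 1 < 1 \<and> 0 < norming n P"
      then have "0 < total_info P / norming n P" unfolding dist_real_def by linarith
      then show "0 < total_info P \<and> 0 < norming n P" using * by (simp add: zero_less_divide_iff)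
    qed
  qed
  have QJ: "tends_in_prob (\<lambda>n P. Q n P / total_info P - 1) 0"
  proof (rule tends_in_prob_bounded_by)
    have "isCont (\<lambda>x. \<bar>x - \<alpha>\<bar> / m) \<alpha>" by (intro continuous_intros) (use m in simp)
    from tends_in_prob_cont[OF x_lim this] show "tends_in_prob (\<lambda>n P. \<bar>x n P - \<alpha>\<bar> / m) 0" by simp
    show "whp (\<lambda>n P. norm (Q n P / total_info P - 1) \<le> \<bar>x n P - \<alpha>\<bar> / m)"
    proof (rule whp_mono[OF whp_conj[OF near J_pos]], intro always_eventually allI ballI impI)
      fix n P assume P: "P \<in> partitions_upto n"
        and *: "((0 < x n P \<and> x n P < 1 \<and> m \<le> x n P \<and> m \<le> 1 - x n P) \<and> \<bar>x n P * block_sum (score (x n P)) P\<bar> \<le> real n powr (\<alpha> / 4)) \<and>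
          total_info P > 0 \<and> norming n P > 0"
      have J: "total_info P > 0" using * by simp
      have "\<bar>Q n P - total_info P\<bar> \<le> \<bar>x n P - \<alpha>\<bar> / m * total_info P"
        unfolding Q_def total_info_def by (rule mean_slope_close[OF P alpha_pos alpha_less_1]) (use * m in auto)
      then have "\<bar>Q n P - total_info P\<bar> / total_info P \<le> \<bar>x n P - \<alpha>\<bar> / m"
        using J by (simp only: pos_divide_le_eq)
      moreover have "Q n P / total_info P - 1 = (Q n P - total_info P) / total_info P"
        using J by (simp add: diff_divide_distrib)
      ultimately show "norm (Q n P / total_info P - 1) \<le> \<bar>x n P - \<alpha>\<bar> / m"
        using J by (simp add: abs_divide)
    qed
  qed
  have QJ1: "tends_in_prob (\<lambda>n P. Q n P / total_info P) 1"
    using tends_in_prob_add[OF QJ tends_in_prob_const[of 1]] by simp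
  have Q_pos: "whp (\<lambda>n P. Q n P > 0)"
  proof (rule whp_mono[OF whp_conj[OF _ J_pos]])
    show "whp (\<lambda>n P. dist (Q n P / total_info P) 1 < 1)"
      using QJ1 by (auto simp: tends_in_prob_def)
    show "\<forall>\<^sub>F n in sequentially. \<forall>P\<in>partitions_upto n. dist (Q n P / total_info P) 1 < 1 \<and> 0 < total_info P \<and> 0 < norming n P \<longrightarrow> 0 < Q n P"
    proof (intro always_eventually allI ballI impI)
      fix n P assume *: "dist (Q n P / total_info P) 1 < 1 \<and> 0 < total_info P \<and> 0 < norming n P"
      then have "0 < Q n P / total_info P" unfolding dist_real_def by linarith
      then show "0 < Q n P" using * by (simp add: zero_less_divide_iff)
    qed
  qed
  \<comment> \<open>The exact ratio between the normalized error and the normalized score difference; it tends to one.\<close>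
  define B where "B n P = sqrt (V n P * (1 / (total_info P / real (card P)))) * sqrt (1 / (total_info P / norming n P)) * (1 / (Q n P / total_info P))" for n P
  have B1: "tends_in_prob B 1"
  proof -
    have "tends_in_prob B (sqrt (tail_info \<alpha> * (1 / tail_info \<alpha>)) * sqrt (1 / 1) * (1 / 1))"
      unfolding B_def using tail_info_pos
      by (intro tends_in_prob_mult tends_in_prob_sqrt tends_in_prob_inverse V QJ1 tends_in_prob_info tends_in_prob_info_norming) auto
    then show ?thesis using tail_info_pos by simp
  qed
  \<comment> \<open>The score at the estimate, which is at most \<open>n powr (\<alpha> / 4) / m\<close>.\<close>
  define R where "R n P = block_sum (score (x n P)) P / sqrt (norming n P)" for n P
  have R0: "tends_in_prob R 0"
  proof (rule tends_in_prob_bounded_by)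
    have "(\<lambda>n. (real n powr (\<alpha> / 4) / m)\<^sup>2 * ((1 + ln (real n)) / real n powr \<alpha>)) \<longlonglongrightarrow> 0"
      using alpha_pos m by real_asymp
    then show "tends_in_prob (\<lambda>n P. (real n powr (\<alpha> / 4) / m) / sqrt (norming n P)) 0"
      by (rule tends_in_prob_over_sqrt_norming)
    show "whp (\<lambda>n P. norm (R n P) \<le> (real n powr (\<alpha> / 4) / m) / sqrt (norming n P))"
    proof (rule whp_mono[OF whp_conj[OF near J_pos]], intro always_eventually allI ballI impI)
      fix n P assume P: "P \<in> partitions_upto n"
        and *: "((0 < x n P \<and> x n P < 1 \<and> m \<le> x n P \<and> m \<le> 1 - x n P) \<and> \<bar>x n P * block_sum (score (x n P)) P\<bar> \<le> real n powr (\<alpha> / 4)) \<and>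
          total_info P > 0 \<and> norming n P > 0"
      let ?S = "block_sum (score (x n P)) P"
      have "m * \<bar>?S\<bar> \<le> x n P * \<bar>?S\<bar>" using * by (intro mult_right_mono) auto
      also have "\<dots> = \<bar>x n P * ?S\<bar>" using * by (simp add: abs_mult)
      also have "\<dots> \<le> real n powr (\<alpha> / 4)" using * by blast
      finally have "\<bar>?S\<bar> \<le> real n powr (\<alpha> / 4) / m" using m by (simp add: pos_le_divide_eq mult.commute)
      then have "\<bar>?S\<bar> / \<bar>sqrt (norming n P)\<bar> \<le> (real n powr (\<alpha> / 4) / m) / \<bar>sqrt (norming n P)\<bar>"
        by (rule divide_right_mono) simp
      moreover have "\<bar>sqrt (norming n P)\<bar> = sqrt (norming n P)" using * by simp
      ultimately show "norm (R n P) \<le> (real n powr (\<alpha> / 4) / m) / sqrt (norming n P)"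
        by (simp only: R_def real_norm_def abs_divide)
    qed
  qed
  have "tends_in_prob (\<lambda>n P. (B n P - 1) * (total_score P / sqrt (norming n P)) + - 1 * (B n P * R n P)) (0 + - 1 * (1 * 0))"
    using tends_in_prob_add[OF B1 tends_in_prob_const[of "- 1"]]
    by (intro tends_in_prob_add tends_in_prob_mult tends_in_prob_tight_mult[OF _ tight_score] B1 R0 tends_in_prob_const) simp
  then have lim: "tends_in_prob (\<lambda>n P. (B n P - 1) * (total_score P / sqrt (norming n P)) + - 1 * (B n P * R n P)) 0" by simp
  show ?thesis
  proof (rule tends_in_prob_cong[OF lim], rule whp_mono[OF whp_conj[OF whp_conj[OF near J_pos] whp_conj[OF Q_pos whp_card_pos]]],
      intro always_eventually allI ballI impI)
    fix n P assume P: "P \<in> partitions_upto n"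
      and *: "(((0 < x n P \<and> x n P < 1 \<and> m \<le> x n P \<and> m \<le> 1 - x n P) \<and> \<bar>x n P * block_sum (score (x n P)) P\<bar> \<le> real n powr (\<alpha> / 4)) \<and>
          total_info P > 0 \<and> norming n P > 0) \<and> Q n P > 0 \<and> 0 < real (card P)"
    define J N q K where "J = total_info P" and "N = norming n P" and "q = Q n P" and "K = real (card P)"
    have pos: "J > 0" "N > 0" "q > 0" "K > 0" using * by (auto simp: J_def N_def q_def K_def)
    have slope: "total_score P - block_sum (score (x n P)) P = (x n P - \<alpha>) * q"
      unfolding total_score_def q_def Q_def by (rule score_difference) (use * alpha_pos alpha_less_1 in auto)
    have "B n P = sqrt (V n P * K / J) * sqrt (N / J) * (J / q)"
      by (simp add: B_def J_def N_def q_def K_def)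
    also have "\<dots> = sqrt (V n P * K) * sqrt N / q"
      using pos by (simp add: real_sqrt_divide divide_simps)
    finally have B: "B n P = sqrt (V n P * K) * sqrt N / q" .
    have "sqrt (V n P * K) * (x n P - \<alpha>) = B n P * ((total_score P - block_sum (score (x n P)) P) / sqrt N)"
      unfolding slope B using pos by simp
    then have "sqrt (V n P * K) * (x n P - \<alpha>) = B n P * (total_score P / sqrt N) - B n P * R n P"
      by (simp add: R_def N_def diff_divide_distrib right_diff_distrib)
    then show "(B n P - 1) * (total_score P / sqrt (norming n P)) + - 1 * (B n P * R n P)
      = sqrt (V n P * real (card P)) * (fst (est n P) - \<alpha>) - total_score P / sqrt (norming n P)"
      by (simp add: K_def N_def x_def left_diff_distrib diff_divide_distrib)
  qed
qed

end

section \<open>Weak limits on events\<close>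

lemma norm_iexp_diff_le: "norm (iexp a - iexp b) \<le> \<bar>a - b\<bar>"
proof -
  have "iexp a - iexp b = iexp b * (iexp (a - b) - 1)"
    by (simp add: right_diff_distrib flip: exp_add)
  also have "norm \<dots> = norm (iexp (a - b) - 1)"
    by (simp add: norm_mult)
  also have "\<dots> \<le> \<bar>a - b\<bar>"
    using iexp_approx1[of "a - b" 0] by simp
  finally show ?thesis .
qed

lemma integral_uniform_measure_event:
  fixes f :: "'a \<Rightarrow> 'b::{banach, second_countable_topology}"
  assumes M: "prob_space M" and A [measurable]: "A \<in> sets M" and pos: "measure M A > 0" and f [measurable]: "f \<in> borel_measurable M"
  shows "(LINT \<omega>|uniform_measure M A. f \<omega>) = (1 / measure M A) *\<^sub>R (LINT \<omega>:A|M. f \<omega>)"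
proof -
  interpret prob_space M by fact
  have U: "uniform_measure M A = density M (\<lambda>\<omega>. ennreal (indicator A \<omega> / prob A))"
    unfolding uniform_measure_def using pos
    by (intro density_cong) (auto simp: emeasure_eq_measure divide_ennreal ennreal_indicator[symmetric])
  have "(LINT \<omega>|uniform_measure M A. f \<omega>) = (LINT \<omega>|M. (indicator A \<omega> / prob A) *\<^sub>R f \<omega>)"
    unfolding U by (subst integral_density) auto
  also have "\<dots> = (LINT \<omega>|M. (1 / prob A) *\<^sub>R (indicator A \<omega> *\<^sub>R f \<omega>))"
    by simp
  also have "\<dots> = (1 / prob A) *\<^sub>R (LINT \<omega>|M. indicator A \<omega> *\<^sub>R f \<omega>)"
    by (rule integral_scaleR_right)
  finally show ?thesis by (simp add: set_lebesgue_integral_def)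
qed

text \<open>
  Conditioning on \<open>A\<close> divides the characteristic functions by the probability of \<open>A\<close>, so this is Levy's
  continuity theorem for the conditional laws.
\<close>

lemma weak_limit_on_event:
  fixes Y :: "nat \<Rightarrow> 'a \<Rightarrow> real"
  assumes M: "prob_space M" and A: "A \<in> sets M" and Y: "\<And>n. Y n \<in> borel_measurable M"
    and char: "\<And>t. (\<lambda>n. LINT \<omega>:A|M. iexp (t * Y n \<omega>)) \<longlonglongrightarrow> of_real (exp (- t\<^sup>2 / 2)) * of_real (measure M A)"
    and pos: "measure M A > 0"
  shows "weak_conv_m (\<lambda>n. distr (uniform_measure M A) borel (Y n)) std_normal_distribution"
proof -
  interpret prob_space M by fact
  have ne: "emeasure M A \<noteq> 0" "emeasure M A \<noteq> \<infinity>"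
    using pos by (auto simp: emeasure_eq_measure)
  interpret U: prob_space "uniform_measure M A"
    by (rule prob_space_uniform_measure[OF ne])
  have meas: "Y n \<in> borel_measurable (uniform_measure M A)" for n
    using Y by simp
  have ch: "char (distr (uniform_measure M A) borel (Y n)) t = of_real (1 / prob A) * (LINT \<omega>:A|M. iexp (t * Y n \<omega>))" for n t
  proof -
    have "char (distr (uniform_measure M A) borel (Y n)) t = (CLINT \<omega>|uniform_measure M A. iexp (t * Y n \<omega>))"
      unfolding char_def by (subst integral_distr[OF meas]) auto
    also have "\<dots> = (1 / prob A) *\<^sub>R (LINT \<omega>:A|M. iexp (t * Y n \<omega>))"
      by (rule integral_uniform_measure_event[OF M A pos]) (use Y in auto)
    finally show ?thesis by (simp only: scaleR_conv_of_real)
  qed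
  show ?thesis
  proof (rule levy_continuity)
    show "real_distribution (distr (uniform_measure M A) borel (Y n))" for n
      by (rule U.real_distribution_distr[OF meas])
    show "real_distribution std_normal_distribution" by (rule real_dist_normal_dist)
    fix t
    have "(\<lambda>n. of_real (1 / prob A) * (LINT \<omega>:A|M. iexp (t * Y n \<omega>))) \<longlonglongrightarrow> of_real (1 / prob A) * (of_real (exp (- t\<^sup>2 / 2)) * of_real (prob A))"
      by (intro tendsto_mult_left char)
    then show "(\<lambda>n. char (distr (uniform_measure M A) borel (Y n)) t) \<longlonglongrightarrow> char std_normal_distribution t"
      unfolding ch char_std_normal_distribution using pos by simp
  qed
qed

lemma event_integral_limit:
  fixes Y :: "nat \<Rightarrow> 'a \<Rightarrow> real" and h :: "real \<Rightarrow> real"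
  assumes M: "prob_space M" and A: "A \<in> sets M" and Y: "\<And>n. Y n \<in> borel_measurable M"
    and char: "\<And>t. (\<lambda>n. LINT \<omega>:A|M. iexp (t * Y n \<omega>)) \<longlonglongrightarrow> of_real (exp (- t\<^sup>2 / 2)) * of_real (measure M A)"
    and h: "\<And>x. isCont h x" "\<And>x. \<bar>h x\<bar> \<le> B"
  shows "(\<lambda>n. LINT \<omega>:A|M. h (Y n \<omega>)) \<longlonglongrightarrow> measure M A * (LINT x|std_normal_distribution. h x)"
proof (cases "measure M A = 0")
  case True
  interpret prob_space M by fact
  have "AE \<omega> in M. \<omega> \<notin> A" using True A by (simp add: prob_eq_0)
  then have "(LINT \<omega>:A|M. h (Y n \<omega>)) = (LINT \<omega>|M. 0)" for n
    unfolding set_lebesgue_integral_def using A Y h(1)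
    by (intro integral_cong_AE borel_measurable_scaleR borel_measurable_indicator measurable_compose[OF Y] borel_measurable_continuous_onI continuous_at_imp_continuous_on) auto
  then show ?thesis using True by simp
next
  case False
  then have pos: "measure M A > 0" using measure_nonneg[of M A] by linarith
  interpret prob_space M by fact
  have ne: "emeasure M A \<noteq> 0" "emeasure M A \<noteq> \<infinity>"
    using pos by (auto simp: emeasure_eq_measure)
  interpret U: prob_space "uniform_measure M A"
    by (rule prob_space_uniform_measure[OF ne])
  have hm: "h \<in> borel_measurable borel"
    using h(1) by (intro borel_measurable_continuous_onI continuous_at_imp_continuous_on) auto
  have meas: "Y n \<in> borel_measurable (uniform_measure M A)" for n
    using Y by simp
  have "(\<lambda>n. LINT x|distr (uniform_measure M A) borel (Y n). h x) \<longlonglongrightarrow> (LINT x|std_normal_distribution. h x)"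
    by (rule weak_conv_imp_integral_bdd_continuous_conv[OF U.real_distribution_distr[OF meas] real_dist_normal_dist
          weak_limit_on_event[OF M A Y char pos] h(1)]) (use h(2) in auto)
  then have "(\<lambda>n. prob A * (LINT x|distr (uniform_measure M A) borel (Y n). h x)) \<longlonglongrightarrow> prob A * (LINT x|std_normal_distribution. h x)"
    by (rule tendsto_mult_left)
  moreover have "prob A * (LINT x|distr (uniform_measure M A) borel (Y n). h x) = (LINT \<omega>:A|M. h (Y n \<omega>))" for n
  proof -
    have "(LINT x|distr (uniform_measure M A) borel (Y n). h x) = (LINT \<omega>|uniform_measure M A. h (Y n \<omega>))"
      by (rule integral_distr[OF meas hm])
    also have "\<dots> = (1 / prob A) *\<^sub>R (LINT \<omega>:A|M. h (Y n \<omega>))"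
      by (rule integral_uniform_measure_event[OF M A pos measurable_compose[OF Y hm]])
    finally show ?thesis using pos by simp
  qed
  ultimately show ?thesis by simp
qed

text \<open>
  The sets for which the limit holds form a Dynkin system. For countable disjoint unions the limit and
  the sum are exchanged by Tannery's theorem with the summable bound \<open>B * measure M (A i)\<close>.
\<close>

lemma set_limit_sigma_sets:
  fixes g :: "nat \<Rightarrow> 'a \<Rightarrow> real"
  assumes M: "prob_space M" and g: "\<And>n. g n \<in> borel_measurable M" "\<And>n \<omega>. \<bar>g n \<omega>\<bar> \<le> B"
    and G: "Int_stable G" "G \<subseteq> sets M" "space M \<in> G"
    and basic: "\<And>A. A \<in> G \<Longrightarrow> (\<lambda>n. LINT \<omega>:A|M. g n \<omega>) \<longlonglongrightarrow> measure M A * c"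
    and A: "A \<in> sigma_sets (space M) G"
  shows "(\<lambda>n. LINT \<omega>:A|M. g n \<omega>) \<longlonglongrightarrow> measure M A * c"
proof -
  interpret prob_space M by fact
  have sub: "sigma_sets (space M) G \<subseteq> sets M"
    by (rule sets.sigma_sets_subset[OF G(2)])
  have int: "set_integrable M S (g n)" if "S \<in> sets M" for S n
    unfolding set_integrable_def
    by (rule integrable_mult_indicator[OF that]) (use g in \<open>auto intro!: integrable_const_bound[where B = B]\<close>)
  have B: "B \<ge> 0" using g(2) abs_ge_zero order_trans by blast
  have closed: "G \<subseteq> Pow (space M)" using G(2) sets.sets_into_space by blast
  show ?thesis
    using G(1) closed A
  proof (induction A rule: sigma_sets_induct_disjoint)
    case (basic A)
    then show ?case by (rule assms(7))
  next
    case empty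
    then show ?case by (simp add: set_lebesgue_integral_def)
  next
    case (compl A)
    then have A: "A \<in> sets M" using sub by blast
    have "(LINT \<omega>:space M - A|M. g n \<omega>) = (LINT \<omega>:space M|M. g n \<omega>) - (LINT \<omega>:A|M. g n \<omega>)" for n
    proof -
      have "(LINT \<omega>:(space M - A) \<union> A|M. g n \<omega>) = (LINT \<omega>:space M - A|M. g n \<omega>) + (LINT \<omega>:A|M. g n \<omega>)"
        by (rule set_integral_Un) (use A int in auto)
      moreover have "(space M - A) \<union> A = space M" using sets.sets_into_space[OF A] by auto
      ultimately show ?thesis by simp
    qed
    moreover have "(\<lambda>n. (LINT \<omega>:space M|M. g n \<omega>) - (LINT \<omega>:A|M. g n \<omega>)) \<longlonglongrightarrow> measure M (space M) * c - measure M A * c"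
      by (intro tendsto_diff assms(7) G(3) compl)
    moreover have "measure M (space M) * c - measure M A * c = measure M (space M - A) * c"
      using prob_compl[OF A] by (simp add: prob_space left_diff_distrib)
    ultimately show ?case by simp
  next
    case (union A)
    then have A: "A i \<in> sets M" for i using sub by blast
    have eq: "(LINT \<omega>:(\<Union>i. A i)|M. g n \<omega>) = (\<Sum>i. LINT \<omega>:A i|M. g n \<omega>)" for n
      by (rule lebesgue_integral_countable_add) (use A union(1) int in \<open>auto simp: disjoint_family_on_def\<close>)
    have sums: "(\<lambda>i. measure M (A i)) sums measure M (\<Union>i. A i)"
      by (rule finite_measure_UNION) (use A union(1) in auto)
    have bound: "\<bar>LINT \<omega>:A i|M. g n \<omega>\<bar> \<le> B * measure M (A i)" for i n
    proof -
      have "\<bar>LINT \<omega>:A i|M. g n \<omega>\<bar> \<le> (LINT \<omega>|M. B * indicator (A i) \<omega>)"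
        unfolding set_lebesgue_integral_def
      proof (rule integral_abs_bound[THEN order_trans], rule integral_mono)
        show "integrable M (\<lambda>\<omega>. \<bar>indicat_real (A i) \<omega> *\<^sub>R g n \<omega>\<bar>)"
          using int[OF A] unfolding set_integrable_def by (rule integrable_abs)
        show "integrable M (\<lambda>\<omega>. B * indicat_real (A i) \<omega>)"
          using A by (intro integrable_mult_right integrable_real_indicator) (auto simp: emeasure_eq_measure)
        show "\<bar>indicat_real (A i) \<omega> *\<^sub>R g n \<omega>\<bar> \<le> B * indicat_real (A i) \<omega>" for \<omega>
          using g(2)[of n \<omega>] by (simp add: indicator_def)
      qed
      also have "\<dots> = B * measure M (A i)"
        using A sets.sets_into_space[OF A] by (simp add: Int_absorb2)
      finally show ?thesis .
    qed
    have "\<forall>\<^sub>F (i, n) in at_top \<times>\<^sub>F sequentially. norm (LINT \<omega>:A i|M. g n \<omega>) \<le> B * measure M (A i)"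
      using bound by (auto intro!: always_eventually)
    from tannerys_theorem[OF union(3) this summable_mult[OF sums_summable[OF sums]]]
    have "(\<lambda>n. \<Sum>i. LINT \<omega>:A i|M. g n \<omega>) \<longlonglongrightarrow> (\<Sum>i. measure M (A i) * c)"
      by simp
    also have "(\<Sum>i. measure M (A i) * c) = measure M (\<Union>i. A i) * c"
      using sums_mult2[OF sums, of c] by (simp add: sums_iff)
    finally show ?case unfolding eq .
  qed
qed

text \<open>
  Both sides are continuous in \<open>f\<close> with respect to the \<open>L\<^sup>1\<close> norm, uniformly in \<open>n\<close>, because
  \<open>g\<close> is bounded; indicators span a dense subspace.
\<close>

lemma integral_limit_from_sets:
  fixes g :: "nat \<Rightarrow> 'a \<Rightarrow> real"
  assumes M: "prob_space M" and G: "subalgebra M G" and g: "\<And>n. g n \<in> borel_measurable M" "\<And>n \<omega>. \<bar>g n \<omega>\<bar> \<le> B"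
    and sets: "\<And>A. A \<in> sets G \<Longrightarrow> (\<lambda>n. LINT \<omega>:A|M. g n \<omega>) \<longlonglongrightarrow> measure M A * c"
    and f: "integrable M f" "f \<in> borel_measurable G"
  shows "(\<lambda>n. LINT \<omega>|M. f \<omega> * g n \<omega>) \<longlonglongrightarrow> (LINT \<omega>|M. f \<omega>) * c"
proof -
  interpret prob_space M by fact
  interpret finite_measure_subalgebra M G by unfold_locales (rule G)
  have prod_int: "integrable M (\<lambda>\<omega>. f \<omega> * g n \<omega>)" if "integrable M f" for f :: "'a \<Rightarrow> real" and n
  proof (rule Bochner_Integration.integrable_bound)
    show "integrable M (\<lambda>\<omega>. B * f \<omega>)" using that by simp
    have "\<bar>f \<omega>\<bar> * \<bar>g n \<omega>\<bar> \<le> \<bar>B\<bar> * \<bar>f \<omega>\<bar>" for \<omega>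
      using mult_left_mono[OF order_trans[OF g(2)[of n \<omega>] abs_ge_self[of B]], of "\<bar>f \<omega>\<bar>"] by (simp add: mult.commute)
    then show "AE \<omega> in M. norm (f \<omega> * g n \<omega>) \<le> norm (B * f \<omega>)"
      by (auto simp: abs_mult)
  qed (use that g in auto)
  have "integrable (restr_to_subalg M G) f" by (rule integrable_in_subalg[OF G f(2,1)])
  then show ?thesis
  proof (induction f rule: integrable_induct)
    case (base A k)
    have A: "A \<in> sets G" using base(1) by (simp add: sets_restr_to_subalg[OF G])
    then have AM: "A \<in> sets M" using G by (auto simp: subalgebra_def)
    have lim: "(\<lambda>n. (LINT \<omega>:A|M. g n \<omega>) * k) \<longlonglongrightarrow> measure M A * c * k"
      by (intro tendsto_mult_right sets A)
    have 1: "(LINT \<omega>|M. indicator A \<omega> *\<^sub>R k * g n \<omega>) = (LINT \<omega>:A|M. g n \<omega>) * k" for n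
      unfolding set_lebesgue_integral_def integral_mult_left_zero[symmetric] by (simp add: mult_ac)
    have "A \<inter> space M = A" using sets.sets_into_space[OF AM] by auto
    then have 2: "(LINT \<omega>|M. indicator A \<omega> *\<^sub>R k) = measure M A * k"
      by simp
    show ?case
      unfolding 1 2 using lim by (simp only: mult_ac)
  next
    case (add f1 f2)
    have i: "integrable M f1" "integrable M f2"
      using add.hyps by (auto intro: integrable_from_subalg[OF G])
    have "(\<lambda>n. (LINT \<omega>|M. f1 \<omega> * g n \<omega>) + (LINT \<omega>|M. f2 \<omega> * g n \<omega>)) \<longlonglongrightarrow> (LINT \<omega>|M. f1 \<omega>) * c + (LINT \<omega>|M. f2 \<omega>) * c"
      by (intro tendsto_add add.IH)
    then show ?case
      using i prod_int by (simp add: distrib_right)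
  next
    \<comment> \<open>The approximating functions satisfy \<open>\<bar>s j\<bar> \<le> 2 * \<bar>f\<bar>\<close>, so they converge in \<open>L\<^sup>1\<close>.\<close>
    case (lim f s)
    have sp: "space (restr_to_subalg M G) = space M" by (rule space_restr_to_subalg)
    have i: "integrable M f" "\<And>j. integrable M (s j)"
      using lim.hyps(1,4) by (auto intro: integrable_from_subalg[OF G])
    have L1: "(\<lambda>j. LINT \<omega>|M. \<bar>s j \<omega> - f \<omega>\<bar>) \<longlonglongrightarrow> (LINT \<omega>|M. 0)"
    proof (rule integral_dominated_convergence[where w = "\<lambda>\<omega>. 3 * \<bar>f \<omega>\<bar>"])
      show "AE \<omega> in M. (\<lambda>j. \<bar>s j \<omega> - f \<omega>\<bar>) \<longlonglongrightarrow> 0"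
      proof (rule AE_I2)
        fix \<omega> assume "\<omega> \<in> space M"
        then have "(\<lambda>j. s j \<omega>) \<longlonglongrightarrow> f \<omega>" using lim.hyps(2) sp by simp
        then show "(\<lambda>j. \<bar>s j \<omega> - f \<omega>\<bar>) \<longlonglongrightarrow> 0"
          by (intro tendsto_rabs_zero) (simp add: LIM_zero)
      qed
      show "AE \<omega> in M. norm \<bar>s j \<omega> - f \<omega>\<bar> \<le> 3 * \<bar>f \<omega>\<bar>" for j
      proof (rule AE_I2)
        fix \<omega> assume "\<omega> \<in> space M"
        then have "\<bar>s j \<omega>\<bar> \<le> 2 * \<bar>f \<omega>\<bar>" using lim.hyps(3)[of \<omega> j] sp by simp
        then show "norm \<bar>s j \<omega> - f \<omega>\<bar> \<le> 3 * \<bar>f \<omega>\<bar>" by simp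
      qed
    qed (use i in auto)
    define K where "K = \<bar>B\<bar> + \<bar>c\<bar> + 1"
    have K: "K > 0" by (simp add: K_def)
    show ?case
    proof (rule LIMSEQ_I)
      fix \<epsilon> :: real assume e: "\<epsilon> > 0"
      have "\<forall>\<^sub>F j in sequentially. (LINT \<omega>|M. \<bar>s j \<omega> - f \<omega>\<bar>) < \<epsilon> / (3 * K)"
        by (rule order_tendstoD(2)[OF L1]) (use e K in simp)
      then obtain j where j: "(LINT \<omega>|M. \<bar>s j \<omega> - f \<omega>\<bar>) < \<epsilon> / (3 * K)"
        by (auto simp: eventually_sequentially)
      define D where "D = (LINT \<omega>|M. \<bar>s j \<omega> - f \<omega>\<bar>)"
      have D0: "D \<ge> 0" by (simp add: D_def)
      have KD: "K * D < \<epsilon> / 3" using j K by (simp add: D_def field_simps)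
      obtain n0 where n0: "\<And>n. n \<ge> n0 \<Longrightarrow> norm ((LINT \<omega>|M. s j \<omega> * g n \<omega>) - (LINT \<omega>|M. s j \<omega>) * c) < \<epsilon> / 3"
        using LIMSEQ_D[OF lim.IH[of j], of "\<epsilon> / 3"] e by auto
      show "\<exists>n0. \<forall>n\<ge>n0. norm ((LINT \<omega>|M. f \<omega> * g n \<omega>) - (LINT \<omega>|M. f \<omega>) * c) < \<epsilon>"
      proof (intro exI allI impI)
        fix n assume n: "n \<ge> n0"
        have "\<bar>(LINT \<omega>|M. s j \<omega> * g n \<omega>) - (LINT \<omega>|M. f \<omega> * g n \<omega>)\<bar> = \<bar>LINT \<omega>|M. (s j \<omega> - f \<omega>) * g n \<omega>\<bar>"
          using i prod_int by (simp add: left_diff_distrib)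
        also have "\<dots> \<le> (LINT \<omega>|M. \<bar>B\<bar> * \<bar>s j \<omega> - f \<omega>\<bar>)"
        proof (rule integral_abs_bound[THEN order_trans], rule integral_mono)
          show "integrable M (\<lambda>\<omega>. \<bar>(s j \<omega> - f \<omega>) * g n \<omega>\<bar>)"
            by (rule integrable_abs, rule prod_int) (use i in simp)
          show "integrable M (\<lambda>\<omega>. \<bar>B\<bar> * \<bar>s j \<omega> - f \<omega>\<bar>)" using i by simp
          show "\<bar>(s j \<omega> - f \<omega>) * g n \<omega>\<bar> \<le> \<bar>B\<bar> * \<bar>s j \<omega> - f \<omega>\<bar>" for \<omega>
            using mult_left_mono[OF order_trans[OF g(2)[of n \<omega>] abs_ge_self[of B]], of "\<bar>s j \<omega> - f \<omega>\<bar>"]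
            by (simp add: abs_mult mult.commute)
        qed
        also have "\<dots> = \<bar>B\<bar> * D" by (simp add: D_def)
        also have "\<dots> \<le> K * D" using D0 by (intro mult_right_mono) (auto simp: K_def)
        finally have 1: "\<bar>(LINT \<omega>|M. s j \<omega> * g n \<omega>) - (LINT \<omega>|M. f \<omega> * g n \<omega>)\<bar> \<le> K * D" .
        have "\<bar>(LINT \<omega>|M. s j \<omega>) - (LINT \<omega>|M. f \<omega>)\<bar> = \<bar>LINT \<omega>|M. s j \<omega> - f \<omega>\<bar>"
          using i by simp
        also have "\<dots> \<le> D" unfolding D_def by (rule integral_abs_bound)
        finally have "\<bar>((LINT \<omega>|M. s j \<omega>) - (LINT \<omega>|M. f \<omega>)) * c\<bar> \<le> D * \<bar>c\<bar>"
          unfolding abs_mult by (rule mult_right_mono) simp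
        also have "\<dots> = \<bar>c\<bar> * D" by (rule mult.commute)
        also have "\<dots> \<le> K * D" using D0 by (intro mult_right_mono) (auto simp: K_def)
        finally have 2: "\<bar>(LINT \<omega>|M. s j \<omega>) * c - (LINT \<omega>|M. f \<omega>) * c\<bar> \<le> K * D"
          by (simp add: left_diff_distrib)
        show "norm ((LINT \<omega>|M. f \<omega> * g n \<omega>) - (LINT \<omega>|M. f \<omega>) * c) < \<epsilon>"
          using 1 2 n0[OF n] KD unfolding real_norm_def by linarith
      qed
    qed
  qed
qed

text \<open>
  Conditional expectation is self-adjoint: both sides equal the integral of the product of the two
  conditional expectations.
\<close>

lemma integral_real_cond_exp_swap:
  fixes f g :: "'a \<Rightarrow> real"
  assumes M: "prob_space M" and G: "subalgebra M G" and f: "integrable M f"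
    and g: "g \<in> borel_measurable M" "\<And>\<omega>. \<bar>g \<omega>\<bar> \<le> B"
  shows "(LINT \<omega>|M. f \<omega> * real_cond_exp M G g \<omega>) = (LINT \<omega>|M. real_cond_exp M G f \<omega> * g \<omega>)"
proof -
  interpret prob_space M by fact
  interpret finite_measure_subalgebra M G by unfold_locales (rule G)
  have gi: "integrable M g"
    using g by (intro integrable_const_bound[where B = B]) auto
  have bnd: "AE \<omega> in M. \<bar>real_cond_exp M G g \<omega>\<bar> \<le> B"
  proof -
    have "AE \<omega> in M. real_cond_exp M G g \<omega> \<le> B"
      by (rule real_cond_exp_le_c[OF gi]) (use g(2) abs_le_D1 in auto)
    moreover have "AE \<omega> in M. real_cond_exp M G g \<omega> \<ge> - B"
      by (rule real_cond_exp_ge_c[OF gi]) (use g(2) in \<open>auto simp: abs_le_iff minus_le_iff\<close>)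
    ultimately show ?thesis by eventually_elim auto
  qed
  have cond_meas: "real_cond_exp M G f \<in> borel_measurable M" "real_cond_exp M G g \<in> borel_measurable M"
    by (auto intro: borel_measurable_cond_exp2)
  have mult_int: "integrable M (\<lambda>\<omega>. u \<omega> * v \<omega>)" if "integrable M v" "u \<in> borel_measurable M" "AE \<omega> in M. \<bar>u \<omega>\<bar> \<le> B" for u v :: "'a \<Rightarrow> real"
  proof (rule Bochner_Integration.integrable_bound)
    show "integrable M (\<lambda>\<omega>. B * v \<omega>)" using that by simp
    show "AE \<omega> in M. norm (u \<omega> * v \<omega>) \<le> norm (B * v \<omega>)"
      using that(3)
    proof eventually_elim
      case (elim \<omega>)
      then have "\<bar>u \<omega>\<bar> * \<bar>v \<omega>\<bar> \<le> \<bar>B\<bar> * \<bar>v \<omega>\<bar>" by (intro mult_right_mono) auto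
      then show ?case by (simp add: abs_mult)
    qed
  qed (use that in auto)
  have "(LINT \<omega>|M. f \<omega> * real_cond_exp M G g \<omega>) = (LINT \<omega>|M. real_cond_exp M G g \<omega> * f \<omega>)"
    by (simp add: mult.commute)
  also have "\<dots> = (LINT \<omega>|M. real_cond_exp M G g \<omega> * real_cond_exp M G f \<omega>)"
    by (rule real_cond_exp_intg(2)[symmetric]) (use f mult_int[OF f cond_meas(2) bnd] in auto)
  also have "\<dots> = (LINT \<omega>|M. real_cond_exp M G f \<omega> * real_cond_exp M G g \<omega>)"
    by (simp add: mult.commute)
  also have "\<dots> = (LINT \<omega>|M. real_cond_exp M G f \<omega> * g \<omega>)"
  proof (rule real_cond_exp_intg(2))
    have "integrable M (\<lambda>\<omega>. g \<omega> * real_cond_exp M G f \<omega>)"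
      by (rule mult_int) (use g real_cond_exp_int(1)[OF f] in auto)
    then show "integrable M (\<lambda>\<omega>. real_cond_exp M G f \<omega> * g \<omega>)" by (simp add: mult.commute)
  qed (use g in auto)
  finally show ?thesis .
qed

text \<open>
  By independence the conditional law of \<open>N\<close> on \<open>A\<close> is its unconditional law.
\<close>

lemma set_integral_independent:
  fixes N :: "'a \<Rightarrow> real" and h :: "real \<Rightarrow> real"
  assumes M: "prob_space M" and N: "distributed M lborel N std_normal_density"
    and ind: "independent_of_algebra M G N" and G: "sets G \<subseteq> sets M" and A: "A \<in> sets G"
    and h: "h \<in> borel_measurable borel" "\<And>x. \<bar>h x\<bar> \<le> B"
  shows "(LINT \<omega>:A|M. h (N \<omega>)) = measure M A * (LINT x|std_normal_distribution. h x)"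
proof -
  interpret prob_space M by fact
  have Nm: "N \<in> borel_measurable M" using distributed_measurable[OF N] by simp
  have AM: "A \<in> sets M" using A G by auto
  have dN: "distr M borel N = std_normal_distribution"
  proof -
    have "distr M borel N = distr M lborel N" by (rule distr_cong) auto
    then show ?thesis using distributed_distr_eq_density[OF N] by simp
  qed
  have hN: "integrable M (\<lambda>\<omega>. h (N \<omega>))"
    using h measurable_compose[OF Nm h(1)] by (intro integrable_const_bound[where B = B]) auto
  have "(LINT \<omega>|M. h (N \<omega>)) = (LINT x|std_normal_distribution. h x)"
    unfolding dN[symmetric] using Nm h(1) by (simp add: integral_distr)
  show ?thesis
  proof (cases "measure M A = 0")
    case True
    have "AE \<omega> in M. \<omega> \<notin> A" using True AM by (simp add: prob_eq_0)
    then have "(LINT \<omega>:A|M. h (N \<omega>)) = (LINT \<omega>|M. 0)"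
      unfolding set_lebesgue_integral_def using AM measurable_compose[OF Nm h(1)]
      by (intro integral_cong_AE) auto
    then show ?thesis using True by simp
  next
    case False
    then have pos: "measure M A > 0" using measure_nonneg[of M A] by linarith
    have Nu: "N \<in> borel_measurable (uniform_measure M A)" using Nm by simp
    have eq: "distr (uniform_measure M A) borel N = distr M borel N"
    proof (rule measure_eqI)
      fix B assume "B \<in> sets (distr (uniform_measure M A) borel N)"
      then have B: "B \<in> sets borel" by simp
      have NB: "N -` B \<inter> space M \<in> sets M" by (rule measurable_sets[OF Nm B])
      have "N -` B \<inter> space M \<in> sets (vimage_algebra (space M) N borel)"
        by (rule in_vimage_algebra[OF B])
      then have "prob ((N -` B \<inter> space M) \<inter> A) = prob (N -` B \<inter> space M) * prob A"
        by (rule indep_setD[OF ind[unfolded independent_of_algebra_def] _ A])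
      then have p: "prob (A \<inter> (N -` B \<inter> space M)) = prob A * prob (N -` B \<inter> space M)"
        by (simp add: Int_commute mult.commute)
      have "emeasure (distr (uniform_measure M A) borel N) B = emeasure (uniform_measure M A) (N -` B \<inter> space M)"
        by (subst emeasure_distr[OF Nu B]) simp
      also have "\<dots> = emeasure M (A \<inter> (N -` B \<inter> space M)) / emeasure M A"
        by (rule emeasure_uniform_measure[OF AM NB])
      also have "\<dots> = emeasure M (N -` B \<inter> space M)"
        using p pos by (simp add: emeasure_eq_measure divide_ennreal)
      also have "\<dots> = emeasure (distr M borel N) B"
        by (subst emeasure_distr[OF Nm B]) simp
      finally show "emeasure (distr (uniform_measure M A) borel N) B = emeasure (distr M borel N) B" .
    qed simp
    have "(LINT x|std_normal_distribution. h x) = (LINT x|distr (uniform_measure M A) borel N. h x)"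
      by (simp only: eq dN)
    also have "\<dots> = (LINT \<omega>|uniform_measure M A. h (N \<omega>))"
      by (rule integral_distr[OF Nu h(1)])
    also have "\<dots> = (1 / prob A) *\<^sub>R (LINT \<omega>:A|M. h (N \<omega>))"
      by (rule integral_uniform_measure_event[OF M AM pos measurable_compose[OF Nm h(1)]])
    finally show ?thesis using pos by simp
  qed
qed

section \<open>Normal quantiles\<close>

interpretation std_normal: real_distribution std_normal_distribution
  by (rule real_dist_normal_dist)

lemma std_normal_singleton: "measure std_normal_distribution {x} = 0"
proof -
  have "emeasure std_normal_distribution {x} = 0"
    by (subst emeasure_density) (auto simp: nn_integral_indicator_singleton)
  then show ?thesis by (simp add: measure_def)
qed

lemma cdf_std_normal_cont: "isCont (cdf std_normal_distribution) x"
  by (simp add: std_normal.isCont_cdf std_normal_singleton)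

text \<open>
  The characteristic function is even.
\<close>

lemma std_normal_symmetric: "distr std_normal_distribution borel uminus = std_normal_distribution"
proof (rule Levy_uniqueness)
  show rd: "real_distribution (distr std_normal_distribution borel uminus)"
    by (rule std_normal.real_distribution_distr) simp
  show "real_distribution std_normal_distribution" by (rule real_dist_normal_dist)
  show "char (distr std_normal_distribution borel uminus) = char std_normal_distribution"
  proof
    fix t
    have "char (distr std_normal_distribution borel uminus) t = char std_normal_distribution (- t)"
      unfolding char_def by (subst integral_distr) auto
    then show "char (distr std_normal_distribution borel uminus) t = char std_normal_distribution t"
      by (simp add: char_std_normal_distribution)
  qed
qed

lemma cdf_std_normal_minus: "cdf std_normal_distribution (- x) = 1 - cdf std_normal_distribution x"
proof -
  have "cdf std_normal_distribution (- x) = measure (distr std_normal_distribution borel uminus) {..- x}"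
    by (simp add: cdf_def std_normal_symmetric)
  also have "\<dots> = measure std_normal_distribution {x..}"
    by (subst measure_distr) (auto intro!: arg_cong[where f = "measure std_normal_distribution"])
  also have "{x..} = {x} \<union> (UNIV - {..x})" by auto
  also have "measure std_normal_distribution ({x} \<union> (UNIV - {..x})) = measure std_normal_distribution {x} + measure std_normal_distribution (UNIV - {..x})"
    by (rule std_normal.finite_measure_Union) auto
  also have "measure std_normal_distribution (UNIV - {..x}) = 1 - measure std_normal_distribution {..x}"
    using std_normal.prob_compl[of "{..x}"] by simp
  finally show ?thesis by (simp add: std_normal_singleton cdf_def)
qed

text \<open>
  The infimum is attained because the distribution function is continuous, and approaching it from
  below gives the reverse inequality.
\<close>

lemma cdf_std_normal_quantile:
  assumes "0 < q" "q < 1"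
  shows "cdf std_normal_distribution (std_normal_quantile q) = q"
proof -
  let ?F = "cdf std_normal_distribution"
  define S where "S = {x. q \<le> ?F x}"
  define t where "t = Inf S"
  have "\<forall>\<^sub>F x in at_top. q < ?F x"
    by (rule order_tendstoD(1)[OF std_normal.cdf_lim_at_top_prob]) (use assms in simp)
  then obtain b where "q < ?F b" by (auto simp: eventually_at_top_linorder)
  then have ne: "S \<noteq> {}" unfolding S_def by (auto intro: less_imp_le)
  have "\<forall>\<^sub>F x in at_bot. ?F x < q"
    by (rule order_tendstoD(2)[OF std_normal.cdf_lim_at_bot]) (use assms in simp)
  then obtain a where a: "\<And>x. x \<le> a \<Longrightarrow> ?F x < q" by (auto simp: eventually_at_bot_linorder)
  have bdd: "bdd_below S"
  proof (rule bdd_belowI)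
    fix x assume "x \<in> S"
    then show "a \<le> x" using a[of x] by (force simp: S_def)
  qed
  have cont: "continuous_on UNIV ?F"
    using cdf_std_normal_cont by (simp add: continuous_at_imp_continuous_on)
  have "closed S"
    unfolding S_def by (intro closed_Collect_le continuous_on_const cont)
  then have "t \<in> S" unfolding t_def by (rule closed_contains_Inf[OF ne bdd])
  then have ge: "q \<le> ?F t" by (simp add: S_def)
  have "(\<lambda>n. t - 1 / real (Suc n)) \<longlonglongrightarrow> t - 0"
    by (intro tendsto_diff tendsto_const LIMSEQ_Suc lim_1_over_n)
  then have "(\<lambda>n. ?F (t - 1 / real (Suc n))) \<longlonglongrightarrow> ?F t"
    using isCont_tendsto_compose[OF cdf_std_normal_cont] by simp
  moreover have "?F (t - 1 / real (Suc n)) \<le> q" for n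
  proof (rule ccontr)
    assume "\<not> ?thesis"
    then have "t - 1 / real (Suc n) \<in> S" by (simp add: S_def)
    then have "t \<le> t - 1 / real (Suc n)" unfolding t_def by (rule cInf_lower[OF _ bdd])
    then show False by simp
  qed
  ultimately have "?F t \<le> q" by (intro LIMSEQ_le_const2) auto
  then show ?thesis
    using ge unfolding std_normal_quantile_def t_def S_def by linarith
qed

lemma std_normal_central_interval:
  assumes "0 < p" "p < 1"
  defines "\<tau> \<equiv> std_normal_quantile (1 - p / 2)"
  shows "measure std_normal_distribution {- \<tau>..\<tau>} = 1 - p"
proof -
  let ?F = "cdf std_normal_distribution"
  have F: "?F \<tau> = 1 - p / 2" unfolding \<tau>_def by (rule cdf_std_normal_quantile) (use assms in auto)
  have Fm: "?F (- \<tau>) = p / 2" using F by (simp add: cdf_std_normal_minus)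
  have "- \<tau> \<le> \<tau>"
  proof (rule ccontr)
    assume "\<not> - \<tau> \<le> \<tau>"
    then have "?F \<tau> \<le> ?F (- \<tau>)" by (intro std_normal.cdf_nondecreasing) simp
    then show False using F Fm assms by simp
  qed
  then have "{- \<tau>..\<tau>} = {- \<tau>} \<union> ({..\<tau>} - {..- \<tau>})" by auto
  then have "measure std_normal_distribution {- \<tau>..\<tau>} = measure std_normal_distribution {- \<tau>} + measure std_normal_distribution ({..\<tau>} - {..- \<tau>})"
    by (simp only:) (rule std_normal.finite_measure_Union, auto)
  also have "measure std_normal_distribution ({..\<tau>} - {..- \<tau>}) = ?F \<tau> - ?F (- \<tau>)"
    unfolding cdf_def by (rule std_normal.finite_measure_Diff) (use \<open>- \<tau> \<le> \<tau>\<close> in auto)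
  finally show ?thesis using F Fm by (simp add: std_normal_singleton)
qed

context ewens_pitman_process
begin

section \<open>Mixing convergence and coverage\<close>

text \<open>
  Once the burn-in time exceeds \<open>m\<close>, an event of the partition of the first \<open>m\<close> balls is a bounded weight
  in \<open>stable_clt_score\<close>; the linearization transfers the limit to the estimator.
\<close>

lemma estimator_clt:
  assumes est: "is_mle est" and V: "tends_in_prob V (tail_info \<alpha>)" and m: "m \<ge> 1"
  shows "(\<lambda>n. expect n (\<lambda>P. of_bool (restrict_partition m P \<in> S) *\<^sub>R
            iexp (u * (sqrt (V n P * real (card P)) * (fst (est n P) - \<alpha>)))))
     \<longlonglongrightarrow> of_real (exp (- u\<^sup>2 / 2)) * of_real (expect m (\<lambda>P. of_bool (P \<in> S)))"
proof -
  define X where "X n P = sqrt (V n P * real (card P)) * (fst (est n P) - \<alpha>)" for n P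
  define Y where "Y n P = total_score P / sqrt (norming n P)" for n P
  define \<phi> where "\<phi> n R = (of_bool (restrict_partition m R \<in> S) :: real)" for n :: nat and R
  define \<Phi> where "\<Phi> P = (of_bool (restrict_partition m P \<in> S) :: real)" for P
  have lin: "tends_in_prob (\<lambda>n P. X n P - Y n P) 0"
    unfolding X_def Y_def by (rule estimator_linearization[OF est V])
  have diff: "(\<lambda>n. expect n (\<lambda>P. \<Phi> P *\<^sub>R (iexp (u * X n P) - iexp (u * Y n P)))) \<longlonglongrightarrow> 0"
  proof (rule expect_tendsto_in_prob)
    show "tends_in_prob (\<lambda>n P. \<Phi> P *\<^sub>R (iexp (u * X n P) - iexp (u * Y n P))) 0"
    proof (rule tends_in_prob_bounded_by)
      have "isCont (\<lambda>v. \<bar>u\<bar> * \<bar>v\<bar>) (0 :: real)" by (intro continuous_intros)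
      from tends_in_prob_cont[OF lin this]
      show "tends_in_prob (\<lambda>n P. \<bar>u\<bar> * \<bar>X n P - Y n P\<bar>) 0" by simp
      have "norm (\<Phi> P *\<^sub>R (iexp (u * X n P) - iexp (u * Y n P))) \<le> \<bar>u\<bar> * \<bar>X n P - Y n P\<bar>" for n P
      proof -
        have "norm (\<Phi> P *\<^sub>R (iexp (u * X n P) - iexp (u * Y n P))) \<le> norm (iexp (u * X n P) - iexp (u * Y n P))"
          by (simp add: \<Phi>_def of_bool_def)
        also have "\<dots> \<le> \<bar>u * X n P - u * Y n P\<bar>" by (rule norm_iexp_diff_le)
        also have "\<dots> = \<bar>u\<bar> * \<bar>X n P - Y n P\<bar>" by (simp flip: abs_mult right_diff_distrib)
        finally show ?thesis .
      qed
      then show "whp (\<lambda>n P. norm (\<Phi> P *\<^sub>R (iexp (u * X n P) - iexp (u * Y n P))) \<le> \<bar>u\<bar> * \<bar>X n P - Y n P\<bar>)"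
        by (intro whp_eventually always_eventually) auto
    qed
    have "norm (\<Phi> P *\<^sub>R (iexp (u * X n P) - iexp (u * Y n P))) \<le> 2" for n P
    proof -
      have "norm (\<Phi> P *\<^sub>R (iexp (u * X n P) - iexp (u * Y n P))) \<le> norm (iexp (u * X n P) - iexp (u * Y n P))"
        by (simp add: \<Phi>_def of_bool_def)
      also have "\<dots> \<le> norm (iexp (u * X n P)) + norm (iexp (u * Y n P))" by (rule norm_triangle_ineq4)
      also have "\<dots> = 2" by (simp only: norm_exp_i_times)
      finally show ?thesis .
    qed
    then show "\<forall>\<^sub>F n in sequentially. \<forall>P\<in>partitions_upto n. norm (\<Phi> P *\<^sub>R (iexp (u * X n P) - iexp (u * Y n P))) \<le> 2"
      by (intro always_eventually) auto
  qed
  define c where "c = complex_of_real (exp (- u\<^sup>2 / 2))"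
  define p where "p = complex_of_real (expect m (\<lambda>P. of_bool (P \<in> S)))"
  have "(\<lambda>n. expect n (\<lambda>P. \<phi> n (restrict_partition (burn_in n) P) *\<^sub>R iexp (u * (total_score P / sqrt (norming n P))))
      - c * expect n (\<lambda>P. complex_of_real (\<phi> n (restrict_partition (burn_in n) P)))) \<longlonglongrightarrow> 0"
    unfolding c_def by (rule stable_clt_score) (simp add: \<phi>_def)
  moreover have "\<forall>\<^sub>F n in sequentially. expect n (\<lambda>P. \<phi> n (restrict_partition (burn_in n) P) *\<^sub>R iexp (u * (total_score P / sqrt (norming n P))))
      - c * expect n (\<lambda>P. complex_of_real (\<phi> n (restrict_partition (burn_in n) P)))
      = expect n (\<lambda>P. \<Phi> P *\<^sub>R iexp (u * Y n P)) - c * p"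
  proof -
    have "\<forall>\<^sub>F n in sequentially. burn_in n \<ge> m"
      using filterlim_burn_in by (auto simp: filterlim_at_top)
    then show ?thesis
      using eventually_ge_at_top[of m]
    proof eventually_elim
      case (elim n)
      have phi: "\<phi> n (restrict_partition (burn_in n) P) = \<Phi> P" for P
        by (simp add: \<phi>_def \<Phi>_def restrict_restrict[OF elim(1)])
      have "expect n (\<lambda>P. complex_of_real (\<Phi> P)) = expect m (\<lambda>P. complex_of_real (of_bool (P \<in> S)))"
        unfolding \<Phi>_def by (rule expect_restrict[OF m elim(2)])
      also have "\<dots> = p"
        unfolding p_def expect_def by (simp add: scaleR_conv_of_real)
      finally show ?case
        unfolding phi Y_def by simp
    qed
  qed
  ultimately have "(\<lambda>n. expect n (\<lambda>P. \<Phi> P *\<^sub>R iexp (u * Y n P)) - c * p) \<longlonglongrightarrow> 0"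
    by (rule Lim_transform_eventually)
  from tendsto_add[OF tendsto_add[OF this diff] tendsto_const[of "c * p"]]
  have "(\<lambda>n. expect n (\<lambda>P. \<Phi> P *\<^sub>R iexp (u * Y n P)) - c * p + expect n (\<lambda>P. \<Phi> P *\<^sub>R (iexp (u * X n P) - iexp (u * Y n P))) + c * p) \<longlonglongrightarrow> c * p"
    by simp
  moreover have "expect n (\<lambda>P. \<Phi> P *\<^sub>R iexp (u * Y n P)) - c * p + expect n (\<lambda>P. \<Phi> P *\<^sub>R (iexp (u * X n P) - iexp (u * Y n P))) + c * p
     = expect n (\<lambda>P. \<Phi> P *\<^sub>R iexp (u * X n P))" for n
    by (simp only: scaleR_diff_right expect_linear) simp
  ultimately show ?thesis
    by (simp only: \<Phi>_def X_def c_def p_def)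
qed

text \<open>
  Events that agree, up to a null set, with an event about some finite partition. The null sets are
  essential: a later partition determines an earlier one almost surely only, and without them the events
  would not be closed under intersection.
\<close>

definition observable_events :: "'a set set" where
  "observable_events = {A \<in> events. \<exists>m\<ge>1. \<exists>S. AE \<omega> in M. \<omega> \<in> A \<longleftrightarrow> \<pi> m \<omega> \<in> S}"

lemma space_observable: "space M \<in> observable_events"
  unfolding observable_events_def by (auto intro!: exI[of _ 1] exI[of _ UNIV])

lemma Int_stable_observable: "Int_stable observable_events"
proof (rule Int_stableI)
  fix A B assume "A \<in> observable_events" "B \<in> observable_events"
  then obtain m S n T where A: "A \<in> events" "m \<ge> 1" "AE \<omega> in M. \<omega> \<in> A \<longleftrightarrow> \<pi> m \<omega> \<in> S"
    and B: "B \<in> events" "n \<ge> 1" "AE \<omega> in M. \<omega> \<in> B \<longleftrightarrow> \<pi> n \<omega> \<in> T"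
    by (auto simp: observable_events_def)
  define k where "k = max m n"
  have "AE \<omega> in M. restrict_partition m (\<pi> k \<omega>) = \<pi> m \<omega>" "AE \<omega> in M. restrict_partition n (\<pi> k \<omega>) = \<pi> n \<omega>"
    by (rule AE_restrict; use A B in \<open>simp add: k_def\<close>)+
  then have "AE \<omega> in M. \<omega> \<in> A \<inter> B \<longleftrightarrow> \<pi> k \<omega> \<in> {P. restrict_partition m P \<in> S \<and> restrict_partition n P \<in> T}"
    using A(3) B(3) by eventually_elim auto
  moreover have "k \<ge> 1" using A by (simp add: k_def)
  ultimately show "A \<inter> B \<in> observable_events"
    using A(1) B(1) unfolding observable_events_def by blast
qed

text \<open>
  The time is shifted by one, here and below, because measurability of \<open>\<pi> n\<close> is guaranteed for
  \<open>n \<ge> 1\<close> only; the shift does not affect limits.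
\<close>

lemma observable_char_limit:
  assumes est: "is_mle est" and V: "tends_in_prob V (tail_info \<alpha>)" and A: "A \<in> observable_events"
  shows "(\<lambda>n. LINT \<omega>:A|M. iexp (u * (sqrt (V (Suc n) (\<pi> (Suc n) \<omega>) * real (card (\<pi> (Suc n) \<omega>))) * (fst (est (Suc n) (\<pi> (Suc n) \<omega>)) - \<alpha>))))
     \<longlonglongrightarrow> of_real (exp (- u\<^sup>2 / 2)) * of_real (prob A)"
proof -
  define X where "X n P = sqrt (V n P * real (card P)) * (fst (est n P) - \<alpha>)" for n P
  obtain m S where AE_A: "A \<in> events" "m \<ge> 1" "AE \<omega> in M. \<omega> \<in> A \<longleftrightarrow> \<pi> m \<omega> \<in> S"
    using A by (auto simp: observable_events_def)
  have "prob A = expect m (\<lambda>P. of_bool (P \<in> S))"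
  proof -
    have "prob A = (LINT \<omega>|M. indicator A \<omega>)"
      using sets.sets_into_space[OF AE_A(1)] by (simp add: Int_absorb2)
    also have "\<dots> = (LINT \<omega>|M. of_bool (\<pi> m \<omega> \<in> S))"
      using AE_A(1) state_measurable[OF AE_A(2), of "\<lambda>P. of_bool (P \<in> S)"] AE_A(3)
      by (intro integral_cong_AE) (auto simp: indicator_def)
    also have "\<dots> = expect m (\<lambda>P. of_bool (P \<in> S))"
      using expectation_state(2)[OF AE_A(2), of "\<lambda>P. of_bool (P \<in> S) :: real"] by simp
    finally show ?thesis .
  qed
  then have lim: "(\<lambda>n. expect n (\<lambda>P. of_bool (restrict_partition m P \<in> S) *\<^sub>R iexp (u * X n P))) \<longlonglongrightarrow> of_real (exp (- u\<^sup>2 / 2)) * of_real (prob A)"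
    using estimator_clt[OF est V AE_A(2), of S u] by (simp add: X_def)
  have "\<forall>\<^sub>F n in sequentially. expect n (\<lambda>P. of_bool (restrict_partition m P \<in> S) *\<^sub>R iexp (u * X n P)) = (LINT \<omega>:A|M. iexp (u * X n (\<pi> n \<omega>)))"
    using eventually_ge_at_top[of m]
  proof eventually_elim
    case (elim n)
    have n: "n \<ge> 1" using elim AE_A(2) by simp
    have "expect n (\<lambda>P. of_bool (restrict_partition m P \<in> S) *\<^sub>R iexp (u * X n P))
      = (LINT \<omega>|M. of_bool (restrict_partition m (\<pi> n \<omega>) \<in> S) *\<^sub>R iexp (u * X n (\<pi> n \<omega>)))"
      by (rule expectation_state(2)[OF n, symmetric])
    also have "\<dots> = (LINT \<omega>:A|M. iexp (u * X n (\<pi> n \<omega>)))"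
      unfolding set_lebesgue_integral_def
    proof (rule integral_cong_AE)
      show "(\<lambda>\<omega>. of_bool (restrict_partition m (\<pi> n \<omega>) \<in> S) *\<^sub>R iexp (u * X n (\<pi> n \<omega>))) \<in> borel_measurable M"
        by (rule state_measurable[OF n])
      show "(\<lambda>\<omega>. indicat_real A \<omega> *\<^sub>R iexp (u * X n (\<pi> n \<omega>))) \<in> borel_measurable M"
        by (intro borel_measurable_scaleR borel_measurable_indicator AE_A(1) state_measurable[OF n])
      show "AE \<omega> in M. of_bool (restrict_partition m (\<pi> n \<omega>) \<in> S) *\<^sub>R iexp (u * X n (\<pi> n \<omega>)) = indicat_real A \<omega> *\<^sub>R iexp (u * X n (\<pi> n \<omega>))"
        using AE_restrict[OF AE_A(2) elim] AE_A(3) by eventually_elim (auto simp: indicator_def)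
    qed
    finally show ?case .
  qed
  from Lim_transform_eventually[OF lim this]
  have "(\<lambda>n. LINT \<omega>:A|M. iexp (u * X n (\<pi> n \<omega>))) \<longlonglongrightarrow> of_real (exp (- u\<^sup>2 / 2)) * of_real (prob A)" .
  then show ?thesis
    unfolding X_def by (rule LIMSEQ_Suc)
qed

lemma partition_algebra_sets:
  assumes "n \<ge> 1"
  shows "sets (partition_algebra M \<pi> n) = {\<pi> n -` B \<inter> space M | B. B \<subseteq> partitions_upto n}"
  unfolding partition_algebra_def
  by (subst sets_vimage_algebra2) (use state_in[OF assms] in auto)

lemma partition_algebra_observable:
  assumes "n \<ge> 1"
  shows "sets (partition_algebra M \<pi> n) \<subseteq> observable_events"
proof
  fix A assume "A \<in> sets (partition_algebra M \<pi> n)"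
  then obtain B where B: "A = \<pi> n -` B \<inter> space M"
    using partition_algebra_sets[OF assms] by auto
  have "A \<in> events" using state_event[OF assms, of "\<lambda>P. P \<in> B"] by (simp add: B vimage_def Int_def conj_commute)
  moreover have "AE \<omega> in M. \<omega> \<in> A \<longleftrightarrow> \<pi> n \<omega> \<in> B" by (rule AE_I2) (simp add: B)
  ultimately show "A \<in> observable_events" unfolding observable_events_def using assms by blast
qed

lemma partition_algebra_limit_sets:
  "sets (partition_algebra_limit M \<pi>) \<subseteq> sigma_sets (space M) observable_events" "space (partition_algebra_limit M \<pi>) = space M"
  "sets (partition_algebra_limit M \<pi>) \<subseteq> events"
proof -
  let ?U = "\<Union>n\<in>{1..}. sets (partition_algebra M \<pi> n)"
  have U: "?U \<subseteq> observable_events" using partition_algebra_observable by auto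
  have obs: "observable_events \<subseteq> events" by (auto simp: observable_events_def)
  have pow: "?U \<subseteq> Pow (space M)" using U obs sets.sets_into_space by blast
  have s: "sets (partition_algebra_limit M \<pi>) = sigma_sets (space M) ?U"
    unfolding partition_algebra_limit_def by (rule sets_measure_of[OF pow])
  show "space (partition_algebra_limit M \<pi>) = space M"
    unfolding partition_algebra_limit_def by (rule space_measure_of[OF pow])
  show "sets (partition_algebra_limit M \<pi>) \<subseteq> sigma_sets (space M) observable_events"
    unfolding s by (rule sigma_sets_mono') (rule U)
  show "sets (partition_algebra_limit M \<pi>) \<subseteq> events"
    unfolding s using U obs by (intro sets.sigma_sets_subset) auto
qed

lemma subalgebra_partition_algebra_limit: "subalgebra M (partition_algebra_limit M \<pi>)"
  unfolding subalgebra_def using partition_algebra_limit_sets(2,3) by auto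

text \<open>
  The self-adjointness of conditional expectation moves the conditioning to \<open>f\<close>, which becomes
  measurable with respect to the limit algebra; the limits of integrals over the sets of that algebra then
  extend to \<open>f\<close>. On the other side, independence makes the conditional expectation of \<open>h \<circ> N\<close> constant.
\<close>

theorem estimator_mixing:
  assumes est: "is_mle est" and N: "distributed M lborel N std_normal_density"
    and ind: "independent_of_algebra M (partition_algebra_limit M \<pi>) N"
  shows "mixing_convergence M (partition_algebra_limit M \<pi>)
    (\<lambda>n \<omega>. sqrt (tail_info \<alpha> * real (card (\<pi> n \<omega>))) * (fst (est n (\<pi> n \<omega>)) - \<alpha>)) N"
  unfolding mixing_convergence_def stable_convergence_def
proof (intro conjI ind allI impI)
  let ?G = "partition_algebra_limit M \<pi>"
  define X where "X n P = sqrt (tail_info \<alpha> * real (card P)) * (fst (est n P) - \<alpha>)" for n P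
  show G: "subalgebra M ?G" by (rule subalgebra_partition_algebra_limit)
  have Xm: "(\<lambda>\<omega>. X n (\<pi> n \<omega>)) \<in> borel_measurable M" if "n \<ge> 1" for n
    by (rule state_measurable[OF that])
  show "\<forall>\<^sub>F n in sequentially. (\<lambda>\<omega>. sqrt (tail_info \<alpha> * real (card (\<pi> n \<omega>))) * (fst (est n (\<pi> n \<omega>)) - \<alpha>)) \<in> borel_measurable M"
    using eventually_ge_at_top[of 1] by eventually_elim (use Xm in \<open>simp add: X_def\<close>)
  show Nm: "N \<in> borel_measurable M" using distributed_measurable[OF N] by simp
  fix f :: "'a \<Rightarrow> real" and h :: "real \<Rightarrow> real"
  assume f: "integrable M f" and h: "continuous_on UNIV h" "bounded (range h)"
  obtain B where B: "\<And>x. \<bar>h x\<bar> \<le> B" using h(2) by (auto simp: bounded_iff)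
  have hm: "h \<in> borel_measurable borel" using h(1) by (rule borel_measurable_continuous_onI)
  have hc: "isCont h x" for x using h(1) by (simp add: continuous_on_eq_continuous_at)
  define c where "c = (LINT x|std_normal_distribution. h x)"
  define f' where "f' = real_cond_exp M ?G f"
  interpret sub: finite_measure_subalgebra M ?G by unfold_locales (rule G)
  have f'_int: "integrable M f'" and f'_eq: "(LINT \<omega>|M. f' \<omega>) = (LINT \<omega>|M. f \<omega>)"
    unfolding f'_def using sub.real_cond_exp_int[OF f] by auto
  have f'_meas: "f' \<in> borel_measurable ?G" by (simp add: f'_def)
  have gm: "(\<lambda>\<omega>. h (X (Suc n) (\<pi> (Suc n) \<omega>))) \<in> borel_measurable M" for n
    by (rule measurable_compose[OF Xm hm]) simp
  have sets_lim: "(\<lambda>n. LINT \<omega>:A|M. h (X (Suc n) (\<pi> (Suc n) \<omega>))) \<longlonglongrightarrow> prob A * c" if "A \<in> sets ?G" for A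
  proof (rule set_limit_sigma_sets[OF prob_space_axioms gm _ Int_stable_observable _ space_observable])
    show "\<bar>h (X (Suc n) (\<pi> (Suc n) \<omega>))\<bar> \<le> B" for n \<omega> by (rule B)
    show "observable_events \<subseteq> events" by (auto simp: observable_events_def)
    show "A \<in> sigma_sets (space M) observable_events" using that partition_algebra_limit_sets(1) by auto
    fix A assume A: "A \<in> observable_events"
    show "(\<lambda>n. LINT \<omega>:A|M. h (X (Suc n) (\<pi> (Suc n) \<omega>))) \<longlonglongrightarrow> prob A * c"
      unfolding c_def
    proof (rule event_integral_limit[OF prob_space_axioms _ _ _ hc B])
      show "A \<in> events" using A by (simp add: observable_events_def)
      show "(\<lambda>\<omega>. X (Suc n) (\<pi> (Suc n) \<omega>)) \<in> borel_measurable M" for n by (rule Xm) simp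
      show "(\<lambda>n. LINT \<omega>:A|M. iexp (t * X (Suc n) (\<pi> (Suc n) \<omega>))) \<longlonglongrightarrow> of_real (exp (- t\<^sup>2 / 2)) * of_real (prob A)" for t
        unfolding X_def by (rule observable_char_limit[OF est tends_in_prob_const A, of t])
    qed
  qed
  have lim: "(\<lambda>n. LINT \<omega>|M. f' \<omega> * h (X (Suc n) (\<pi> (Suc n) \<omega>))) \<longlonglongrightarrow> (LINT \<omega>|M. f' \<omega>) * c"
    by (rule integral_limit_from_sets[OF prob_space_axioms G gm B sets_lim f'_int f'_meas])
  have "(\<lambda>n. LINT \<omega>|M. f \<omega> * real_cond_exp M ?G (\<lambda>\<omega>. h (X (Suc n) (\<pi> (Suc n) \<omega>))) \<omega>) \<longlonglongrightarrow> (LINT \<omega>|M. f' \<omega>) * c"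
    using lim unfolding f'_def integral_real_cond_exp_swap[OF prob_space_axioms G f gm B] .
  then have lhs: "(\<lambda>n. LINT \<omega>|M. f \<omega> * real_cond_exp M ?G (\<lambda>\<omega>. h (X n (\<pi> n \<omega>))) \<omega>) \<longlonglongrightarrow> (LINT \<omega>|M. f' \<omega>) * c"
    by (rule LIMSEQ_imp_Suc)
  have hN: "integrable M (\<lambda>\<omega>. h (N \<omega>))"
    using measurable_compose[OF Nm hm] B by (intro integrable_const_bound[where B = B]) auto
  have "AE \<omega> in M. real_cond_exp M ?G (\<lambda>\<omega>. h (N \<omega>)) \<omega> = c"
  proof (rule sub.real_cond_exp_charact[OF _ hN])
    fix A assume A: "A \<in> sets ?G"
    then have AM: "A \<in> events" using partition_algebra_limit_sets(3) by auto
    have "(LINT \<omega>:A|M. h (N \<omega>)) = prob A * c"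
      unfolding c_def by (rule set_integral_independent[OF prob_space_axioms N ind partition_algebra_limit_sets(3) A hm B])
    also have "\<dots> = (LINT \<omega>:A|M. c)"
      unfolding set_lebesgue_integral_def using sets.sets_into_space[OF AM] by (simp add: Int_absorb2)
    finally show "(LINT \<omega>:A|M. h (N \<omega>)) = (LINT \<omega>:A|M. c)" .
  qed auto
  then have "(LINT \<omega>|M. f \<omega> * real_cond_exp M ?G (\<lambda>\<omega>. h (N \<omega>)) \<omega>) = (LINT \<omega>|M. f \<omega> * c)"
    using f borel_measurable_cond_exp2[of M ?G] by (intro integral_cong_AE) auto
  also have "\<dots> = (LINT \<omega>|M. f' \<omega>) * c" by (simp add: f'_eq)
  finally show "(\<lambda>n. LINT \<omega>|M. f \<omega> * real_cond_exp M ?G (\<lambda>\<omega>'. h (sqrt (tail_info \<alpha> * real (card (\<pi> n \<omega>'))) * (fst (est n (\<pi> n \<omega>')) - \<alpha>))) \<omega>)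
      \<longlonglongrightarrow> (LINT \<omega>|M. f \<omega> * real_cond_exp M ?G (\<lambda>\<omega>'. h (N \<omega>')) \<omega>)"
    using lhs by (simp add: X_def)
qed

text \<open>
  The interval covers \<open>\<alpha>\<close> exactly when the error, studentized by the estimated information, lies
  between the two quantiles. The estimated information is consistent, so this variable is asymptotically
  normal, and the normal law has no atoms at the end points.
\<close>

theorem confidence_interval_coverage:
  assumes est: "is_mle est" and p: "0 < p" "p < 1"
  shows "(\<lambda>n. \<P>(\<omega> in M. \<alpha> \<in> confidence_interval p (fst (est n (\<pi> n \<omega>))) (card (\<pi> n \<omega>)))) \<longlonglongrightarrow> 1 - p"
proof -
  define \<tau> where "\<tau> = std_normal_quantile (1 - p / 2)"
  define V where "V n P = tail_info (fst (est n P))" for n P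
  have V: "tends_in_prob V (tail_info \<alpha>)"
    unfolding V_def by (rule tends_in_prob_cont[OF consistent_estimate[OF est] isCont_tail_info[OF alpha_pos alpha_less_1]])
  define X where "X n P = sqrt (V n P * real (card P)) * (fst (est n P) - \<alpha>)" for n P
  define Y where "Y n \<omega> = X (Suc n) (\<pi> (Suc n) \<omega>)" for n \<omega>
  have Ym: "Y n \<in> borel_measurable M" for n
    unfolding Y_def[abs_def] by (rule state_measurable) simp
  have char: "(\<lambda>n. LINT \<omega>:space M|M. iexp (t * Y n \<omega>)) \<longlonglongrightarrow> of_real (exp (- t\<^sup>2 / 2)) * of_real (prob (space M))" for t
    unfolding Y_def X_def by (rule observable_char_limit[OF est V space_observable])
  interpret U: prob_space "uniform_measure M (space M)"
    by (rule prob_space_uniform_measure) (auto simp: emeasure_space_1)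
  have Yu: "Y n \<in> borel_measurable (uniform_measure M (space M))" for n using Ym by simp
  have weak: "weak_conv_m (\<lambda>n. distr (uniform_measure M (space M)) borel (Y n)) std_normal_distribution"
    by (rule weak_limit_on_event[OF prob_space_axioms _ Ym char]) (auto simp: prob_space)
  have frontier: "std_normal_distribution (frontier {- \<tau>..\<tau>}) = 0"
  proof -
    have "frontier {- \<tau>..\<tau>} \<subseteq> {- \<tau>, \<tau>}"
      by (auto simp: frontier_def)
    moreover have "emeasure std_normal_distribution {- \<tau>, \<tau>} \<le> 0"
      using emeasure_subadditive[of "{- \<tau>}" std_normal_distribution "{\<tau>}"]
      by (simp add: std_normal.emeasure_eq_measure std_normal_singleton insert_commute)
    ultimately show ?thesis
      using emeasure_mono[of "frontier {- \<tau>..\<tau>}" "{- \<tau>, \<tau>}" std_normal_distribution] by simp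
  qed
  have "(\<lambda>n. measure (distr (uniform_measure M (space M)) borel (Y n)) {- \<tau>..\<tau>}) \<longlonglongrightarrow> measure std_normal_distribution {- \<tau>..\<tau>}"
    by (rule weak_conv_imp_continuity_set_conv[OF U.real_distribution_distr[OF Yu] real_dist_normal_dist weak _ frontier]) simp
  then have lim: "(\<lambda>n. measure (distr (uniform_measure M (space M)) borel (Y n)) {- \<tau>..\<tau>}) \<longlonglongrightarrow> 1 - p"
    using std_normal_central_interval[OF p] by (simp add: \<tau>_def)
  have "measure (distr (uniform_measure M (space M)) borel (Y n)) {- \<tau>..\<tau>}
     = \<P>(\<omega> in M. \<alpha> \<in> confidence_interval p (fst (est (Suc n) (\<pi> (Suc n) \<omega>))) (card (\<pi> (Suc n) \<omega>)))" for n
  proof -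
    have "measure (distr (uniform_measure M (space M)) borel (Y n)) {- \<tau>..\<tau>} = measure (uniform_measure M (space M)) (Y n -` {- \<tau>..\<tau>} \<inter> space M)"
      by (subst measure_distr[OF Yu]) auto
    also have "\<dots> = measure M (Y n -` {- \<tau>..\<tau>} \<inter> space M)"
      using measurable_sets[OF Ym, of "{- \<tau>..\<tau>}" n]
      by (subst measure_uniform_measure) (auto simp: emeasure_space_1 prob_space Int_absorb1)
    also have "Y n -` {- \<tau>..\<tau>} \<inter> space M = {\<omega> \<in> space M. \<alpha> \<in> confidence_interval p (fst (est (Suc n) (\<pi> (Suc n) \<omega>))) (card (\<pi> (Suc n) \<omega>))}"
    proof -
      have "Y n \<omega> \<in> {- \<tau>..\<tau>} \<longleftrightarrow> \<alpha> \<in> confidence_interval p (fst (est (Suc n) (\<pi> (Suc n) \<omega>))) (card (\<pi> (Suc n) \<omega>))"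
        if "\<omega> \<in> space M" for \<omega>
      proof -
        define P where "P = \<pi> (Suc n) \<omega>"
        have P: "P \<in> partitions_upto (Suc n)" unfolding P_def by (rule state_in) (use that in auto)
        define a where "a = fst (est (Suc n) P)"
        have "est (Suc n) P \<in> parameter_space"
          using est P unfolding is_mle_def by auto
        then have a: "0 < a" "a < 1" by (auto simp: a_def parameter_space_def)
        define s where "s = sqrt (tail_info a * real (card P))"
        have "tail_info a > 0" using tail_info_ge[OF a] a by (meson less_le_trans zero_less_divide_1_iff zero_less_power)
        moreover have "real (card P) > 0" using card_partition_bounds(2)[OF P] by simp
        ultimately have s: "s > 0" by (simp add: s_def)
        have "Y n \<omega> = s * (a - \<alpha>)" by (simp add: Y_def X_def V_def s_def a_def P_def)
        then have "Y n \<omega> \<in> {- \<tau>..\<tau>} \<longleftrightarrow> \<bar>s * (a - \<alpha>)\<bar> \<le> \<tau>" by (auto simp: abs_le_iff)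
        also have "\<dots> \<longleftrightarrow> \<bar>a - \<alpha>\<bar> \<le> \<tau> / s" using s by (simp add: abs_mult pos_le_divide_eq mult.commute)
        also have "\<dots> \<longleftrightarrow> \<alpha> \<in> {a - \<tau> / s..a + \<tau> / s}" by (auto simp: abs_le_iff)
        also have "{a - \<tau> / s..a + \<tau> / s} = confidence_interval p a (card P)"
          by (simp add: confidence_interval_def Let_def \<tau>_def s_def sibuya_information_eq[OF a])
        finally show ?thesis by (simp add: a_def P_def)
      qed
      then show ?thesis by auto
    qed
    finally show ?thesis .
  qed
  with lim have "(\<lambda>n. \<P>(\<omega> in M. \<alpha> \<in> confidence_interval p (fst (est (Suc n) (\<pi> (Suc n) \<omega>))) (card (\<pi> (Suc n) \<omega>)))) \<longlonglongrightarrow> 1 - p"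
    by simp
  then show ?thesis by (rule LIMSEQ_imp_Suc)
qed

end

theorem corollary3p5p1:
  fixes M :: "'a measure" and \<alpha> \<theta> :: real
    and \<pi> :: "nat \<Rightarrow> 'a \<Rightarrow> nat set set"
    and est :: "nat \<Rightarrow> nat set set \<Rightarrow> real \<times> real"
  assumes "0 < \<alpha>" and "\<alpha> < 1" and "\<theta> > - \<alpha>"
    and "ewens_pitman M \<alpha> \<theta> \<pi>"
    and "is_mle est"
  shows "(\<forall>N. distributed M lborel N std_normal_density \<and>
              independent_of_algebra M (partition_algebra_limit M \<pi>) N \<longrightarrow>
            mixing_convergence M (partition_algebra_limit M \<pi>)
              (\<lambda>n \<omega>. sqrt (sibuya_information \<alpha> * real (card (\<pi> n \<omega>)))
                       * (fst (est n (\<pi> n \<omega>)) - \<alpha>)) N) \<and>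
         (\<forall>p. 0 < p \<and> p < 1 \<longrightarrow>
            (\<lambda>n. \<P>(\<omega> in M. \<alpha> \<in> confidence_interval p (fst (est n (\<pi> n \<omega>))) (card (\<pi> n \<omega>))))
              \<longlonglongrightarrow> 1 - p)"
proof -
  interpret ewens_pitman M \<alpha> \<theta> \<pi> by fact
  interpret ewens_pitman_process M \<alpha> \<theta> \<pi> by unfold_locales (use assms in auto)
  show ?thesis
    unfolding sibuya_information_eq[OF assms(1,2)]
    using estimator_mixing[OF assms(5)] confidence_interval_coverage[OF assms(5)] by blast
qed

end
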